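(* Let $K$ be an algebraically closed field of arbitrary characteristic, let $a,b\in K$, let $f=Y^2Z-X^3-aXZ^2-bZ^3$, and assume that the projective plane cubic $E=\mathrm{Proj}\big(K[X,Y,Z]/(f)\big)$ is smooth. Let $e=[0:1:0]\in E$, $T=K[[X,Y,Z]]$ and $S=T/(f)$. For a point $[\lambda:\mu:1]$ of $E$ put $P_E(\lambda,\mu)=-X^2-\lambda XZ-(a+\lambda^2)Z^2$. Then the following matrix factorisations of $f$ over $T$ are mutually non-isomorphic and describe all indecomposable rank one Maximal Cohen-Macaulay $S$-modules (that is, every indecomposable Maximal Cohen-Macaulay $S$-module of rank one is isomorphic to the module given by exactly one of them), where $[\lambda:\mu:1]$ runs through all rational points of $E\setminus\{e\}$: (1) $$T^2 \xrightarrow{\begin{pmatrix} P_E(\lambda,\mu) & -Z(Y + \mu Z)\\ Y - \mu Z & X- \lambda Z \end{pmatrix}} T^2 \xrightarrow{\begin{pmatrix} X - \lambda Z & Z(Y + \mu Z) \\ \mu Z -Y & P_E(\lambda,\mu) \end{pmatrix}} T^2$$ (2) $$T^2\xrightarrow{\begin{pmatrix} -X^2-aZ^2 & bZ^2-Y^2\\ -Z & -X \end{pmatrix}} T^2 \xrightarrow{\begin{pmatrix} X & bZ^2-Y^2 \\ -Z & X^2+aZ^2 \end{pmatrix}} T^2$$ (3) $$T^2 \xrightarrow{\begin{pmatrix} P_E(\lambda,\mu) & -Y-\mu Z \\ -Z(Y-\mu Z) & \lambda Z - X \end{pmatrix}} T^2 \xrightarrow{\begin{pmatrix} X - \lambda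 Z & -Y - \mu Z \\ -Z(Y - \mu Z) & -P_E(\lambda,\mu) \end{pmatrix}} T^2$$ (4) $$T^2 \xrightarrow{\begin{pmatrix} aXZ - Y^2 + bZ^2 & -X \\ -X^2 & -Z \end{pmatrix}} T^2 \xrightarrow{\begin{pmatrix} -Z & X \\ X^2 & bZ^2-Y^2 + aXZ \end{pmatrix}} T^2$$ (5) $$T^3 \xrightarrow{\begin{pmatrix} P_E(\lambda,\mu) & -Z(Y + \mu Z) & \lambda \mu Z^2 + XY + \mu XZ + \lambda YZ \\ -X(Y- \mu Z) & -X(X- \lambda Z) & -(a + \lambda^2) XZ +Y^2 -bZ^2\\ -Z(Y- \mu Z) & -Z(X- \lambda Z) & X^2 - \lambda^2 Z^2 \end{pmatrix}} T^3 \xrightarrow{\begin{pmatrix} X- \lambda Z & 0 & -Y - \mu Z\\ \mu Z -Y & X + \lambda Z & (a + \lambda^2)Z \\ 0 & Z & -X \end{pmatrix}} T^3$$ (6) $$T \xrightarrow{\;1\;} T \xrightarrow{\;Y^2Z-X^3-aXZ^2-bZ^3\;} T$$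
   Context: A matrix factorisation of $f$ over $T$ of size $m$ is a pair $T^m\xrightarrow{\alpha}T^m\xrightarrow{\beta}T^m$ of $T$-linear maps with $\alpha\beta=\beta\alpha=f\cdot\mathrm{id}$; matrices act on column vectors from the left. The Maximal Cohen-Macaulay $S$-module given by the matrix factorisation $(\alpha,\beta)$ is the cokernel $\mathrm{cok}(\beta)$ of the second map, which is annihilated by $f$. The rank of an $S$-module $M$ is $\dim_{Q(S)}(M\otimes_S Q(S))$, where $Q(S)$ is the field of fractions of the domain $S$. *)

theory Defs
  imports
    "Jordan_Normal_Form.VS_Connect"
    "HOL-Computational_Algebra.Formal_Power_Series"
    "HOL-Algebra.QuotRing"
    "HOL-Algebra.Free_Abelian_Groups"
    "HOL-Library.Extended_Nat"
begin

section \<open>Commutative algebra\<close>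

text \<open>Supremum of the lengths \<open>n\<close> of chains of primes \<open>P 0 \<subset> \<dots> \<subset> P n\<close>.\<close>

definition krull_dim :: "('r, 'z) ring_scheme \<Rightarrow> enat" where
  "krull_dim R =
    Sup {enat n | n. \<exists>P. (\<forall>i\<le>n. primeideal (P i) R) \<and> (\<forall>i<n. P i \<subset> P (Suc i))}"

definition finitely_generated :: "('r, 'z) ring_scheme \<Rightarrow> ('r, 'm, 'y) module_scheme \<Rightarrow> bool" where
  "finitely_generated R M \<longleftrightarrow>
    (\<exists>A. finite A \<and> A \<subseteq> carrier M \<and> LinearCombinations.module.span R M A = carrier M)"

text \<open>The submodule \<open>(x\<^sub>1, \<dots>, x\<^sub>n) M\<close>.\<close>

definition list_smult_module ::
    "('r, 'z) ring_scheme \<Rightarrow> ('r, 'm, 'y) module_scheme \<Rightarrow> 'r list \<Rightarrow> 'm set" where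
  "list_smult_module R M xs = LinearCombinations.module.span R M {x \<odot>\<^bsub>M\<^esub> v | x v. x \<in> set xs \<and> v \<in> carrier M}"

text \<open>Each \<open>x\<^sub>i\<close> is a nonzerodivisor on \<open>M / (x\<^sub>1, \<dots>, x\<^bsub>i-1\<^esub>) M\<close>, and \<open>(x\<^sub>1, \<dots>, x\<^sub>n) M \<noteq> M\<close>.\<close>

definition regular_sequence ::
    "('r, 'z) ring_scheme \<Rightarrow> ('r, 'm, 'y) module_scheme \<Rightarrow> 'r list \<Rightarrow> bool" where
  "regular_sequence R M xs \<longleftrightarrow>
    set xs \<subseteq> carrier R \<and>
    (\<forall>i < length xs. \<forall>v \<in> carrier M.
       (xs ! i) \<odot>\<^bsub>M\<^esub> v \<in> list_smult_module R M (take i xs) \<longrightarrow>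
       v \<in> list_smult_module R M (take i xs)) \<and>
    list_smult_module R M xs \<noteq> carrier M"

definition depth ::
    "('r, 'z) ring_scheme \<Rightarrow> 'r set \<Rightarrow> ('r, 'm, 'y) module_scheme \<Rightarrow> enat" where
  "depth R I M = Sup {enat (length xs) | xs. set xs \<subseteq> I \<and> regular_sequence R M xs}"

text \<open>Meant for a Noetherian local ring \<open>R\<close>, with maximal ideal \<open>\<mm>\<close>.\<close>

definition maximal_cohen_macaulay ::
    "('r, 'z) ring_scheme \<Rightarrow> ('r, 'm, 'y) module_scheme \<Rightarrow> bool" where
  "maximal_cohen_macaulay R M \<longleftrightarrow>
    Module.module R M \<and> finitely_generated R M \<and>
    (\<exists>\<mm>. {I. maximalideal I R} = {\<mm>} \<and> depth R \<mm> M = krull_dim R)"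

definition indecomposable ::
    "('r, 'z) ring_scheme \<Rightarrow> ('r, 'm, 'y) module_scheme \<Rightarrow> bool" where
  "indecomposable R M \<longleftrightarrow>
    Module.module R M \<and> carrier M \<noteq> {\<zero>\<^bsub>M\<^esub>} \<and>
    (\<forall>N1 N2. LinearCombinations.submodule R N1 M \<and> LinearCombinations.submodule R N2 M \<and>
       N1 \<inter> N2 = {\<zero>\<^bsub>M\<^esub>} \<and> N1 <+>\<^bsub>M\<^esub> N2 = carrier M \<longrightarrow>
       N1 = {\<zero>\<^bsub>M\<^esub>} \<or> N2 = {\<zero>\<^bsub>M\<^esub>})"

definition module_iso ::
    "('r, 'z) ring_scheme \<Rightarrow> ('r, 'm, 'y) module_scheme \<Rightarrow> ('r, 'n, 'x) module_scheme \<Rightarrow> bool" where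
  "module_iso R M N \<longleftrightarrow> (\<exists>h. mod_hom R M N h \<and> bij_betw h (carrier M) (carrier N))"


section \<open>Field of fractions, base change and rank\<close>

definition frac_rel :: "('r, 'z) ring_scheme \<Rightarrow> (('r \<times> 'r) \<times> ('r \<times> 'r)) set" where
  "frac_rel R = {((r, s), (r', s')).
     r \<in> carrier R \<and> s \<in> carrier R - {\<zero>\<^bsub>R\<^esub>} \<and>
     r' \<in> carrier R \<and> s' \<in> carrier R - {\<zero>\<^bsub>R\<^esub>} \<and>
     r \<otimes>\<^bsub>R\<^esub> s' = r' \<otimes>\<^bsub>R\<^esub> s}"

definition fraction :: "('r, 'z) ring_scheme \<Rightarrow> 'r \<Rightarrow> 'r \<Rightarrow> ('r \<times> 'r) set" where
  "fraction R r s = frac_rel R `` {(r, s)}"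

definition fraction_field :: "('r, 'z) ring_scheme \<Rightarrow> ('r \<times> 'r) set ring" where
  "fraction_field R = \<lparr>
     carrier = (carrier R \<times> (carrier R - {\<zero>\<^bsub>R\<^esub>})) // frac_rel R,
     monoid.mult = (\<lambda>A B. \<Union>(r, s)\<in>A. \<Union>(r', s')\<in>B. fraction R (r \<otimes>\<^bsub>R\<^esub> r') (s \<otimes>\<^bsub>R\<^esub> s')),
     monoid.one = fraction R \<one>\<^bsub>R\<^esub> \<one>\<^bsub>R\<^esub>,
     ring.zero = fraction R \<zero>\<^bsub>R\<^esub> \<one>\<^bsub>R\<^esub>,
     ring.add = (\<lambda>A B. \<Union>(r, s)\<in>A. \<Union>(r', s')\<in>B.
              fraction R (r \<otimes>\<^bsub>R\<^esub> s' \<oplus>\<^bsub>R\<^esub> r' \<otimes>\<^bsub>R\<^esub> s) (s \<otimes>\<^bsub>R\<^esub> s')) \<rparr>"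

text \<open>
  \<open>M \<otimes>\<^sub>R Q\<close> for a ring homomorphism \<open>\<phi> : R \<rightarrow> Q\<close>: the free abelian group on the symbols \<open>(x, q)\<close>
  modulo the bilinearity relations, with \<open>Q\<close> acting through the second factor.
\<close>

definition tensor_relations ::
    "('r, 'z) ring_scheme \<Rightarrow> ('q, 'w) ring_scheme \<Rightarrow> ('r \<Rightarrow> 'q) \<Rightarrow> ('r, 'm, 'y) module_scheme
      \<Rightarrow> ('m \<times> 'q \<Rightarrow>\<^sub>0 int) set" where
  "tensor_relations R Q \<phi> M =
     {frag_of (x \<oplus>\<^bsub>M\<^esub> y, q) - frag_of (x, q) - frag_of (y, q) | x y q.
        x \<in> carrier M \<and> y \<in> carrier M \<and> q \<in> carrier Q} \<union>
     {frag_of (x, p \<oplus>\<^bsub>Q\<^esub> q) - frag_of (x, p) - frag_of (x, q) | x p q.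
        x \<in> carrier M \<and> p \<in> carrier Q \<and> q \<in> carrier Q} \<union>
     {frag_of (r \<odot>\<^bsub>M\<^esub> x, q) - frag_of (x, \<phi> r \<otimes>\<^bsub>Q\<^esub> q) | r x q.
        r \<in> carrier R \<and> x \<in> carrier M \<and> q \<in> carrier Q}"

definition base_change ::
    "('r, 'z) ring_scheme \<Rightarrow> ('q, 'w) ring_scheme \<Rightarrow> ('r \<Rightarrow> 'q) \<Rightarrow> ('r, 'm, 'y) module_scheme
      \<Rightarrow> ('q, ('m \<times> 'q \<Rightarrow>\<^sub>0 int) set) module" where
  "base_change R Q \<phi> M =
     (let G = free_Abelian_group (carrier M \<times> carrier Q);
          N = generate G (tensor_relations R Q \<phi> M)
      in \<lparr> carrier = rcosets\<^bsub>G\<^esub> N,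
           monoid.mult = undefined,
           monoid.one = undefined,
           ring.zero = N,
           ring.add = set_mult G,
           smult = (\<lambda>q C. \<Union>c\<in>C. N #>\<^bsub>G\<^esub> frag_extend (\<lambda>(x, p). frag_of (x, q \<otimes>\<^bsub>Q\<^esub> p)) c) \<rparr>)"

text \<open>
  \<open>fin_dim\<close> has to be demanded separately, because \<open>vectorspace.dim\<close> is an unspecified natural number
  for spaces of infinite dimension.
\<close>

definition has_rank :: "('r, 'z) ring_scheme \<Rightarrow> ('r, 'm, 'y) module_scheme \<Rightarrow> nat \<Rightarrow> bool" where
  "has_rank R M n \<longleftrightarrow>
     (let Q = fraction_field R; V = base_change R Q (\<lambda>r. fraction R r \<one>\<^bsub>R\<^esub>) M
      in vectorspace.fin_dim Q V \<and> vectorspace.dim Q V = n)"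


section \<open>Matrix factorisations\<close>

definition matrix_factorisation :: "'t :: comm_ring_1 \<Rightarrow> nat \<Rightarrow> 't mat \<times> 't mat \<Rightarrow> bool" where
  "matrix_factorisation f n = (\<lambda>(\<alpha>, \<beta>).
     \<alpha> \<in> carrier_mat n n \<and> \<beta> \<in> carrier_mat n n \<and>
     \<alpha> * \<beta> = f \<cdot>\<^sub>m 1\<^sub>m n \<and> \<beta> * \<alpha> = f \<cdot>\<^sub>m 1\<^sub>m n)"

text \<open>
  Invertible \<open>U\<close>, \<open>V\<close> making the following diagram commute (\<open>U\<close> occurs at both ends):
  \<open>T\<^sup>n \<midarrow>\<alpha>\<rightarrow> T\<^sup>n \<midarrow>\<beta>\<rightarrow> T\<^sup>n\<close> over \<open>T\<^sup>n \<midarrow>\<alpha>'\<rightarrow> T\<^sup>n \<midarrow>\<beta>'\<rightarrow> T\<^sup>n\<close>, with verticals \<open>U\<close>, \<open>V\<close>, \<open>U\<close>.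
\<close>

definition mf_iso :: "'t :: comm_ring_1 mat \<times> 't mat \<Rightarrow> 't mat \<times> 't mat \<Rightarrow> bool" where
  "mf_iso = (\<lambda>(\<alpha>, \<beta>) (\<alpha>', \<beta>').
     dim_row \<alpha> = dim_row \<alpha>' \<and>
     (\<exists>U V. U \<in> carrier_mat (dim_row \<alpha>) (dim_row \<alpha>) \<and> V \<in> carrier_mat (dim_row \<alpha>) (dim_row \<alpha>) \<and>
        invertible_mat U \<and> invertible_mat V \<and>
        V * \<alpha> = \<alpha>' * U \<and> U * \<beta> = \<beta>' * V))"

text \<open>
  The cokernel of \<open>\<beta>\<close>, as a module over the quotient of the ground ring by an ideal that annihilates
  it; a scalar \<open>c\<close> is thus itself a coset.
\<close>

definition cokernel :: "'t :: comm_ring_1 mat \<Rightarrow> ('t set, 't vec set) module" where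
  "cokernel \<beta> =
     (let V = module_vec TYPE('t) (dim_row \<beta>);
          N = (\<lambda>v. \<beta> *\<^sub>v v) ` carrier_vec (dim_col \<beta>)
      in \<lparr> carrier = a_rcosets\<^bsub>V\<^esub> N,
           monoid.mult = undefined,
           monoid.one = undefined,
           ring.zero = N,
           ring.add = set_add V,
           smult = (\<lambda>c C. \<Union>t\<in>c. \<Union>v\<in>C. N +>\<^bsub>V\<^esub> t \<odot>\<^bsub>V\<^esub> v) \<rparr>)"


section \<open>The Weierstrass cubic\<close>

text \<open>
  \<open>f\<close>, used as a polynomial, as a power series, and as a function of the coordinates of a point.
\<close>

definition weierstrass :: "'r :: comm_ring_1 \<Rightarrow> 'r \<Rightarrow> 'r \<Rightarrow> 'r \<Rightarrow> 'r \<Rightarrow> 'r" where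
  "weierstrass a b x y z = y^2 * z - x^3 - a * x * z^2 - b * z^3"

text \<open>
  \<open>K[X, Y, Z]\<close> is rendered as \<open>K[X][Y][Z]\<close>, so \<open>X\<close> is the innermost and \<open>Z\<close> the outermost variable.
\<close>

definition eval3 :: "'k :: comm_ring_1 poly poly poly \<Rightarrow> 'k \<Rightarrow> 'k \<Rightarrow> 'k \<Rightarrow> 'k" where
  "eval3 F x y z = poly (poly (poly F [:[:z:]:]) [:y:]) x"

definition weierstrass_poly :: "'k :: comm_ring_1 \<Rightarrow> 'k \<Rightarrow> 'k poly poly poly" where
  "weierstrass_poly a b =
     weierstrass [:[:[:a:]:]:] [:[:[:b:]:]:] [:[:[:0, 1:]:]:] [:[:0, 1:]:] [:0, 1:]"

text \<open>
  Jacobian criterion for the plane projective curve of a homogeneous \<open>F\<close> over an algebraically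
  closed field; the three derivatives are those by \<open>X\<close>, \<open>Y\<close> and \<open>Z\<close>.
\<close>

definition smooth_plane_curve :: "'k :: alg_closed_field poly poly poly \<Rightarrow> bool" where
  "smooth_plane_curve F \<longleftrightarrow>
     (\<forall>x y z. (x, y, z) \<noteq> (0, 0, 0) \<and> eval3 F x y z = 0 \<longrightarrow>
        eval3 (map_poly (map_poly pderiv) F) x y z \<noteq> 0 \<or>
        eval3 (map_poly pderiv F) x y z \<noteq> 0 \<or>
        eval3 (pderiv F) x y z \<noteq> 0)"

text \<open>\<open>T = K[[X, Y, Z]]\<close> is rendered as \<open>K[[X]][[Y]][[Z]]\<close>.\<close>

type_synonym 'k T = "'k fps fps fps"

definition cst :: "'k :: field \<Rightarrow> 'k T" where
  "cst c = fps_const (fps_const (fps_const c))"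

definition \<X> :: "'k :: field T" where "\<X> = fps_const (fps_const fps_X)"

definition \<Y> :: "'k :: field T" where "\<Y> = fps_const fps_X"

definition \<Z> :: "'k :: field T" where "\<Z> = fps_X"

definition f\<^sub>E :: "'k :: field \<Rightarrow> 'k \<Rightarrow> 'k T" where
  "f\<^sub>E a b = weierstrass (cst a) (cst b) \<X> \<Y> \<Z>"

definition S\<^sub>E :: "'k :: field \<Rightarrow> 'k \<Rightarrow> 'k T set ring" where
  "S\<^sub>E a b = class_ring Quot (PIdl\<^bsub>class_ring\<^esub> (f\<^sub>E a b))"

definition P\<^sub>E :: "'k :: field \<Rightarrow> 'k \<Rightarrow> 'k T" where
  "P\<^sub>E a l = - (\<X>^2) - cst l * \<X> * \<Z> - (cst a + cst l^2) * \<Z>^2"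

text \<open>\<open>l\<close> and \<open>m\<close> stand for the coordinates of a point \<open>[\<lambda>:\<mu>:1]\<close>.\<close>

datatype 'k mf_label = MF1 'k 'k | MF2 | MF3 'k 'k | MF4 | MF5 'k 'k | MF6

definition mf_labels :: "'k :: field \<Rightarrow> 'k \<Rightarrow> 'k mf_label set" where
  "mf_labels a b =
     {MF2, MF4, MF6} \<union>
     (\<Union>(l, m) \<in> {(l, m). weierstrass a b l m 1 = 0}. {MF1 l m, MF3 l m, MF5 l m})"

primrec mf_size :: "'k mf_label \<Rightarrow> nat" where
  "mf_size (MF1 l m) = 2"
| "mf_size MF2 = 2"
| "mf_size (MF3 l m) = 2"
| "mf_size MF4 = 2"
| "mf_size (MF5 l m) = 3"
| "mf_size MF6 = 1"

primrec mf :: "'k :: field \<Rightarrow> 'k \<Rightarrow> 'k mf_label \<Rightarrow> 'k T mat \<times> 'k T mat" where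
  "mf a b (MF1 l m) =
    (mat_of_rows_list 2
      [[P\<^sub>E a l, - (\<Z> * (\<Y> + cst m * \<Z>))],
       [\<Y> - cst m * \<Z>, \<X> - cst l * \<Z>]],
     mat_of_rows_list 2
      [[\<X> - cst l * \<Z>, \<Z> * (\<Y> + cst m * \<Z>)],
       [cst m * \<Z> - \<Y>, P\<^sub>E a l]])"
| "mf a b MF2 =
    (mat_of_rows_list 2
      [[- (\<X>^2) - cst a * \<Z>^2, cst b * \<Z>^2 - \<Y>^2],
       [- \<Z>, - \<X>]],
     mat_of_rows_list 2
      [[\<X>, cst b * \<Z>^2 - \<Y>^2],
       [- \<Z>, \<X>^2 + cst a * \<Z>^2]])"
| "mf a b (MF3 l m) =
    (mat_of_rows_list 2
      [[P\<^sub>E a l, - \<Y> - cst m * \<Z>],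
       [- (\<Z> * (\<Y> - cst m * \<Z>)), cst l * \<Z> - \<X>]],
     mat_of_rows_list 2
      [[\<X> - cst l * \<Z>, - \<Y> - cst m * \<Z>],
       [- (\<Z> * (\<Y> - cst m * \<Z>)), - P\<^sub>E a l]])"
| "mf a b MF4 =
    (mat_of_rows_list 2
      [[cst a * \<X> * \<Z> - \<Y>^2 + cst b * \<Z>^2, - \<X>],
       [- (\<X>^2), - \<Z>]],
     mat_of_rows_list 2
      [[- \<Z>, \<X>],
       [\<X>^2, cst b * \<Z>^2 - \<Y>^2 + cst a * \<X> * \<Z>]])"
| "mf a b (MF5 l m) =
    (mat_of_rows_list 3
      [[P\<^sub>E a l, - (\<Z> * (\<Y> + cst m * \<Z>)),
          cst l * cst m * \<Z>^2 + \<X> * \<Y> + cst m * \<X> * \<Z> + cst l * \<Y> * \<Z>],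
       [- (\<X> * (\<Y> - cst m * \<Z>)), - (\<X> * (\<X> - cst l * \<Z>)),
          - ((cst a + cst l^2) * \<X> * \<Z>) + \<Y>^2 - cst b * \<Z>^2],
       [- (\<Z> * (\<Y> - cst m * \<Z>)), - (\<Z> * (\<X> - cst l * \<Z>)), \<X>^2 - cst l^2 * \<Z>^2]],
     mat_of_rows_list 3
      [[\<X> - cst l * \<Z>, 0, - \<Y> - cst m * \<Z>],
       [cst m * \<Z> - \<Y>, \<X> + cst l * \<Z>, (cst a + cst l^2) * \<Z>],
       [0, \<Z>, - \<X>]])"
| "mf a b MF6 = (mat_of_rows_list 1 [[1]], mat_of_rows_list 1 [[f\<^sub>E a b]])"

end

theory Submission imports Defs "HOL-Library.Function_Algebras"
begin

text \<open>
  A finitely generated module over the hypersurface ring is recorded by the lattice \<open>L\<close> of relations between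
  its generators. The cubic is of degree \<open>3\<close> in \<open>X\<close> up to sign, so a lattice of rank one and depth two is free
  over the power series in \<open>Y\<close> and \<open>Z\<close> with a basis of three elements, and multiplication by \<open>X\<close> yields a
  presentation by a \<open>3 \<times> 3\<close> matrix with determinant \<open>- f\<close>. If an entry is a unit, the matrix splits. For
  \<open>2 \<times> 2\<close> matrices without units the linear parts of a row or a column are independent and cut out a point
  of the curve; completing it formally and using smoothness at that point determines the matrix up to equivalence. A
  \<open>3 \<times> 3\<close> matrix without units reduced modulo \<open>X\<close> and \<open>Z\<close> is singular, which allows one row to be
  normalised to \<open>(0, Z, - X)\<close>; the remaining \<open>2 \<times> 3\<close> block then reduces to the \<open>2 \<times> 2\<close> case.
  Conversely each listed cokernel is the lattice of a single linear form modulo \<open>f\<close>, hence of rank one, and the linear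
  parts of the matrices separate the isomorphism classes.
\<close>

text \<open>The variables Y and Z are singled out because f = Z (Y^2 - b Z^2 - a X Z) - X^3: modulo
  Z the element X is nilpotent, so Y and Z are parameters of T/(f). Depth two provides only some
  regular sequence of length two, and the first obstacle is to exchange it for Z, Y; socle elements
  and Krull's intersection theorem do this. Only the second matrix of a pair has to be classified,
  since f is a nonzerodivisor and the second matrix therefore determines the first. Rank one enters
  in a form free of tensor products: any two elements of the module are proportional over the domain
  S. Smoothness is felt at a single place. A row of two independent linear forms defines a formal
  branch that touches the line over a point of E to first order only; the second-order discrepancy
  can be removed by row operations exactly because a partial derivative of the cubic is nonzero at
  the point. Neither 2 nor 3 is ever inverted, so the characteristic stays arbitrary.\<close>

unbundle fps_syntax
no_notation vec_index (infixl "$" 100)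

section \<open>Submodules of free modules, with vectors as functions on the naturals\<close>

definition scal :: "'r::comm_ring_1 \<Rightarrow> (nat \<Rightarrow> 'r) \<Rightarrow> nat \<Rightarrow> 'r" (infixr "\<star>" 75) where
  "t \<star> v = (\<lambda>i. t * v i)"

lemma scal_apply [simp]: "(t \<star> v) i = t * v i"
  by (simp add: scal_def)

lemma sum_fun_apply: "(\<Sum>a\<in>A. f a) i = (\<Sum>a\<in>A. f a i)"
  by (induction A rule: infinite_finite_induct) (auto simp: zero_fun_def)

lemma scal_simps:
  "t \<star> (v + w) = t \<star> v + t \<star> w" "t \<star> (v - w) = t \<star> v - t \<star> w" "t \<star> - v = - (t \<star> v)"
  "(s + t) \<star> v = s \<star> v + t \<star> v" "(s - t) \<star> v = s \<star> v - t \<star> v"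
  "s \<star> t \<star> v = (s * t) \<star> v" "1 \<star> v = v" "0 \<star> v = 0" "t \<star> 0 = 0"
  by (auto simp: fun_eq_iff algebra_simps)

text \<open>Vectors have infinitely many coordinates; a finite rank \<open>N\<close> is imposed
  separately by demanding that the submodule contain every vector vanishing below \<open>N\<close>.
  One type then serves free modules of all ranks.\<close>

definition submod :: "(nat \<Rightarrow> 'r::comm_ring_1) set \<Rightarrow> bool" where
  "submod L \<longleftrightarrow> 0 \<in> L \<and> (\<forall>v\<in>L. \<forall>w\<in>L. v + w \<in> L) \<and> (\<forall>t. \<forall>v\<in>L. t \<star> v \<in> L)"

lemma submodD:
  assumes "submod L"
  shows submod_0: "0 \<in> L" and submod_add: "v \<in> L \<Longrightarrow> w \<in> L \<Longrightarrow> v + w \<in> L"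
    and submod_scal: "v \<in> L \<Longrightarrow> t \<star> v \<in> L"
  using assms by (auto simp: submod_def)

lemma submod_minus: "submod L \<Longrightarrow> v \<in> L \<Longrightarrow> - v \<in> L"
proof -
  have "(-1) \<star> v = - v" by (simp add: fun_eq_iff)
  then show "submod L \<Longrightarrow> v \<in> L \<Longrightarrow> - v \<in> L" using submod_scal[of L v "-1"] by simp
qed

lemma submod_diff: "submod L \<Longrightarrow> v \<in> L \<Longrightarrow> w \<in> L \<Longrightarrow> v - w \<in> L"
  using submod_add[of L v "- w"] submod_minus[of L w] by simp

lemma submod_sum: "submod L \<Longrightarrow> (\<And>a. a \<in> A \<Longrightarrow> f a \<in> L) \<Longrightarrow> (\<Sum>a\<in>A. f a) \<in> L"
  by (induction A rule: infinite_finite_induct) (auto simp: submodD)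

text \<open>A difference lying in \<open>L\<close> stands for equality in the quotient by
  \<open>L\<close>. This rule and the next ones form the congruence calculus that replaces computing
  with cosets.\<close>

lemma submod_cong: "submod L \<Longrightarrow> v - w \<in> L \<Longrightarrow> v \<in> L \<longleftrightarrow> w \<in> L"
  using submod_add[of L "v - w" w] submod_diff[of L v "v - w"] by auto

lemma submod_cong_trans: "submod L \<Longrightarrow> u - v \<in> L \<Longrightarrow> v - w \<in> L \<Longrightarrow> u - w \<in> L"
  using submod_add[of L "u - v" "v - w"] by simp

lemma submod_cong_sym: "submod L \<Longrightarrow> u - v \<in> L \<Longrightarrow> v - u \<in> L"
  using submod_minus[of L "u - v"] by simp

lemma submod_cong_add: "submod L \<Longrightarrow> u - v \<in> L \<Longrightarrow> u' - v' \<in> L \<Longrightarrow> u + u' - (v + v') \<in> L"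
  using submod_add[of L "u - v" "u' - v'"] by (simp add: algebra_simps)

lemma submod_cong_scal: "submod L \<Longrightarrow> u - v \<in> L \<Longrightarrow> t \<star> u - t \<star> v \<in> L"
  using submod_scal[of L "u - v" t] by (simp add: scal_simps)

lemma submod_cong_sum:
  assumes "submod L" "\<And>a. a \<in> A \<Longrightarrow> f a - g a \<in> L"
  shows "(\<Sum>a\<in>A. f a) - (\<Sum>a\<in>A. g a) \<in> L"
  unfolding sum_subtractf[symmetric] using assms by (intro submod_sum)

text \<open>Gaussian elimination without division: a pivot \<open>p\<close> removes the last
  coordinate by cross-multiplication, so the coefficients may come from any domain.\<close>

lemma linear_dependence:
  fixes v :: "'i \<Rightarrow> nat \<Rightarrow> 'a::idom"
  assumes "finite S" "n < card S"
  shows "\<exists>c. (\<exists>k\<in>S. c k \<noteq> 0) \<and> (\<forall>j<n. (\<Sum>k\<in>S. c k * v k j) = 0)"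
  using assms
proof (induction n arbitrary: S v)
  case 0
  then obtain k where "k \<in> S" by (metis card_gt_0_iff ex_in_conv)
  then show ?case by (intro exI[of _ "\<lambda>_. 1"]) auto
next
  case (Suc n)
  show ?case
  proof (cases "\<forall>k\<in>S. v k n = 0")
    case True
    obtain c where c: "\<exists>k\<in>S. c k \<noteq> 0" "\<forall>j<n. (\<Sum>k\<in>S. c k * v k j) = 0"
      using Suc.IH[of S v] Suc.prems by auto
    have "(\<Sum>k\<in>S. c k * v k j) = 0" if "j < Suc n" for j
      using that c True by (cases "j = n") auto
    then show ?thesis using c by blast
  next
    case False
    then obtain p where p: "p \<in> S" "v p n \<noteq> 0" by blast
    define w where "w k j = v p n * v k j - v k n * v p j" for k j
    have "n < card (S - {p})" using Suc.prems p by simp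
    then obtain d where d: "\<exists>k\<in>S - {p}. d k \<noteq> 0" "\<forall>j<n. (\<Sum>k\<in>S - {p}. d k * w k j) = 0"
      using Suc.IH[of "S - {p}" w] Suc.prems by auto
    \<comment> \<open>The coefficient of the pivot vector collects what the vectors \<open>w\<close>
      subtract, so that both combinations agree in every coordinate.\<close>
    define c where "c k = (if k = p then - (\<Sum>k\<in>S - {p}. d k * v k n) else d k * v p n)" for k
    have eq: "(\<Sum>k\<in>S. c k * v k j) = (\<Sum>k\<in>S - {p}. d k * w k j)" for j
    proof -
      have "(\<Sum>k\<in>S. c k * v k j) = c p * v p j + (\<Sum>k\<in>S - {p}. c k * v k j)"
        using Suc.prems p by (simp add: sum.remove)
      also have "(\<Sum>k\<in>S - {p}. c k * v k j) = (\<Sum>k\<in>S - {p}. d k * v p n * v k j)"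
        by (intro sum.cong) (auto simp: c_def)
      finally show ?thesis
        by (simp add: c_def w_def algebra_simps sum_subtractf sum_distrib_left sum_distrib_right)
    qed
    have "(\<Sum>k\<in>S. c k * v k j) = 0" if "j < Suc n" for j
      using that d(2) by (cases "j = n") (auto simp: eq w_def)
    moreover have "\<exists>k\<in>S. c k \<noteq> 0" using d(1) p by (auto simp: c_def)
    ultimately show ?thesis by blast
  qed
qed

section \<open>Power series over a Noetherian ring\<close>

text \<open>Finite generation is demanded for submodules of all free modules of finite rank at once,
  so that the induction on the number of variables needs no passage from ideals to modules.\<close>

definition noeth :: "'r::comm_ring_1 itself \<Rightarrow> bool" where
  "noeth _ \<longleftrightarrow> (\<forall>N (L::(nat \<Rightarrow> 'r) set). submod L \<longrightarrow>
     (\<exists>G. finite G \<and> G \<subseteq> L \<and> (\<forall>v\<in>L. \<exists>c. \<forall>i<N. v i = (\<Sum>g\<in>G. c g * g i))))"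

lemma noethD:
  assumes "noeth TYPE('r::comm_ring_1)" "submod (L :: (nat \<Rightarrow> 'r) set)"
  obtains G where "finite G" "G \<subseteq> L" "\<And>v. v \<in> L \<Longrightarrow> \<exists>c. \<forall>i<N. v i = (\<Sum>g\<in>G. c g * g i)"
proof -
  have "\<exists>G. finite G \<and> G \<subseteq> L \<and> (\<forall>v\<in>L. \<exists>c. \<forall>i<N. v i = (\<Sum>g\<in>G. c g * g i))"
    using assms unfolding noeth_def by blast
  then show ?thesis using that by blast
qed

text \<open>Vectors that are independent in the first \<open>N\<close> coordinates number at most
  \<open>N\<close>. An independent set of maximal size generates, since any further vector has a
  nonzero coefficient in some relation.\<close>

lemma noeth_field: "noeth TYPE('k::field)"
  unfolding noeth_def
proof (intro allI impI)
  fix N and L :: "(nat \<Rightarrow> 'k) set"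
  assume "submod L"
  define ind where "ind G \<longleftrightarrow> (\<forall>c. (\<forall>i<N. (\<Sum>g\<in>G. c g * g i) = 0) \<longrightarrow> (\<forall>g\<in>G. c g = 0))"
    for G :: "(nat \<Rightarrow> 'k) set"
  have bd: "card G \<le> N" if fin: "finite G" and ind: "ind G" for G
  proof (rule ccontr)
    assume "\<not> card G \<le> N"
    then obtain c where "\<exists>k\<in>G. c k \<noteq> 0" "\<forall>j<N. (\<Sum>k\<in>G. c k * k j) = 0"
      using linear_dependence[OF fin, of N "\<lambda>g. g"] not_le by blast
    then show False using ind by (auto simp: ind_def)
  qed
  define P where "P n \<longleftrightarrow> (\<exists>G. finite G \<and> G \<subseteq> L \<and> ind G \<and> card G = n)" for n
  have "P 0" unfolding P_def by (intro exI[of _ "{}"]) (simp add: ind_def)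
  moreover have "\<forall>n. P n \<longrightarrow> n \<le> N" using bd by (auto simp: P_def)
  ultimately obtain n where n: "P n" "\<And>m. P m \<Longrightarrow> m \<le> n"
    using Nat.ex_has_greatest_nat[of P 0 N] by auto
  then obtain G where G: "finite G" "G \<subseteq> L" "ind G" "card G = n" by (auto simp: P_def)
  have "\<exists>c. \<forall>i<N. v i = (\<Sum>g\<in>G. c g * g i)" if "v \<in> L" for v
  proof (cases "v \<in> G")
    case True
    then show ?thesis using G(1)
      by (intro exI[of _ "\<lambda>g. if g = v then 1 else 0"]) (simp add: mult_delta_left)
  next
    case False
    have "\<not> ind (insert v G)"
    proof
      assume "ind (insert v G)"
      then have "P (Suc n)" using G False that unfolding P_def
        by (intro exI[of _ "insert v G"]) auto
      then show False using n(2) by fastforce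
    qed
    then obtain c where c: "\<forall>i<N. (\<Sum>g\<in>insert v G. c g * g i) = 0" "\<exists>g\<in>insert v G. c g \<noteq> 0"
      by (auto simp: ind_def)
    have c': "\<forall>i<N. c v * v i + (\<Sum>g\<in>G. c g * g i) = 0" using c(1) False G(1) by simp
    have cv: "c v \<noteq> 0"
    proof
      assume "c v = 0"
      then have "\<forall>g\<in>G. c g = 0" using c' G(3) by (auto simp: ind_def)
      then show False using c(2) \<open>c v = 0\<close> by auto
    qed
    have "v i = (\<Sum>g\<in>G. (- c g / c v) * g i)" if "i < N" for i
    proof -
      have "c v * v i = - (\<Sum>g\<in>G. c g * g i)" using c' that by (simp add: eq_neg_iff_add_eq_0)
      then have "v i = - (\<Sum>g\<in>G. c g * g i) / c v" using cv by (simp add: field_simps)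
      also have "\<dots> = (\<Sum>g\<in>G. (- c g / c v) * g i)"
        by (simp add: sum_divide_distrib sum_negf)
      finally show ?thesis .
    qed
    then show ?thesis by (intro exI[of _ "\<lambda>g. - c g / c v"]) auto
  qed
  then show "\<exists>G. finite G \<and> G \<subseteq> L \<and> (\<forall>v\<in>L. \<exists>c. \<forall>i<N. v i = (\<Sum>g\<in>G. c g * g i))"
    using G by blast
qed

text \<open>Hilbert's basis theorem for power series. The lowest coefficients \<open>lead k\<close>
  of elements of order at least \<open>k\<close> form an ascending chain of submodules over the
  coefficient ring, exhausted at some degree \<open>d\<close>. Lifts of generators of
  \<open>lead 0\<close>, ..., \<open>lead d\<close> generate, because corrections of ever higher
  order converge.\<close>

lemma noeth_fps:
  assumes "noeth TYPE('r::comm_ring_1)"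
  shows "noeth TYPE('r fps)"
  unfolding noeth_def
proof (intro allI impI)
  fix N and L :: "(nat \<Rightarrow> 'r fps) set"
  assume L: "submod L"
  define lead where "lead k = {c. \<exists>v\<in>L. \<forall>i<N. (\<forall>j<k. v i $ j = 0) \<and> v i $ k = c i}" for k
  have lead_sub: "submod (lead k)" for k
    unfolding submod_def
  proof (intro conjI ballI allI)
    show "0 \<in> lead k" using submod_0[OF L] by (auto simp: lead_def intro!: bexI[of _ 0])
  next
    fix c d assume "c \<in> lead k" "d \<in> lead k"
    then obtain v w where "v \<in> L" "w \<in> L" "\<forall>i<N. (\<forall>j<k. v i $ j = 0) \<and> v i $ k = c i"
      "\<forall>i<N. (\<forall>j<k. w i $ j = 0) \<and> w i $ k = d i" by (auto simp: lead_def)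
    then show "c + d \<in> lead k" unfolding lead_def
      by (auto intro!: bexI[of _ "v + w"] submod_add[OF L])
  next
    fix c t assume "c \<in> lead k"
    then obtain v where "v \<in> L" "\<forall>i<N. (\<forall>j<k. v i $ j = 0) \<and> v i $ k = c i" by (auto simp: lead_def)
    then show "t \<star> c \<in> lead k" unfolding lead_def
      by (auto intro!: bexI[of _ "fps_const t \<star> v"] submod_scal[OF L])
  qed
  have lead_Suc: "lead k \<subseteq> lead (Suc k)" for k
  proof
    fix c assume "c \<in> lead k"
    then obtain v where "v \<in> L" "\<forall>i<N. (\<forall>j<k. v i $ j = 0) \<and> v i $ k = c i" by (auto simp: lead_def)
    then show "c \<in> lead (Suc k)" unfolding lead_def
      by (auto intro!: bexI[of _ "fps_X \<star> v"] submod_scal[OF L])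
  qed
  have lead_mono: "lead k \<subseteq> lead l" if "k \<le> l" for k l
    by (rule lift_Suc_mono_le[of lead, OF lead_Suc that])
  define U where "U = (\<Union>k. lead k)"
  have "submod U"
    unfolding submod_def
  proof (intro conjI ballI allI)
    show "0 \<in> U" using submod_0[OF lead_sub] by (auto simp: U_def)
  next
    fix c d assume "c \<in> U" "d \<in> U"
    then obtain k l where "c \<in> lead k" "d \<in> lead l" by (auto simp: U_def)
    then have "c \<in> lead (max k l)" "d \<in> lead (max k l)" using lead_mono[of k "max k l"] lead_mono[of l "max k l"] by auto
    then show "c + d \<in> U" using submod_add[OF lead_sub] by (auto simp: U_def)
  next
    fix c t assume "c \<in> U"
    then show "t \<star> c \<in> U" using submod_scal[OF lead_sub] by (auto simp: U_def)
  qed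
  then obtain G where G: "finite G" "G \<subseteq> U" "\<And>v. v \<in> U \<Longrightarrow> \<exists>c. \<forall>i<N. v i = (\<Sum>g\<in>G. c g * g i)"
    using noethD[OF assms] by blast
  have "\<exists>d. G \<subseteq> lead d" using G(1,2)
  proof (induction G)
    case (insert g G)
    then obtain d k where "G \<subseteq> lead d" "g \<in> lead k" by (auto simp: U_def)
    then have "insert g G \<subseteq> lead (max d k)" using lead_mono[of k "max d k"] lead_mono[of d "max d k"] by auto
    then show ?case by blast
  qed auto
  then obtain d where d: "G \<subseteq> lead d" ..
  have "\<exists>G. finite G \<and> G \<subseteq> lead k \<and> (\<forall>v\<in>lead k. \<exists>c. \<forall>i<N. v i = (\<Sum>g\<in>G. c g * g i))" for k
    using assms lead_sub[of k] unfolding noeth_def by blast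
  then have "\<forall>k. \<exists>G. finite G \<and> G \<subseteq> lead k \<and> (\<forall>v\<in>lead k. \<exists>c. \<forall>i<N. v i = (\<Sum>g\<in>G. c g * g i))"
    by blast
  from choice[OF this] obtain H where H: "\<And>k. finite (H k)" "\<And>k. H k \<subseteq> lead k"
    "\<And>k v. v \<in> lead k \<Longrightarrow> \<exists>c. \<forall>i<N. v i = (\<Sum>g\<in>H k. c g * g i)" by blast
  \<comment> \<open>From degree \<open>d\<close> on, the generators of the union \<open>U\<close>
    serve for every degree.\<close>
  define Gs where "Gs k = (if k < d then H k else G)" for k
  have Gs: "finite (Gs k)" "\<And>v. v \<in> lead k \<Longrightarrow> \<exists>c. \<forall>i<N. v i = (\<Sum>g\<in>Gs k. c g * g i)" for k
  proof -
    show "finite (Gs k)" using H G by (simp add: Gs_def)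
    show "\<exists>c. \<forall>i<N. v i = (\<Sum>g\<in>Gs k. c g * g i)" if "v \<in> lead k" for v
      using H(3)[OF that] G(3)[of v] that by (cases "k < d") (auto simp: Gs_def U_def)
  qed
  have Gs_lead: "Gs k \<subseteq> lead k" if "k \<le> d" for k using H(2) d that by (auto simp: Gs_def)
  define lam where "lam k g = (SOME v. v \<in> L \<and> (\<forall>i<N. (\<forall>j<k. v i $ j = 0) \<and> v i $ k = g i))" for k g
  have lam0: "lam k g \<in> L \<and> (\<forall>i<N. (\<forall>j<k. lam k g i $ j = 0) \<and> lam k g i $ k = g i)" if "g \<in> lead k" for k g
  proof -
    have "\<exists>v. v \<in> L \<and> (\<forall>i<N. (\<forall>j<k. v i $ j = 0) \<and> v i $ k = g i)"
      using that by (simp add: lead_def) blast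
    from someI_ex[OF this] show ?thesis unfolding lam_def .
  qed
  then have lam: "\<And>g k. g \<in> lead k \<Longrightarrow> lam k g \<in> L"
    "\<And>g k i j. g \<in> lead k \<Longrightarrow> i < N \<Longrightarrow> j < k \<Longrightarrow> lam k g i $ j = 0"
    "\<And>g k i. g \<in> lead k \<Longrightarrow> i < N \<Longrightarrow> lam k g i $ k = g i" by auto
  define GG where "GG = (\<Union>k\<in>{..d}. lam k ` Gs k)"
  have GG: "finite GG" "GG \<subseteq> L" using Gs(1) Gs_lead lam(1) by (auto simp: GG_def subset_iff)
  define gen where "gen v \<longleftrightarrow> (\<exists>c. \<forall>i<N. v i = (\<Sum>g\<in>GG. c g * g i))" for v :: "nat \<Rightarrow> 'r fps"
  have gen_add: "gen (v + w)" if "gen v" "gen w" for v w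
  proof -
    obtain c c' where "\<forall>i<N. v i = (\<Sum>g\<in>GG. c g * g i)" "\<forall>i<N. w i = (\<Sum>g\<in>GG. c' g * g i)"
      using \<open>gen v\<close> \<open>gen w\<close> by (auto simp: gen_def)
    then show ?thesis unfolding gen_def
      by (intro exI[of _ "\<lambda>g. c g + c' g"]) (simp add: distrib_right sum.distrib)
  qed
  have gen_scal: "gen (t \<star> v)" if "gen v" for v t
  proof -
    obtain c where "\<forall>i<N. v i = (\<Sum>g\<in>GG. c g * g i)"
      using \<open>gen v\<close> by (auto simp: gen_def)
    then show ?thesis unfolding gen_def
      by (intro exI[of _ "\<lambda>g. t * c g"]) (simp add: sum_distrib_left mult.assoc)
  qed
  have gen_el: "gen g" if "g \<in> GG" for g
    unfolding gen_def using that GG(1)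
    by (intro exI[of _ "\<lambda>h. if h = g then 1 else 0"]) (simp add: mult_delta_left)
  have gen_0: "gen 0" unfolding gen_def by (intro exI[of _ "\<lambda>_. 0"]) simp
  have gen_sum: "gen (\<Sum>a\<in>A. h a)" if "\<And>a. a \<in> A \<Longrightarrow> gen (h a)" for h :: "(nat \<Rightarrow> 'r) \<Rightarrow> nat \<Rightarrow> 'r fps" and A
    using that by (induction A rule: infinite_finite_induct) (auto intro: gen_0 gen_add)
  have gen_cong: "gen v" if "gen w" "\<forall>i<N. v i = w i" for v w using that by (auto simp: gen_def)
  \<comment> \<open>One correction: subtracting multiples of the lifts raises the order by one.
    Below \<open>d\<close> the lifts of the right degree are used as they are; above
    \<open>d\<close> the lifts of degree \<open>d\<close> are multiplied by powers of the
    variable.\<close>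
  have step: "\<exists>w r. w \<in> L \<and> (\<forall>i<N. \<forall>j<Suc (k + n). w i $ j = 0) \<and>
      w = v - (\<Sum>g\<in>Gs k. (fps_const (r g) * fps_X ^ n) \<star> lam k g)"
    if v: "v \<in> L" "\<forall>i<N. \<forall>j<k + n. v i $ j = 0" and k: "k \<le> d" and n: "n = 0 \<or> k = d" for v k n
  proof -
    have "(\<lambda>i. v i $ (k + n)) \<in> lead (k + n)" using v by (auto simp: lead_def)
    then have "\<exists>r. \<forall>i<N. v i $ (k + n) = (\<Sum>g\<in>Gs k. r g * g i)"
      using Gs(2)[of "\<lambda>i. v i $ (k + n)" "k + n"] n by (auto simp: Gs_def)
    then obtain r where r: "\<And>i. i < N \<Longrightarrow> v i $ (k + n) = (\<Sum>g\<in>Gs k. r g * g i)" by blast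
    define w where "w = v - (\<Sum>g\<in>Gs k. (fps_const (r g) * fps_X ^ n) \<star> lam k g)"
    have "w \<in> L" unfolding w_def using v lam(1) Gs_lead[OF k]
      by (intro submod_diff submod_sum submod_scal L) auto
    moreover have "w i $ j = 0" if "i < N" "j < Suc (k + n)" for i j
    proof -
      have tm: "((fps_const (r g) * fps_X ^ n) * lam k g i) $ j = (if j = k + n then r g * g i else 0)"
        if "g \<in> Gs k" for g
      proof -
        have g: "g \<in> lead k" using that Gs_lead[OF k] by auto
        show ?thesis using lam(2)[OF g \<open>i < N\<close>, of "j - n"] lam(3)[OF g \<open>i < N\<close>] \<open>j < Suc (k + n)\<close>
          by (auto simp: mult.assoc fps_X_power_mult_nth)
      qed
      have "w i $ j = v i $ j - (\<Sum>g\<in>Gs k. if j = k + n then r g * g i else 0)"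
        using tm by (simp add: w_def sum_fun_apply fps_sum_nth)
      then show ?thesis using r[OF \<open>i < N\<close>] v(2) that by (cases "j = k + n") auto
    qed
    ultimately show ?thesis unfolding w_def by blast
  qed
  have base: "gen v" if v: "v \<in> L" "\<forall>i<N. \<forall>j<d. v i $ j = 0" for v
  proof -
    define P where "P n w \<longleftrightarrow> w \<in> L \<and> (\<forall>i<N. \<forall>j<d + n. w i $ j = 0) \<and> (n = 0 \<longrightarrow> w = v)" for n w
    define Q where "Q n w w' \<longleftrightarrow> (\<exists>r. w' = w - (\<Sum>g\<in>Gs d. (fps_const (r g) * fps_X ^ n) \<star> lam d g))" for n w w'
    have "\<exists>h. \<forall>n. P n (h n) \<and> Q n (h n) (h (Suc n))"
    proof (rule dependent_nat_choice)
      show "\<exists>w. P 0 w" using v by (auto simp: P_def)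
    next
      fix w n assume "P n w"
      then show "\<exists>w'. P (Suc n) w' \<and> Q n w w'" using step[of w d n] by (auto simp: P_def Q_def)
    qed
    then obtain h where h: "\<And>n. P n (h n)" "\<And>n. Q n (h n) (h (Suc n))" by blast
    obtain r where r: "\<And>n. h (Suc n) = h n - (\<Sum>g\<in>Gs d. (fps_const (r n g) * fps_X ^ n) \<star> lam d g)"
      using h(2) unfolding Q_def by metis
    have minus_diff_eq': "a - (b - c) = (a - b) + c" for a b c :: "nat \<Rightarrow> 'r fps"
      by (simp add: algebra_simps)
    have hn: "v - h n = (\<Sum>m<n. \<Sum>g\<in>Gs d. (fps_const (r m g) * fps_X ^ m) \<star> lam d g)" for n
    proof (induction n)
      case 0 then show ?case using h(1)[of 0] by (simp add: P_def)
    next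
      case (Suc n)
      have "v - h (Suc n) = (v - h n) + (\<Sum>g\<in>Gs d. (fps_const (r n g) * fps_X ^ n) \<star> lam d g)"
        unfolding r by (rule minus_diff_eq')
      then show ?case by (simp only: Suc.IH sum.lessThan_Suc)
    qed
    \<comment> \<open>The infinitely many corrections use the same finite set of lifts, so the
      coefficients of each lift assemble to a single power series.\<close>
    define R where "R g = Abs_fps (\<lambda>m. r m g)" for g
    have "v i = (\<Sum>g\<in>Gs d. R g \<star> lam d g) i" if "i < N" for i
    proof (rule fps_ext)
      fix j
      have tm: "(fps_const (r m g) * fps_X ^ m * lam d g i) $ j = r m g * lam d g i $ (j - m)" if "m < Suc j" for m g
        using that by (simp add: mult.assoc fps_X_power_mult_nth)
      have "v i $ j = (v - h (Suc j)) i $ j" using h(1)[of "Suc j"] that by (simp add: P_def)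
      also have "\<dots> = (\<Sum>m<Suc j. \<Sum>g\<in>Gs d. r m g * lam d g i $ (j - m))"
        unfolding hn by (simp add: sum_fun_apply fps_sum_nth tm del: sum.lessThan_Suc)
      also have "\<dots> = (\<Sum>g\<in>Gs d. \<Sum>m<Suc j. r m g * lam d g i $ (j - m))"
        by (rule sum.swap)
      also have "\<dots> = (\<Sum>g\<in>Gs d. R g \<star> lam d g) i $ j"
        by (simp add: sum_fun_apply fps_sum_nth fps_mult_nth R_def atLeast0AtMost lessThan_Suc_atMost del: sum.lessThan_Suc)
      finally show "v i $ j = (\<Sum>g\<in>Gs d. R g \<star> lam d g) i $ j" .
    qed
    moreover have "gen (\<Sum>g\<in>Gs d. R g \<star> lam d g)"
      by (intro gen_sum gen_scal gen_el) (auto simp: GG_def)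
    ultimately show ?thesis using gen_cong by blast
  qed
  \<comment> \<open>Elements of order below \<open>d\<close> need only finitely many corrections;
    \<open>e\<close> counts how many are still missing.\<close>
  have "gen v" if "v \<in> L" "\<forall>i<N. \<forall>j<d - e. v i $ j = 0" for v e
    using that
  proof (induction e arbitrary: v)
    case 0 then show ?case using base by simp
  next
    case (Suc e)
    show ?case
    proof (cases "e < d")
      case False then show ?thesis using Suc by simp
    next
      case True
      then obtain w r where w: "w \<in> L" "\<forall>i<N. \<forall>j<Suc (d - Suc e). w i $ j = 0"
        "w = v - (\<Sum>g\<in>Gs (d - Suc e). (fps_const (r g) * fps_X ^ 0) \<star> lam (d - Suc e) g)"
        using step[of v "d - Suc e" 0] Suc.prems by auto
      have "gen w" using Suc.IH[OF w(1)] w(2) True by (simp add: Suc_diff_Suc)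
      moreover have "gen (\<Sum>g\<in>Gs (d - Suc e). (fps_const (r g) * fps_X ^ 0) \<star> lam (d - Suc e) g)"
        by (intro gen_sum gen_scal gen_el) (auto simp: GG_def)
      ultimately have "gen (w + (\<Sum>g\<in>Gs (d - Suc e). (fps_const (r g) * fps_X ^ 0) \<star> lam (d - Suc e) g))"
        by (rule gen_add)
      then show ?thesis unfolding w(3) diff_add_cancel .
    qed
  qed
  from this[where e=d] have "gen v" if "v \<in> L" for v using that by auto
  then show "\<exists>G. finite G \<and> G \<subseteq> L \<and> (\<forall>v\<in>L. \<exists>c. \<forall>i<N. v i = (\<Sum>g\<in>G. c g * g i))"
    using GG unfolding gen_def by blast
qed

text \<open>If \<open>v\<close> is congruent to \<open>x ^ k \<star> u k\<close> for every
  \<open>k\<close>, then by Noetherianity some \<open>u k\<close> is a combination of earlier ones.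
  Multiplying that relation by \<open>x ^ k\<close> expresses \<open>v\<close> as a multiple
  \<open>x * s\<close> of itself modulo \<open>L\<close>, and \<open>1 - x * s\<close> is a unit.
  Artin-Rees is bypassed.\<close>

lemma krull_intersection:
  fixes x :: "'r::comm_ring_1"
  assumes "noeth TYPE('r)" and L: "submod L" and N: "\<And>v. (\<forall>i<N. v i = 0) \<Longrightarrow> v \<in> L"
    and unit: "\<And>c. \<exists>u. u * (1 - x * c) = 1" and v: "\<And>k. \<exists>u. v - x ^ k \<star> u \<in> L"
  shows "v \<in> L"
proof -
  obtain u where u: "\<And>k. v - x ^ k \<star> u k \<in> L" using v by metis
  define S where "S = {w. \<exists>k c. w = (\<Sum>l<k. c l \<star> u l)}"
  have ext: "\<exists>c'. (\<Sum>l<k. c l \<star> u l) = (\<Sum>l<k'. c' l \<star> u l)" if "k \<le> k'" for k k' and c :: "nat \<Rightarrow> 'r"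
  proof (intro exI)
    have "(\<Sum>l<k'. (if l < k then c l else 0) \<star> u l) = (\<Sum>l<k. (if l < k then c l else 0) \<star> u l)"
      using that by (intro sum.mono_neutral_right) (auto simp: scal_simps)
    then show "(\<Sum>l<k. c l \<star> u l) = (\<Sum>l<k'. (if l < k then c l else 0) \<star> u l)" by simp
  qed
  have S: "submod S"
    unfolding submod_def
  proof (intro conjI ballI allI)
    show "0 \<in> S" by (auto simp: S_def intro!: exI[of _ 0])
  next
    fix a b assume "a \<in> S" "b \<in> S"
    then obtain k c k' c' where "a = (\<Sum>l<k. c l \<star> u l)" "b = (\<Sum>l<k'. c' l \<star> u l)" by (auto simp: S_def)
    then obtain e e' where "a = (\<Sum>l<max k k'. e l \<star> u l)" "b = (\<Sum>l<max k k'. e' l \<star> u l)"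
      using ext[of k "max k k'" c] ext[of k' "max k k'" c'] by auto
    then have "a + b = (\<Sum>l<max k k'. (e l + e' l) \<star> u l)" by (simp add: scal_simps sum.distrib)
    then show "a + b \<in> S" by (auto simp: S_def)
  next
    fix a t assume "a \<in> S"
    then obtain k c where "a = (\<Sum>l<k. c l \<star> u l)" by (auto simp: S_def)
    then have "t \<star> a = (\<Sum>l<k. (t * c l) \<star> u l)"
      by (auto simp: fun_eq_iff sum_fun_apply sum_distrib_left mult.assoc)
    then show "t \<star> a \<in> S" by (auto simp: S_def)
  qed
  then obtain G where G: "finite G" "G \<subseteq> S" "\<And>v. v \<in> S \<Longrightarrow> \<exists>c. \<forall>i<N. v i = (\<Sum>g\<in>G. c g * g i)"
    using noethD[OF assms(1)] by blast
  \<comment> \<open>Finitely many generators of the span of the \<open>u l\<close> involve only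
    finitely many of these vectors.\<close>
  have "\<exists>k. \<forall>g\<in>G. \<exists>c. g = (\<Sum>l<k. c l \<star> u l)" using G(1,2)
  proof (induction G)
    case (insert g G)
    then obtain k where k: "\<forall>g\<in>G. \<exists>c. g = (\<Sum>l<k. c l \<star> u l)" by blast
    obtain k' c where c: "g = (\<Sum>l<k'. c l \<star> u l)" using insert.prems unfolding S_def by blast
    have "\<exists>c. h = (\<Sum>l<max k k'. c l \<star> u l)" if h: "h \<in> insert g G" for h
    proof (cases "h = g")
      case True
      then show ?thesis using ext[of k' "max k k'" c] c by simp
    next
      case False
      then obtain e where "h = (\<Sum>l<k. e l \<star> u l)" using bspec[OF k, of h] h by blast
      then show ?thesis using ext[of k "max k k'" e] by simp
    qed
    then show ?case by blast
  qed auto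
  then obtain k a where a: "\<And>g. g \<in> G \<Longrightarrow> g = (\<Sum>l<k. a g l \<star> u l)" by metis
  have "u k \<in> S" unfolding S_def
    by (auto intro!: exI[of _ "Suc k"] exI[of _ "\<lambda>l. if l = k then 1 else 0"] simp: fun_eq_iff sum_fun_apply)
  then obtain c where c: "\<And>i. i < N \<Longrightarrow> u k i = (\<Sum>g\<in>G. c g * g i)" using G(3) by blast
  define b where "b l = (\<Sum>g\<in>G. c g * a g l)" for l
  have "u k i = (\<Sum>l<k. b l \<star> u l) i" if "i < N" for i
  proof -
    have "u k i = (\<Sum>g\<in>G. c g * (\<Sum>l<k. a g l * u l i))"
      unfolding c[OF that]
    proof (rule sum.cong)
      fix g assume "g \<in> G"
      then have "g i = (\<Sum>l<k. a g l \<star> u l) i" using a[of g] by metis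
      then show "c g * g i = c g * (\<Sum>l<k. a g l * u l i)" by (simp add: sum_fun_apply)
    qed simp
    also have "\<dots> = (\<Sum>l<k. \<Sum>g\<in>G. c g * a g l * u l i)"
      by (simp add: sum_distrib_left mult.assoc sum.swap[of _ G])
    finally show ?thesis by (simp add: sum_fun_apply b_def sum_distrib_right)
  qed
  then have "u k - (\<Sum>l<k. b l \<star> u l) \<in> L" by (intro N) auto
  moreover have "x ^ k \<star> (\<Sum>l<k. b l \<star> u l) = (\<Sum>l<k. (b l * x ^ (k - l)) \<star> x ^ l \<star> u l)"
  proof
    fix i
    have "x ^ k * (b l * u l i) = b l * x ^ (k - l) * (x ^ l * u l i)" if "l < k" for l
    proof -
      have "x ^ k = x ^ (k - l) * x ^ l" using that by (simp flip: power_add)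
      then show ?thesis by (simp add: ac_simps)
    qed
    then show "(x ^ k \<star> (\<Sum>l<k. b l \<star> u l)) i = (\<Sum>l<k. (b l * x ^ (k - l)) \<star> x ^ l \<star> u l) i"
      by (simp add: sum_fun_apply sum_distrib_left)
  qed
  ultimately have 1: "x ^ k \<star> u k - (\<Sum>l<k. (b l * x ^ (k - l)) \<star> x ^ l \<star> u l) \<in> L"
    using submod_cong_scal[OF L, of "u k" _ "x ^ k"] by metis
  have 2: "(\<Sum>l<k. (b l * x ^ (k - l)) \<star> x ^ l \<star> u l) - (\<Sum>l<k. (b l * x ^ (k - l)) \<star> v) \<in> L"
    by (intro submod_cong_sum submod_cong_scal submod_cong_sym[OF L u] L)
  \<comment> \<open>All exponents \<open>k - l\<close> are positive, so one factor \<open>x\<close>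
    can be taken out.\<close>
  define s where "s = (\<Sum>l<k. b l * x ^ (k - l - 1))"
  have 3: "(\<Sum>l<k. (b l * x ^ (k - l)) \<star> v) = (x * s) \<star> v"
  proof -
    have "b l * x ^ (k - l) = x * (b l * x ^ (k - l - 1))" if "l < k" for l
      using that by (simp add: power_eq_if[of x "k - l"] ac_simps)
    then have "x * s = (\<Sum>l<k. b l * x ^ (k - l))" by (simp add: s_def sum_distrib_left)
    then show ?thesis by (auto simp: fun_eq_iff sum_fun_apply sum_distrib_right)
  qed
  have "v - (x * s) \<star> v \<in> L"
    using submod_cong_trans[OF L submod_cong_trans[OF L u 1] 2] unfolding 3 .
  then have 4: "(1 - x * s) \<star> v \<in> L" by (simp add: scal_simps)
  obtain e where "e * (1 - x * s) = 1" using unit by blast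
  then show "v \<in> L" using submod_scal[OF L 4, of e] by (simp only: scal_simps(6,7))
qed

section \<open>Division of power series\<close>

text \<open>Weierstrass division in the form needed here: the coefficient of order \<open>n\<close>
  of \<open>g * q\<close> is \<open>g $ 0 * q $ n\<close> plus terms in earlier coefficients of
  \<open>q\<close>. Division by \<open>g $ 0\<close> with remainders in \<open>R0\<close> therefore
  determines the quotient recursively.\<close>

lemma fps_division:
  fixes g :: "'r::comm_ring_1 fps"
  assumes "\<And>p. \<exists>q r. p = g $ 0 * q + r \<and> r \<in> R0"
  shows "\<exists>q r. p = g * q + r \<and> (\<forall>n. r $ n \<in> R0)"
proof -
  define P where "P q n y \<longleftrightarrow> p $ n - (\<Sum>i = 1..n. g $ i * q (n - i)) - g $ 0 * y \<in> R0" for q n y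
  have "\<exists>q. \<forall>n. P q n (q n)"
  proof (rule dependent_wellorder_choice)
    fix r and f h :: "nat \<Rightarrow> 'r" and n :: nat assume "\<And>y. y < n \<Longrightarrow> f y = h y"
    then have "(\<Sum>i = 1..n. g $ i * f (n - i)) = (\<Sum>i = 1..n. g $ i * h (n - i))"
      by (intro sum.cong) auto
    then show "P f n r = P h n r" by (simp add: P_def)
  next
    fix n :: nat and f :: "nat \<Rightarrow> 'r"
    obtain q r where "p $ n - (\<Sum>i = 1..n. g $ i * f (n - i)) = g $ 0 * q + r" "r \<in> R0"
      using assms by blast
    then show "\<exists>r. P f n r" by (intro exI[of _ q]) (simp add: P_def)
  qed
  then obtain q where q: "\<And>n. P q n (q n)" by blast
  have "(p - g * Abs_fps q) $ n \<in> R0" for n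
    using q[of n] by (simp add: P_def fps_mult_nth sum.atLeast_Suc_atMost algebra_simps)
  then show ?thesis by (intro exI[of _ "Abs_fps q"] exI[of _ "p - g * Abs_fps q"]) auto
qed

lemma fps_division_unique:
  fixes g :: "'r::comm_ring_1 fps"
  assumes "\<And>q r. g $ 0 * q + r = 0 \<Longrightarrow> r \<in> R0 \<Longrightarrow> q = 0"
    and "g * q + r = 0" "\<forall>n. r $ n \<in> R0"
  shows "q = 0"
proof -
  have "q $ n = 0" for n
  proof (induction n rule: less_induct)
    case (less n)
    have "0 = (g * q + r) $ n" using assms(2) by simp
    also have "\<dots> = g $ 0 * q $ n + r $ n"
      using less by (simp add: fps_mult_nth sum.atLeast_Suc_atMost)
    finally show ?case using assms(1)[of "q $ n" "r $ n"] assms(3) by simp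
  qed
  then show ?thesis by (simp add: fps_eq_iff)
qed

section \<open>The power series ring\<close>

lemma fps_split: "g = fps_const (g $ 0) + fps_X * fps_shift 1 g" for g :: "'r::comm_ring_1 fps"
proof (rule fps_ext)
  fix n show "g $ n = (fps_const (g $ 0) + fps_X * fps_shift 1 g) $ n" by (cases n) auto
qed

lemma fps_X_dvd_iff: "fps_X dvd g \<longleftrightarrow> g $ 0 = 0" for g :: "'r::comm_ring_1 fps"
proof
  assume "g $ 0 = 0"
  then have "g = fps_X * fps_shift 1 g" using fps_split[of g] by simp
  then show "fps_X dvd g" by (metis dvd_triv_left)
next
  assume "fps_X dvd g"
  then obtain h where "g = fps_X * h" by (rule dvdE)
  then show "g $ 0 = 0" by simp
qed

lemma fps_const_dvd_iff: "fps_const c dvd g \<longleftrightarrow> (\<forall>n. c dvd g $ n)" for g :: "'r::comm_ring_1 fps"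
proof
  assume "\<forall>n. c dvd g $ n"
  then have "\<forall>n. \<exists>h. g $ n = c * h" by (auto simp: dvd_def)
  from choice[OF this] obtain h where h: "\<And>n. g $ n = c * h n" by blast
  have "g = fps_const c * Abs_fps h" by (rule fps_ext) (simp add: h)
  then show "fps_const c dvd g" by (metis dvd_triv_left)
next
  assume "fps_const c dvd g"
  then obtain h where "g = fps_const c * h" by (rule dvdE)
  then show "\<forall>n. c dvd g $ n" by simp
qed

definition mapf :: "('r::comm_ring_1 \<Rightarrow> 's::comm_ring_1) \<Rightarrow> 'r fps \<Rightarrow> 's fps" where
  "mapf h g = Abs_fps (\<lambda>n. h (g $ n))"

lemma mapf_nth [simp]: "mapf h g $ n = h (g $ n)"
  by (simp add: mapf_def)

lemma comm_ring_hom_mapf: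
  assumes "comm_ring_hom h" shows "comm_ring_hom (mapf h)"
proof -
  interpret comm_ring_hom h by fact
  show ?thesis
  proof
    show "mapf h 1 = 1" by (rule fps_ext) simp
    show "mapf h (x + y) = mapf h x + mapf h y" for x y by (rule fps_ext) (simp add: hom_add)
    show "mapf h (x * y) = mapf h x * mapf h y" for x y
      by (rule fps_ext) (simp add: fps_mult_nth hom_sum hom_mult)
    show "mapf h 0 = 0" by (rule fps_ext) simp
  qed
qed

lemma comm_ring_hom_nth0: "comm_ring_hom (\<lambda>g :: 'r::comm_ring_1 fps. g $ 0)"
  by standard auto

lemma comm_ring_hom_const: "comm_ring_hom (fps_const :: 'r::comm_ring_1 \<Rightarrow> _)"
  by standard auto

lemma comm_ring_hom_comp: "comm_ring_hom h \<Longrightarrow> comm_ring_hom g \<Longrightarrow> comm_ring_hom (\<lambda>x. h (g x))"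
proof -
  assume "comm_ring_hom h" "comm_ring_hom g"
  then interpret h: comm_ring_hom h + g: comm_ring_hom g by simp_all
  show ?thesis by standard (auto simp: g.hom_add h.hom_add g.hom_mult h.hom_mult)
qed

text \<open>In the nested rendering Z is the outermost variable and X the innermost.
  \<open>\<iota>\<close>, \<open>emb_Y\<close> and \<open>emb_Z\<close> include K[[Y,Z]], K[[Y]] and
  K[[Z]] as the series free of the other variables; \<open>res_Y\<close> puts X = Z = 0 and
  \<open>res_YZ\<close> puts X = 0.\<close>

definition emb_YZ :: "'k::field fps fps \<Rightarrow> 'k T" ("\<iota>") where "\<iota> = mapf (mapf fps_const)"
definition emb_Y :: "'k::field fps \<Rightarrow> 'k T" where "emb_Y p = fps_const (mapf fps_const p)"
definition emb_Z :: "'k::field fps \<Rightarrow> 'k T" where "emb_Z p = mapf (\<lambda>c. fps_const (fps_const c)) p"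
definition res_Y :: "'k::field T \<Rightarrow> 'k fps" where "res_Y t = mapf (\<lambda>p. p $ 0) (t $ 0)"
definition res_YZ :: "'k::field T \<Rightarrow> 'k fps fps" where "res_YZ = mapf (mapf (\<lambda>p. p $ 0))"

lemma comm_ring_hom_emb:
  "comm_ring_hom (\<iota> :: 'k::field fps fps \<Rightarrow> _)" "comm_ring_hom (emb_Y :: 'k::field fps \<Rightarrow> _)"
  "comm_ring_hom (emb_Z :: 'k::field fps \<Rightarrow> _)" "comm_ring_hom (cst :: 'k::field \<Rightarrow> _)"
  unfolding emb_YZ_def emb_Y_def[abs_def] emb_Z_def[abs_def] cst_def[abs_def]
  by (rule comm_ring_hom_mapf comm_ring_hom_const comm_ring_hom_comp[of fps_const "mapf fps_const"]
      comm_ring_hom_comp[of fps_const fps_const] comm_ring_hom_comp[of fps_const "\<lambda>c. fps_const (fps_const c)"])+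

lemma comm_ring_hom_res:
  "comm_ring_hom (res_Y :: 'k::field T \<Rightarrow> _)" "comm_ring_hom (res_YZ :: 'k::field T \<Rightarrow> _)"
  unfolding res_Y_def[abs_def] res_YZ_def
  by (rule comm_ring_hom_mapf comm_ring_hom_nth0
      comm_ring_hom_comp[of "mapf (\<lambda>p. p $ 0)" "\<lambda>t. t $ 0"])+

interpretation iota: comm_ring_hom "\<iota> :: 'k::field fps fps \<Rightarrow> _" by (rule comm_ring_hom_emb)
interpretation emb_Y: comm_ring_hom "emb_Y :: 'k::field fps \<Rightarrow> _" by (rule comm_ring_hom_emb)
interpretation emb_Z: comm_ring_hom "emb_Z :: 'k::field fps \<Rightarrow> _" by (rule comm_ring_hom_emb)
interpretation cst: comm_ring_hom "cst :: 'k::field \<Rightarrow> _" by (rule comm_ring_hom_emb)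
interpretation res_Y: comm_ring_hom "res_Y :: 'k::field T \<Rightarrow> _" by (rule comm_ring_hom_res)
interpretation res_YZ: comm_ring_hom "res_YZ :: 'k::field T \<Rightarrow> _" by (rule comm_ring_hom_res)

lemma var_nth [simp]:
  "(\<X> :: 'k::field T) $ 0 = fps_const fps_X" "(\<Y> :: 'k T) $ 0 = fps_X" "(\<Z> :: 'k T) $ 0 = 0"
  "(\<X> :: 'k T) $ Suc n = 0" "(\<Y> :: 'k T) $ Suc n = 0" "(\<Z> :: 'k T) $ Suc 0 = 1" "cst c $ 0 = fps_const (fps_const c)"
  "cst c $ Suc n = 0"
  by (simp_all add: \<X>_def \<Y>_def \<Z>_def cst_def)

lemma res_Y_var [simp]: "res_Y \<X> = 0" "res_Y \<Y> = fps_X" "res_Y \<Z> = 0" "res_Y (cst c) = fps_const c"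
  by (auto simp: res_Y_def fps_eq_iff)

lemma res_YZ_var [simp]: "res_YZ \<X> = 0" "res_YZ \<Y> = fps_const fps_X" "res_YZ \<Z> = fps_X"
  "res_YZ (cst c) = fps_const (fps_const c)"
  by (auto simp: res_YZ_def fps_eq_iff \<X>_def \<Y>_def \<Z>_def cst_def)

lemma iota_var [simp]: "\<iota> (fps_const fps_X) = \<Y>" "\<iota> fps_X = \<Z>" "\<iota> (fps_const (fps_const c)) = cst c"
  by (auto simp: emb_YZ_def fps_eq_iff \<Y>_def \<Z>_def cst_def)

lemma emb_Y_X [simp]: "emb_Y fps_X = \<Y>" and emb_Z_X [simp]: "emb_Z fps_X = \<Z>"
  by (auto simp: emb_Y_def emb_Z_def fps_eq_iff \<Y>_def \<Z>_def)

lemma res_Y_iota [simp]: "res_Y (\<iota> a) = a $ 0"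
  by (auto simp: res_Y_def emb_YZ_def fps_eq_iff)

lemma res_Y_emb_Y [simp]: "res_Y (emb_Y p) = p"
  by (auto simp: res_Y_def emb_Y_def fps_eq_iff)

lemma fps_unit: "\<exists>h. g * h = 1" if "g $ 0 * y = 1" for g :: "'r::comm_ring_1 fps"
  using fps_right_inverse[OF that] by blast

lemma T_unit: "\<exists>s. t * s = 1" if "t $ 0 $ 0 $ 0 \<noteq> 0" for t :: "'k::field T"
proof -
  have "t $ 0 $ 0 $ 0 * inverse (t $ 0 $ 0 $ 0) = 1" using that by simp
  then obtain h1 where h1: "t $ 0 $ 0 * h1 = 1" using fps_unit by blast
  then obtain h2 where "t $ 0 * h2 = 1" using fps_unit by blast
  then show ?thesis using fps_unit by blast
qed

lemma Z_dvd_iff: "\<Z> dvd t \<longleftrightarrow> t $ 0 = 0"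
  by (simp add: \<Z>_def fps_X_dvd_iff)

lemma Y_dvd_iff: "\<Y> dvd t \<longleftrightarrow> (\<forall>k. t $ k $ 0 = 0)"
  by (simp add: \<Y>_def fps_X_dvd_iff fps_const_dvd_iff)

lemma X_dvd_iff: "\<X> dvd t \<longleftrightarrow> res_YZ t = 0" for t :: "'k::field T"
  by (auto simp: \<X>_def fps_X_dvd_iff fps_const_dvd_iff res_YZ_def fps_eq_iff)

lemma res_Y_0D: "\<exists>p q. t = \<X> * p + \<Z> * q" if "res_Y t = 0" for t :: "'k::field T"
proof -
  have "fps_const fps_X dvd t $ 0" using that
    by (auto simp: fps_const_dvd_iff fps_X_dvd_iff res_Y_def fps_eq_iff)
  then obtain p where p: "t $ 0 = fps_const fps_X * p" by (rule dvdE)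
  have "t = \<X> * fps_const p + \<Z> * fps_shift 1 t"
    using fps_split[of t] by (simp add: p \<X>_def \<Z>_def)
  then show ?thesis by blast
qed

text \<open>The double coefficient \<open>t $ 0 $ 0\<close> is the image of \<open>t\<close> modulo
  (Y, Z), a series in X.\<close>

lemma const_0D: "\<exists>p q. t = \<Y> * p + \<Z> * q" if "t $ 0 $ 0 = 0" for t :: "'k::field T"
proof -
  have "fps_X dvd t $ 0" using that by (simp add: fps_X_dvd_iff)
  then obtain p where p: "t $ 0 = fps_X * p" by (rule dvdE)
  have "t = \<Y> * fps_const p + \<Z> * fps_shift 1 t"
    using fps_split[of t] by (simp add: p \<Y>_def \<Z>_def)
  then show ?thesis by blast
qed

lemma T_split: "\<exists>p q. t = emb_Y (res_Y t) + \<X> * p + \<Z> * q" for t :: "'k::field T"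
  using res_Y_0D[of "t - emb_Y (res_Y t)"] by (simp add: res_Y.hom_minus algebra_simps) 

lemma fps_order: "\<exists>n u s. p = fps_X ^ n * u \<and> u * s = 1" if "p \<noteq> 0" for p :: "'k::field fps"
proof (intro exI conjI)
  show "p = fps_X ^ subdegree p * unit_factor p"
    by (metis fps_unit_factor_decompose mult.commute that)
  show "unit_factor p * inverse (unit_factor p) = 1"
    using that by (simp add: inverse_mult_eq_1')
qed

lemma fps_order': "\<exists>n u. p = fps_X ^ n * u \<and> u $ 0 \<noteq> 0" if "p \<noteq> 0" for p :: "'r::comm_ring_1 fps"
  using that by (intro exI[of _ "subdegree p"] exI[of _ "fps_shift (subdegree p) p"])
    (metis fps_shift_subdegree_zero_iff fps_shift_nth nth_subdegree_nonzero subdegree_decompose mult.commute add_0)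

lemma T_max: "\<exists>p q r. t = \<X> * p + \<Y> * q + \<Z> * r" if "t $ 0 $ 0 $ 0 = 0" for t :: "'k::field T"
proof -
  obtain p q where pq: "t = emb_Y (res_Y t) + \<X> * p + \<Z> * q" using T_split by blast
  have "res_Y t $ 0 = 0" using that by (simp add: res_Y_def)
  then obtain s where "res_Y t = fps_X * s" by (metis fps_X_dvd_iff dvdE)
  then have "t = \<X> * p + \<Y> * emb_Y s + \<Z> * q" using pq by (simp add: emb_Y.hom_mult)
  then show ?thesis by blast
qed

section \<open>Division by the cubic\<close>

text \<open>Here the two nested variables are X (inner) and Y. These are the remainders for division
  by X^3, the value of \<open>- f\<^sub>E a b\<close> at Z = 0.\<close>

definition low :: "'k::field fps fps set" where
  "low = {p. \<forall>j i. 3 \<le> i \<longrightarrow> p $ j $ i = 0}"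

context
  fixes a b :: "'k::field"
begin

text \<open>The shape used throughout: modulo f the cube of X is Z times a series that becomes Y^2
  at X = Z = 0.\<close>

lemma f_eq: "f\<^sub>E a b = \<Z> * (\<Y>\<^sup>2 - cst b * \<Z>\<^sup>2 - cst a * \<X> * \<Z>) - \<X> ^ 3"
  by (simp add: f\<^sub>E_def weierstrass_def algebra_simps power2_eq_square power3_eq_cube)

lemma f_nth0: "f\<^sub>E a b $ 0 = - (fps_const fps_X ^ 3)"
  by (simp add: f_eq fps_power_zeroth)

lemma f_nth00 [simp]: "f\<^sub>E a b $ 0 $ 0 = - (fps_X ^ 3)"
  by (simp add: f_nth0 fps_power_zeroth)

lemma f_nth000 [simp]: "f\<^sub>E a b $ 0 $ 0 $ 0 = 0"
  by simp

lemma res_Y_f [simp]: "res_Y (f\<^sub>E a b) = 0"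
  by (simp add: f_eq res_Y.hom_minus res_Y.hom_mult res_Y.hom_power)

lemma f_ne_0: "f\<^sub>E a b \<noteq> 0"
proof
  assume "f\<^sub>E a b = 0"
  then have "f\<^sub>E a b $ 0 $ 0 = 0" by simp
  then show False unfolding f_nth00 by simp
qed

lemma f_nth_nth: "f\<^sub>E a b $ 0 * q = - fps_const (fps_X ^ 3) * q"
  by (simp add: f_nth0 fps_const_power)

lemma f_division0: "\<exists>q r. p = f\<^sub>E a b $ 0 * q + r \<and> r \<in> low"
proof (intro exI conjI)
  show "p = f\<^sub>E a b $ 0 * (- Abs_fps (\<lambda>j. fps_shift 3 (p $ j))) + Abs_fps (\<lambda>j. fps_cutoff 3 (p $ j))"
    by (auto simp: f_nth_nth fps_eq_iff fps_X_power_mult_nth)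
  show "Abs_fps (\<lambda>j. fps_cutoff 3 (p $ j)) \<in> low" by (auto simp: low_def)
qed

lemma f_division0_unique: "q = 0" if "f\<^sub>E a b $ 0 * q + r = 0" "r \<in> low"
proof -
  have "q $ j $ i = 0" for i j
  proof -
    have "0 = (f\<^sub>E a b $ 0 * q + r) $ j $ (i + 3)" using that(1) by simp
    also have "\<dots> = - (q $ j $ i)" using that(2) by (simp add: f_nth_nth low_def fps_X_power_mult_nth)
    finally show ?thesis by simp
  qed
  then show ?thesis by (simp add: fps_eq_iff)
qed

lemma sum3: "(\<Sum>i<3. h i) = h 0 + h 1 + h (2::nat)" for h :: "nat \<Rightarrow> 'c::comm_monoid_add"
  by (simp add: numeral_3_eq_3 numeral_2_eq_2)

lemma pol_nth: "(\<Sum>i<3. \<iota> (c i) * \<X> ^ i) $ k $ j $ l = (if l < 3 then c l $ k $ j else 0)" for c :: "nat \<Rightarrow> 'k fps fps"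
proof -
  have "(\<iota> (c i) * \<X> ^ i) $ k $ j $ l = (if l = i then c l $ k $ j else 0)" for i
    by (simp add: \<X>_def fps_const_power emb_YZ_def)
  then show ?thesis by (simp add: fps_sum_nth) 
qed

text \<open>The cubic is regular of order three in X, so 1, X, X^2 generate T/(f) over K[[Y,Z]].
  Together with \<open>f_division_unique\<close> they form a basis.\<close>

lemma f_division: "\<exists>c. f\<^sub>E a b dvd t - (\<Sum>i<3. \<iota> (c i) * \<X> ^ i)"
proof -
  obtain q r where qr: "t = f\<^sub>E a b * q + r" "\<forall>n. r $ n \<in> low"
    using fps_division[of "f\<^sub>E a b" low t] f_division0 by blast
  \<comment> \<open>The remainder is sorted by powers of Z on the outside; it is regrouped by powers
    of X.\<close>
  define c where "c i = Abs_fps (\<lambda>k. Abs_fps (\<lambda>j. r $ k $ j $ i))" for i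
  have "r = (\<Sum>i<3. \<iota> (c i) * \<X> ^ i)"
    using qr(2) by (auto simp: fps_eq_iff pol_nth c_def low_def)
  then show ?thesis using qr(1) by (intro exI[of _ c]) simp
qed

lemma f_division_unique: "c i = 0" if dvd: "f\<^sub>E a b dvd (\<Sum>i<3. \<iota> (c i) * \<X> ^ i)" and i: "i < 3"
proof -
  obtain q where q: "(\<Sum>i<3. \<iota> (c i) * \<X> ^ i) = f\<^sub>E a b * q" using dvd by (rule dvdE)
  then have "f\<^sub>E a b * (- q) + (\<Sum>i<3. \<iota> (c i) * \<X> ^ i) = 0" by simp
  then have "- q = 0"
  proof (rule fps_division_unique[of "f\<^sub>E a b" low, rotated])
    show "\<forall>n. (\<Sum>i<3. \<iota> (c i) * \<X> ^ i) $ n \<in> low" by (simp add: low_def pol_nth)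
  qed (rule f_division0_unique)
  then have "(\<Sum>i<3. \<iota> (c i) * \<X> ^ i) $ k $ j $ i = 0" for k j using q by simp
  then show ?thesis using i by (simp add: pol_nth fps_eq_iff)
qed

section \<open>The coordinate ring is a domain\<close>

text \<open>At X = 0 the cubic becomes Y^2 Z - b Z^3, which is nonzero in the domain K[[Y,Z]]. Hence
  a multiple of f divisible by X has a cofactor divisible by X.\<close>

lemma f_dvd_X_mult: "f\<^sub>E a b dvd s" if dvd: "f\<^sub>E a b dvd \<X> * s"
proof -
  obtain t where t: "\<X> * s = f\<^sub>E a b * t" using dvd by (rule dvdE)
  then have "res_YZ (f\<^sub>E a b) * res_YZ t = 0"
    by (metis res_YZ.hom_mult res_YZ_var(1) mult_zero_left)
  moreover have "res_YZ (f\<^sub>E a b) \<noteq> 0"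
  proof
    assume "res_YZ (f\<^sub>E a b) = 0"
    then have "res_YZ (f\<^sub>E a b) $ 1 $ 2 = 0" by simp
    then show False
      by (simp add: f_eq res_YZ.hom_minus res_YZ.hom_mult res_YZ.hom_power fps_const_power flip: fps_const_mult)
  qed
  ultimately have "res_YZ t = 0" by simp
  then obtain t' where "t = \<X> * t'" by (metis X_dvd_iff dvdE)
  then have "\<X> * s = \<X> * (f\<^sub>E a b * t')" using t by (simp add: ac_simps)
  moreover have "\<X> \<noteq> (0 :: 'k T)" by (metis res_YZ.hom_zero X_dvd_iff var_nth(1) fps_X_neq_zero fps_const_eq_0_iff fps_zero_nth)
  ultimately have "s = f\<^sub>E a b * t'" by (metis mult_left_cancel)
  then show ?thesis by simp
qed

lemma f_dvd_X_power_mult: "f\<^sub>E a b dvd \<X> ^ n * s \<Longrightarrow> f\<^sub>E a b dvd s"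
  by (induction n) (auto dest: f_dvd_X_mult simp: mult.assoc)

text \<open>In the localisation at \<open>(\<X>, \<Z>)\<close> the element \<open>\<theta>\<close> is a unit and \<open>\<X>\<close> is a uniformiser, as
  \<open>\<X>\<^sup>3 = \<Z> \<theta>\<close>; hence every nonzero element has a valuation.\<close>

lemma f_valuation:
  assumes "\<not> f\<^sub>E a b dvd p"
  defines "\<theta> \<equiv> \<Y>\<^sup>2 - cst b * \<Z>\<^sup>2 - cst a * \<X> * \<Z>"
  shows "\<exists>k n h. f\<^sub>E a b dvd \<theta> ^ k * p - \<X> ^ n * h \<and> res_Y h \<noteq> 0"
proof -
  obtain c where c: "f\<^sub>E a b dvd p - (\<Sum>i<3. \<iota> (c i) * \<X> ^ i)" using f_division by blast
  define J where "J = {i. i < 3 \<and> c i \<noteq> 0}"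
  have J: "finite J" "J \<noteq> {}"
  proof -
    show "J \<noteq> {}"
    proof
      assume "J = {}"
      then have "(\<Sum>i<3. \<iota> (c i) * \<X> ^ i) = 0" by (auto simp: J_def)
      then show False using c assms(1) by simp
    qed
  qed (simp add: J_def)
  have "\<forall>i. \<exists>e u. c i \<noteq> 0 \<longrightarrow> c i = fps_X ^ e * u \<and> u $ 0 \<noteq> 0" using fps_order' by blast
  then obtain e u where eu: "\<And>i. c i \<noteq> 0 \<Longrightarrow> c i = fps_X ^ e i * u i" "\<And>i. c i \<noteq> 0 \<Longrightarrow> u i $ 0 \<noteq> 0"
    by metis
  define m where "m = Max (e ` J)"
  have em: "e i \<le> m" if "i \<in> J" for i using J that by (simp add: m_def)
  \<comment> \<open>The valuation of the term with index \<open>i\<close>: Z counts three times as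
    much as X because the factor \<open>\<theta>\<close> is a unit of the localisation. The values
    differ modulo 3, so the minimum is attained only once.\<close>
  define n where "n i = 3 * e i + i" for i
  obtain l where l: "l \<in> J" "\<And>i. i \<in> J \<Longrightarrow> n l \<le> n i"
    using J by (metis arg_min_if_finite(1) arg_min_least)
  have less: "n l < n i" if "i \<in> J" "i \<noteq> l" for i
  proof -
    have "n j mod 3 = j" if "j \<in> J" for j using that by (simp add: n_def J_def)
    then have "n l \<noteq> n i" using that l(1) by metis
    then show ?thesis using l(2)[OF that(1)] by simp
  qed
  \<comment> \<open>A common power \<open>\<theta> ^ m\<close> is used for all terms; each
    replacement of \<open>\<Z> * \<theta>\<close> by the cube of X consumes one factor.\<close>
  define g where "g i = \<theta> ^ (m - e i) * \<iota> (u i)" for i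
  have ft: "f\<^sub>E a b = \<Z> * \<theta> - \<X> ^ 3" unfolding \<theta>_def by (rule f_eq)
  have 1: "f\<^sub>E a b dvd \<theta> ^ m * (\<iota> (c i) * \<X> ^ i) - \<X> ^ n i * g i" if "i \<in> J" for i
  proof -
    have "f\<^sub>E a b dvd (\<Z> * \<theta>) ^ e i - (\<X> ^ 3) ^ e i"
      unfolding ft power_diff_sumr2 by simp
    then have "f\<^sub>E a b dvd ((\<Z> * \<theta>) ^ e i - (\<X> ^ 3) ^ e i) * (\<theta> ^ (m - e i) * \<iota> (u i) * \<X> ^ i)" by simp
    moreover have "\<theta> ^ m = \<theta> ^ e i * \<theta> ^ (m - e i)" using em[OF that] by (simp flip: power_add)
    moreover have "\<iota> (c i) = \<Z> ^ e i * \<iota> (u i)"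
      using eu(1)[of i] that by (simp add: J_def iota.hom_mult iota.hom_power)
    moreover have "(\<X> ^ 3) ^ e i = (\<X> :: 'k T) ^ (3 * e i)" by (simp add: power_mult)
    ultimately show ?thesis
      by (simp add: n_def g_def power_add power_mult_distrib algebra_simps)
  qed
  define h where "h = g l + (\<Sum>i\<in>J - {l}. \<X> ^ (n i - n l) * g i)"
  have "\<X> ^ n l * h = (\<Sum>i\<in>J. \<X> ^ n i * g i)"
  proof -
    have "\<X> ^ n l * (\<X> ^ (n i - n l) * g i) = \<X> ^ n i * g i" if "i \<in> J - {l}" for i
      using less[of i] that by (simp flip: power_add mult.assoc)
    then have "(\<Sum>i\<in>J - {l}. \<X> ^ n l * (\<X> ^ (n i - n l) * g i)) = (\<Sum>i\<in>J - {l}. \<X> ^ n i * g i)"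
      by (rule sum.cong[OF refl])
    then show ?thesis using J l(1) by (simp only: h_def distrib_left sum_distrib_left sum.remove[of J l])
  qed
  moreover have "(\<Sum>i<3. \<iota> (c i) * \<X> ^ i) = (\<Sum>i\<in>J. \<iota> (c i) * \<X> ^ i)"
    by (rule sum.mono_neutral_right) (auto simp: J_def)
  ultimately have "\<theta> ^ m * (\<Sum>i<3. \<iota> (c i) * \<X> ^ i) - \<X> ^ n l * h = (\<Sum>i\<in>J. \<theta> ^ m * (\<iota> (c i) * \<X> ^ i) - \<X> ^ n i * g i)"
    by (simp add: sum_subtractf sum_distrib_left)
  then have "f\<^sub>E a b dvd \<theta> ^ m * (\<Sum>i<3. \<iota> (c i) * \<X> ^ i) - \<X> ^ n l * h"
    using 1 by (simp add: dvd_sum)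
  moreover have "f\<^sub>E a b dvd \<theta> ^ m * (p - (\<Sum>i<3. \<iota> (c i) * \<X> ^ i))" using c by simp
  ultimately have "f\<^sub>E a b dvd \<theta> ^ m * p - \<X> ^ n l * h"
    using dvd_add by (fastforce simp: algebra_simps)
  moreover have "res_Y h \<noteq> 0"
  proof -
    \<comment> \<open>Terms of larger valuation keep a factor X and vanish under
      \<open>res_Y\<close>; only the minimal term survives.\<close>
    have "res_Y (\<X> ^ (n i - n l) * g i) = 0" if "i \<in> J - {l}" for i
      using less[of i] that by (simp add: res_Y.hom_mult res_Y.hom_power)
    then have "res_Y h = res_Y (g l)" by (simp add: h_def res_Y.hom_add res_Y.hom_sum)
    also have "\<dots> = fps_X ^ (2 * (m - e l)) * u l $ 0"
      by (simp add: g_def \<theta>_def res_Y.hom_mult res_Y.hom_power res_Y.hom_minus power_mult)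
    finally show ?thesis using eu(2)[of l] l(1) by (simp add: J_def)
  qed
  ultimately show ?thesis by blast
qed

text \<open>After multiplication by powers of \<open>\<theta>\<close>, each factor becomes a power
  of X times a series with nonzero \<open>res_Y\<close>. The powers of X cancel, and modulo (X, Z),
  where f vanishes, two nonzero elements of K[[Y]] would have product zero.\<close>

lemma f_prime: "f\<^sub>E a b dvd p \<or> f\<^sub>E a b dvd q" if "f\<^sub>E a b dvd p * q"
proof (rule ccontr)
  define \<theta> where "\<theta> = \<Y>\<^sup>2 - cst b * \<Z>\<^sup>2 - cst a * \<X> * \<Z>"
  assume "\<not> ?thesis"
  then have npq: "\<not> f\<^sub>E a b dvd p" "\<not> f\<^sub>E a b dvd q" by auto
  obtain k n h where h: "f\<^sub>E a b dvd \<theta> ^ k * p - \<X> ^ n * h" "res_Y h \<noteq> 0"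
    using f_valuation[OF npq(1)] unfolding \<theta>_def by blast
  obtain l m g where g: "f\<^sub>E a b dvd \<theta> ^ l * q - \<X> ^ m * g" "res_Y g \<noteq> 0"
    using f_valuation[OF npq(2)] unfolding \<theta>_def by blast
  have "f\<^sub>E a b dvd (\<theta> ^ k * p - \<X> ^ n * h) * (\<theta> ^ l * q) + (\<theta> ^ l * q - \<X> ^ m * g) * (\<X> ^ n * h)
      - \<theta> ^ k * \<theta> ^ l * (p * q)"
    using h g that by (intro dvd_diff dvd_add) auto
  also have "\<dots> = - (\<X> ^ (n + m) * (h * g))" by (simp add: algebra_simps power_add)
  finally have "f\<^sub>E a b dvd \<X> ^ (n + m) * (h * g)" by (simp only: dvd_minus_iff)
  then have "f\<^sub>E a b dvd h * g" by (rule f_dvd_X_power_mult)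
  then obtain s where "h * g = f\<^sub>E a b * s" by (rule dvdE)
  then have "res_Y (h * g) = res_Y (f\<^sub>E a b * s)" by simp
  then have "res_Y h * res_Y g = 0" unfolding res_Y.hom_mult res_Y_f by simp
  then show False using h g by simp
qed

lemma f_dvd_power: "f\<^sub>E a b dvd p" if "f\<^sub>E a b dvd p ^ n"
  using that
proof (induction n)
  case 0
  then obtain s where "1 = f\<^sub>E a b * s" by (auto elim: dvdE)
  then have "(1 :: 'k fps) = 0" by (metis res_Y.hom_mult res_Y.hom_one res_Y_f mult_zero_left)
  then show ?case by simp
next
  case (Suc n) then show ?case using f_prime by auto
qed

text \<open>A substitute for the norm from T/(f) to K[[Y,Z]]. The four elements 1, s, s^2, s^3 of a
  module of rank three are dependent; dividing the relation by the lowest power of \<open>s\<close>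
  leaves a nonzero constant term that is a multiple of \<open>s\<close>.\<close>

lemma f_norm: "\<exists>s' \<delta>. \<delta> \<noteq> 0 \<and> f\<^sub>E a b dvd s * s' - \<iota> \<delta>" if "\<not> f\<^sub>E a b dvd s"
proof -
  have "\<forall>k. \<exists>c. f\<^sub>E a b dvd s ^ k - (\<Sum>i<3. \<iota> (c i) * \<X> ^ i)" using f_division by blast
  then obtain v where v: "\<And>k. f\<^sub>E a b dvd s ^ k - (\<Sum>i<3. \<iota> (v k i) * \<X> ^ i)" by metis
  obtain c where c: "\<exists>k\<in>{..<4}. c k \<noteq> 0" "\<forall>j<3. (\<Sum>k\<in>{..<4::nat}. c k * v k j) = 0"
    using linear_dependence[of "{..<4::nat}" 3 v] by auto
  have "f\<^sub>E a b dvd (\<Sum>k<4. \<iota> (c k) * (s ^ k - (\<Sum>i<3. \<iota> (v k i) * \<X> ^ i)))"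
    using v by (intro dvd_sum) auto
  also have "\<dots> = (\<Sum>k<4. \<iota> (c k) * s ^ k) - (\<Sum>i<3. \<iota> (\<Sum>k<4. c k * v k i) * \<X> ^ i)"
    by (simp add: right_diff_distrib sum_subtractf sum_distrib_left sum_distrib_right iota.hom_sum iota.hom_mult
        mult.assoc sum.swap[of _ "{..<3}"])
  also have "\<dots> = (\<Sum>k<4. \<iota> (c k) * s ^ k)" using c(2) by simp
  finally have d: "f\<^sub>E a b dvd (\<Sum>k<4. \<iota> (c k) * s ^ k)" .
  \<comment> \<open>The relation is divisible by \<open>s ^ m\<close>; since f is prime and does not
    divide \<open>s\<close>, this factor may be dropped.\<close>
  define m where "m = (LEAST k. c k \<noteq> 0)"
  have m: "c m \<noteq> 0" "\<And>k. k < m \<Longrightarrow> c k = 0" "m < 4"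
  proof -
    obtain k where k: "k < 4" "c k \<noteq> 0" using c(1) by auto
    show "c m \<noteq> 0" unfolding m_def using k(2) by (rule LeastI)
    show "c k = 0" if "k < m" for k using that not_less_Least unfolding m_def by blast
    show "m < 4" using Least_le[of "\<lambda>k. c k \<noteq> 0" k] k unfolding m_def by simp
  qed
  define s' where "s' = (\<Sum>k\<in>{m<..<4}. \<iota> (c k) * s ^ (k - m - 1))"
  have "(\<Sum>k<4. \<iota> (c k) * s ^ k) = (\<Sum>k\<in>{m..<4}. \<iota> (c k) * s ^ k)"
    using m(2) by (intro sum.mono_neutral_right) auto
  also have "{m..<4} = insert m {m<..<4}" using m(3) by auto
  also have "(\<Sum>k\<in>insert m {m<..<4}. \<iota> (c k) * s ^ k) = s ^ m * (\<iota> (c m) + s * s')"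
  proof -
    have "s ^ k = s ^ m * (s * s ^ (k - m - 1))" if "m < k" for k
          proof -
      have "s ^ k = s ^ (m + Suc (k - m - 1))" using that by simp
      then show ?thesis by (simp only: power_add power_Suc)
    qed
    then show ?thesis by (simp add: s'_def distrib_left sum_distrib_left ac_simps)
  qed
  finally have "f\<^sub>E a b dvd \<iota> (c m) + s * s'" using d f_prime f_dvd_power that by metis
  then have "f\<^sub>E a b dvd s * s' - \<iota> (- c m)" by (simp add: iota.hom_uminus add.commute)
  then show ?thesis using m(1) by (intro exI[of _ s'] exI[of _ "- c m"]) simp
qed

end

declare scal_apply [simp del]

section \<open>Small matrices\<close>

abbreviation mk2 :: "'a \<Rightarrow> 'a \<Rightarrow> 'a \<Rightarrow> 'a \<Rightarrow> 'a mat" where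
  "mk2 a b c d \<equiv> mat_of_rows_list 2 [[a, b], [c, d]]"

abbreviation mk3 :: "'a \<Rightarrow> 'a \<Rightarrow> 'a \<Rightarrow> 'a \<Rightarrow> 'a \<Rightarrow> 'a \<Rightarrow> 'a \<Rightarrow> 'a \<Rightarrow> 'a \<Rightarrow> 'a mat" where
  "mk3 a b c d e f g h i \<equiv> mat_of_rows_list 3 [[a, b, c], [d, e, f], [g, h, i]]"

lemma less_2_iff: "i < 2 \<longleftrightarrow> i = 0 \<or> i = Suc 0" and less_3_iff: "i < 3 \<longleftrightarrow> i = 0 \<or> i = Suc 0 \<or> i = 2"
  for i :: nat by auto

lemma mk1_simps [simp]:
  "mat_of_rows_list (Suc 0) [[a]] \<in> carrier_mat (Suc 0) (Suc 0)" "mat_of_rows_list (Suc 0) [[a]] $$ (0, 0) = a"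
  "dim_row (mat_of_rows_list (Suc 0) [[a]]) = Suc 0" "dim_col (mat_of_rows_list (Suc 0) [[a]]) = Suc 0"
  by (simp_all add: mat_of_rows_list_def)

lemma mk_dim [simp]:
  "dim_row (mk2 a b c d) = 2" "dim_row (mk3 a b c d e f g h i) = 3"
  "dim_col (mk2 a b c d) = 2" "dim_col (mk3 a b c d e f g h i) = 3"
  by (simp_all add: mat_of_rows_list_def)

lemma mk_carrier [simp]: "mk2 a b c d \<in> carrier_mat 2 2" "mk3 a b c d e f g h i \<in> carrier_mat 3 3"
  by (simp_all only: carrier_matI mk_dim)

lemma mk2_index [simp]: "mk2 a b c d $$ (0, 0) = a" "mk2 a b c d $$ (0, Suc 0) = b"
  "mk2 a b c d $$ (Suc 0, 0) = c" "mk2 a b c d $$ (Suc 0, Suc 0) = d"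
  by (simp_all add: mat_of_rows_list_def)

lemma mk3_index [simp]:
  "mk3 a b c d e f g h i $$ (0, 0) = a" "mk3 a b c d e f g h i $$ (0, Suc 0) = b" "mk3 a b c d e f g h i $$ (0, 2) = c"
  "mk3 a b c d e f g h i $$ (Suc 0, 0) = d" "mk3 a b c d e f g h i $$ (Suc 0, Suc 0) = e" "mk3 a b c d e f g h i $$ (Suc 0, 2) = f"
  "mk3 a b c d e f g h i $$ (2, 0) = g" "mk3 a b c d e f g h i $$ (2, Suc 0) = h" "mk3 a b c d e f g h i $$ (2, 2) = i"
  by (simp_all add: mat_of_rows_list_def)

lemma eq_mk2I:
  assumes "A \<in> carrier_mat 2 2" "A $$ (0, 0) = a" "A $$ (0, Suc 0) = b" "A $$ (Suc 0, 0) = c" "A $$ (Suc 0, Suc 0) = d"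
  shows "A = mk2 a b c d"
  by (rule eq_matI) (use assms in \<open>auto simp: less_2_iff\<close>)

lemma eq_mk3I:
  assumes "A \<in> carrier_mat 3 3" "A $$ (0, 0) = a" "A $$ (0, Suc 0) = b" "A $$ (0, 2) = c"
    "A $$ (Suc 0, 0) = d" "A $$ (Suc 0, Suc 0) = e" "A $$ (Suc 0, 2) = f"
    "A $$ (2, 0) = g" "A $$ (2, Suc 0) = h" "A $$ (2, 2) = i"
  shows "A = mk3 a b c d e f g h i"
  by (rule eq_matI) (use assms in \<open>auto simp: less_3_iff\<close>)

lemma sum_2: "sum h {0..<2} = h 0 + h (Suc 0)" and sum_3: "sum h {0..<3} = h 0 + h (Suc 0) + h 2"
  for h :: "nat \<Rightarrow> 'a::comm_monoid_add"
  by (simp_all add: numeral_2_eq_2 numeral_3_eq_3)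

lemma index_mult_sum:
  "A \<in> carrier_mat n n \<Longrightarrow> B \<in> carrier_mat n n \<Longrightarrow> i < n \<Longrightarrow> j < n \<Longrightarrow>
    (A * B) $$ (i, j) = (\<Sum>k\<in>{0..<n}. A $$ (i, k) * B $$ (k, j))"
  by (simp add: scalar_prod_def)

lemma mk1_mult: "mat_of_rows_list 1 [[a]] * mat_of_rows_list 1 [[b]] = mat_of_rows_list 1 [[a * b]]" for a :: "'a::semiring_0"
  by (rule eq_matI) (auto simp: scalar_prod_def)

lemma mk2_mult: "mk2 a b c d * mk2 a' b' c' d' =
    mk2 (a * a' + b * c') (a * b' + b * d') (c * a' + d * c') (c * b' + d * d')" for a :: "'a::semiring_0"
  by (rule eq_mk2I) (simp_all add: index_mult_sum[of _ 2] sum_2 mult_carrier_mat[of _ 2 2] del: index_mult_mat)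

lemma mk3_mult: "mk3 a b c d e f g h i * mk3 a' b' c' d' e' f' g' h' i' =
    mk3 (a * a' + b * d' + c * g') (a * b' + b * e' + c * h') (a * c' + b * f' + c * i')
      (d * a' + e * d' + f * g') (d * b' + e * e' + f * h') (d * c' + e * f' + f * i')
      (g * a' + h * d' + i * g') (g * b' + h * e' + i * h') (g * c' + h * f' + i * i')" for a :: "'a::semiring_0"
  by (rule eq_mk3I) (simp_all add: index_mult_sum[of _ 3] sum_3 mult_carrier_mat[of _ 3 3] del: index_mult_mat)

lemma mk2_transpose: "transpose_mat (mk2 a b c d) = mk2 a c b d"
  by (rule eq_mk2I) simp_all

lemma det_mk1: "det (mat_of_rows_list 1 [[a]]) = (a :: 'a::comm_ring_1)"
  by (subst det_single) simp_all

lemma det_mk2: "det (mk2 a b c d) = a * d - b * (c :: 'a::comm_ring_1)"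
proof -
  have del: "mat_delete (mk2 a b c d) 0 0 = mat_of_rows_list 1 [[d]]" "mat_delete (mk2 a b c d) (Suc 0) 0 = mat_of_rows_list 1 [[b]]"
    by (rule eq_matI; simp add: mat_delete_def)+
  show ?thesis
    by (subst laplace_expansion_column[of _ 2 0])
      (simp_all add: cofactor_def del det_mk1 lessThan_atLeast0 sum_2 algebra_simps del: One_nat_def)
qed

lemma det_mk3: "det (mk3 a b c d e f g h i) =
    a * (e * i - f * h) - d * (b * i - c * h) + g * (b * f - c * (e :: 'a::comm_ring_1))"
proof -
  have "mat_delete (mk3 a b c d e f g h i) 0 0 = mk2 e f h i" "mat_delete (mk3 a b c d e f g h i) (Suc 0) 0 = mk2 b c h i"
    "mat_delete (mk3 a b c d e f g h i) 2 0 = mk2 b c e f"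
    by (rule eq_mk2I; simp add: mat_delete_def flip: numeral_2_eq_2)+
  then show ?thesis
    by (subst laplace_expansion_column[of _ 3 0])
      (simp_all add: cofactor_def det_mk2 lessThan_atLeast0 sum_3 algebra_simps)
qed

lemma adj_sum:
  assumes "A \<in> carrier_mat n n" "i < n" "k < n"
  shows "(\<Sum>j<n. A $$ (i, j) * adj_mat A $$ (j, k)) = (if i = k then det A else (0 :: 'a::comm_ring_1))"
proof -
  have "(A * adj_mat A) $$ (i, k) = (\<Sum>j\<in>{0..<n}. A $$ (i, j) * adj_mat A $$ (j, k))"
    using adj_mat(1)[OF assms(1)] assms by (intro index_mult_sum) auto
  then show ?thesis using adj_mat(2)[OF assms(1)] assms by (auto simp: lessThan_atLeast0)
qed

text \<open>The image of \<open>A\<close> on column vectors. Coordinates beyond the rows of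
  \<open>A\<close> are unconstrained, in accordance with the convention that a lattice contains all
  vectors vanishing below its rank.\<close>

definition lat :: "'r::comm_ring_1 mat \<Rightarrow> (nat \<Rightarrow> 'r) set" where
  "lat A = {w. \<exists>u. \<forall>i<dim_row A. w i = (\<Sum>j<dim_col A. A $$ (i, j) * u j)}"

definition linear_fn :: "((nat \<Rightarrow> 'r::comm_ring_1) \<Rightarrow> nat \<Rightarrow> 'r) \<Rightarrow> bool" where
  "linear_fn \<theta> \<longleftrightarrow> (\<forall>v w. \<theta> (v + w) = \<theta> v + \<theta> w) \<and> (\<forall>t v. \<theta> (t \<star> v) = t \<star> \<theta> v)"

text \<open>The quotients by \<open>L\<close> and \<open>L'\<close> are isomorphic: the equivalence
  makes \<open>\<theta>\<close> well defined and injective on classes, the last clause makes it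
  surjective.\<close>

definition liso :: "(nat \<Rightarrow> 'r::comm_ring_1) set \<Rightarrow> (nat \<Rightarrow> 'r) set \<Rightarrow> bool" where
  "liso L L' \<longleftrightarrow> (\<exists>\<theta>. linear_fn \<theta> \<and> (\<forall>v. v \<in> L \<longleftrightarrow> \<theta> v \<in> L') \<and> (\<forall>w. \<exists>v. w - \<theta> v \<in> L'))"

section \<open>Regular sequences on lattices\<close>

text \<open>The preimage of xM when M is the quotient by \<open>L\<close>. Regularity on M/xM thus
  becomes a statement about another lattice.\<close>

definition adjoin :: "(nat \<Rightarrow> 'r::comm_ring_1) set \<Rightarrow> 'r \<Rightarrow> (nat \<Rightarrow> 'r) set" where
  "adjoin L x = {v. \<exists>w. v - x \<star> w \<in> L}"

lemma submod_adjoin: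
  assumes "submod L" shows "submod (adjoin L x)"
  unfolding submod_def
proof (intro conjI ballI allI)
  show "0 \<in> adjoin L x" using submod_0[OF assms] by (auto simp: adjoin_def scal_simps intro!: exI[of _ 0])
next
  fix v w assume "v \<in> adjoin L x" "w \<in> adjoin L x"
  then obtain v' w' where "v - x \<star> v' \<in> L" "w - x \<star> w' \<in> L" by (auto simp: adjoin_def)
  then have "v + w - x \<star> (v' + w') \<in> L" using submod_cong_add[OF assms, of v _ w] by (simp add: scal_simps)
  then show "v + w \<in> adjoin L x" by (auto simp: adjoin_def)
next
  fix v t assume "v \<in> adjoin L x"
  then obtain v' where "v - x \<star> v' \<in> L" by (auto simp: adjoin_def)
  then have "t \<star> v - x \<star> t \<star> v' \<in> L" using submod_cong_scal[OF assms, of v "x \<star> v'" t] by (simp add: scal_simps mult.commute)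
  then show "t \<star> v \<in> adjoin L x" by (auto simp: adjoin_def)
qed

lemma adjoinI: "submod L \<Longrightarrow> v \<in> L \<Longrightarrow> v \<in> adjoin L x" "submod L \<Longrightarrow> x \<star> v \<in> adjoin L x"
  unfolding adjoin_def mem_Collect_eq
  by (rule exI[of _ 0], simp add: scal_simps) (rule exI[of _ v], simp add: submod_0)

lemma adjoinI': "v - x \<star> w \<in> L \<Longrightarrow> v \<in> adjoin L x"
  by (auto simp: adjoin_def)

text \<open>The source of socle elements: if a power of \<open>x\<close> kills \<open>v\<close>, the
  last nonzero power of \<open>x\<close> times \<open>v\<close> is killed by \<open>x\<close>
  itself.\<close>

lemma power_socle:
  assumes "submod L" "x ^ n \<star> v \<in> L" "v \<notin> L"
  shows "\<exists>i. x ^ i \<star> v \<notin> L \<and> x \<star> x ^ i \<star> v \<in> L"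
proof -
  define m where "m = (LEAST m. x ^ m \<star> v \<in> L)"
  have m: "x ^ m \<star> v \<in> L" unfolding m_def using assms(2) by (rule LeastI)
  then have "m \<noteq> 0" using assms(3) by (metis power_0 scal_simps(7))
  then obtain i where i: "m = Suc i" by (auto simp: gr0_conv_Suc)
  then have "x ^ i \<star> v \<notin> L" using not_less_Least[of i "\<lambda>m. x ^ m \<star> v \<in> L"] unfolding m_def by auto
  then show ?thesis using m by (auto simp: i scal_simps)
qed

lemma regular_power:
  assumes "\<And>v. x \<star> v \<in> L \<Longrightarrow> v \<in> L" "x ^ n \<star> v \<in> L" shows "v \<in> L"
  using assms(2)
proof (induction n)
  case 0 then show ?case by (simp add: scal_simps(7))
next
  case (Suc n)
  then have "x \<star> x ^ n \<star> v \<in> L" by (simp add: scal_simps(6))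
  then show ?case using assms(1) Suc.IH by blast
qed

lemma max_kill:
  fixes L :: "(nat \<Rightarrow> 'k::field T) set"
  assumes L: "submod L" and "\<X> \<star> w \<in> L" "\<Y> \<star> w \<in> L" "\<Z> \<star> w \<in> L" "c $ 0 $ 0 $ 0 = 0"
  shows "c \<star> w \<in> L"
proof -
  obtain p q r where "c = \<X> * p + \<Y> * q + \<Z> * r" using T_max assms(5) by blast
  then have "c \<star> w = p \<star> \<X> \<star> w + q \<star> \<Y> \<star> w + r \<star> \<Z> \<star> w" by (simp add: scal_simps mult.commute)
  then show ?thesis using assms by (simp add: submodD)
qed

lemma noeth_T: "noeth TYPE('k::field T)"
  by (intro noeth_fps noeth_field)

lemma T_unit_max: "\<exists>u. u * (1 - x * c) = 1" if "x $ 0 $ 0 $ 0 = 0" for x :: "'k::field T"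
  using T_unit[of "1 - x * c"] that by (auto simp: mult.commute)

lemma common_order:
  fixes c :: "'i \<Rightarrow> 'r::comm_ring_1 fps"
  assumes "\<exists>b\<in>B. c b \<noteq> 0"
  shows "\<exists>n c'. (\<forall>b\<in>B. c b = fps_X ^ n * c' b) \<and> (\<exists>b\<in>B. c' b $ 0 \<noteq> 0)"
proof -
  define n where "n = (LEAST n. \<exists>b\<in>B. c b $ n \<noteq> 0)"
  have "\<exists>n. \<exists>b\<in>B. c b $ n \<noteq> 0" using assms by (auto simp: fps_eq_iff)
  from LeastI_ex[OF this] have n: "\<exists>b\<in>B. c b $ n \<noteq> 0" unfolding n_def .
  have z: "c b $ m = 0" if "m < n" "b \<in> B" for m b using not_less_Least[of m] that unfolding n_def by blast
  have "c b = fps_X ^ n * fps_shift n (c b)" if "b \<in> B" for b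
    by (rule fps_ext) (use z[OF _ that] in \<open>simp add: fps_X_power_mult_nth\<close>)
  then show ?thesis using n by (intro exI[of _ n] exI[of _ "\<lambda>b. fps_shift n (c b)"]) auto
qed

text \<open>The pair \<open>x1\<close>, \<open>x2\<close> is whatever regular sequence the depth
  provides. The aim of the locale is to replace it by Z, Y.\<close>

locale mcm_lattice =
  fixes a b :: "'k::field" and L :: "(nat \<Rightarrow> 'k T) set" and N :: nat and x1 x2 :: "'k T"
  assumes L: "submod L" and N: "(\<forall>i<N. v i = 0) \<Longrightarrow> v \<in> L" and fL: "f\<^sub>E a b \<star> v \<in> L"
    and mx1: "x1 $ 0 $ 0 $ 0 = 0" and mx2: "x2 $ 0 $ 0 $ 0 = 0"
    and reg1: "x1 \<star> v \<in> L \<Longrightarrow> v \<in> L" and reg2: "x2 \<star> v \<in> adjoin L x1 \<Longrightarrow> v \<in> adjoin L x1"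
begin

lemma X3_cong: "\<X> ^ 3 \<star> v - \<Z> \<star> (\<Y>\<^sup>2 - cst b * \<Z>\<^sup>2 - cst a * \<X> * \<Z>) \<star> v \<in> L"
  by (rule back_subst[of "\<lambda>v. v \<in> L", OF submod_minus[OF L fL[of v]]]) (simp add: f_eq fun_eq_iff scal_apply algebra_simps)

text \<open>Suppose Z kills a nonzero element. By the cubic X^3 kills it too, which yields a nonzero
  \<open>w\<close> killed by X and Z, on which \<open>x1\<close> acts as a series in Y alone.
  Removing from \<open>w\<close> the largest power of \<open>x1\<close> leaves \<open>u\<close>,
  still killed by X and Z but nonzero modulo \<open>x1\<close>. There Y acts nilpotently, so a socle
  element of M/x1 M appears, which regularity of \<open>x2\<close> forbids.\<close>

lemma Z_regular: "v \<in> L" if "\<Z> \<star> v \<in> L"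
proof (rule ccontr)
  assume "v \<notin> L"
  have "\<Z> \<star> (\<Y>\<^sup>2 - cst b * \<Z>\<^sup>2 - cst a * \<X> * \<Z>) \<star> v \<in> L"
    by (rule back_subst[of "\<lambda>v. v \<in> L", OF submod_scal[OF L that, of "\<Y>\<^sup>2 - cst b * \<Z>\<^sup>2 - cst a * \<X> * \<Z>"]])
      (simp add: fun_eq_iff scal_apply algebra_simps)
  then have "\<X> ^ 3 \<star> v \<in> L" using submod_cong[OF L X3_cong] by blast
  then obtain i where i: "\<X> ^ i \<star> v \<notin> L" "\<X> \<star> \<X> ^ i \<star> v \<in> L" using power_socle[OF L _ \<open>v \<notin> L\<close>] by blast
  define w where "w = \<X> ^ i \<star> v"
  have w: "w \<notin> L" "\<X> \<star> w \<in> L" "\<Z> \<star> w \<in> L"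
    using i submod_scal[OF L that, of "\<X> ^ i"] by (simp_all add: w_def scal_simps mult.commute)
  obtain s t where st: "x1 = emb_Y (res_Y x1) + \<X> * s + \<Z> * t" using T_split by blast
  have x1: "x1 \<star> u - emb_Y (res_Y x1) \<star> u \<in> L" if "\<X> \<star> u \<in> L" "\<Z> \<star> u \<in> L" for u
  proof -
    have "x1 \<star> u - emb_Y (res_Y x1) \<star> u = s \<star> \<X> \<star> u + t \<star> \<Z> \<star> u"
      by (subst st) (simp add: scal_simps mult.commute)
    then show ?thesis using that by (simp add: submodD[OF L])
  qed
  have "res_Y x1 \<noteq> 0"
  proof
    assume "res_Y x1 = 0"
    then have "x1 \<star> w \<in> L" using x1[OF w(2,3)] by (simp add: scal_simps)
    then show False using reg1 w(1) by blast
  qed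
  then obtain n u0 s0 where us: "res_Y x1 = fps_X ^ n * u0" "u0 * s0 = 1" using fps_order by blast
  \<comment> \<open>Krull's theorem bounds the powers of \<open>x1\<close> that divide
    \<open>w\<close>; \<open>k\<close> is the first power that does not, and \<open>u\<close> is the
    quotient by the power before it.\<close>
  have "\<exists>k. \<not> (\<exists>u. w - x1 ^ k \<star> u \<in> L)"
    using krull_intersection[OF noeth_T L N T_unit_max[OF mx1], where v=w] w(1) by blast
  then obtain k where k: "\<not> (\<exists>u. w - x1 ^ k \<star> u \<in> L)" "\<And>l. l < k \<Longrightarrow> \<exists>u. w - x1 ^ l \<star> u \<in> L"
    using exists_least_iff[of "\<lambda>k. \<not> (\<exists>u. w - x1 ^ k \<star> u \<in> L)"] by blast
  have "k \<noteq> 0"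
  proof
    assume "k = 0"
    then have "w - x1 ^ k \<star> w \<in> L" using submod_0[OF L] by (simp add: scal_simps)
    then show False using k(1) by blast
  qed
  then obtain l where l: "k = Suc l" by (cases k) auto
  then obtain u where u: "w - x1 ^ l \<star> u \<in> L" using k(2)[of l] by blast
  \<comment> \<open>Since \<open>x1\<close> is regular, whatever kills \<open>w\<close> also kills
    \<open>u\<close>.\<close>
  have kill: "c \<star> u \<in> L" if "c \<star> w \<in> L" for c
  proof -
    have "c \<star> w - c \<star> x1 ^ l \<star> u \<in> L" using submod_cong_scal[OF L u] .
    then have "x1 ^ l \<star> c \<star> u \<in> L" using submod_cong[OF L] that by (simp add: scal_simps mult.commute)
    then show ?thesis using regular_power reg1 by blast
  qed
  have u1: "u \<notin> adjoin L x1"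
  proof
    assume "u \<in> adjoin L x1"
    then obtain u' where "u - x1 \<star> u' \<in> L" by (auto simp: adjoin_def)
    then have "x1 ^ l \<star> u - x1 ^ l \<star> x1 \<star> u' \<in> L" by (rule submod_cong_scal[OF L])
    from submod_cong_trans[OF L u this] have "w - x1 ^ k \<star> u' \<in> L" by (simp add: l scal_simps mult.commute)
    then show False using k(1) by blast
  qed
  \<comment> \<open>On \<open>u\<close> the element \<open>x1\<close> acts as Y^n times a unit, so
    Y^n kills \<open>u\<close> modulo \<open>x1\<close>.\<close>
  have "x1 \<star> u - \<Y> ^ n \<star> emb_Y u0 \<star> u \<in> L"
    using x1[OF kill[OF w(2)] kill[OF w(3)]] by (simp add: us emb_Y.hom_mult emb_Y.hom_power scal_simps)
  then have "\<Y> ^ n \<star> emb_Y u0 \<star> u \<in> adjoin L x1"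
    using submod_cong[OF submod_adjoin[OF L], of "x1 \<star> u"] adjoinI[OF L] by blast
  then have "emb_Y s0 \<star> \<Y> ^ n \<star> emb_Y u0 \<star> u \<in> adjoin L x1" by (rule submod_scal[OF submod_adjoin[OF L]])
  moreover have "emb_Y s0 * (\<Y> ^ n * emb_Y u0) = \<Y> ^ n"
  proof -
    have "emb_Y s0 * (\<Y> ^ n * emb_Y u0) = \<Y> ^ n * emb_Y (u0 * s0)" by (simp only: emb_Y.hom_mult ac_simps)
    then show ?thesis by (simp only: us(2) emb_Y.hom_one mult_1_right)
  qed
  ultimately have "\<Y> ^ n \<star> u \<in> adjoin L x1" by (simp only: scal_simps)
  then obtain j where j: "\<Y> ^ j \<star> u \<notin> adjoin L x1" "\<Y> \<star> \<Y> ^ j \<star> u \<in> adjoin L x1"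
    using power_socle[OF submod_adjoin[OF L] _ u1] by blast
  have "c \<star> \<Y> ^ j \<star> u \<in> adjoin L x1" if "c \<star> w \<in> L" for c
    using submod_scal[OF L kill[OF that], of "\<Y> ^ j"] adjoinI(1)[OF L] by (simp add: scal_simps mult.commute)
  from max_kill[OF submod_adjoin[OF L] this[OF w(2)] j(2) this[OF w(3)] mx2]
  have "x2 \<star> \<Y> ^ j \<star> u \<in> adjoin L x1" .
  then show False using reg2 j(1) by blast
qed

text \<open>The socle of M/ZM is compared with that of M/x1 M. For a socle element \<open>w\<close>
  of M/ZM write x1 w = Z w'. Multiplying by \<open>x2\<close> and cancelling Z shows that
  \<open>x2\<close> maps w' into x1 M; hence w' lies in x1 M, and cancelling \<open>x1\<close> puts
  \<open>w\<close> into ZM.\<close>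

lemma Y_regular: "v \<in> adjoin L \<Z>" if "\<Y> \<star> v \<in> adjoin L \<Z>"
proof (rule ccontr)
  assume v: "v \<notin> adjoin L \<Z>"
  have LZ: "submod (adjoin L \<Z>)" by (rule submod_adjoin[OF L])
  have "\<X> ^ 3 \<star> v \<in> adjoin L \<Z>" using X3_cong by (rule adjoinI')
  then obtain i where i: "\<X> ^ i \<star> v \<notin> adjoin L \<Z>" "\<X> \<star> \<X> ^ i \<star> v \<in> adjoin L \<Z>" using power_socle[OF LZ _ v] by blast
  define w where "w = \<X> ^ i \<star> v"
  have w: "w \<notin> adjoin L \<Z>" "\<X> \<star> w \<in> adjoin L \<Z>" "\<Y> \<star> w \<in> adjoin L \<Z>" "\<Z> \<star> w \<in> adjoin L \<Z>"
    using i submod_scal[OF LZ that, of "\<X> ^ i"] adjoinI(2)[OF L, of \<Z> "\<X> ^ i \<star> v"]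
    by (simp_all add: w_def scal_simps mult.commute)
  have mw: "\<exists>u. c \<star> w - \<Z> \<star> u \<in> L" if "c $ 0 $ 0 $ 0 = 0" for c
    using max_kill[OF LZ w(2-4) that] by (auto simp: adjoin_def)
  obtain w' where w': "x1 \<star> w - \<Z> \<star> w' \<in> L" using mw[OF mx1] by blast
  have "x2 \<star> w' \<in> adjoin L x1"
  proof -
    obtain u where u: "x2 \<star> w - \<Z> \<star> u \<in> L" using mw[OF mx2] by blast
    have "x2 \<star> x1 \<star> w - x2 \<star> \<Z> \<star> w' \<in> L" "x1 \<star> x2 \<star> w - x1 \<star> \<Z> \<star> u \<in> L"
      using submod_cong_scal[OF L w'] submod_cong_scal[OF L u] .
    from submod_diff[OF L this(2,1)] have "\<Z> \<star> (x2 \<star> w' - x1 \<star> u) \<in> L"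
      by (simp add: scal_simps mult.commute)
    then show ?thesis using Z_regular adjoinI' by blast
  qed
  then obtain u where u: "w' - x1 \<star> u \<in> L" using reg2 by (auto simp: adjoin_def)
  have "\<Z> \<star> w' - \<Z> \<star> x1 \<star> u \<in> L" using submod_cong_scal[OF L u] .
  from submod_cong_trans[OF L w' this] have "x1 \<star> (w - \<Z> \<star> u) \<in> L" by (simp add: scal_simps mult.commute)
  then show False using reg1 adjoinI' w(1) by blast
qed

end

section \<open>A basis over the subring of power series in two variables\<close>

context mcm_lattice
begin

definition agen :: "(nat \<Rightarrow> 'k T) set \<Rightarrow> bool" where
  "agen B \<longleftrightarrow> (\<forall>v. \<exists>c. v - (\<Sum>b\<in>B. \<iota> (c b) \<star> b) \<in> L)"

lemma f_dvd_kill: "f\<^sub>E a b dvd t \<Longrightarrow> t \<star> v \<in> L"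
  using fL by (auto simp: dvd_def simp flip: scal_simps(6))

lemma f_dvd_cong: "f\<^sub>E a b dvd s - t \<Longrightarrow> s \<star> v - t \<star> v \<in> L"
  using f_dvd_kill[of "s - t" v] by (simp add: scal_simps)

lemma ex_agen: "\<exists>B. finite B \<and> agen B"
proof -
  define e :: "nat \<Rightarrow> nat \<Rightarrow> 'k T" where "e j = (\<lambda>i. if i = j then 1 else 0)" for j
  define B0 where "B0 = (\<lambda>(j, i). \<X> ^ i \<star> e j) ` ({..<N} \<times> {..<3::nat})"
  interpret am: Modules.module "\<lambda>c (v :: nat \<Rightarrow> 'k T). \<iota> c \<star> v"
    by standard (auto simp: fun_eq_iff scal_apply algebra_simps iota.hom_add iota.hom_mult)
  have fin: "finite B0" by (simp add: B0_def)
  have "\<exists>c. v - (\<Sum>b\<in>B0. \<iota> (c b) \<star> b) \<in> L" for v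
  proof -
    have "\<forall>j. \<exists>c. f\<^sub>E a b dvd v j - (\<Sum>i<3. \<iota> (c i) * \<X> ^ i)" using f_division by blast
    from choice[OF this] obtain c where c: "\<And>j. f\<^sub>E a b dvd v j - (\<Sum>i<3. \<iota> (c j i) * \<X> ^ i)" by blast
    define w where "w = (\<Sum>j<N. \<Sum>i<3. \<iota> (c j i) \<star> \<X> ^ i \<star> e j)"
    have "w \<in> am.span B0" unfolding w_def
      by (intro am.span_sum am.span_scale am.span_base) (auto simp: B0_def)
    then obtain u where u: "w = (\<Sum>b\<in>B0. \<iota> (u b) \<star> b)" unfolding am.span_finite[OF fin] by blast
    have w: "w = (\<Sum>j<N. (\<Sum>i<3. \<iota> (c j i) * \<X> ^ i) \<star> e j)"
      unfolding w_def by (rule sum.cong[OF refl]) (auto simp: fun_eq_iff scal_apply sum_fun_apply sum_distrib_right mult.assoc)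
    have 1: "(\<Sum>j<N. v j \<star> e j) - w \<in> L" unfolding w by (intro submod_cong_sum L f_dvd_cong c)
    have 2: "v - (\<Sum>j<N. v j \<star> e j) \<in> L"
    proof (rule N, intro allI impI)
      fix i assume i: "i < N"
      have "(\<Sum>j<N. v j \<star> e j) i = (\<Sum>j<N. if j = i then v j else 0)"
        unfolding sum_fun_apply by (rule sum.cong) (auto simp: e_def scal_apply)
      also have "\<dots> = v i" using i by simp
      finally show "(v - (\<Sum>j<N. v j \<star> e j)) i = 0" by simp
    qed
    show ?thesis using submod_cong_trans[OF L 2 1] unfolding u by blast
  qed
  then show ?thesis using fin unfolding agen_def by blast
qed

lemma ex_basis:
  "\<exists>B. finite B \<and> agen B \<and> (\<forall>c. (\<Sum>b\<in>B. \<iota> (c b) \<star> b) \<in> L \<longrightarrow> (\<forall>b\<in>B. c b = 0))"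
proof -
  obtain B where B: "finite B" "agen B" and min: "\<And>B'. finite B' \<and> agen B' \<Longrightarrow> card B \<le> card B'"
    using ex_has_least_nat[of "\<lambda>B. finite B \<and> agen B" _ card] ex_agen by metis
  \<comment> \<open>A relation with a unit coefficient contradicts minimality: the corresponding
    generator is eliminated.\<close>
  have elim: False if "b0 \<in> B" and cL: "(\<Sum>b\<in>B. \<iota> (c b) \<star> b) \<in> L" and "c b0 $ 0 $ 0 \<noteq> 0" for b0 c
  proof -
    have "c b0 $ 0 $ 0 * inverse (c b0 $ 0 $ 0) = 1" using that by simp
    then obtain h where "c b0 $ 0 * h = 1" using fps_unit by blast
    then obtain s where s: "c b0 * s = 1" using fps_unit by blast
    have "agen (B - {b0})" unfolding agen_def
    proof
      fix v
      obtain d where d: "v - (\<Sum>b\<in>B. \<iota> (d b) \<star> b) \<in> L" using B(2) by (auto simp: agen_def)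
      define d' where "d' b = d b - d b0 * s * c b" for b
      have "(\<Sum>b\<in>B. \<iota> (d b) \<star> b) - \<iota> (d b0 * s) \<star> (\<Sum>b\<in>B. \<iota> (c b) \<star> b) = (\<Sum>b\<in>B. \<iota> (d' b) \<star> b)"
        by (auto simp: fun_eq_iff scal_apply sum_fun_apply d'_def iota.hom_minus iota.hom_mult algebra_simps sum_subtractf sum_distrib_left)
      also have "\<dots> = (\<Sum>b\<in>B - {b0}. \<iota> (d' b) \<star> b)"
      proof (rule sum.mono_neutral_right)
        have "d' b0 = d b0 - d b0 * (c b0 * s)" by (simp add: d'_def ac_simps)
        then have "d' b0 = 0" by (simp add: s)
        then show "\<forall>i\<in>B - (B - {b0}). \<iota> (d' i) \<star> i = 0" by (auto simp: scal_simps)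
      qed (use B in auto)
      finally have "(\<Sum>b\<in>B. \<iota> (d b) \<star> b) - (\<Sum>b\<in>B - {b0}. \<iota> (d' b) \<star> b) \<in> L"
        using submod_scal[OF L cL, of "\<iota> (d b0 * s)"] by (simp add: algebra_simps)
      from submod_cong_trans[OF L d this] show "\<exists>c. v - (\<Sum>b\<in>B - {b0}. \<iota> (c b) \<star> b) \<in> L" by blast
    qed
    then have "card B \<le> card (B - {b0})" using B by (intro min) auto
    moreover have "card (B - {b0}) < card B" using B \<open>b0 \<in> B\<close> by (intro psubset_card_mono) auto
    ultimately show False by simp
  qed
  have "\<forall>b\<in>B. c b = 0" if cL: "(\<Sum>b\<in>B. \<iota> (c b) \<star> b) \<in> L" for c
  proof (rule ccontr)
    assume "\<not> ?thesis"
    then obtain n c' where c': "\<forall>b\<in>B. c b = fps_X ^ n * c' b" "\<exists>b\<in>B. c' b $ 0 \<noteq> 0"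
      using common_order[of B c] by blast
    have "(\<Sum>b\<in>B. \<iota> (c b) \<star> b) = \<Z> ^ n \<star> (\<Sum>b\<in>B. \<iota> (c' b) \<star> b)"
      using c'(1) by (auto simp: fun_eq_iff scal_apply sum_fun_apply sum_distrib_left iota.hom_mult iota.hom_power mult.assoc intro!: sum.cong)
    then have "\<Z> ^ n \<star> (\<Sum>b\<in>B. \<iota> (c' b) \<star> b) \<in> L" using cL by simp
    then have c'L: "(\<Sum>b\<in>B. \<iota> (c' b) \<star> b) \<in> L" using regular_power[of \<Z> L n] Z_regular by blast
    obtain m p where p: "\<forall>b\<in>B. c' b $ 0 = fps_X ^ m * p b" "\<exists>b\<in>B. p b $ 0 \<noteq> 0"
      using common_order[of B "\<lambda>b. c' b $ 0"] c'(2) by blast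
    define s where "s = (\<Sum>b\<in>B. \<iota> (fps_const (p b)) \<star> b)"
    have "\<iota> (c' b) = \<Y> ^ m * \<iota> (fps_const (p b)) + \<Z> * \<iota> (fps_shift 1 (c' b))" if "b \<in> B" for b
    proof -
      have "c' b = fps_const fps_X ^ m * fps_const (p b) + fps_X * fps_shift 1 (c' b)"
        using fps_split[of "c' b"] p(1) that by (simp add: fps_const_power)
      then have "\<iota> (c' b) = \<iota> (fps_const fps_X ^ m * fps_const (p b) + fps_X * fps_shift 1 (c' b))" by simp
      then show ?thesis by (simp only: iota.hom_add iota.hom_mult iota.hom_power iota_var)
    qed
    then have "(\<Sum>b\<in>B. \<iota> (c' b) \<star> b) = \<Y> ^ m \<star> s + \<Z> \<star> (\<Sum>b\<in>B. \<iota> (fps_shift 1 (c' b)) \<star> b)"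
      by (auto simp: s_def fun_eq_iff scal_apply sum_fun_apply sum_distrib_left distrib_right sum.distrib mult.assoc)
    then have "\<Y> ^ m \<star> s - \<Z> \<star> - (\<Sum>b\<in>B. \<iota> (fps_shift 1 (c' b)) \<star> b) \<in> L" using c'L by (simp add: scal_simps)
    then have "\<Y> ^ m \<star> s \<in> adjoin L \<Z>" by (rule adjoinI')
    then have "s \<in> adjoin L \<Z>" using regular_power[of \<Y> "adjoin L \<Z>" m] Y_regular by blast
    then obtain v where v: "s - \<Z> \<star> v \<in> L" by (auto simp: adjoin_def)
    obtain d where d: "v - (\<Sum>b\<in>B. \<iota> (d b) \<star> b) \<in> L" using B(2) by (auto simp: agen_def)
    \<comment> \<open>Since \<open>s\<close> lies in ZM, it equals Z times a combination of the
      generators. The difference is a relation whose coefficients agree with those of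
      \<open>s\<close> modulo Z, so one of them is a unit.\<close>
    define c2 where "c2 b = fps_const (p b) - fps_X * d b" for b
    have "s - \<Z> \<star> (\<Sum>b\<in>B. \<iota> (d b) \<star> b) \<in> L"
      using submod_cong_trans[OF L v submod_cong_scal[OF L d]] .
    also have "s - \<Z> \<star> (\<Sum>b\<in>B. \<iota> (d b) \<star> b) = (\<Sum>b\<in>B. \<iota> (c2 b) \<star> b)"
      by (auto simp: s_def c2_def fun_eq_iff scal_apply sum_fun_apply sum_distrib_left left_diff_distrib sum_subtractf
          iota.hom_minus iota.hom_mult mult.assoc)
    finally have "(\<Sum>b\<in>B. \<iota> (c2 b) \<star> b) \<in> L" .
    moreover obtain b0 where "b0 \<in> B" "p b0 $ 0 \<noteq> 0" using p(2) by blast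
    ultimately show False using elim[of b0 c2] by (simp add: c2_def)
  qed
  then show ?thesis using B by blast
qed

end

text \<open>Rank one with denominators cleared: any two elements are proportional by factors that
  are not both zero in S.\<close>

locale rank1_lattice = mcm_lattice a b L N x1 x2
  for a b :: "'k::field" and L :: "(nat \<Rightarrow> 'k T) set" and N :: nat and x1 x2 :: "'k T" +
  assumes proper: "\<exists>v. v \<notin> L"
    and rank: "\<And>v w. \<exists>s t. \<not> (f\<^sub>E a b dvd s \<and> f\<^sub>E a b dvd t) \<and> s \<star> v - t \<star> w \<in> L"
begin

abbreviation pol :: "(nat \<Rightarrow> 'k fps fps) \<Rightarrow> 'k T" where "pol c \<equiv> (\<Sum>i<3. \<iota> (c i) * \<X> ^ i)"

text \<open>The module has rank one over S and S has rank three over K[[Y,Z]]. More than three basis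
  elements would be dependent because each has a multiple in S b0; fewer than three are excluded
  because 1, X, X^2 times b0 are independent. Torsion is excluded with \<open>f_norm\<close> and
  freeness.\<close>

lemma ex_three_basis:
  "\<exists>\<beta> :: nat \<Rightarrow> nat \<Rightarrow> 'k T. (\<forall>v. \<exists>c. v - (\<Sum>j<3. \<iota> (c j) \<star> \<beta> j) \<in> L) \<and>
     (\<forall>c. (\<Sum>j<3. \<iota> (c j) \<star> \<beta> j) \<in> L \<longrightarrow> (\<forall>j<3. c j = 0)) \<and>
     (\<forall>s v. \<not> f\<^sub>E a b dvd s \<longrightarrow> s \<star> v \<in> L \<longrightarrow> v \<in> L)"
proof -
  obtain B where B: "finite B" "agen B" and ind: "\<And>c. (\<Sum>b\<in>B. \<iota> (c b) \<star> b) \<in> L \<Longrightarrow> (\<forall>b\<in>B. c b = 0)"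
    using ex_basis by blast
  have gen: "\<exists>c. v - (\<Sum>b\<in>B. \<iota> (c b) \<star> b) \<in> L" for v using B(2) by (auto simp: agen_def)
  have tf: "v \<in> L" if s: "\<not> f\<^sub>E a b dvd s" and sv: "s \<star> v \<in> L" for s v
  proof -
    obtain s' \<delta> where \<delta>: "\<delta> \<noteq> 0" "f\<^sub>E a b dvd s * s' - \<iota> \<delta>" using f_norm[OF s] by blast
    have "(s * s') \<star> v \<in> L" using submod_scal[OF L sv, of s'] by (simp add: scal_simps mult.commute)
    then have \<delta>v: "\<iota> \<delta> \<star> v \<in> L" using submod_cong[OF L f_dvd_cong[OF \<delta>(2)]] by blast
    obtain c where c: "v - (\<Sum>b\<in>B. \<iota> (c b) \<star> b) \<in> L" using gen by blast
    have "\<iota> \<delta> \<star> (\<Sum>b\<in>B. \<iota> (c b) \<star> b) \<in> L" using submod_cong[OF L submod_cong_scal[OF L c]] \<delta>v by blast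
    also have "\<iota> \<delta> \<star> (\<Sum>b\<in>B. \<iota> (c b) \<star> b) = (\<Sum>b\<in>B. \<iota> (\<delta> * c b) \<star> b)"
      by (auto simp: fun_eq_iff scal_apply sum_fun_apply sum_distrib_left iota.hom_mult mult.assoc)
    finally have "\<forall>b\<in>B. \<delta> * c b = 0" by (rule ind)
    then have "\<forall>b\<in>B. c b = 0" using \<delta>(1) by simp
    then have "(\<Sum>b\<in>B. \<iota> (c b) \<star> b) = 0" by (simp add: scal_simps)
    then show "v \<in> L" using c by simp
  qed
  have bL: "b0 \<notin> L" if b0: "b0 \<in> B" for b0
  proof
    assume b0L: "b0 \<in> L"
    have "(\<Sum>b\<in>B. \<iota> (if b = b0 then 1 else 0) \<star> b) = (\<Sum>b\<in>B. if b = b0 then b0 else 0)"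
      by (rule sum.cong) (auto simp: scal_simps)
    also have "\<dots> = b0" using b0 B(1) by simp
    finally have "(\<Sum>b\<in>B. \<iota> (if b = b0 then 1 else 0) \<star> b) \<in> L" using b0L by simp
    from bspec[OF ind[OF this] b0] show False by simp
  qed
  have "B \<noteq> {}"
  proof
    assume "B = {}"
    then have "v \<in> L" for v using gen[of v] by simp
    then show False using proper by blast
  qed
  then obtain b0 where b0: "b0 \<in> B" by blast
  \<comment> \<open>Proportionality with \<open>b0\<close> combined with \<open>f_norm\<close>: the
    multiplier of \<open>v\<close> can be taken from K[[Y,Z]], and the multiplier of
    \<open>b0\<close> reduces to degree below three in X.\<close>
  have "\<exists>\<delta> d. \<delta> \<noteq> 0 \<and> \<iota> \<delta> \<star> v - pol d \<star> b0 \<in> L" for v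
  proof -
    obtain s t where st: "\<not> (f\<^sub>E a b dvd s \<and> f\<^sub>E a b dvd t)" "s \<star> v - t \<star> b0 \<in> L" using rank by blast
    have "\<not> f\<^sub>E a b dvd s"
    proof
      assume s: "f\<^sub>E a b dvd s"
      then have "t \<star> b0 \<in> L" using submod_cong[OF L st(2)] f_dvd_kill by blast
      then show False using tf st(1) s bL[OF b0] by blast
    qed
    then obtain s' \<delta> where \<delta>: "\<delta> \<noteq> 0" "f\<^sub>E a b dvd s * s' - \<iota> \<delta>" using f_norm by blast
    obtain d where d: "f\<^sub>E a b dvd s' * t - pol d" using f_division by blast
    have 1: "\<iota> \<delta> \<star> v - s' \<star> s \<star> v \<in> L"
      using submod_cong_sym[OF L f_dvd_cong[OF \<delta>(2), of v]] by (simp add: scal_simps mult.commute)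
    have 2: "s' \<star> s \<star> v - s' \<star> t \<star> b0 \<in> L" by (rule submod_cong_scal[OF L st(2)])
    have 3: "s' \<star> t \<star> b0 - pol d \<star> b0 \<in> L" using f_dvd_cong[OF d, of b0] by (simp add: scal_simps)
    show ?thesis using submod_cong_trans[OF L submod_cong_trans[OF L 1 2] 3] \<delta>(1) by blast
  qed
  then have "\<forall>v. \<exists>\<delta> d. \<delta> \<noteq> 0 \<and> \<iota> \<delta> \<star> v - pol d \<star> b0 \<in> L" by blast
  from choice[OF this] obtain \<delta> where "\<forall>v. \<exists>d. \<delta> v \<noteq> 0 \<and> \<iota> (\<delta> v) \<star> v - pol d \<star> b0 \<in> L" by blast
  from choice[OF this] obtain d where d: "\<And>v. \<delta> v \<noteq> 0" "\<And>v. \<iota> (\<delta> v) \<star> v - pol (d v) \<star> b0 \<in> L" by blast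
  have "card B \<le> 3"
  proof (rule ccontr)
    assume "\<not> card B \<le> 3"
    then obtain c where c: "\<exists>k\<in>B. c k \<noteq> 0" "\<forall>j<3. (\<Sum>k\<in>B. c k * d k j) = 0"
      using linear_dependence[OF B(1), of 3 d] by auto
    have "(\<Sum>k\<in>B. \<iota> (c k) \<star> \<iota> (\<delta> k) \<star> k) - (\<Sum>k\<in>B. \<iota> (c k) \<star> pol (d k) \<star> b0) \<in> L"
      by (intro submod_cong_sum submod_cong_scal L d)
    also have "(\<Sum>k\<in>B. \<iota> (c k) \<star> pol (d k) \<star> b0) = pol (\<lambda>j. \<Sum>k\<in>B. c k * d k j) \<star> b0"
      by (auto simp: fun_eq_iff scal_apply sum_fun_apply sum_distrib_left sum_distrib_right iota.hom_mult iota.hom_sum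
          mult.assoc sum.swap[of _ "{..<3}"])
    also have "pol (\<lambda>j. \<Sum>k\<in>B. c k * d k j) = 0" using c(2) by simp
    also have "(\<Sum>k\<in>B. \<iota> (c k) \<star> \<iota> (\<delta> k) \<star> k) = (\<Sum>k\<in>B. \<iota> (c k * \<delta> k) \<star> k)"
      by (simp only: scal_simps iota.hom_mult)
    finally have "(\<Sum>k\<in>B. \<iota> (c k * \<delta> k) \<star> k) \<in> L" by (simp only: scal_simps diff_zero)
    then have "\<forall>k\<in>B. c k * \<delta> k = 0" by (rule ind)
    then show False using c(1) d(1) by auto
  qed
  moreover have "\<not> card B < 3"
  proof
    assume "card B < 3"
    have "\<forall>i. \<exists>g. \<X> ^ i \<star> b0 - (\<Sum>b\<in>B. \<iota> (g b) \<star> b) \<in> L" using gen by blast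
    from choice[OF this] obtain g where g: "\<And>i. \<X> ^ i \<star> b0 - (\<Sum>b\<in>B. \<iota> (g i b) \<star> b) \<in> L" by blast
    obtain \<beta> where \<beta>: "bij_betw \<beta> {0..<card B} B" using ex_bij_betw_nat_finite[OF B(1)] by blast
    obtain c where c: "\<exists>k\<in>{..<3}. c k \<noteq> 0" "\<forall>j<card B. (\<Sum>k\<in>{..<3::nat}. c k * g k (\<beta> j)) = 0"
      using linear_dependence[of "{..<3::nat}" "card B" "\<lambda>k j. g k (\<beta> j)"] \<open>card B < 3\<close> by auto
    have z: "(\<Sum>k<3. c k * g k b) = 0" if b: "b \<in> B" for b
    proof -
      have "b \<in> \<beta> ` {0..<card B}" using \<beta> b by (simp add: bij_betw_def)
      then obtain j where "j < card B" "b = \<beta> j" by auto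
      then show ?thesis using c(2) by simp
    qed
    have "(\<Sum>k<3. \<iota> (c k) \<star> \<X> ^ k \<star> b0) - (\<Sum>k<3. \<iota> (c k) \<star> (\<Sum>b\<in>B. \<iota> (g k b) \<star> b)) \<in> L"
      by (intro submod_cong_sum submod_cong_scal L g)
    also have "(\<Sum>k<3. \<iota> (c k) \<star> (\<Sum>b\<in>B. \<iota> (g k b) \<star> b)) = (\<Sum>b\<in>B. \<iota> (\<Sum>k<3. c k * g k b) \<star> b)"
      by (auto simp: fun_eq_iff scal_apply sum_fun_apply sum_distrib_left sum_distrib_right iota.hom_mult iota.hom_sum
          mult.assoc sum.swap[of _ "{..<3}"])
    also have "\<dots> = 0" using z by (simp add: scal_simps)
    also have "(\<Sum>k<3. \<iota> (c k) \<star> \<X> ^ k \<star> b0) = pol c \<star> b0"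
      by (auto simp: fun_eq_iff scal_apply sum_fun_apply sum_distrib_right mult.assoc)
    finally have "pol c \<star> b0 \<in> L" by simp
    then have "f\<^sub>E a b dvd pol c" using tf bL[OF b0] by blast
    then show False using f_division_unique c(1) by blast
  qed
  ultimately have card: "card B = 3" by simp
  obtain \<beta> where "bij_betw \<beta> {0..<card B} B" using ex_bij_betw_nat_finite[OF B(1)] by blast
  then have \<beta>: "bij_betw \<beta> {..<3} B" by (simp add: card lessThan_atLeast0)
  have sum: "(\<Sum>b\<in>B. h b) = (\<Sum>j<3. h (\<beta> j))" for h :: "(nat \<Rightarrow> 'k T) \<Rightarrow> nat \<Rightarrow> 'k T"
    by (rule sum.reindex_bij_betw[OF \<beta>, symmetric])
  show ?thesis
  proof (intro exI[of _ \<beta>] conjI allI impI)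
    fix v
    obtain c where "v - (\<Sum>b\<in>B. \<iota> (c b) \<star> b) \<in> L" using gen by blast
    then show "\<exists>c. v - (\<Sum>j<3. \<iota> (c j) \<star> \<beta> j) \<in> L" unfolding sum by (intro exI[of _ "\<lambda>j. c (\<beta> j)"])
  next
    fix c j assume c: "(\<Sum>j<3. \<iota> (c j) \<star> \<beta> j) \<in> L" and j: "j < (3::nat)"
    define c' where "c' b = c (inv_into {..<3} \<beta> b)" for b
    have c': "c' (\<beta> j) = c j" if "j < 3" for j
      using bij_betw_inv_into_left[OF \<beta>, of j] that by (simp add: c'_def)
    have "(\<Sum>b\<in>B. \<iota> (c' b) \<star> b) = (\<Sum>j<3. \<iota> (c j) \<star> \<beta> j)"
      unfolding sum by (rule sum.cong) (auto simp: c')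
    then have "(\<Sum>b\<in>B. \<iota> (c' b) \<star> b) \<in> L" using c by simp
    then have "\<forall>b\<in>B. c' b = 0" by (rule ind)
    moreover have "\<beta> j \<in> B" using \<beta> j by (auto simp: bij_betw_def)
    ultimately show "c j = 0" using c' j by metis
  qed (rule tf)
qed

text \<open>If multiplication by X on the basis has matrix phi over K[[Y,Z]], the module is the
  cokernel of X - phi over T. The determinant is monic of degree three in X; it annihilates the
  module by the adjugate identity, hence f divides it, and comparing degrees leaves only -
  f.\<close>

lemma presentation:
  "\<exists>\<Phi>. \<Phi> \<in> carrier_mat 3 3 \<and> det \<Phi> = - f\<^sub>E a b \<and> liso (lat \<Phi>) L"
proof -
  obtain \<beta> :: "nat \<Rightarrow> nat \<Rightarrow> 'k T" where gen: "\<And>v. \<exists>c. v - (\<Sum>j<3. \<iota> (c j) \<star> \<beta> j) \<in> L"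
    and ind: "\<And>c. (\<Sum>j<3. \<iota> (c j) \<star> \<beta> j) \<in> L \<Longrightarrow> (\<forall>j<3. c j = 0)"
    and tf: "\<And>s v. \<not> f\<^sub>E a b dvd s \<Longrightarrow> s \<star> v \<in> L \<Longrightarrow> v \<in> L" using ex_three_basis by blast
  have "\<forall>j. \<exists>c. \<X> \<star> \<beta> j - (\<Sum>i<3. \<iota> (c i) \<star> \<beta> i) \<in> L" using gen by blast
  from choice[OF this] obtain \<phi> where \<phi>: "\<And>j. \<X> \<star> \<beta> j - (\<Sum>i<3. \<iota> (\<phi> j i) \<star> \<beta> i) \<in> L" by blast
  \<comment> \<open>Column \<open>j\<close> is the relation that expresses X times the basis element
    \<open>j\<close>.\<close>
  define \<Phi> where "\<Phi> = mat 3 3 (\<lambda>(i, j). (if i = j then \<X> else 0) - \<iota> (\<phi> j i))"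
  have \<Phi>: "\<Phi> \<in> carrier_mat 3 3" by (simp add: \<Phi>_def)
  have \<Phi>_ij: "\<Phi> $$ (i, j) = (if i = j then \<X> else 0) - \<iota> (\<phi> j i)" if "i < 3" "j < 3" for i j
    using that by (simp add: \<Phi>_def)
  define \<theta> where "\<theta> w = (\<Sum>j<3. w j \<star> \<beta> j)" for w :: "nat \<Rightarrow> 'k T"
  have lin: "linear_fn \<theta>"
    by (auto simp: linear_fn_def \<theta>_def fun_eq_iff scal_apply sum_fun_apply sum_distrib_left distrib_right sum.distrib mult.assoc)
  have col: "\<theta> (\<lambda>i. \<Phi> $$ (i, j)) \<in> L" if "j < 3" for j
  proof -
    have "\<theta> (\<lambda>i. \<Phi> $$ (i, j)) = (\<Sum>i<3. (if i = j then \<X> else 0) \<star> \<beta> i - \<iota> (\<phi> j i) \<star> \<beta> i)"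
      unfolding \<theta>_def by (rule sum.cong) (auto simp: \<Phi>_ij that scal_simps)
    also have "\<dots> = (\<Sum>i<3. (if i = j then \<X> else 0) \<star> \<beta> i) - (\<Sum>i<3. \<iota> (\<phi> j i) \<star> \<beta> i)"
      by (rule sum_subtractf)
    also have "(\<Sum>i<3. (if i = j then \<X> else 0) \<star> \<beta> i) = (\<Sum>i<3. if i = j then \<X> \<star> \<beta> i else 0)"
      by (rule sum.cong) (auto simp: scal_simps)
    also have "\<dots> = \<X> \<star> \<beta> j" using that by simp
    finally have eq: "\<theta> (\<lambda>i. \<Phi> $$ (i, j)) = \<X> \<star> \<beta> j - (\<Sum>i<3. \<iota> (\<phi> j i) \<star> \<beta> i)" .
    show ?thesis using \<phi>[of j] by (simp only: eq)
  qed
  have im: "\<theta> w \<in> L" if "\<And>i. i < 3 \<Longrightarrow> w i = (\<Sum>j<3. \<Phi> $$ (i, j) * u j)" for w u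
  proof -
    have "\<theta> w = (\<Sum>i<3. (\<Sum>j<3. \<Phi> $$ (i, j) * u j) \<star> \<beta> i)"
      unfolding \<theta>_def by (rule sum.cong) (auto simp: that)
    also have "\<dots> = (\<Sum>j<3. u j \<star> \<theta> (\<lambda>i. \<Phi> $$ (i, j)))"
      by (auto simp: \<theta>_def fun_eq_iff scal_apply sum_fun_apply sum_distrib_left sum_distrib_right ac_simps intro: sum.swap)
    finally show ?thesis using col by (auto intro!: submod_sum submod_scal L)
  qed
  have adj: "(\<Sum>j<3. \<Phi> $$ (i, j) * adj_mat \<Phi> $$ (j, k)) = (if i = k then det \<Phi> else 0)" if "i < 3" "k < 3" for i k
    using adj_sum[OF \<Phi> that] .
  have "\<theta> (\<lambda>i. if i = 0 then det \<Phi> else 0) \<in> L"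
    by (rule im[where u="\<lambda>j. adj_mat \<Phi> $$ (j, 0)"]) (simp add: adj)
  then have "det \<Phi> \<star> \<beta> 0 \<in> L" by (simp add: \<theta>_def numeral_3_eq_3 scal_simps)
  then have "(det \<Phi> + f\<^sub>E a b) \<star> \<beta> 0 \<in> L" using submod_add[OF L _ fL] by (simp add: scal_simps)
  moreover have "\<beta> 0 \<notin> L"
  proof
    assume "\<beta> 0 \<in> L"
    then have "(\<Sum>j<3. \<iota> (if j = 0 then 1 else 0) \<star> \<beta> j) \<in> L" by (simp add: numeral_3_eq_3 scal_simps)
    from spec[OF ind[OF this], of 0] show False by simp
  qed
  ultimately have fd: "f\<^sub>E a b dvd det \<Phi> + f\<^sub>E a b" using tf by blast
  define q where "q i j = \<phi> j i" for i j
  have "\<Phi> = mk3 (\<X> - \<iota> (q 0 0)) (- \<iota> (q 0 1)) (- \<iota> (q 0 2)) (- \<iota> (q 1 0)) (\<X> - \<iota> (q 1 1)) (- \<iota> (q 1 2))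
     (- \<iota> (q 2 0)) (- \<iota> (q 2 1)) (\<X> - \<iota> (q 2 2))"
    by (rule eq_mk3I) (simp_all add: \<Phi> \<Phi>_ij q_def)
  then have det: "det \<Phi> = (\<X> - \<iota> (q 0 0)) * ((\<X> - \<iota> (q 1 1)) * (\<X> - \<iota> (q 2 2)) - \<iota> (q 1 2) * \<iota> (q 2 1))
     + \<iota> (q 1 0) * (- \<iota> (q 0 1) * (\<X> - \<iota> (q 2 2)) - \<iota> (q 0 2) * \<iota> (q 2 1))
     - \<iota> (q 2 0) * (\<iota> (q 0 1) * \<iota> (q 1 2) + \<iota> (q 0 2) * (\<X> - \<iota> (q 1 1)))"
    by (simp add: det_mk3 algebra_simps)
  obtain y a' b' :: "'k fps fps" where vars: "\<iota> y = \<Y>" "\<iota> a' = cst a" "\<iota> b' = cst b" using iota_var(1,3) by blast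
  \<comment> \<open>The coefficients of 1, X and X^2 in det + f; the cubes of X cancel, so
    uniqueness of division forces all three to vanish.\<close>
  define cc where "cc i = (if i = 0 then fps_X * (y ^ 2 - b' * fps_X ^ 2)
      - q 0 0 * (q 1 1 * q 2 2 - q 1 2 * q 2 1) + q 1 0 * (q 0 1 * q 2 2 - q 0 2 * q 2 1) - q 2 0 * (q 0 1 * q 1 2 - q 0 2 * q 1 1)
     else if i = 1 then - a' * fps_X ^ 2 + (q 1 1 * q 2 2 - q 1 2 * q 2 1) + q 0 0 * (q 1 1 + q 2 2) - q 1 0 * q 0 1 - q 2 0 * q 0 2
     else - (q 0 0 + q 1 1 + q 2 2))" for i :: nat
  have cc: "det \<Phi> + f\<^sub>E a b = pol cc"
    unfolding det sum3
    by (simp add: cc_def f_eq iota.hom_add iota.hom_minus iota.hom_mult iota.hom_power iota.hom_uminus vars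
        algebra_simps power2_eq_square power3_eq_cube)
  then have "\<forall>i<3. cc i = 0" using f_division_unique fd by auto
  then have "det \<Phi> + f\<^sub>E a b = 0" unfolding cc by simp
  then have det_f: "det \<Phi> = - f\<^sub>E a b" by (simp add: eq_neg_iff_add_eq_0)
  \<comment> \<open>\<open>H w\<close>: modulo the columns of \<open>\<Phi>\<close> the vector
    \<open>w\<close> can be freed of X. Once this holds for all vectors, the kernel of
    \<open>\<theta>\<close> is exactly the column lattice, because vectors over K[[Y,Z]] meet the
    kernel only in zero.\<close>
  define H where "H w \<longleftrightarrow> (\<exists>c u. \<forall>i<3. w i = \<iota> (c i) + (\<Sum>j<3. \<Phi> $$ (i, j) * u j))" for w :: "nat \<Rightarrow> 'k T"
  have H_add: "H (v + w)" if vw: "H v" "H w" for v w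
  proof -
    obtain c u c' u' where "\<forall>i<3. v i = \<iota> (c i) + (\<Sum>j<3. \<Phi> $$ (i, j) * u j)" "\<forall>i<3. w i = \<iota> (c' i) + (\<Sum>j<3. \<Phi> $$ (i, j) * u' j)"
      using vw unfolding H_def by blast
    then show ?thesis unfolding H_def
      by (intro exI[of _ "\<lambda>i. c i + c' i"] exI[of _ "\<lambda>i. u i + u' i"]) (simp add: iota.hom_add algebra_simps sum.distrib)
  qed
  have H_iota: "H (\<iota> t \<star> v)" if v: "H v" for v t
  proof -
    obtain c u where "\<forall>i<3. v i = \<iota> (c i) + (\<Sum>j<3. \<Phi> $$ (i, j) * u j)" using v unfolding H_def by blast
    then show ?thesis unfolding H_def
      by (intro exI[of _ "\<lambda>i. t * c i"] exI[of _ "\<lambda>i. \<iota> t * u i"]) (simp add: scal_apply iota.hom_mult algebra_simps sum_distrib_left)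
  qed
  have H_X: "H (\<X> \<star> v)" if v: "H v" for v
  proof -
    obtain c u where cu: "\<forall>i<3. v i = \<iota> (c i) + (\<Sum>j<3. \<Phi> $$ (i, j) * u j)" using v unfolding H_def by blast
    have "\<X> * v i = \<iota> (\<Sum>j<3. \<phi> j i * c j) + (\<Sum>j<3. \<Phi> $$ (i, j) * (\<X> * u j + \<iota> (c j)))" if i: "i < 3" for i
    proof -
      have "(\<Sum>j<3. \<Phi> $$ (i, j) * \<iota> (c j)) = (\<Sum>j<3. (if i = j then \<X> * \<iota> (c j) else 0) - \<iota> (\<phi> j i) * \<iota> (c j))"
        by (rule sum.cong) (auto simp: \<Phi>_ij i algebra_simps)
      also have "\<dots> = \<X> * \<iota> (c i) - \<iota> (\<Sum>j<3. \<phi> j i * c j)"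
        using i by (simp add: sum_subtractf iota.hom_sum iota.hom_mult)
      finally show ?thesis using cu i by (simp add: algebra_simps sum.distrib sum_distrib_left)
    qed
    then show ?thesis unfolding H_def
      by (intro exI[of _ "\<lambda>i. \<Sum>j<3. \<phi> j i * c j"] exI[of _ "\<lambda>j. \<X> * u j + \<iota> (c j)"]) (simp add: scal_apply)
  qed
  \<comment> \<open>As f = - det, multiples of f are columns combined with the negative
    adjugate.\<close>
  have H_f: "H (f\<^sub>E a b \<star> v)" for v
  proof -
    have "(f\<^sub>E a b \<star> v) i = (\<Sum>j<3. \<Phi> $$ (i, j) * (- (\<Sum>k<3. adj_mat \<Phi> $$ (j, k) * v k)))" if i: "i < 3" for i
    proof -
      have "(\<Sum>j<3. \<Phi> $$ (i, j) * (\<Sum>k<3. adj_mat \<Phi> $$ (j, k) * v k)) = (\<Sum>k<3. (\<Sum>j<3. \<Phi> $$ (i, j) * adj_mat \<Phi> $$ (j, k)) * v k)"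
        unfolding sum_distrib_left sum_distrib_right by (subst sum.swap) (simp add: mult.assoc)
      also have "\<dots> = (\<Sum>k<3. if i = k then det \<Phi> * v k else 0)"
        by (rule sum.cong) (auto simp: adj i)
      also have "\<dots> = - f\<^sub>E a b * v i" using i by (simp add: det_f)
      finally show ?thesis by (simp add: sum_negf scal_apply)
    qed
    then show ?thesis unfolding H_def by (intro exI[of _ "\<lambda>_. 0"] exI[of _ "\<lambda>j. - (\<Sum>k<3. adj_mat \<Phi> $$ (j, k) * v k)"]) simp
  qed
  define e :: "nat \<Rightarrow> nat \<Rightarrow> 'k T" where "e j = (\<lambda>i. if i = j then 1 else 0)" for j
  have H_e: "H (\<X> ^ n \<star> e j)" for n j
  proof (induction n)
    case 0
    have "H (e j)" unfolding H_def
      by (intro exI[of _ "\<lambda>i. if i = j then 1 else 0"] exI[of _ "\<lambda>_. 0"]) (simp add: e_def)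
    then show ?case by (simp add: scal_simps)
  next
    case (Suc n) then show ?case using H_X[of "\<X> ^ n \<star> e j"] by (simp add: scal_simps)
  qed
  have H_te: "H (t \<star> e j)" for t j
  proof -
    obtain c where "f\<^sub>E a b dvd t - pol c" using f_division by blast
    then obtain s where "t - pol c = f\<^sub>E a b * s" by (rule dvdE)
    then have "t = f\<^sub>E a b * s + pol c" by (simp add: algebra_simps)
    then have eq: "t \<star> e j = f\<^sub>E a b \<star> s \<star> e j + (\<iota> (c 0) \<star> \<X> ^ 0 \<star> e j + \<iota> (c 1) \<star> \<X> ^ 1 \<star> e j + \<iota> (c 2) \<star> \<X> ^ 2 \<star> e j)"
      unfolding sum3 by (simp only: scal_simps)
    show ?thesis unfolding eq by (rule H_add[OF H_f H_add[OF H_add[OF H_iota[OF H_e] H_iota[OF H_e]] H_iota[OF H_e]]])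
  qed
  have H: "H w" for w
  proof -
    have "H (w 0 \<star> e 0 + w 1 \<star> e 1 + w 2 \<star> e 2)" by (rule H_add[OF H_add[OF H_te H_te] H_te])
    then show ?thesis by (simp add: H_def e_def less_3_iff scal_apply)
  qed
  have ker: "w \<in> lat \<Phi>" if w: "\<theta> w \<in> L" for w
  proof -
    obtain c u where cu: "\<And>i. i < 3 \<Longrightarrow> w i = \<iota> (c i) + (\<Sum>j<3. \<Phi> $$ (i, j) * u j)" using H[of w] unfolding H_def by blast
    have "\<theta> (\<lambda>i. w i - \<iota> (c i)) \<in> L" by (rule im[where u=u]) (simp add: cu)
    from submod_diff[OF L w this] have "(\<Sum>j<3. \<iota> (c j) \<star> \<beta> j) \<in> L"
      by (simp add: \<theta>_def scal_simps sum_subtractf)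
    then have "\<forall>j<3. c j = 0" by (rule ind)
    then show ?thesis using cu \<Phi> by (auto simp: lat_def intro!: exI[of _ u])
  qed
  have "liso (lat \<Phi>) L" unfolding liso_def
  proof (intro exI[of _ \<theta>] conjI allI iffI)
    show "linear_fn \<theta>" by (rule lin)
    show "\<theta> w \<in> L" if "w \<in> lat \<Phi>" for w using that \<Phi> by (auto simp: lat_def intro: im)
    show "\<exists>v. w - \<theta> v \<in> L" for w 
    proof -
      obtain c where "w - (\<Sum>j<3. \<iota> (c j) \<star> \<beta> j) \<in> L" using gen by blast
      then show ?thesis by (intro exI[of _ "\<lambda>j. \<iota> (c j)"]) (simp only: \<theta>_def)
    qed
  qed (rule ker)
  then show ?thesis using \<Phi> det_f by blast
qed

end

section \<open>Chains of primes\<close>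

definition tprime :: "'r::comm_ring_1 set \<Rightarrow> bool" where
  "tprime P \<longleftrightarrow> 0 \<in> P \<and> (\<forall>s\<in>P. \<forall>t\<in>P. s + t \<in> P) \<and> (\<forall>r. \<forall>s\<in>P. r * s \<in> P) \<and> 1 \<notin> P \<and>
     (\<forall>s t. s * t \<in> P \<longrightarrow> s \<in> P \<or> t \<in> P)"

lemma tprimeD:
  assumes "tprime P"
  shows "0 \<in> P" "s \<in> P \<Longrightarrow> t \<in> P \<Longrightarrow> s + t \<in> P" "s \<in> P \<Longrightarrow> r * s \<in> P" "s \<in> P \<Longrightarrow> s * r \<in> P" "1 \<notin> P"
    "s * t \<in> P \<Longrightarrow> s \<in> P \<or> t \<in> P" "s \<in> P \<Longrightarrow> - s \<in> P" "s \<in> P \<Longrightarrow> t \<in> P \<Longrightarrow> s - t \<in> P"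
proof -
  show *: "0 \<in> P" "s \<in> P \<Longrightarrow> t \<in> P \<Longrightarrow> s + t \<in> P" "s \<in> P \<Longrightarrow> r * s \<in> P" "1 \<notin> P"
    "s * t \<in> P \<Longrightarrow> s \<in> P \<or> t \<in> P" for r s t using assms by (auto simp: tprime_def)
  show "s \<in> P \<Longrightarrow> s * r \<in> P" using *(3)[of s r] by (simp add: mult.commute)
  show m: "s \<in> P \<Longrightarrow> - s \<in> P" for s using *(3)[of s "-1"] by simp
  show "s \<in> P \<Longrightarrow> t \<in> P \<Longrightarrow> s - t \<in> P" using *(2)[of s "- t"] m by simp
qed

lemma tprime_power: "tprime P \<Longrightarrow> s ^ n \<in> P \<Longrightarrow> s \<in> P"
  by (induction n) (auto dest: tprimeD(5) tprimeD(6))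

lemma tprime_sum: "tprime P \<Longrightarrow> (\<And>i. i \<in> A \<Longrightarrow> h i \<in> P) \<Longrightarrow> (\<Sum>i\<in>A. h i) \<in> P"
  by (induction A rule: infinite_finite_induct) (auto intro: tprimeD)

lemma tprime_unit: "tprime P \<Longrightarrow> s * u \<in> P \<Longrightarrow> u * v = 1 \<Longrightarrow> s \<in> P"
  using tprimeD(4)[of P "s * u" v] by (simp add: mult.assoc)

text \<open>An algebraic relation of \<open>g\<close> modulo a prime is divided by the lowest power
  of \<open>g\<close>, as in \<open>f_norm\<close>. The map \<open>h\<close> embeds the ring of
  coefficients.\<close>

lemma tprime_least:
  assumes P: "tprime P" and g: "g \<notin> P" and sum: "(\<Sum>k<n. h (c k) * g ^ k) \<in> P" and "\<exists>k<n. c k \<noteq> 0" and h0: "h 0 = 0"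
  shows "\<exists>k<n. \<exists>s. c k \<noteq> 0 \<and> h (c k) + g * s \<in> P"
proof -
  define m where "m = (LEAST k. c k \<noteq> 0)"
  have m: "c m \<noteq> 0" "\<And>k. k < m \<Longrightarrow> c k = 0" "m < n"
  proof -
    obtain k where k: "k < n" "c k \<noteq> 0" using assms(4) by auto
    show "c m \<noteq> 0" unfolding m_def using k(2) by (rule LeastI)
    show "c k = 0" if "k < m" for k using that not_less_Least unfolding m_def by blast
    show "m < n" using Least_le[of "\<lambda>k. c k \<noteq> 0" k] k unfolding m_def by simp
  qed
  define s where "s = (\<Sum>k\<in>{m<..<n}. h (c k) * g ^ (k - m - 1))"
  have "(\<Sum>k<n. h (c k) * g ^ k) = (\<Sum>k\<in>{m..<n}. h (c k) * g ^ k)"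
    using m(2) by (intro sum.mono_neutral_right) (auto simp: h0)
  also have "{m..<n} = insert m {m<..<n}" using m(3) by auto
  also have "(\<Sum>k\<in>insert m {m<..<n}. h (c k) * g ^ k) = g ^ m * (h (c m) + g * s)"
  proof -
    have "g ^ k = g ^ m * (g * g ^ (k - m - 1))" if "m < k" for k
    proof -
      have "g ^ k = g ^ (m + Suc (k - m - 1))" using that by simp
      then show ?thesis by (simp only: power_add power_Suc)
    qed
    then show ?thesis by (simp add: s_def distrib_left sum_distrib_left ac_simps)
  qed
  finally have "g ^ m * (h (c m) + g * s) \<in> P" using sum by simp
  then have "h (c m) + g * s \<in> P" using tprimeD(6)[OF P] tprime_power[OF P] g by blast
  then show ?thesis using m by blast
qed

context
  fixes a b :: "'k::field"
begin

lemma prime_Z_X: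
  assumes "tprime P" "f\<^sub>E a b \<in> P" "\<Z> \<in> P" shows "\<X> \<in> P"
proof -
  have "\<Z> * (\<Y>\<^sup>2 - cst b * \<Z>\<^sup>2 - cst a * \<X> * \<Z>) - f\<^sub>E a b \<in> P"
    by (intro tprimeD(8)[OF assms(1)] tprimeD(4)[OF assms(1)] assms)
  then have "\<X> ^ 3 \<in> P" by (simp add: f_eq)
  then show ?thesis by (rule tprime_power[OF assms(1)])
qed

text \<open>Modulo X and Z the element \<open>y\<close> is a power of Y times a unit.\<close>

lemma prime_res_Y:
  assumes P: "tprime P" and "\<X> \<in> P" "\<Z> \<in> P" "y \<in> P" "res_Y y \<noteq> 0"
  shows "\<Y> \<in> (P :: 'k T set)"
proof -
  obtain p q where "y = emb_Y (res_Y y) + \<X> * p + \<Z> * q" using T_split by blast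
  then have "emb_Y (res_Y y) = y - \<X> * p - \<Z> * q" by (simp add: algebra_simps)
  also have "\<dots> \<in> P" by (intro tprimeD(8)[OF P] tprimeD(4)[OF P] assms)
  finally have y: "emb_Y (res_Y y) \<in> P" .
  obtain n u s where us: "res_Y y = fps_X ^ n * u" "u * s = 1" using fps_order assms(5) by blast
  have "\<Y> ^ n * emb_Y u \<in> P" using y by (simp add: us emb_Y.hom_mult emb_Y.hom_power)
  moreover have "emb_Y u * emb_Y s = 1" using us(2) by (metis emb_Y.hom_mult emb_Y.hom_one)
  ultimately show ?thesis using tprime_unit[OF P] tprime_power[OF P] by blast
qed

lemma prime_XYZ_max:
  assumes P: "tprime P" and "\<X> \<in> P" "\<Y> \<in> P" "\<Z> \<in> P" and Q: "tprime Q"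
  shows "\<not> (P :: 'k T set) \<subset> Q"
proof
  assume "P \<subset> Q"
  then obtain y where y: "y \<in> Q" "y \<notin> P" by blast
  have "y $ 0 $ 0 $ 0 \<noteq> 0"
  proof
    assume "y $ 0 $ 0 $ 0 = 0"
    then obtain p q r where "y = \<X> * p + \<Y> * q + \<Z> * r" using T_max by blast
    also have "\<dots> \<in> P" by (intro tprimeD(2)[OF P] tprimeD(4)[OF P] assms)
    finally show False using y(2) by simp
  qed
  then obtain s where "y * s = 1" using T_unit by blast
  then show False using tprimeD(4)[OF Q y(1), of s] tprimeD(5)[OF Q] by simp
qed

text \<open>Division by a series of Y-order \<open>j\<close> at Z = 0: modulo such a series K[[Y,Z]]
  is spanned over K[[Z]] by the powers of Y below \<open>j\<close>.\<close>

lemma Z_pol_division: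
  fixes p g :: "'k fps fps"
  assumes "p $ 0 = fps_X ^ j * u" "u $ 0 \<noteq> 0"
  shows "\<exists>c q. \<iota> g = \<iota> p * q + (\<Sum>l<j. emb_Z (c l) * \<Y> ^ l)"
proof -
  define R0 where "R0 = {r :: 'k fps. \<forall>i\<ge>j. r $ i = 0}"
  have uu: "u * inverse u = 1" using assms(2) by (simp add: inverse_mult_eq_1')
  have "\<exists>q r. s = p $ 0 * q + r \<and> r \<in> R0" for s
  proof (intro exI conjI)
    have "p $ 0 * (inverse u * fps_shift j s) = (u * inverse u) * (fps_X ^ j * fps_shift j s)"
      unfolding assms(1) by (simp only: ac_simps)
    also have "\<dots> = fps_X ^ j * fps_shift j s" by (simp add: uu)
    finally show "s = p $ 0 * (inverse u * fps_shift j s) + fps_cutoff j s"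
      by (auto simp: fps_eq_iff fps_X_power_mult_nth)
    show "fps_cutoff j s \<in> R0" by (auto simp: R0_def)
  qed
  then obtain q r where qr: "g = p * q + r" "\<forall>n. r $ n \<in> R0" using fps_division[of p R0 g] by blast
  have "\<iota> r = (\<Sum>l<j. emb_Z (Abs_fps (\<lambda>k. r $ k $ l)) * \<Y> ^ l)"
  proof (intro fps_ext)
    fix k m i
    have "(emb_Z (Abs_fps (\<lambda>k. r $ k $ l)) * \<Y> ^ l) $ k $ m $ i = (if m = l then if i = 0 then r $ k $ l else 0 else 0)" for l
      by (simp add: \<Y>_def fps_const_power emb_Z_def)
    then show "\<iota> r $ k $ m $ i = (\<Sum>l<j. emb_Z (Abs_fps (\<lambda>k. r $ k $ l)) * \<Y> ^ l) $ k $ m $ i"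
      using qr(2) by (auto simp: fps_sum_nth emb_YZ_def R0_def not_less)
  qed
  then show ?thesis using qr(1) by (intro exI[of _ "\<lambda>l. Abs_fps (\<lambda>k. r $ k $ l)"] exI[of _ "\<iota> q"]) (simp add: iota.hom_add iota.hom_mult)
qed

text \<open>An element of the second prime outside the first has a nonzero norm in K[[Y,Z]], of the
  form Z^n p with p nonzero at Z = 0. If Z lies in \<open>P 1\<close>, then so does X, and
  \<open>P 2\<close> must also contain Y. If p lies in \<open>P 1\<close>, the quotient by
  \<open>P 1\<close> is finite over K[[Z]], so the larger prime \<open>P 2\<close> contains Z.
  Either way \<open>P 2\<close> is already maximal.\<close>

lemma no_prime_chain:
  fixes P :: "nat \<Rightarrow> 'k T set"
  assumes P: "\<And>i. i \<le> 3 \<Longrightarrow> tprime (P i)" and f: "\<And>i. i \<le> 3 \<Longrightarrow> f\<^sub>E a b \<in> P i"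
    and sub: "\<And>i. i < 3 \<Longrightarrow> P i \<subset> P (Suc i)"
  shows False
proof -
  have P': "tprime (P 0)" "tprime (P 1)" "tprime (P 2)" "tprime (P 3)" and f': "f\<^sub>E a b \<in> P 0" "f\<^sub>E a b \<in> P 1" "f\<^sub>E a b \<in> P 2"
    using P f by auto
  have sub': "P 0 \<subset> P 1" "P 1 \<subset> P 2" "P 2 \<subset> P 3"
    using sub[of 0] sub[of 1] sub[of 2] by (auto simp: numeral_2_eq_2 numeral_3_eq_3)
  obtain x g where x: "x \<in> P 1" "x \<notin> P 0" and g: "g \<in> P 2" "g \<notin> P 1" using sub' by blast
  \<comment> \<open>Z brings X along, and an element nonzero modulo (X, Z) brings Y: no room remains
    for \<open>P 3\<close>.\<close>
  have contra: False if "\<Z> \<in> P 2" "y \<in> P 2" "res_Y y \<noteq> 0" for y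
    using prime_XYZ_max[OF P'(3) _ _ that(1) P'(4)] prime_Z_X[OF P'(3) f'(3) that(1)]
      prime_res_Y[OF P'(3) _ that] sub'(3) by blast
  have "\<not> f\<^sub>E a b dvd x" using x(2) tprimeD(4)[OF P'(1) f'(1)] by (auto elim!: dvdE)
  then obtain s' \<delta> where \<delta>: "\<delta> \<noteq> 0" "f\<^sub>E a b dvd x * s' - \<iota> \<delta>" using f_norm by blast
  obtain t where "x * s' - \<iota> \<delta> = f\<^sub>E a b * t" using \<delta>(2) by (rule dvdE)
  then have "\<iota> \<delta> = x * s' - f\<^sub>E a b * t" by (simp add: algebra_simps)
  also have "\<dots> \<in> P 1" by (intro tprimeD(8)[OF P'(2)] tprimeD(4)[OF P'(2)] x f')
  finally have \<delta>P: "\<iota> \<delta> \<in> P 1" .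
  obtain n p where p: "\<delta> = fps_X ^ n * p" "p $ 0 \<noteq> 0" using fps_order'[OF \<delta>(1)] by blast
  have "\<Z> ^ n * \<iota> p \<in> P 1" using \<delta>P by (simp add: p iota.hom_mult iota.hom_power)
  then have "\<Z> \<in> P 1 \<or> \<iota> p \<in> P 1" using tprimeD(6)[OF P'(2)] tprime_power[OF P'(2)] by blast
  then show False
  proof
    assume Z: "\<Z> \<in> P 1"
    then have X: "\<X> \<in> P 1" by (rule prime_Z_X[OF P'(2) f'(2)])
    have "res_Y g \<noteq> 0"
    proof
      assume "res_Y g = 0"
      then obtain p q where "g = \<X> * p + \<Z> * q" using res_Y_0D by blast
      also have "\<dots> \<in> P 1" by (intro tprimeD(2)[OF P'(2)] tprimeD(4)[OF P'(2)] X Z)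
      finally show False using g(2) by simp
    qed
    then show False using contra Z g sub'(2) by blast
  next
    assume ip: "\<iota> p \<in> P 1"
    obtain j u where ju: "p $ 0 = fps_X ^ j * u" "u $ 0 \<noteq> 0" using fps_order'[OF p(2)] by blast
    have "\<exists>c. t - (\<Sum>i<3. \<Sum>l<j. emb_Z (c i l) * \<Y> ^ l * \<X> ^ i) \<in> P 1" for t
    proof -
      obtain d where "f\<^sub>E a b dvd t - (\<Sum>i<3. \<iota> (d i) * \<X> ^ i)" using f_division by blast
      then obtain s where s: "t - (\<Sum>i<3. \<iota> (d i) * \<X> ^ i) = f\<^sub>E a b * s" by (rule dvdE)
      have "\<forall>i. \<exists>c. \<exists>q. \<iota> (d i) = \<iota> p * q + (\<Sum>l<j. emb_Z (c l) * \<Y> ^ l)" using Z_pol_division[OF ju] by blast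
      from choice[OF this] obtain c where "\<forall>i. \<exists>q. \<iota> (d i) = \<iota> p * q + (\<Sum>l<j. emb_Z (c i l) * \<Y> ^ l)" by blast
      from choice[OF this] obtain q where cq: "\<And>i. \<iota> (d i) = \<iota> p * q i + (\<Sum>l<j. emb_Z (c i l) * \<Y> ^ l)" by blast
      have "t = f\<^sub>E a b * s + (\<Sum>i<3. \<iota> (d i) * \<X> ^ i)" using s by (simp add: algebra_simps)
      then have "t - (\<Sum>i<3. \<Sum>l<j. emb_Z (c i l) * \<Y> ^ l * \<X> ^ i) = f\<^sub>E a b * s + \<iota> p * (\<Sum>i<3. q i * \<X> ^ i)"
        unfolding cq by (simp add: distrib_right sum.distrib sum_distrib_right sum_distrib_left mult.assoc)
      also have "\<dots> \<in> P 1" by (intro tprimeD(2)[OF P'(2)] tprimeD(4)[OF P'(2)] ip f')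
      finally show ?thesis by blast
    qed
    then have "\<forall>k. \<exists>c. g ^ k - (\<Sum>i<3. \<Sum>l<j. emb_Z (c i l) * \<Y> ^ l * \<X> ^ i) \<in> P 1" by blast
    from choice[OF this] obtain w where w: "\<And>k. g ^ k - (\<Sum>i<3. \<Sum>l<j. emb_Z (w k i l) * \<Y> ^ l * \<X> ^ i) \<in> P 1" by blast
    \<comment> \<open>One power of \<open>g\<close> more than the \<open>3 * j\<close> products of
      powers of Y and X that span the quotient over K[[Z]]; an index \<open>m\<close> encodes such a
      product by \<open>m mod 3\<close> and \<open>m div 3\<close>.\<close>
    define n where "n = Suc (3 * j)"
    obtain c where c: "\<exists>k\<in>{..<n}. c k \<noteq> 0" "\<forall>m<3 * j. (\<Sum>k\<in>{..<n}. c k * w k (m mod 3) (m div 3)) = 0"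
      using linear_dependence[of "{..<n}" "3 * j" "\<lambda>k m. w k (m mod 3) (m div 3)"] by (auto simp: n_def)
    have z: "(\<Sum>k<n. c k * w k i l) = 0" if "i < 3" "l < j" for i l
    proof -
      have "3 * l + i < 3 * j" "(3 * l + i) mod 3 = i" "(3 * l + i) div 3 = l" using that by auto
      then show ?thesis using c(2) by metis
    qed
    have "(\<Sum>k<n. emb_Z (c k) * (g ^ k - (\<Sum>i<3. \<Sum>l<j. emb_Z (w k i l) * \<Y> ^ l * \<X> ^ i))) \<in> P 1"
      by (intro tprime_sum[OF P'(2)] tprimeD(3)[OF P'(2)] w)
    also have "(\<Sum>k<n. emb_Z (c k) * (g ^ k - (\<Sum>i<3. \<Sum>l<j. emb_Z (w k i l) * \<Y> ^ l * \<X> ^ i))) =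
       (\<Sum>k<n. emb_Z (c k) * g ^ k) - (\<Sum>k<n. \<Sum>i<3. \<Sum>l<j. emb_Z (c k * w k i l) * \<Y> ^ l * \<X> ^ i)"
      by (simp add: right_diff_distrib sum_subtractf sum_distrib_left emb_Z.hom_mult mult.assoc)
    also have "(\<Sum>k<n. \<Sum>i<3. \<Sum>l<j. emb_Z (c k * w k i l) * \<Y> ^ l * \<X> ^ i) =
        (\<Sum>i<3. \<Sum>k<n. \<Sum>l<j. emb_Z (c k * w k i l) * \<Y> ^ l * \<X> ^ i)" by (rule sum.swap)
    also have "\<dots> = (\<Sum>i<3. \<Sum>l<j. \<Sum>k<n. emb_Z (c k * w k i l) * \<Y> ^ l * \<X> ^ i)"
      by (rule sum.cong[OF refl]) (rule sum.swap)
    also have "\<dots> = (\<Sum>i<3. \<Sum>l<j. emb_Z (\<Sum>k<n. c k * w k i l) * \<Y> ^ l * \<X> ^ i)"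
      by (simp only: emb_Z.hom_sum sum_distrib_right)
    also have "\<dots> = 0" using z by simp
    finally have "(\<Sum>k<n. emb_Z (c k) * g ^ k) \<in> P 1" by simp
    then obtain k s where ks: "c k \<noteq> 0" "emb_Z (c k) + g * s \<in> P 1"
      using tprime_least[OF P'(2) g(2), of emb_Z c n] c(1) by (auto simp: emb_Z.hom_zero)
    have "emb_Z (c k) + g * s - g * s \<in> P 2"
      using ks(2) sub'(2) tprimeD(4)[OF P'(3) g(1)] by (intro tprimeD(8)[OF P'(3)]) auto
    then have cP: "emb_Z (c k) \<in> P 2" by simp
    obtain m u' v where us: "c k = fps_X ^ m * u'" "u' * v = 1" using fps_order ks(1) by blast
    have "\<Z> ^ m * emb_Z u' \<in> P 2" using cP by (simp add: us emb_Z.hom_mult emb_Z.hom_power)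
    moreover have "emb_Z u' * emb_Z v = 1" using us(2) by (metis emb_Z.hom_mult emb_Z.hom_one)
    ultimately have "\<Z> \<in> P 2" using tprime_unit[OF P'(3)] tprime_power[OF P'(3)] by blast
    then show False using contra[of "\<iota> p"] ip sub'(2) p(2) by auto
  qed
qed

end

section \<open>Depth\<close>

text \<open>An elementwise comparison of the socles of M/(Y,Z)M and M/(x1,x2)M, both of which
  compute Ext^2 of the residue field into M. A nonzero socle element \<open>v\<close> of the first
  is carried to a socle element \<open>w\<close> of the second; a third regular element forces
  \<open>w\<close> to vanish there, and running the construction backwards makes \<open>v\<close>
  vanish.\<close>

lemma regular_length_le_2:
  fixes L :: "(nat \<Rightarrow> 'k::field T) set"
  assumes L: "submod L" and fL: "\<And>v. f\<^sub>E a b \<star> v \<in> L"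
    and Zr: "\<And>v. \<Z> \<star> v \<in> L \<Longrightarrow> v \<in> L" and Yr: "\<And>v. \<Y> \<star> v \<in> L \<Longrightarrow> v \<in> L"
    and YZr: "\<And>v. \<Y> \<star> v \<in> adjoin L \<Z> \<Longrightarrow> v \<in> adjoin L \<Z>"
    and proper: "v0 \<notin> adjoin (adjoin L \<Z>) \<Y>"
    and m: "x1 $ 0 $ 0 $ 0 = 0" "x2 $ 0 $ 0 $ 0 = 0" "x3 $ 0 $ 0 $ 0 = 0"
    and r1: "\<And>v. x1 \<star> v \<in> L \<Longrightarrow> v \<in> L" and r2: "\<And>v. x2 \<star> v \<in> adjoin L x1 \<Longrightarrow> v \<in> adjoin L x1"
    and r3: "\<And>v. x3 \<star> v \<in> adjoin (adjoin L x1) x2 \<Longrightarrow> v \<in> adjoin (adjoin L x1) x2"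
  shows False
proof -
  have aa: "v \<in> adjoin (adjoin L x) y \<longleftrightarrow> (\<exists>p q. v - y \<star> p - x \<star> q \<in> L)" for v x y by (auto simp: adjoin_def)
  define M where "M = adjoin (adjoin L \<Z>) \<Y>"
  have M: "submod M" unfolding M_def by (intro submod_adjoin L)
  have "\<X> ^ 3 \<star> v0 - \<Z> \<star> (\<Y>\<^sup>2 - cst b * \<Z>\<^sup>2 - cst a * \<X> * \<Z>) \<star> v0 \<in> L"
    by (rule back_subst[of "\<lambda>v. v \<in> L", OF submod_minus[OF L fL[of v0]]]) (simp add: f_eq fun_eq_iff scal_apply algebra_simps)
  then have "\<X> ^ 3 \<star> v0 \<in> M" unfolding M_def using adjoinI' adjoinI(1)[OF submod_adjoin[OF L]] by blast
  then obtain i where i: "\<X> ^ i \<star> v0 \<notin> M" "\<X> \<star> \<X> ^ i \<star> v0 \<in> M" using power_socle[OF M] proper unfolding M_def by blast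
  define v where "v = \<X> ^ i \<star> v0"
  have v: "v \<notin> M" "\<X> \<star> v \<in> M" using i by (simp_all add: v_def)
  have Yv: "\<Y> \<star> v \<in> M" unfolding M_def by (rule adjoinI(2)[OF submod_adjoin[OF L]])
  have Zv: "\<Z> \<star> v \<in> M" unfolding M_def by (rule adjoinI(1)[OF submod_adjoin[OF L] adjoinI(2)[OF L]])
  have mv: "\<exists>p q. c \<star> v - \<Y> \<star> p - \<Z> \<star> q \<in> L" if "c $ 0 $ 0 $ 0 = 0" for c
    using max_kill[OF M v(2) Yv Zv that] unfolding M_def aa .
  \<comment> \<open>Relations between Z and Y on M are the obvious ones, because Z, Y is a regular
    sequence.\<close>
  have reg: "\<exists>e. q - \<Z> \<star> e \<in> L \<and> p + \<Y> \<star> e \<in> L" if "\<Z> \<star> p + \<Y> \<star> q \<in> L" for p q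
  proof -
    have "\<Y> \<star> q - \<Z> \<star> - p \<in> L" using that by (simp add: scal_simps add.commute)
    then obtain e where e: "q - \<Z> \<star> e \<in> L" using YZr adjoinI' unfolding adjoin_def by blast
    have "\<Z> \<star> p + \<Y> \<star> q - \<Y> \<star> (q - \<Z> \<star> e) \<in> L" by (intro submod_diff submod_scal L that e)
    also have "\<Z> \<star> p + \<Y> \<star> q - \<Y> \<star> (q - \<Z> \<star> e) = \<Z> \<star> (p + \<Y> \<star> e)"
      by (simp add: fun_eq_iff scal_apply algebra_simps)
    finally show ?thesis using Zr e by blast
  qed
  obtain b1 a1 where 1: "x1 \<star> v - \<Y> \<star> b1 - \<Z> \<star> a1 \<in> L" using mv[OF m(1)] by blast
  obtain b2 a2 where 2: "x2 \<star> v - \<Y> \<star> b2 - \<Z> \<star> a2 \<in> L" using mv[OF m(2)] by blast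
  have "x1 \<star> (x2 \<star> v - \<Y> \<star> b2 - \<Z> \<star> a2) - x2 \<star> (x1 \<star> v - \<Y> \<star> b1 - \<Z> \<star> a1) \<in> L"
    by (intro submod_diff submod_scal L 1 2)
  also have "x1 \<star> (x2 \<star> v - \<Y> \<star> b2 - \<Z> \<star> a2) - x2 \<star> (x1 \<star> v - \<Y> \<star> b1 - \<Z> \<star> a1) =
     \<Z> \<star> (x2 \<star> a1 - x1 \<star> a2) + \<Y> \<star> (x2 \<star> b1 - x1 \<star> b2)"
    by (simp add: fun_eq_iff scal_apply algebra_simps)
  finally obtain w where w: "x2 \<star> b1 - x1 \<star> b2 - \<Z> \<star> w \<in> L" "x2 \<star> a1 - x1 \<star> a2 + \<Y> \<star> w \<in> L" using reg by blast
  \<comment> \<open>The image \<open>w\<close> is killed by the maximal ideal modulo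
    \<open>x1\<close>, \<open>x2\<close>: the same relation between Z and Y is applied to the pairs
    (x1, c) and (x2, c), and Y is cancelled at the end.\<close>
  have "c \<star> w \<in> adjoin (adjoin L x1) x2" if c0: "c $ 0 $ 0 $ 0 = 0" for c
  proof -
    obtain bc ac where c: "c \<star> v - \<Y> \<star> bc - \<Z> \<star> ac \<in> L" using mv[OF c0] by blast
    have *: "\<exists>e. c \<star> b' - x \<star> bc - \<Z> \<star> e \<in> L \<and> c \<star> a' - x \<star> ac + \<Y> \<star> e \<in> L"
      if "x \<star> v - \<Y> \<star> b' - \<Z> \<star> a' \<in> L" for x a' b'
    proof -
      have "x \<star> (c \<star> v - \<Y> \<star> bc - \<Z> \<star> ac) - c \<star> (x \<star> v - \<Y> \<star> b' - \<Z> \<star> a') \<in> L"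
        by (intro submod_diff submod_scal L c that)
      also have "x \<star> (c \<star> v - \<Y> \<star> bc - \<Z> \<star> ac) - c \<star> (x \<star> v - \<Y> \<star> b' - \<Z> \<star> a') =
        \<Z> \<star> (c \<star> a' - x \<star> ac) + \<Y> \<star> (c \<star> b' - x \<star> bc)"
        by (simp add: fun_eq_iff scal_apply algebra_simps)
      finally show ?thesis using reg by blast
    qed
    obtain e1 where e1: "c \<star> b1 - x1 \<star> bc - \<Z> \<star> e1 \<in> L" "c \<star> a1 - x1 \<star> ac + \<Y> \<star> e1 \<in> L" using *[OF 1] by blast
    obtain e2 where e2: "c \<star> b2 - x2 \<star> bc - \<Z> \<star> e2 \<in> L" "c \<star> a2 - x2 \<star> ac + \<Y> \<star> e2 \<in> L" using *[OF 2] by blast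
    have "c \<star> (x2 \<star> a1 - x1 \<star> a2 + \<Y> \<star> w) - x2 \<star> (c \<star> a1 - x1 \<star> ac + \<Y> \<star> e1) + x1 \<star> (c \<star> a2 - x2 \<star> ac + \<Y> \<star> e2) \<in> L"
      by (intro submod_diff submod_add submod_scal L w e1 e2)
    also have "c \<star> (x2 \<star> a1 - x1 \<star> a2 + \<Y> \<star> w) - x2 \<star> (c \<star> a1 - x1 \<star> ac + \<Y> \<star> e1) + x1 \<star> (c \<star> a2 - x2 \<star> ac + \<Y> \<star> e2) =
      \<Y> \<star> (c \<star> w - x2 \<star> e1 - x1 \<star> - e2)"
      by (simp add: fun_eq_iff scal_apply algebra_simps)
    finally show ?thesis unfolding aa using Yr by blast
  qed
  then have "x3 \<star> w \<in> adjoin (adjoin L x1) x2" using m(3) by blast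
  then have "w \<in> adjoin (adjoin L x1) x2" by (rule r3)
  then obtain q p where pq: "w - x2 \<star> q - x1 \<star> p \<in> L" unfolding aa by blast
  \<comment> \<open>With \<open>w\<close> expressed through \<open>x1\<close> and \<open>x2\<close>,
    the corrected \<open>a1\<close> and \<open>b1\<close> become divisible by \<open>x1\<close>;
    then \<open>x1\<close> cancels in the equation that defined them.\<close>
  have "x2 \<star> a1 - x1 \<star> a2 + \<Y> \<star> w - \<Y> \<star> (w - x2 \<star> q - x1 \<star> p) \<in> L"
    by (intro submod_diff submod_scal L w pq)
  also have "x2 \<star> a1 - x1 \<star> a2 + \<Y> \<star> w - \<Y> \<star> (w - x2 \<star> q - x1 \<star> p) = x2 \<star> (a1 + \<Y> \<star> q) - x1 \<star> (a2 - \<Y> \<star> p)"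
    by (simp add: fun_eq_iff scal_apply algebra_simps)
  finally have "a1 + \<Y> \<star> q \<in> adjoin L x1" using r2 adjoinI' by blast
  then obtain g where g: "a1 + \<Y> \<star> q - x1 \<star> g \<in> L" by (auto simp: adjoin_def)
  have "x2 \<star> b1 - x1 \<star> b2 - \<Z> \<star> w + \<Z> \<star> (w - x2 \<star> q - x1 \<star> p) \<in> L"
    by (intro submod_add submod_scal L w pq)
  also have "x2 \<star> b1 - x1 \<star> b2 - \<Z> \<star> w + \<Z> \<star> (w - x2 \<star> q - x1 \<star> p) = x2 \<star> (b1 - \<Z> \<star> q) - x1 \<star> (b2 + \<Z> \<star> p)"
    by (simp add: fun_eq_iff scal_apply algebra_simps)
  finally have "b1 - \<Z> \<star> q \<in> adjoin L x1" using r2 adjoinI' by blast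
  then obtain h where h: "b1 - \<Z> \<star> q - x1 \<star> h \<in> L" by (auto simp: adjoin_def)
  have "x1 \<star> v - \<Y> \<star> b1 - \<Z> \<star> a1 + \<Z> \<star> (a1 + \<Y> \<star> q - x1 \<star> g) + \<Y> \<star> (b1 - \<Z> \<star> q - x1 \<star> h) \<in> L"
    by (intro submod_add submod_scal L 1 g h)
  also have "x1 \<star> v - \<Y> \<star> b1 - \<Z> \<star> a1 + \<Z> \<star> (a1 + \<Y> \<star> q - x1 \<star> g) + \<Y> \<star> (b1 - \<Z> \<star> q - x1 \<star> h) =
    x1 \<star> (v - \<Y> \<star> h - \<Z> \<star> g)"
    by (simp add: fun_eq_iff scal_apply algebra_simps)
  finally have "v \<in> M" unfolding M_def aa using r1 by blast
  then show False using v(1) by blast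
qed

section \<open>The lattice of a matrix factorisation\<close>

context
  fixes a b :: "'k::field" and \<alpha> \<beta> :: "'k T mat" and n :: nat
  assumes car: "\<alpha> \<in> carrier_mat n n" "\<beta> \<in> carrier_mat n n"
    and prod: "\<alpha> * \<beta> = f\<^sub>E a b \<cdot>\<^sub>m 1\<^sub>m n" "\<beta> * \<alpha> = f\<^sub>E a b \<cdot>\<^sub>m 1\<^sub>m n"
begin

abbreviation mv :: "'k T mat \<Rightarrow> (nat \<Rightarrow> 'k T) \<Rightarrow> nat \<Rightarrow> 'k T" where
  "mv A v i \<equiv> (\<Sum>j<n. A $$ (i, j) * v j)"

lemma mv_mv:
  assumes "A \<in> carrier_mat n n" "B \<in> carrier_mat n n" "A * B = f\<^sub>E a b \<cdot>\<^sub>m 1\<^sub>m n" "i < n"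
  shows "mv A (\<lambda>j. mv B v j) i = f\<^sub>E a b * v i"
proof -
  have "mv A (\<lambda>j. mv B v j) i = (\<Sum>k<n. (\<Sum>j<n. A $$ (i, j) * B $$ (j, k)) * v k)"
    unfolding sum_distrib_left sum_distrib_right by (subst sum.swap) (simp add: mult.assoc)
  also have "\<dots> = (\<Sum>k<n. (A * B) $$ (i, k) * v k)"
    by (rule sum.cong) (use assms(1,2,4) in \<open>auto simp: index_mult_sum[of _ n] lessThan_atLeast0 simp del: index_mult_mat\<close>)
  also have "\<dots> = (\<Sum>k<n. if k = i then f\<^sub>E a b * v k else 0)"
    unfolding assms(3) by (rule sum.cong) (use assms(4) in auto)
  finally show ?thesis using assms(4) by simp
qed

lemma mv_simps: "mv A (\<lambda>j. v j + w j) i = mv A v i + mv A w i" "mv A (\<lambda>j. v j - w j) i = mv A v i - mv A w i"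
  "mv A (\<lambda>j. t * v j) i = t * mv A v i"
  by (simp_all add: algebra_simps sum.distrib sum_subtractf sum_distrib_left)

lemma lat_iff_mv: "v \<in> lat \<beta> \<longleftrightarrow> (\<exists>u. \<forall>i<n. v i = mv \<beta> u i)"
  using car by (auto simp: lat_def)

text \<open>Membership in the image of \<open>\<beta>\<close> is tested by \<open>\<alpha>\<close>:
  if f divides the vector \<open>\<alpha> v\<close>, applying \<open>\<beta>\<close> and cancelling
  f recovers a preimage. Torsion-freeness follows at once from f being prime.\<close>

lemma lat_iff: "v \<in> lat \<beta> \<longleftrightarrow> (\<forall>i<n. f\<^sub>E a b dvd mv \<alpha> v i)"
proof
  assume "v \<in> lat \<beta>"
  then obtain u where u: "\<forall>i<n. v i = mv \<beta> u i" by (auto simp: lat_iff_mv)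
  then have "mv \<alpha> v i = mv \<alpha> (\<lambda>j. mv \<beta> u j) i" for i by simp
  then show "\<forall>i<n. f\<^sub>E a b dvd mv \<alpha> v i" using mv_mv[OF car prod(1)] by simp
next
  assume "\<forall>i<n. f\<^sub>E a b dvd mv \<alpha> v i"
  then have "\<forall>i. \<exists>k. i < n \<longrightarrow> mv \<alpha> v i = f\<^sub>E a b * k" by (auto simp: dvd_def)
  from choice[OF this] obtain k where k: "\<And>i. i < n \<Longrightarrow> mv \<alpha> v i = f\<^sub>E a b * k i" by blast
  have "f\<^sub>E a b * v i = f\<^sub>E a b * mv \<beta> k i" if "i < n" for i
  proof -
    have "f\<^sub>E a b * v i = mv \<beta> (\<lambda>j. mv \<alpha> v j) i" using mv_mv[OF car(2,1) prod(2) that] by simp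
    also have "\<dots> = mv \<beta> (\<lambda>j. f\<^sub>E a b * k j) i" by (rule sum.cong) (auto simp: k)
    finally show ?thesis by (simp add: mv_simps)
  qed
  then have "v i = mv \<beta> k i" if "i < n" for i using that by (simp add: f_ne_0)
  then show "v \<in> lat \<beta>" by (auto simp: lat_iff_mv)
qed

lemma f_lat: "f\<^sub>E a b \<star> v \<in> lat \<beta>"
  by (simp add: lat_iff scal_apply mv_simps)

lemma lat_torsion_free: "\<not> f\<^sub>E a b dvd s \<Longrightarrow> s \<star> v \<in> lat \<beta> \<Longrightarrow> v \<in> lat \<beta>"
  unfolding lat_iff scal_apply mv_simps using f_prime by blast

lemma Z_not_f_dvd: "\<not> f\<^sub>E a b dvd \<Z>" and Y_not_f_dvd: "\<not> f\<^sub>E a b dvd \<Y>"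
proof -
  show "\<not> f\<^sub>E a b dvd \<Y>"
  proof
    assume "f\<^sub>E a b dvd \<Y>"
    then obtain s where "\<Y> = f\<^sub>E a b * s" by (rule dvdE)
    then have "res_Y \<Y> = res_Y (f\<^sub>E a b * s)" by simp
    then show False unfolding res_Y.hom_mult res_Y_f by simp
  qed
  show "\<not> f\<^sub>E a b dvd \<Z>"
  proof
    assume "f\<^sub>E a b dvd \<Z>"
    then have "f\<^sub>E a b dvd (\<Sum>i<3. \<iota> (if i = 0 then fps_X else 0) * \<X> ^ i)" by (simp add: sum3)
    from f_division_unique[OF this, of 0] show False by simp
  qed
qed

text \<open>Applying \<open>\<alpha>\<close> turns the hypothesis into Y p - Z q = f k entrywise. At
  Y = Z = 0 the cubic is - X^3, so k lies in (Y, Z); removing its Y-part leaves p congruent to a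
  multiple of f modulo Z. Applying \<open>\<beta>\<close> and cancelling f, which is nonzero modulo
  Z, finishes the argument.\<close>

lemma lat_Y_regular:
  assumes "\<Y> \<star> v \<in> adjoin (lat \<beta>) \<Z>"
  shows "v \<in> adjoin (lat \<beta>) \<Z>"
proof -
  obtain w where "\<Y> \<star> v - \<Z> \<star> w \<in> lat \<beta>" using assms by (auto simp: adjoin_def)
  then have "\<forall>i. \<exists>k. i < n \<longrightarrow> \<Y> * mv \<alpha> v i - \<Z> * mv \<alpha> w i = f\<^sub>E a b * k"
    by (auto simp: lat_iff dvd_def scal_apply mv_simps)
  from choice[OF this] obtain k where k: "\<And>i. i < n \<Longrightarrow> \<Y> * mv \<alpha> v i - \<Z> * mv \<alpha> w i = f\<^sub>E a b * k i" by blast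
  have "\<exists>k' m'. mv \<alpha> v i = f\<^sub>E a b * k' + \<Z> * m'" if "i < n" for i
  proof -
    have "(\<Y> * mv \<alpha> v i - \<Z> * mv \<alpha> w i) $ 0 $ 0 = (f\<^sub>E a b * k i) $ 0 $ 0" using k[OF that] by simp
    then have "k i $ 0 $ 0 = 0" by simp
    then obtain k' k'' where k': "k i = \<Y> * k' + \<Z> * k''" using const_0D by blast
    have "\<Y> * (mv \<alpha> v i - f\<^sub>E a b * k') = \<Z> * (mv \<alpha> w i + f\<^sub>E a b * k'')"
      using k[OF that] unfolding k' by (simp add: algebra_simps)
    then have "(\<Y> * (mv \<alpha> v i - f\<^sub>E a b * k')) $ 0 = (\<Z> * (mv \<alpha> w i + f\<^sub>E a b * k'')) $ 0" by simp
    then have "(mv \<alpha> v i - f\<^sub>E a b * k') $ 0 = 0" by simp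
    then obtain m' where "mv \<alpha> v i - f\<^sub>E a b * k' = \<Z> * m'" using Z_dvd_iff by (metis dvdE)
    then have "mv \<alpha> v i = f\<^sub>E a b * k' + \<Z> * m'" by (simp add: algebra_simps)
    then show ?thesis by blast
  qed
  then have "\<forall>i. \<exists>k'. \<exists>m'. i < n \<longrightarrow> mv \<alpha> v i = f\<^sub>E a b * k' + \<Z> * m'" by blast
  from choice[OF this] obtain k' where "\<forall>i. \<exists>m'. i < n \<longrightarrow> mv \<alpha> v i = f\<^sub>E a b * k' i + \<Z> * m'" by blast
  from choice[OF this] obtain m' where km: "\<And>i. i < n \<Longrightarrow> mv \<alpha> v i = f\<^sub>E a b * k' i + \<Z> * m' i" by blast
  have "\<exists>e. v i - mv \<beta> k' i = \<Z> * e" if "i < n" for i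
  proof -
    have "f\<^sub>E a b * v i = mv \<beta> (\<lambda>j. mv \<alpha> v j) i" using mv_mv[OF car(2,1) prod(2) that] by simp
    also have "\<dots> = mv \<beta> (\<lambda>j. f\<^sub>E a b * k' j + \<Z> * m' j) i" by (rule sum.cong) (auto simp: km)
    finally have "f\<^sub>E a b * v i = f\<^sub>E a b * mv \<beta> k' i + \<Z> * mv \<beta> m' i" by (simp only: mv_simps)
    then have "f\<^sub>E a b * (v i - mv \<beta> k' i) = \<Z> * mv \<beta> m' i" by (simp only: right_diff_distrib add_diff_cancel_left')
    then have "(f\<^sub>E a b * (v i - mv \<beta> k' i)) $ 0 = (\<Z> * mv \<beta> m' i) $ 0" by simp
    moreover have "f\<^sub>E a b $ 0 \<noteq> 0" by (simp add: f_nth0)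
    ultimately have "(v i - mv \<beta> k' i) $ 0 = 0" by simp
    then show ?thesis using Z_dvd_iff by (metis dvdE)
  qed
  then have "\<forall>i. \<exists>e. i < n \<longrightarrow> v i - mv \<beta> k' i = \<Z> * e" by blast
  from choice[OF this] obtain e where e: "\<And>i. i < n \<Longrightarrow> v i - mv \<beta> k' i = \<Z> * e i" by blast
  have "v - \<Z> \<star> e \<in> lat \<beta>" unfolding lat_iff_mv
    using e by (intro exI[of _ k']) (auto simp: scal_apply algebra_simps)
  then show ?thesis by (rule adjoinI')
qed

lemma lat_proper:
  assumes "n > 0" "\<And>i j. i < n \<Longrightarrow> j < n \<Longrightarrow> \<beta> $$ (i, j) $ 0 $ 0 $ 0 = 0"
  shows "(\<lambda>_. 1) \<notin> adjoin (adjoin (lat \<beta>) \<Z>) \<Y>"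
proof
  assume "(\<lambda>_. 1) \<in> adjoin (adjoin (lat \<beta>) \<Z>) \<Y>"
  then obtain p q where "(\<lambda>_. 1) - \<Y> \<star> p - \<Z> \<star> q \<in> lat \<beta>" by (auto simp: adjoin_def)
  then obtain u where "\<forall>i<n. 1 - \<Y> * p i - \<Z> * q i = mv \<beta> u i" by (auto simp: lat_iff_mv scal_apply)
  then have "(1 - \<Y> * p 0 - \<Z> * q 0) $ 0 $ 0 $ 0 = mv \<beta> u 0 $ 0 $ 0 $ 0" using assms(1) by simp
  then show False using assms by (simp add: fps_sum_nth)
qed

end

section \<open>Equivalence of matrices\<close>

definition inv_mat :: "nat \<Rightarrow> 'r::comm_ring_1 mat \<Rightarrow> bool" where
  "inv_mat n U \<longleftrightarrow> U \<in> carrier_mat n n \<and> (\<exists>U'\<in>carrier_mat n n. U * U' = 1\<^sub>m n \<and> U' * U = 1\<^sub>m n)"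

definition meq :: "nat \<Rightarrow> 'r::comm_ring_1 mat \<Rightarrow> 'r mat \<Rightarrow> bool" where
  "meq n A B \<longleftrightarrow> A \<in> carrier_mat n n \<and> (\<exists>U V. inv_mat n U \<and> inv_mat n V \<and> B = U * A * V)"

lemma inv_mat_det:
  assumes U: "U \<in> carrier_mat n n" and s: "det U * s = 1" shows "inv_mat n U"
proof -
  note a = adj_mat[OF U]
  have "U * (s \<cdot>\<^sub>m adj_mat U) = 1\<^sub>m n" "(s \<cdot>\<^sub>m adj_mat U) * U = 1\<^sub>m n"
    using a U s by (auto simp: mult_smult_distrib[of _ n n _ n] mult_smult_assoc_mat[of _ n n _ n] mult.commute intro!: eq_matI)
  then show ?thesis using U a(1) by (auto simp: inv_mat_def intro!: bexI[of _ "s \<cdot>\<^sub>m adj_mat U"])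
qed

lemma inv_mat_one: "inv_mat n (1\<^sub>m n)"
  by (auto simp: inv_mat_def intro!: bexI[of _ "1\<^sub>m n"])

lemma inv_mat_mult: "inv_mat n (U * V)" if U: "inv_mat n U" and V: "inv_mat n V"
proof -
  obtain U' where U': "U' \<in> carrier_mat n n" "U * U' = 1\<^sub>m n" "U' * U = 1\<^sub>m n" using U by (auto simp: inv_mat_def)
  obtain V' where V': "V' \<in> carrier_mat n n" "V * V' = 1\<^sub>m n" "V' * V = 1\<^sub>m n" using V by (auto simp: inv_mat_def)
  have c: "U \<in> carrier_mat n n" "V \<in> carrier_mat n n" using U V by (auto simp: inv_mat_def)
  have "U * V * (V' * U') = U * (V * V') * U'"
    using c U'(1) V'(1) by (simp add: assoc_mult_mat[of _ n n _ n _ n])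
  then have 1: "U * V * (V' * U') = 1\<^sub>m n" by (simp only: V'(2) right_mult_one_mat[OF c(1)] U'(2))
  have "V' * U' * (U * V) = V' * (U' * U) * V"
    using c U'(1) V'(1) by (simp add: assoc_mult_mat[of _ n n _ n _ n])
  then have "V' * U' * (U * V) = 1\<^sub>m n" by (simp only: U'(3) right_mult_one_mat[OF V'(1)] V'(3))
  then show ?thesis unfolding inv_mat_def using 1 mult_carrier_mat[OF c] mult_carrier_mat[OF V'(1) U'(1)] by blast
qed

lemma inv_mat_transpose: "inv_mat n (transpose_mat U)" if U: "inv_mat n U"
proof -
  obtain U' where U': "U' \<in> carrier_mat n n" "U * U' = 1\<^sub>m n" "U' * U = 1\<^sub>m n" using U by (auto simp: inv_mat_def)
  have c: "U \<in> carrier_mat n n" using U by (auto simp: inv_mat_def)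
  have "transpose_mat U * transpose_mat U' = 1\<^sub>m n" "transpose_mat U' * transpose_mat U = 1\<^sub>m n"
    by (simp_all only: U' transpose_one flip: transpose_mult[OF U'(1) c] transpose_mult[OF c U'(1)])
  then show ?thesis using c U' by (auto simp: inv_mat_def intro!: bexI[of _ "transpose_mat U'"])
qed

lemma meqI: "A \<in> carrier_mat n n \<Longrightarrow> inv_mat n U \<Longrightarrow> inv_mat n V \<Longrightarrow> B = U * A * V \<Longrightarrow> meq n A B"
  by (auto simp: meq_def)

lemma meq_carrier: "meq n A B \<Longrightarrow> A \<in> carrier_mat n n" "meq n A B \<Longrightarrow> B \<in> carrier_mat n n"
  by (auto simp: meq_def inv_mat_def intro: mult_carrier_mat)

lemma meq_refl: "A \<in> carrier_mat n n \<Longrightarrow> meq n A A"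
  by (rule meqI[OF _ inv_mat_one inv_mat_one]) auto

lemma meq_trans: "meq n A C" if AB: "meq n A B" and BC: "meq n B C"
proof -
  obtain U V where A: "A \<in> carrier_mat n n" and UV: "inv_mat n U" "inv_mat n V" "B = U * A * V" using AB by (auto simp: meq_def)
  obtain U' V' where UV': "inv_mat n U'" "inv_mat n V'" "C = U' * B * V'" using BC by (auto simp: meq_def)
  have c: "U \<in> carrier_mat n n" "V \<in> carrier_mat n n" "U' \<in> carrier_mat n n" "V' \<in> carrier_mat n n"
    using UV UV' by (auto simp: inv_mat_def)
  have "C = (U' * U) * A * (V * V')" unfolding UV'(3) UV(3)
    using A c by (simp add: assoc_mult_mat[of _ n n _ n _ n])
  then show ?thesis using A inv_mat_mult[OF UV'(1) UV(1)] inv_mat_mult[OF UV(2) UV'(2)] by (intro meqI)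
qed

lemma meq_sym: "meq n B A" if AB: "meq n A B"
proof -
  obtain U V where A: "A \<in> carrier_mat n n" and UV: "inv_mat n U" "inv_mat n V" "B = U * A * V" using AB by (auto simp: meq_def)
  obtain U' where U': "U' \<in> carrier_mat n n" "U * U' = 1\<^sub>m n" "U' * U = 1\<^sub>m n" using UV by (auto simp: inv_mat_def)
  obtain V' where V': "V' \<in> carrier_mat n n" "V * V' = 1\<^sub>m n" "V' * V = 1\<^sub>m n" using UV by (auto simp: inv_mat_def)
  have c: "U \<in> carrier_mat n n" "V \<in> carrier_mat n n" using UV by (auto simp: inv_mat_def)
  have "U' * B * V' = (U' * U) * A * (V * V')" unfolding UV(3)
    using A c U'(1) V'(1) by (simp add: assoc_mult_mat[of _ n n _ n _ n])
  then have "A = U' * B * V'" by (simp only: U'(3) V'(2) left_mult_one_mat[OF A] right_mult_one_mat[OF A])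
  then show ?thesis using meq_carrier(2)[OF AB] U' V' c by (intro meqI[of _ _ U' V']) (auto simp: inv_mat_def)
qed

lemma meq_transpose: "meq n (transpose_mat A) (transpose_mat B)" if AB: "meq n A B"
proof -
  obtain U V where A: "A \<in> carrier_mat n n" and UV: "inv_mat n U" "inv_mat n V" "B = U * A * V" using AB by (auto simp: meq_def)
  have c: "U \<in> carrier_mat n n" "V \<in> carrier_mat n n" using UV by (auto simp: inv_mat_def)
  have "transpose_mat B = transpose_mat V * (transpose_mat A * transpose_mat U)"
    unfolding UV(3) using c A by (simp add: transpose_mult[of _ n n _ n])
  also have "\<dots> = transpose_mat V * transpose_mat A * transpose_mat U"
    using c A by (simp add: assoc_mult_mat[of _ n n _ n _ n])
  finally show ?thesis using A UV by (intro meqI[of _ _ "transpose_mat V" "transpose_mat U"] inv_mat_transpose) auto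
qed

lemma inv_mat_det_unit: "\<exists>s. det U * s = 1" if U: "inv_mat n U"
proof -
  obtain U' where U': "U' \<in> carrier_mat n n" "U * U' = 1\<^sub>m n" using U by (auto simp: inv_mat_def)
  have "det (U * U') = det U * det U'" using U U' by (intro det_mult[of _ n]) (auto simp: inv_mat_def)
  then show ?thesis using U'(2) by (metis det_one)
qed

lemma unit_mult: "a * s = 1 \<Longrightarrow> b * t = 1 \<Longrightarrow> (a * b) * (s * t) = 1" for a b :: "'r::comm_ring_1"
  by (metis mult.assoc mult.left_commute mult_1_right)

lemma meq_det: "\<exists>e s. e * s = 1 \<and> det B = e * det A" if AB: "meq n A B"
proof -
  obtain U V where A: "A \<in> carrier_mat n n" and UV: "inv_mat n U" "inv_mat n V" "B = U * A * V" using AB by (auto simp: meq_def)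
  have c: "U \<in> carrier_mat n n" "V \<in> carrier_mat n n" using UV by (auto simp: inv_mat_def)
  obtain s t where "det U * s = 1" "det V * t = 1" using inv_mat_det_unit UV by metis
  moreover have "det B = det U * det V * det A" unfolding UV(3)
    using c A by (simp add: det_mult[of _ n] mult_carrier_mat[of _ n n] ac_simps)
  ultimately show ?thesis using unit_mult by metis
qed

lemma lat_iff_vec: "A \<in> carrier_mat n n \<Longrightarrow> v \<in> lat A \<longleftrightarrow> (\<exists>u\<in>carrier_vec n. vec n v = A *\<^sub>v u)"
proof
  assume A: "A \<in> carrier_mat n n" and "v \<in> lat A"
  then obtain u where u: "\<forall>i<n. v i = (\<Sum>j<n. A $$ (i, j) * u j)" by (auto simp: lat_def)
  have "vec n v = A *\<^sub>v vec n u"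
    by (rule eq_vecI) (use u A in \<open>auto simp: scalar_prod_def lessThan_atLeast0\<close>)
  then show "\<exists>u\<in>carrier_vec n. vec n v = A *\<^sub>v u" by (intro bexI[of _ "vec n u"]) auto
next
  assume A: "A \<in> carrier_mat n n" and "\<exists>u\<in>carrier_vec n. vec n v = A *\<^sub>v u"
  then obtain u where u: "u \<in> carrier_vec n" "vec n v = A *\<^sub>v u" by blast
  have "v i = (\<Sum>j<n. A $$ (i, j) * vec_index u j)" if "i < n" for i
  proof -
    have "v i = vec_index (vec n v) i" using that by simp
    also have "\<dots> = (\<Sum>j<n. A $$ (i, j) * vec_index u j)" unfolding u(2)
      using A u(1) that by (auto simp: scalar_prod_def lessThan_atLeast0)
    finally show ?thesis .
  qed
  then show "v \<in> lat A" using A by (auto simp: lat_def intro!: exI[of _ "vec_index u"])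
qed

text \<open>The left factor carries one image onto the other, while an invertible right factor does
  not change an image.\<close>

lemma liso_meq: "liso (lat A) (lat B)" if AB: "meq n A B"
proof -
  obtain U V where A: "A \<in> carrier_mat n n" and UV: "inv_mat n U" "inv_mat n V" "B = U * A * V" using AB by (auto simp: meq_def)
  obtain U' where U': "U' \<in> carrier_mat n n" "U * U' = 1\<^sub>m n" "U' * U = 1\<^sub>m n" using UV by (auto simp: inv_mat_def)
  obtain V' where V': "V' \<in> carrier_mat n n" "V * V' = 1\<^sub>m n" "V' * V = 1\<^sub>m n" using UV by (auto simp: inv_mat_def)
  have c: "U \<in> carrier_mat n n" "V \<in> carrier_mat n n" "B \<in> carrier_mat n n" using UV meq_carrier[OF AB] by (auto simp: inv_mat_def)
  define \<theta> where "\<theta> M v = (\<lambda>i. if i < n then \<Sum>j<n. M $$ (i, j) * v j else 0)" for M :: "'a mat" and v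
  have lin: "linear_fn (\<theta> M)" for M
    by (auto simp: linear_fn_def \<theta>_def fun_eq_iff scal_apply algebra_simps sum.distrib sum_distrib_left)
  have \<theta>: "vec n (\<theta> M v) = M *\<^sub>v vec n v" if "M \<in> carrier_mat n n" for M v
    by (rule eq_vecI) (use that in \<open>auto simp: \<theta>_def scalar_prod_def lessThan_atLeast0\<close>)
  have "v \<in> lat A \<longleftrightarrow> \<theta> U v \<in> lat B" for v
  proof
    assume "v \<in> lat A"
    then obtain u where u: "u \<in> carrier_vec n" "vec n v = A *\<^sub>v u" using lat_iff_vec[OF A] by blast
    have "B *\<^sub>v (V' *\<^sub>v u) = U *\<^sub>v (A *\<^sub>v ((V * V') *\<^sub>v u))" unfolding UV(3)
      using c A u(1) V'(1) by (simp add: assoc_mult_mat_vec[of _ n n _ n])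
    also have "\<dots> = vec n (\<theta> U v)" unfolding V'(2) \<theta>[OF c(1)] u(2) using u(1) by simp
    finally show "\<theta> U v \<in> lat B" unfolding lat_iff_vec[OF c(3)] using V'(1) u(1) by (intro bexI[of _ "V' *\<^sub>v u"]) auto
  next
    assume "\<theta> U v \<in> lat B"
    then obtain u where u: "u \<in> carrier_vec n" "U *\<^sub>v vec n v = B *\<^sub>v u" using lat_iff_vec[OF c(3)] \<theta>[OF c(1)] by auto
    have "(U' * U) *\<^sub>v vec n v = U' *\<^sub>v (B *\<^sub>v u)" using u c U'(1) by (simp add: assoc_mult_mat_vec[of _ n n _ n])
    also have "\<dots> = (U' * U) *\<^sub>v (A *\<^sub>v (V *\<^sub>v u))" unfolding UV(3)
      using c A u(1) U'(1) by (simp add: assoc_mult_mat_vec[of _ n n _ n])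
    finally have "vec n v = A *\<^sub>v (V *\<^sub>v u)" unfolding U'(3) using A c u(1) by simp
    then show "v \<in> lat A" unfolding lat_iff_vec[OF A] using c(2) u(1) by (intro bexI[of _ "V *\<^sub>v u"]) auto
  qed
  moreover have "\<exists>v. w - \<theta> U v \<in> lat B" for w
  proof
    have "vec n (\<theta> U (\<theta> U' w)) = (U * U') *\<^sub>v vec n w" using \<theta> c U'(1) by (simp add: assoc_mult_mat_vec[of _ n n _ n])
    then have eq: "vec n (\<theta> U (\<theta> U' w)) = vec n w" unfolding U'(2) by simp
    have "w i - \<theta> U (\<theta> U' w) i = 0" if "i < n" for i
    proof -
      have "vec_index (vec n (\<theta> U (\<theta> U' w))) i = vec_index (vec n w) i" using eq by simp
      then show ?thesis using that by simp
    qed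
    then show "w - \<theta> U (\<theta> U' w) \<in> lat B" using c(3) by (auto simp: lat_def intro!: exI[of _ "\<lambda>_. 0"])
  qed
  ultimately show ?thesis unfolding liso_def using lin by blast
qed

lemma liso_trans: "liso L1 L3" if 12: "liso L1 L2" and 23: "liso L2 L3" and L3: "submod L3"
proof -
  obtain \<theta> where \<theta>: "linear_fn \<theta>" "\<And>v. v \<in> L1 \<longleftrightarrow> \<theta> v \<in> L2" "\<And>w. \<exists>v. w - \<theta> v \<in> L2" using 12 by (auto simp: liso_def)
  obtain \<psi> where \<psi>: "linear_fn \<psi>" "\<And>v. v \<in> L2 \<longleftrightarrow> \<psi> v \<in> L3" "\<And>w. \<exists>v. w - \<psi> v \<in> L3" using 23 by (auto simp: liso_def)
  have lin: "linear_fn (\<lambda>v. \<psi> (\<theta> v))" using \<theta>(1) \<psi>(1) by (simp add: linear_fn_def)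
  have diff: "\<psi> (v - w) = \<psi> v - \<psi> w" for v w
  proof -
    have "\<psi> (v - w + w) = \<psi> (v - w) + \<psi> w" using \<psi>(1) unfolding linear_fn_def by blast
    then show ?thesis by simp
  qed
  have "\<exists>v. w - \<psi> (\<theta> v) \<in> L3" for w
  proof -
    obtain v where v: "w - \<psi> v \<in> L3" using \<psi>(3) by blast
    obtain u where "v - \<theta> u \<in> L2" using \<theta>(3) by blast
    then have "\<psi> v - \<psi> (\<theta> u) \<in> L3" using \<psi>(2)[of "v - \<theta> u"] by (simp only: diff)
    from submod_cong_trans[OF L3 v this] show ?thesis by blast
  qed
  then show ?thesis unfolding liso_def using lin \<theta>(2) \<psi>(2) by blast
qed

text \<open>Instantiations follow the order of occurrence: u1, u4, u2, u3 and the inverse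
  \<open>s\<close> of the determinant, then likewise for the right factor.\<close>

lemma meq2I:
  assumes "(u1 * u4 - u2 * u3) * s = 1" "(v1 * v4 - v2 * v3) * t = (1 :: 'r::comm_ring_1)" "B = mk2 u1 u2 u3 u4 * mk2 a b c d * mk2 v1 v2 v3 v4"
  shows "meq 2 (mk2 a b c d) B"
  by (rule meqI[OF _ inv_mat_det inv_mat_det assms(3)]) (use assms in \<open>auto simp: det_mk2\<close>)

lemma meq2_swap_rows: "meq 2 (mk2 a b c d) (mk2 c d a (b :: 'r::comm_ring_1))"
  by (rule meq2I[of 0 0 1 1 "-1" 1 1 0 0 1]) (simp_all add: mk2_mult)

lemma meq2_swap_cols: "meq 2 (mk2 a b c d) (mk2 b a d (c :: 'r::comm_ring_1))"
  by (rule meq2I[of 1 1 0 0 1 0 0 1 1 "-1"]) (simp_all add: mk2_mult)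

lemma meq2_neg_col: "meq 2 (mk2 a b c d) (mk2 a (- b) c (- d :: 'r::comm_ring_1))"
  by (rule meq2I[of 1 1 0 0 1 1 "-1" 0 0 "-1"]) (simp_all add: mk2_mult)

lemma meq2_add_row: "meq 2 (mk2 a b c d) (mk2 (a + t * c) (b + t * d) c (d :: 'r::comm_ring_1))"
  by (rule meq2I[of 1 1 t 0 1 1 1 0 0 1]) (simp_all add: mk2_mult)

lemma meq2_add_col: "meq 2 (mk2 a b c d) (mk2 (a + b * t) b (c + d * t) (d :: 'r::comm_ring_1))"
  by (rule meq2I[of 1 1 0 0 1 1 1 0 t 1]) (simp_all add: mk2_mult)

lemma unit_cancel: "e * s = 1 \<Longrightarrow> s * (e * F) = F" for e s F :: "'r::comm_ring_1"
  by (metis mult.assoc mult.commute mult_1)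

section \<open>Smooth curve germs\<close>

text \<open>The affine points of E and the point at infinity are treated alike by abstracting from
  the names of the variables: \<open>z\<close> is the coordinate nonzero at the point. The maps
  \<open>l1\<close> and \<open>l2\<close> are the derivations at the origin that read off the linear
  coefficients of \<open>x\<close> and \<open>y\<close>.\<close>

locale coords =
  fixes x y z :: "'k::field T" and l1 l2 :: "'k T \<Rightarrow> 'k"
  assumes max: "t $ 0 $ 0 $ 0 = 0 \<Longrightarrow> \<exists>p q r. t = x * p + y * q + z * r"
    and c0 [simp]: "x $ 0 $ 0 $ 0 = 0" "y $ 0 $ 0 $ 0 = 0" "z $ 0 $ 0 $ 0 = 0"
    and reg: "z dvd x * p + y * q \<Longrightarrow> \<exists>k p'. p = y * k + z * p'"
    and zx: "z dvd x * s \<Longrightarrow> z dvd s" and zy: "z dvd y * s \<Longrightarrow> z dvd s" and z0: "z \<noteq> 0"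
    and l1: "l1 (s * t) = s $ 0 $ 0 $ 0 * l1 t + l1 s * t $ 0 $ 0 $ 0" "l1 (s + t) = l1 s + l1 t" "l1 (s - t) = l1 s - l1 t"
    and l2: "l2 (s * t) = s $ 0 $ 0 $ 0 * l2 t + l2 s * t $ 0 $ 0 $ 0" "l2 (s + t) = l2 s + l2 t" "l2 (s - t) = l2 s - l2 t"
    and l1_var: "l1 x = 1" "l1 y = 0" "l1 z = 0" and l2_var: "l2 x = 0" "l2 y = 1" "l2 z = 0"

interpretation XYZ: coords \<X> \<Y> \<Z> "\<lambda>t. t $ 0 $ 0 $ 1" "\<lambda>t. t $ 0 $ 1 $ 0"
proof
  fix p q s t :: "'a T"
  show "\<exists>p q r. t = \<X> * p + \<Y> * q + \<Z> * r" if "t $ 0 $ 0 $ 0 = 0" using T_max[OF that] .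
  show "\<exists>k p'. p = \<Y> * k + \<Z> * p'" if "\<Z> dvd \<X> * p + \<Y> * q"
  proof (rule const_0D)
    have "(\<X> * p + \<Y> * q) $ 0 $ 0 = 0" using that unfolding Z_dvd_iff by simp
    then show "p $ 0 $ 0 = 0" by simp
  qed
  show "\<Z> dvd s" if "\<Z> dvd \<X> * s" using that unfolding Z_dvd_iff by simp
  show "\<Z> dvd s" if "\<Z> dvd \<Y> * s" using that unfolding Z_dvd_iff by simp
qed (simp_all add: \<Z>_def fps_mult_nth_1)

interpretation XZY: coords \<X> \<Z> \<Y> "\<lambda>t. t $ 0 $ 0 $ 1" "\<lambda>t. t $ 1 $ 0 $ 0"
proof
  fix p q s t :: "'a T"
  show "\<exists>p q r. t = \<X> * p + \<Z> * q + \<Y> * r" if "t $ 0 $ 0 $ 0 = 0"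
    using T_max[OF that] by (metis add.assoc add.commute)
  show "\<exists>k p'. p = \<Z> * k + \<Y> * p'" if "\<Y> dvd \<X> * p + \<Z> * q"
  proof -
    have "(\<X> * p + \<Z> * q) $ 0 $ 0 = 0" using that unfolding Y_dvd_iff by blast
    then have "p $ 0 $ 0 = 0" by simp
    then show ?thesis using const_0D by (metis add.commute)
  qed
  show "\<Y> dvd s" if "\<Y> dvd \<X> * s" using that unfolding Y_dvd_iff \<X>_def by simp
  show "\<Y> dvd s" if "\<Y> dvd \<Z> * s" unfolding Y_dvd_iff
  proof
    fix k
    have "(\<Z> * s) $ Suc k $ 0 = 0" using that unfolding Y_dvd_iff by blast
    then show "s $ k $ 0 = 0" by (simp add: \<Z>_def)
  qed
  show "\<Y> \<noteq> (0 :: 'a T)" by (simp add: \<Y>_def)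
qed (simp_all add: \<Z>_def fps_mult_nth_1)

text \<open>The equations u = v = 0 describe a smooth formal branch parametrised by
  \<open>z\<close>, with tangent direction given by the constant terms of \<open>\<xi>\<close> and
  \<open>\<eta>\<close>. The ideal of the branch is \<open>J\<close>.\<close>

locale germ = coords +
  fixes \<xi> \<eta> u v
  defines u_def: "u \<equiv> x - z * \<xi>" and v_def: "v \<equiv> y - z * \<eta>"
begin

definition J where "J t \<longleftrightarrow> (\<exists>p q. t = u * p + v * q)"

lemma J_uv: "J (u * p)" "J (v * q)" "J (p * u)" "J (q * v)"
proof -
  show u: "J (u * p)" for p unfolding J_def by (intro exI[of _ p] exI[of _ 0]) simp
  show v: "J (v * q)" for q unfolding J_def by (intro exI[of _ 0] exI[of _ q]) simp
  show "J (p * u)" "J (q * v)" using u[of p] v[of q] by (simp_all add: mult.commute)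
qed

lemma J_add: "J s \<Longrightarrow> J t \<Longrightarrow> J (s + t)"
proof -
  assume "J s" "J t"
  then obtain p q p' q' where "s = u * p + v * q" "t = u * p' + v * q'" by (auto simp: J_def)
  then have "s + t = u * (p + p') + v * (q + q')" by (simp add: algebra_simps)
  then show ?thesis unfolding J_def by blast
qed

lemma J_mult: "J t \<Longrightarrow> J (s * t)"
proof -
  assume "J t"
  then obtain p q where "t = u * p + v * q" by (auto simp: J_def)
  then have "s * t = u * (s * p) + v * (s * q)" by (simp add: algebra_simps)
  then show ?thesis unfolding J_def by blast
qed

lemma J_minus: "J t \<Longrightarrow> J (- t)" using J_mult[of t "-1"] by simp
lemma J_diff: "J s \<Longrightarrow> J t \<Longrightarrow> J (s - t)" using J_add[of s "- t"] J_minus by simp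

text \<open>Modulo z the pair u, v becomes x, y, whose relations are generated by the obvious one;
  this lets one factor z be removed from a representation by u and v.\<close>

lemma J_reg: "J s" if Jz: "J (z * s)"
proof -
  obtain p q where pq: "z * s = u * p + v * q" using Jz unfolding J_def by blast
  then have "x * p + y * q = z * (s + \<xi> * p + \<eta> * q)" by (simp add: u_def v_def algebra_simps)
  then obtain k p' where p: "p = y * k + z * p'" using reg by (metis dvd_triv_left)
  have "y * (x * k + q) = z * (s + \<xi> * p + \<eta> * q - x * p')"
    using \<open>x * p + y * q = _\<close> p by (simp add: algebra_simps)
  then obtain q' where q': "x * k + q = z * q'" using zy by (metis dvd_triv_left dvdE)
  have "z * s = z * (u * (\<eta> * k + p') + v * (q' - \<xi> * k))"
  proof -
    have "q = z * q' - x * k" using q' by (simp add: algebra_simps)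
    then have "z * s = u * (y * k + z * p') + v * (z * q' - x * k)" using pq p by metis
    also have "\<dots> = z * (u * (\<eta> * k + p') + v * (q' - \<xi> * k))" by (simp add: u_def v_def algebra_simps)
    finally show ?thesis .
  qed
  then show ?thesis using z0 unfolding J_def by auto
qed

lemma uv [simp]: "u $ 0 $ 0 $ 0 = 0" "v $ 0 $ 0 $ 0 = 0" "l1 u = 1" "l1 v = 0" "l2 u = 0" "l2 v = 1"
  by (simp_all add: u_def v_def l1 l2 l1_var l2_var)

lemma J_c0: "J t \<Longrightarrow> t $ 0 $ 0 $ 0 = 0"
  by (auto simp: J_def)

lemma v_ne_0: "v \<noteq> 0"
proof
  assume "v = 0"
  moreover have "l2 (0 - 0) = l2 0 - l2 0" by (rule l2(3))
  ultimately show False using uv(6) by simp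
qed

text \<open>Modulo z the relation is the trivial one by \<open>reg\<close>. Successive correction
  gives it modulo every power of z, and Krull's theorem for the ideal generated by \<open>v\<close>
  removes the remainder.\<close>

lemma koszul: "\<exists>k. p = v * k \<and> q = u * k" if eq: "u * p = v * q"
proof -
  have step: "\<exists>k p1 q1. p = v * k + z * p1 \<and> u * p1 = v * q1" if "u * p = v * q" for p q
  proof -
    have "x * p + y * (- q) = z * (\<xi> * p - \<eta> * q)" using that by (simp add: u_def v_def algebra_simps)
    then obtain k p' where p: "p = y * k + z * p'" using reg by (metis dvd_triv_left)
    define p1 where "p1 = \<eta> * k + p'"
    have p1: "p = v * k + z * p1" by (simp add: p p1_def v_def algebra_simps)
    have e: "v * (q - u * k) = z * (u * p1)" using that unfolding p1 by (simp add: algebra_simps)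
    then have "y * (q - u * k) = z * (u * p1 + \<eta> * (q - u * k))" by (simp add: v_def algebra_simps)
    then obtain q1 where q1: "q - u * k = z * q1" using zy by (metis dvd_triv_left dvdE)
    have "z * (u * p1) = z * (v * q1)" using e unfolding q1 by (metis mult.left_commute)
    then have "u * p1 = v * q1" unfolding mult_left_cancel[OF z0] .
    then show ?thesis using p1 by blast
  qed
  have iter: "\<exists>k p1 q1. p = v * k + z ^ n * p1 \<and> u * p1 = v * q1" for n
  proof (induction n)
    case 0 then show ?case using eq by (intro exI[of _ 0] exI[of _ p] exI[of _ q]) simp
  next
    case (Suc n)
    then obtain k p1 q1 where 1: "p = v * k + z ^ n * p1" "u * p1 = v * q1" by blast
    obtain k' p2 q2 where 2: "p1 = v * k' + z * p2" "u * p2 = v * q2" using step[OF 1(2)] by blast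
    have "p = v * (k + z ^ n * k') + z ^ Suc n * p2" using 1(1) unfolding 2(1) by (simp add: algebra_simps)
    then show ?case using 2(2) by blast
  qed
  define L where "L = {w :: nat \<Rightarrow> 'a T. v dvd w 0}"
  have "(\<lambda>_. p) \<in> L"
  proof (rule krull_intersection[of L 1 z])
    show "noeth TYPE('a T)" by (rule noeth_T)
    show "submod L" by (auto simp: submod_def L_def scal_apply zero_fun_def)
    show "w \<in> L" if "\<forall>i<1. w i = 0" for w using that by (simp add: L_def)
    show "\<exists>e. e * (1 - z * c) = 1" for c by (rule T_unit_max) simp
    show "\<exists>w. (\<lambda>_. p) - z ^ n \<star> w \<in> L" for n
    proof -
      obtain k p1 where "p = v * k + z ^ n * p1" using iter by blast
      then have "(\<lambda>_. p) - z ^ n \<star> (\<lambda>_. p1) \<in> L" by (simp add: L_def scal_apply)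
      then show ?thesis by blast
    qed
  qed
  then obtain k where k: "p = v * k" by (auto simp: L_def elim: dvdE)
  then have "v * (u * k) = v * q" using eq by (simp add: ac_simps)
  then have "q = u * k" using v_ne_0 by simp
  then show ?thesis using k by blast
qed

text \<open>The second row (u0, v0) describes the tangent line of the branch and agrees with it only
  up to z^2. The first row (x0, w0) restricted to the branch is z^2 times a vector with a unit
  entry, so a multiple of it corrects the second row into \<open>J\<close>. The corrected row
  generates the same ideal as (u, v), and then the determinant fixes the first row up to a multiple
  of the second.\<close>

lemma germ_meq:
  assumes F: "X * v - W * u = e * F" "e * s = 1" "x0 * v0 - w0 * u0 = e0 * F" "e0 * s0 = 1"
    and u0: "u0 = x - z * cst (\<xi> $ 0 $ 0 $ 0)" and v0: "v0 = y - z * cst (\<eta> $ 0 $ 0 $ 0)"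
    and x0: "J (x0 - z\<^sup>2 * h1)" and w0: "J (w0 - z\<^sup>2 * h2)" and h: "h1 $ 0 $ 0 $ 0 \<noteq> 0 \<or> h2 $ 0 $ 0 $ 0 \<noteq> 0"
    and l: "l1 x0 = 0" "l2 x0 = 0" "l1 w0 = 0" "l2 w0 = 0" "x0 $ 0 $ 0 $ 0 = 0" "w0 $ 0 $ 0 $ 0 = 0"
  shows "meq 2 (mk2 x0 w0 u0 v0) (mk2 X W u v)"
proof -
  have "F = s * (X * v - W * u)" unfolding F(1) using F(2) by (metis mult.assoc mult.commute mult_1)
  then have JF: "J F" using J_mult[OF J_diff[OF J_uv(4) J_uv(3)]] by simp
  \<comment> \<open>The difference of \<open>\<zeta>\<close> and its constant term lies in the
    maximal ideal, and on the branch \<open>x\<close> and \<open>y\<close> are multiples of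
    \<open>z\<close>; this supplies the second factor \<open>z\<close>.\<close>
  have shift: "\<exists>g. J (z * (\<zeta> - cst (\<zeta> $ 0 $ 0 $ 0)) - z\<^sup>2 * g)" for \<zeta>
  proof -
    have "(\<zeta> - cst (\<zeta> $ 0 $ 0 $ 0)) $ 0 $ 0 $ 0 = 0" by simp
    then obtain p q r where eq: "\<zeta> - cst (\<zeta> $ 0 $ 0 $ 0) = x * p + y * q + z * r" using max by blast
    have "z * (\<zeta> - cst (\<zeta> $ 0 $ 0 $ 0)) - z\<^sup>2 * (\<xi> * p + \<eta> * q + r) = u * (z * p) + v * (z * q)"
      unfolding eq by (simp add: u_def v_def algebra_simps power2_eq_square)
    then show ?thesis unfolding J_def by blast
  qed
  obtain g1 where "J (z * (\<xi> - cst (\<xi> $ 0 $ 0 $ 0)) - z\<^sup>2 * g1)" using shift by blast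
  from J_add[OF J_uv(1)[of 1] this] have g1: "J (u0 - z\<^sup>2 * g1)" by (simp add: u_def u0 algebra_simps)
  obtain g2 where "J (z * (\<eta> - cst (\<eta> $ 0 $ 0 $ 0)) - z\<^sup>2 * g2)" using shift by blast
  from J_add[OF J_uv(2)[of 1] this] have g2: "J (v0 - z\<^sup>2 * g2)" by (simp add: v_def v0 algebra_simps)
  have J_reg2: "J t" if "J (z\<^sup>2 * h * t)" "h * h' = 1" for h h' t
  proof -
    have "h' * (z\<^sup>2 * h * t) = (h * h') * (z * (z * t))" by (simp only: power2_eq_square ac_simps)
    then have "h' * (z\<^sup>2 * h * t) = z * (z * t)" by (simp only: that(2) mult_1)
    then show ?thesis using J_mult[OF that(1), of h'] J_reg by metis
  qed
  \<comment> \<open>The unit among \<open>h1\<close>, \<open>h2\<close> determines \<open>c\<close>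
    from one entry. The other entry follows from the determinant, because f vanishes on the branch
    and z^2 times a unit can be cancelled.\<close>
  have "\<exists>c. J (u0 + c * x0) \<and> J (v0 + c * w0)"
  proof (cases "h1 $ 0 $ 0 $ 0 = 0")
    case False
    then obtain t where t: "h1 * t = 1" using T_unit by blast
    define c where "c = - g1 * t"
    have "g1 + c * h1 = g1 - g1 * (h1 * t)" by (simp add: c_def ac_simps)
    then have 0: "g1 + c * h1 = 0" by (simp add: t)
    have eq: "u0 + c * x0 = (u0 - z\<^sup>2 * g1) + c * (x0 - z\<^sup>2 * h1) + z\<^sup>2 * (g1 + c * h1)" by (simp add: algebra_simps)
    have 1: "J (u0 + c * x0)" unfolding eq 0 using J_add[OF g1 J_mult[OF x0, of c]] by simp
    have "x0 * (v0 + c * w0) = w0 * (u0 + c * x0) + e0 * F" using F(3) by (simp add: algebra_simps)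
    then have "J (x0 * (v0 + c * w0))" using J_add[OF J_mult[OF 1] J_mult[OF JF]] by simp
    from J_diff[OF this J_mult[OF x0, of "v0 + c * w0"]] have "J (z\<^sup>2 * h1 * (v0 + c * w0))" by (simp add: algebra_simps)
    then have "J (v0 + c * w0)" using t by (rule J_reg2)
    then show ?thesis using 1 by blast
  next
    case True
    then obtain t where t: "h2 * t = 1" using T_unit h by blast
    define c where "c = - g2 * t"
    have "g2 + c * h2 = g2 - g2 * (h2 * t)" by (simp add: c_def ac_simps)
    then have 0: "g2 + c * h2 = 0" by (simp add: t)
    have eq: "v0 + c * w0 = (v0 - z\<^sup>2 * g2) + c * (w0 - z\<^sup>2 * h2) + z\<^sup>2 * (g2 + c * h2)" by (simp add: algebra_simps)
    have 1: "J (v0 + c * w0)" unfolding eq 0 using J_add[OF g2 J_mult[OF w0, of c]] by simp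
    have "w0 * (u0 + c * x0) = x0 * (v0 + c * w0) - e0 * F" using F(3) by (simp add: algebra_simps)
    then have "J (w0 * (u0 + c * x0))" using J_diff[OF J_mult[OF 1] J_mult[OF JF]] by simp
    from J_diff[OF this J_mult[OF w0, of "u0 + c * x0"]] have "J (z\<^sup>2 * h2 * (u0 + c * x0))" by (simp add: algebra_simps)
    then have "J (u0 + c * x0)" using t by (rule J_reg2)
    then show ?thesis using 1 by blast
  qed
  then obtain c g11 g21 g12 g22 where G: "u0 + c * x0 = u * g11 + v * g21" "v0 + c * w0 = u * g12 + v * g22"
    unfolding J_def by blast
  have lin: "l1 u0 = 1" "l2 u0 = 0" "l1 v0 = 0" "l2 v0 = 1" by (simp_all add: u0 v0 l1 l2 l1_var l2_var)
  have "l1 (u0 + c * x0) = 1" "l2 (u0 + c * x0) = 0" "l1 (v0 + c * w0) = 0" "l2 (v0 + c * w0) = 1"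
    by (simp_all add: l1 l2 lin l)
  \<comment> \<open>Comparing linear parts, the matrix that expresses the corrected row through u
    and v is the identity modulo the maximal ideal, hence invertible.\<close>
  then have g: "g11 $ 0 $ 0 $ 0 = 1" "g21 $ 0 $ 0 $ 0 = 0" "g12 $ 0 $ 0 $ 0 = 0" "g22 $ 0 $ 0 $ 0 = 1"
    unfolding G by (simp_all add: l1 l2)
  define D where "D = g11 * g22 - g12 * g21"
  have "D $ 0 $ 0 $ 0 \<noteq> 0" by (simp add: D_def g)
  then obtain d where d: "D * d = 1" using T_unit by blast
  define x1 w1 where "x1 = d * (x0 * g22 - w0 * g21)" and "w1 = d * (w0 * g11 - x0 * g12)"
  have "x1 * v - w1 * u = d * (x0 * (u * g12 + v * g22) - w0 * (u * g11 + v * g21))"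
    by (simp add: x1_def w1_def algebra_simps)
  also have "\<dots> = d * (x0 * v0 - w0 * u0)" unfolding G[symmetric] by (simp add: algebra_simps)
  also have "\<dots> = d * e0 * F" by (simp add: F)
  finally have det1: "x1 * v - w1 * u = d * e0 * F" .
  \<comment> \<open>The quotient of the two determinants: after scaling by it both first rows have
    the same determinant with (u, v), so their difference is a multiple of (u, v) by
    \<open>koszul\<close>.\<close>
  define \<kappa> where "\<kappa> = e * s0 * D"
  have "\<kappa> * (x1 * v - w1 * u) = e * (e0 * s0) * (D * d) * F" unfolding det1 \<kappa>_def by (simp only: ac_simps)
  then have "\<kappa> * (x1 * v - w1 * u) = X * v - W * u" by (simp add: F(1,4) d)
  then have "u * (W - \<kappa> * w1) = v * (X - \<kappa> * x1)" by (simp add: algebra_simps)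
  then obtain k where "W - \<kappa> * w1 = v * k" "X - \<kappa> * x1 = u * k" using koszul by blast
  then have XW: "X = \<kappa> * x1 + u * k" "W = \<kappa> * w1 + v * k" by (simp_all add: algebra_simps)
  have U: "((\<kappa> + k * c) * 1 - k * c) * (s * e0 * d) = 1"
  proof -
    have "((\<kappa> + k * c) * 1 - k * c) * (s * e0 * d) = (e * s) * (e0 * s0) * (D * d)" by (simp add: \<kappa>_def algebra_simps)
    then show ?thesis by (simp add: F d)
  qed
  have V: "(d * g22 * (d * g11) - (- d * g12) * (- d * g21)) * D = 1"
  proof -
    have "(d * g22 * (d * g11) - (- d * g12) * (- d * g21)) * D = (D * d) * (D * d)" by (simp add: D_def algebra_simps)
    then show ?thesis by (simp add: d)
  qed
  have c1: "(u0 + c * x0) * (d * g22) + (v0 + c * w0) * (- d * g21) = u"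
  proof -
    have "(u0 + c * x0) * (d * g22) + (v0 + c * w0) * (- d * g21) = u * (D * d)" unfolding G by (simp add: D_def algebra_simps)
    then show ?thesis by (simp add: d)
  qed
  have c2: "(u0 + c * x0) * (- d * g12) + (v0 + c * w0) * (d * g11) = v"
  proof -
    have "(u0 + c * x0) * (- d * g12) + (v0 + c * w0) * (d * g11) = v * (D * d)" unfolding G by (simp add: D_def algebra_simps)
    then show ?thesis by (simp add: d)
  qed
  have "mk2 X W u v = mk2 (\<kappa> + k * c) k c 1 * mk2 x0 w0 u0 v0 * mk2 (d * g22) (- d * g12) (- d * g21) (d * g11)"
  proof -
    have r1: "((\<kappa> + k * c) * x0 + k * u0) * (d * g22) + ((\<kappa> + k * c) * w0 + k * v0) * (- d * g21) = X"
      unfolding XW c1[symmetric] x1_def by (simp add: algebra_simps)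
    have r2: "((\<kappa> + k * c) * x0 + k * u0) * (- d * g12) + ((\<kappa> + k * c) * w0 + k * v0) * (d * g11) = W"
      unfolding XW c2[symmetric] w1_def by (simp add: algebra_simps)
    have r3: "(c * x0 + 1 * u0) * (d * g22) + (c * w0 + 1 * v0) * (- d * g21) = u" using c1 by (simp add: algebra_simps)
    have r4: "(c * x0 + 1 * u0) * (- d * g12) + (c * w0 + 1 * v0) * (d * g11) = v" using c2 by (simp add: algebra_simps)
    show ?thesis unfolding mk2_mult r1 r2 r3 r4 ..
  qed
  then show ?thesis by (rule meq2I[OF U V])
qed

end

section \<open>Classification of the presentation matrices\<close>

lemma mf_labels_iff: "MF1 l m \<in> mf_labels a b \<longleftrightarrow> weierstrass a b l m 1 = 0" "MF3 l m \<in> mf_labels a b \<longleftrightarrow> weierstrass a b l m 1 = 0"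
  "MF5 l m \<in> mf_labels a b \<longleftrightarrow> weierstrass a b l m 1 = 0" "MF2 \<in> mf_labels a b" "MF4 \<in> mf_labels a b" "MF6 \<in> mf_labels a b"
  by (auto simp: mf_labels_def)

context
  fixes a b :: "'k::field"
  assumes smooth: "weierstrass a b l m 1 = 0 \<Longrightarrow> 2 * m \<noteq> 0 \<or> 3 * l\<^sup>2 + a \<noteq> 0"
begin

text \<open>The labels whose second matrix has a row of two independent linear forms;
  \<open>MF4\<close> belongs to the point at infinity.\<close>

definition row_label :: "'k mf_label \<Rightarrow> bool" where
  "row_label i \<longleftrightarrow> i \<in> mf_labels a b \<and> (i = MF4 \<or> (\<exists>l m. i = MF3 l m))"

lemma weierstrass_minus: "weierstrass a b l (- m) 1 = weierstrass a b l m 1"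
  by (simp add: weierstrass_def)

lemma MF3_det:
  assumes "weierstrass a b l m 1 = 0"
  shows "- (\<Z> * (\<Y> + cst m * \<Z>)) * (\<Y> - cst m * \<Z>) - P\<^sub>E a l * (\<X> - cst l * \<Z>) = - 1 * f\<^sub>E a b"
proof -
  have "cst (weierstrass a b l m 1) = 0" using assms by (simp add: cst.hom_zero)
  then have "cst m ^ 2 - cst l ^ 3 - cst a * cst l - cst b = 0"
    by (simp add: weierstrass_def cst.hom_minus cst.hom_mult cst.hom_power)
  then have b: "cst b = cst m ^ 2 - cst l ^ 3 - cst a * cst l" by (simp add: algebra_simps)
  show ?thesis
    by (simp add: f\<^sub>E_def weierstrass_def P\<^sub>E_def b algebra_simps power2_eq_square power3_eq_cube)
qed

text \<open>The row X - lZ, Y - mZ vanishes over the point [l:m:1], but the entry - Y - mZ of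
  \<open>MF3\<close> changes the sign of the second coordinate; hence the inverse point on E appears
  in the label.\<close>

lemma MF3_shape:
  "meq 2 (mk2 (- (\<Z> * (\<Y> + cst m * \<Z>))) (P\<^sub>E a l) (\<X> - cst l * \<Z>) (\<Y> - cst m * \<Z>)) (snd (mf a b (MF3 l (- m))))"
proof -
  have "snd (mf a b (MF3 l (- m))) = mk2 (\<X> - cst l * \<Z>) (- (\<Y> - cst m * \<Z>)) (- (\<Z> * (\<Y> + cst m * \<Z>))) (- P\<^sub>E a l)"
    by (simp add: cst.hom_uminus)
  then show ?thesis using meq_trans[OF meq2_swap_rows meq2_neg_col] by metis
qed

lemma MF4_shape:
  "meq 2 (mk2 (cst b * \<Z>\<^sup>2 - \<Y>\<^sup>2 + cst a * \<X> * \<Z>) (- (\<X>\<^sup>2)) \<X> \<Z>) (snd (mf a b MF4))"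
proof -
  have "snd (mf a b MF4) = mk2 (- \<Z>) \<X> (- (- (\<X>\<^sup>2))) (cst b * \<Z>\<^sup>2 - \<Y>\<^sup>2 + cst a * \<X> * \<Z>)" by simp
  then show ?thesis using meq_trans[OF meq_trans[OF meq2_swap_rows meq2_neg_col] meq2_swap_cols] by metis
qed

text \<open>The forms u and v can be solved for X and Y, or, failing that, for X and Z. Because f
  lies in the ideal they generate, the tangent direction of the branch lies on E: an affine point in
  the first case, the point at infinity in the second. The matrix is then compared with the standard
  one by \<open>germ_meq\<close>.\<close>

lemma row_type:
  assumes uv: "u $ 0 $ 0 $ 0 = 0" "v $ 0 $ 0 $ 0 = 0" and det: "X * v - W * u = e * f\<^sub>E a b" "e * s = 1"
    and ind: "u $ 0 $ 0 $ 1 * v $ 0 $ 1 $ 0 - u $ 0 $ 1 $ 0 * v $ 0 $ 0 $ 1 \<noteq> 0 \<or> u $ 0 $ 0 $ 1 * v $ 1 $ 0 $ 0 - u $ 1 $ 0 $ 0 * v $ 0 $ 0 $ 1 \<noteq> 0"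
  shows "\<exists>i. row_label i \<and> meq 2 (mk2 X W u v) (snd (mf a b i))"
proof -
  obtain a1 b1 c1 where u: "u = \<X> * a1 + \<Y> * b1 + \<Z> * c1" using T_max uv(1) by blast
  obtain a2 b2 c2 where v: "v = \<X> * a2 + \<Y> * b2 + \<Z> * c2" using T_max uv(2) by blast
  have lin: "u $ 0 $ 0 $ 1 = a1 $ 0 $ 0 $ 0" "u $ 0 $ 1 $ 0 = b1 $ 0 $ 0 $ 0" "u $ 1 $ 0 $ 0 = c1 $ 0 $ 0 $ 0"
    "v $ 0 $ 0 $ 1 = a2 $ 0 $ 0 $ 0" "v $ 0 $ 1 $ 0 = b2 $ 0 $ 0 $ 0" "v $ 1 $ 0 $ 0 = c2 $ 0 $ 0 $ 0"
    unfolding u v by (simp_all add: \<Z>_def fps_mult_nth_1)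
  show ?thesis
  proof (cases "u $ 0 $ 0 $ 1 * v $ 0 $ 1 $ 0 - u $ 0 $ 1 $ 0 * v $ 0 $ 0 $ 1 = 0")
    case False
    then have "(a1 * b2 - b1 * a2) $ 0 $ 0 $ 0 \<noteq> 0" by (simp add: lin[unfolded One_nat_def])
    then obtain d where d: "(a1 * b2 - b1 * a2) * d = 1" using T_unit by blast
    \<comment> \<open>Cramer's rule for solving u and v for X and Y.\<close>
    define \<xi> \<eta> where "\<xi> = - d * (c1 * b2 - b1 * c2)" and "\<eta> = - d * (a1 * c2 - c1 * a2)"
    interpret germ \<X> \<Y> \<Z> "\<lambda>t. t $ 0 $ 0 $ 1" "\<lambda>t. t $ 0 $ 1 $ 0" \<xi> \<eta> "\<X> - \<Z> * \<xi>" "\<Y> - \<Z> * \<eta>"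
      by unfold_locales
    have u': "u * (d * b2) + v * (- d * b1) = \<X> - \<Z> * \<xi>"
    proof -
      have "u * (d * b2) + v * (- d * b1) = \<X> * ((a1 * b2 - b1 * a2) * d) - \<Z> * \<xi>"
        unfolding u v \<xi>_def by (simp add: algebra_simps)
      then show ?thesis by (simp add: d)
    qed
    have v': "u * (- d * a2) + v * (d * a1) = \<Y> - \<Z> * \<eta>"
    proof -
      have "u * (- d * a2) + v * (d * a1) = \<Y> * ((a1 * b2 - b1 * a2) * d) - \<Z> * \<eta>"
        unfolding u v \<eta>_def by (simp add: algebra_simps)
      then show ?thesis by (simp add: d)
    qed
    have V: "(d * b2 * (d * a1) - (- d * a2) * (- d * b1)) * (a1 * b2 - b1 * a2) = 1"
    proof -
      have "(d * b2 * (d * a1) - (- d * a2) * (- d * b1)) * (a1 * b2 - b1 * a2) =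
        ((a1 * b2 - b1 * a2) * d) * ((a1 * b2 - b1 * a2) * d)" by (simp add: algebra_simps)
      then show ?thesis by (simp add: d)
    qed
    define X' W' where "X' = X * (d * b2) + W * (- d * b1)" and "W' = X * (- d * a2) + W * (d * a1)"
    have m1: "meq 2 (mk2 X W u v) (mk2 X' W' (\<X> - \<Z> * \<xi>) (\<Y> - \<Z> * \<eta>))"
      by (rule meq2I[of 1 1 0 0 1, OF _ V]) (simp_all add: mk2_mult X'_def W'_def u' v' flip: u' v')
    have det': "X' * (\<Y> - \<Z> * \<eta>) - W' * (\<X> - \<Z> * \<xi>) = (d * e) * f\<^sub>E a b"
    proof -
      have "X' * (\<Y> - \<Z> * \<eta>) - W' * (\<X> - \<Z> * \<xi>) = ((a1 * b2 - b1 * a2) * d) * d * (X * v - W * u)"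
        unfolding u'[symmetric] v'[symmetric] X'_def W'_def by (simp add: algebra_simps)
      then show ?thesis by (simp add: d det)
    qed
    have de: "(d * e) * ((a1 * b2 - b1 * a2) * s) = 1"
      using unit_mult[OF d det(2)] by (simp add: ac_simps)
    have "f\<^sub>E a b = ((a1 * b2 - b1 * a2) * s) * (X' * (\<Y> - \<Z> * \<eta>) - W' * (\<X> - \<Z> * \<xi>))"
      unfolding det' by (rule unit_cancel[OF de, symmetric])
    then have Jf: "J (f\<^sub>E a b)" using J_mult[OF J_diff[OF J_uv(4) J_uv(3)]] by simp
    \<comment> \<open>On the branch X and Y are Z times \<open>\<xi>\<close> and
      \<open>\<eta>\<close>, so f becomes Z^3 times its affine value there; Z is cancelled three
      times.\<close>
    have "f\<^sub>E a b - \<Z> * (\<Z> * (\<Z> * weierstrass (cst a) (cst b) \<xi> \<eta> 1)) =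
      (\<Y> - \<Z> * \<eta>) * (\<Z> * (\<Y> + \<Z> * \<eta>)) - (\<X> - \<Z> * \<xi>) * (\<X>\<^sup>2 + \<X> * \<Z> * \<xi> + \<Z>\<^sup>2 * \<xi>\<^sup>2 + cst a * \<Z>\<^sup>2)"
      by (simp add: f\<^sub>E_def weierstrass_def algebra_simps power2_eq_square power3_eq_cube)
    then have "J (f\<^sub>E a b - \<Z> * (\<Z> * (\<Z> * weierstrass (cst a) (cst b) \<xi> \<eta> 1)))" using J_diff[OF J_uv(2) J_uv(1)] by simp
    from J_diff[OF Jf this] have "J (weierstrass (cst a) (cst b) \<xi> \<eta> 1)" using J_reg by simp
    then have "(weierstrass (cst a) (cst b) \<xi> \<eta> 1) $ 0 $ 0 $ 0 = 0" by (rule J_c0)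
    then have pt: "weierstrass a b (\<xi> $ 0 $ 0 $ 0) (\<eta> $ 0 $ 0 $ 0) 1 = 0" by (simp add: weierstrass_def fps_power_zeroth)
    define l m where "l = \<xi> $ 0 $ 0 $ 0" and "m = \<eta> $ 0 $ 0 $ 0"
    have "meq 2 (mk2 (- (\<Z> * (\<Y> + cst m * \<Z>))) (P\<^sub>E a l) (\<X> - cst l * \<Z>) (\<Y> - cst m * \<Z>)) (mk2 X' W' (\<X> - \<Z> * \<xi>) (\<Y> - \<Z> * \<eta>))"
    proof (rule germ_meq[OF det' de MF3_det])
      show "weierstrass a b l m 1 = 0" using pt by (simp add: l_def m_def)
      show "- 1 * - 1 = (1 :: 'k T)" by simp
      show "\<X> - cst l * \<Z> = \<X> - \<Z> * cst (\<xi> $ 0 $ 0 $ 0)" "\<Y> - cst m * \<Z> = \<Y> - \<Z> * cst (\<eta> $ 0 $ 0 $ 0)"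
        by (simp_all add: l_def m_def mult.commute)
      have eq: "- (\<Z> * (\<Y> + cst m * \<Z>)) - \<Z>\<^sup>2 * - (\<eta> + cst m) = (\<Y> - \<Z> * \<eta>) * (- \<Z>)"
        by (simp add: algebra_simps power2_eq_square)
      show "J (- (\<Z> * (\<Y> + cst m * \<Z>)) - \<Z>\<^sup>2 * - (\<eta> + cst m))" unfolding eq by (rule J_uv)
      have eq2: "P\<^sub>E a l - \<Z>\<^sup>2 * - (\<xi> * \<xi> + cst l * \<xi> + cst a + cst l * cst l) = (\<X> - \<Z> * \<xi>) * (- (\<X> + \<Z> * \<xi>) - cst l * \<Z>)"
        by (simp add: P\<^sub>E_def algebra_simps power2_eq_square)
      show "J (P\<^sub>E a l - \<Z>\<^sup>2 * - (\<xi> * \<xi> + cst l * \<xi> + cst a + cst l * cst l))" unfolding eq2 by (rule J_uv)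
      \<comment> \<open>The factors beside Z^2 have constant terms - 2 m and - (3 l^2 + a), the
        partial derivatives of the cubic up to sign. This is where smoothness enters.\<close>
      have "2 * m \<noteq> 0 \<or> 3 * l\<^sup>2 + a \<noteq> 0" using smooth pt by (simp add: l_def m_def)
      then show "(- (\<eta> + cst m)) $ 0 $ 0 $ 0 \<noteq> 0 \<or> (- (\<xi> * \<xi> + cst l * \<xi> + cst a + cst l * cst l)) $ 0 $ 0 $ 0 \<noteq> 0"
      proof
        assume "2 * m \<noteq> 0"
        moreover have "(- (\<eta> + cst m)) $ 0 $ 0 $ 0 = - (2 * m)" by (simp add: m_def)
        ultimately show ?thesis by simp
      next
        assume "3 * l\<^sup>2 + a \<noteq> 0"
        moreover have h2: "(- (\<xi> * \<xi> + cst l * \<xi> + cst a + cst l * cst l)) $ 0 $ 0 $ 0 = - (3 * l\<^sup>2 + a)"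
          by (simp add: l_def power2_eq_square algebra_simps)
        ultimately show ?thesis unfolding h2 by (simp only: neg_equal_0_iff_equal simp_thms)
      qed
    qed (simp_all add: \<Z>_def P\<^sub>E_def fps_mult_nth_1 power2_eq_square)
    from meq_trans[OF m1 meq_trans[OF meq_sym[OF this] MF3_shape]]
    show ?thesis using pt unfolding row_label_def
      by (intro exI[of _ "MF3 l (- m)"]) (simp add: mf_labels_iff weierstrass_minus l_def m_def del: mf.simps)
  next
    case True
    then have "(a1 * c2 - c1 * a2) $ 0 $ 0 $ 0 \<noteq> 0" using ind by (simp add: lin[unfolded One_nat_def])
    then obtain d where d: "(a1 * c2 - c1 * a2) * d = 1" using T_unit by blast
    define \<xi> \<eta> where "\<xi> = - d * (b1 * c2 - c1 * b2)" and "\<eta> = - d * (a1 * b2 - b1 * a2)"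
    \<comment> \<open>The vanishing minor of the X- and Y-coefficients is what the constant term of
      \<open>\<eta>\<close> measures.\<close>
    have \<eta>0: "\<eta> $ 0 $ 0 $ 0 = 0" using True by (simp add: \<eta>_def lin[unfolded One_nat_def])
    interpret germ \<X> \<Z> \<Y> "\<lambda>t. t $ 0 $ 0 $ 1" "\<lambda>t. t $ 1 $ 0 $ 0" \<xi> \<eta> "\<X> - \<Y> * \<xi>" "\<Z> - \<Y> * \<eta>"
      by unfold_locales
    have u': "u * (d * c2) + v * (- d * c1) = \<X> - \<Y> * \<xi>"
    proof -
      have "u * (d * c2) + v * (- d * c1) = \<X> * ((a1 * c2 - c1 * a2) * d) - \<Y> * \<xi>"
        unfolding u v \<xi>_def by (simp add: algebra_simps)
      then show ?thesis by (simp add: d)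
    qed
    have v': "u * (- d * a2) + v * (d * a1) = \<Z> - \<Y> * \<eta>"
    proof -
      have "u * (- d * a2) + v * (d * a1) = \<Z> * ((a1 * c2 - c1 * a2) * d) - \<Y> * \<eta>"
        unfolding u v \<eta>_def by (simp add: algebra_simps)
      then show ?thesis by (simp add: d)
    qed
    have V: "(d * c2 * (d * a1) - (- d * a2) * (- d * c1)) * (a1 * c2 - c1 * a2) = 1"
    proof -
      have "(d * c2 * (d * a1) - (- d * a2) * (- d * c1)) * (a1 * c2 - c1 * a2) =
        ((a1 * c2 - c1 * a2) * d) * ((a1 * c2 - c1 * a2) * d)" by (simp add: algebra_simps)
      then show ?thesis by (simp add: d)
    qed
    define X' W' where "X' = X * (d * c2) + W * (- d * c1)" and "W' = X * (- d * a2) + W * (d * a1)"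
    have m1: "meq 2 (mk2 X W u v) (mk2 X' W' (\<X> - \<Y> * \<xi>) (\<Z> - \<Y> * \<eta>))"
      by (rule meq2I[of 1 1 0 0 1, OF _ V]) (simp_all add: mk2_mult X'_def W'_def u' v' flip: u' v')
    have det': "X' * (\<Z> - \<Y> * \<eta>) - W' * (\<X> - \<Y> * \<xi>) = (d * e) * f\<^sub>E a b"
    proof -
      have "X' * (\<Z> - \<Y> * \<eta>) - W' * (\<X> - \<Y> * \<xi>) = ((a1 * c2 - c1 * a2) * d) * d * (X * v - W * u)"
        unfolding u'[symmetric] v'[symmetric] X'_def W'_def by (simp add: algebra_simps)
      then show ?thesis by (simp add: d det)
    qed
    have de: "(d * e) * ((a1 * c2 - c1 * a2) * s) = 1"
      using unit_mult[OF d det(2)] by (simp add: ac_simps)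
    have "f\<^sub>E a b = ((a1 * c2 - c1 * a2) * s) * (X' * (\<Z> - \<Y> * \<eta>) - W' * (\<X> - \<Y> * \<xi>))"
      unfolding det' by (rule unit_cancel[OF de, symmetric])
    then have Jf: "J (f\<^sub>E a b)" using J_mult[OF J_diff[OF J_uv(4) J_uv(3)]] by simp
    have "f\<^sub>E a b - \<Y> * (\<Y> * (\<Y> * weierstrass (cst a) (cst b) \<xi> 1 \<eta>)) =
      (\<Z> - \<Y> * \<eta>) * (\<Y>\<^sup>2 - cst a * \<X> * (\<Z> + \<Y> * \<eta>) - cst b * (\<Z>\<^sup>2 + \<Z> * \<Y> * \<eta> + \<Y>\<^sup>2 * \<eta>\<^sup>2))
      - (\<X> - \<Y> * \<xi>) * (\<X>\<^sup>2 + \<X> * \<Y> * \<xi> + \<Y>\<^sup>2 * \<xi>\<^sup>2 + cst a * \<Y>\<^sup>2 * \<eta>\<^sup>2)"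
      by (simp add: f\<^sub>E_def weierstrass_def algebra_simps power2_eq_square power3_eq_cube)
    then have "J (f\<^sub>E a b - \<Y> * (\<Y> * (\<Y> * weierstrass (cst a) (cst b) \<xi> 1 \<eta>)))" using J_diff[OF J_uv(2) J_uv(1)] by simp
    from J_diff[OF Jf this] have "J (weierstrass (cst a) (cst b) \<xi> 1 \<eta>)" using J_reg by simp
    then have "(weierstrass (cst a) (cst b) \<xi> 1 \<eta>) $ 0 $ 0 $ 0 = 0" by (rule J_c0)
    \<comment> \<open>With the Z-direction zero the equation of E reduces to the cube of the
      X-direction, so only the point [0:1:0] remains.\<close>
    then have \<xi>0: "\<xi> $ 0 $ 0 $ 0 = 0" by (simp add: weierstrass_def fps_power_zeroth \<eta>0)
    have "meq 2 (mk2 (cst b * \<Z>\<^sup>2 - \<Y>\<^sup>2 + cst a * \<X> * \<Z>) (- (\<X>\<^sup>2)) \<X> \<Z>) (mk2 X' W' (\<X> - \<Y> * \<xi>) (\<Z> - \<Y> * \<eta>))"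
    proof (rule germ_meq[OF det' de])
      show "(cst b * \<Z>\<^sup>2 - \<Y>\<^sup>2 + cst a * \<X> * \<Z>) * \<Z> - - (\<X>\<^sup>2) * \<X> = - 1 * f\<^sub>E a b"
        by (simp add: f\<^sub>E_def weierstrass_def algebra_simps power2_eq_square power3_eq_cube)
      show "- 1 * - 1 = (1 :: 'k T)" by simp
      show "\<X> = \<X> - \<Y> * cst (\<xi> $ 0 $ 0 $ 0)" "\<Z> = \<Z> - \<Y> * cst (\<eta> $ 0 $ 0 $ 0)" by (simp_all add: \<xi>0 \<eta>0 cst.hom_zero)
      have "cst b * \<Z>\<^sup>2 - \<Y>\<^sup>2 + cst a * \<X> * \<Z> - \<Y>\<^sup>2 * (cst b * \<eta>\<^sup>2 - 1 + cst a * \<xi> * \<eta>) =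
        (\<Z> - \<Y> * \<eta>) * (cst b * (\<Z> + \<Y> * \<eta>) + cst a * \<Y> * \<xi>) + (\<X> - \<Y> * \<xi>) * (cst a * \<Z>)"
        by (simp add: algebra_simps power2_eq_square)
      then show "J (cst b * \<Z>\<^sup>2 - \<Y>\<^sup>2 + cst a * \<X> * \<Z> - \<Y>\<^sup>2 * (cst b * \<eta>\<^sup>2 - 1 + cst a * \<xi> * \<eta>))"
        using J_add[OF J_uv(2) J_uv(1)] by simp
      have eq3: "- (\<X>\<^sup>2) - \<Y>\<^sup>2 * (- (\<xi>\<^sup>2)) = (\<X> - \<Y> * \<xi>) * (- \<X> - \<Y> * \<xi>)" by (simp add: algebra_simps power2_eq_square)
      show "J (- (\<X>\<^sup>2) - \<Y>\<^sup>2 * (- (\<xi>\<^sup>2)))" unfolding eq3 by (rule J_uv)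
      \<comment> \<open>The constant term is - 1: the point at infinity is smooth for all
        \<open>a\<close> and \<open>b\<close>.\<close>
      show "(cst b * \<eta>\<^sup>2 - 1 + cst a * \<xi> * \<eta>) $ 0 $ 0 $ 0 \<noteq> 0 \<or> (- (\<xi>\<^sup>2)) $ 0 $ 0 $ 0 \<noteq> 0"
        by (simp add: \<eta>0 \<xi>0 fps_power_zeroth)
    qed (simp_all add: \<Z>_def fps_mult_nth_1 power2_eq_square)
    from meq_trans[OF m1 meq_trans[OF meq_sym[OF this] MF4_shape]]
    show ?thesis unfolding row_label_def
      by (intro exI[of _ MF4]) (simp add: mf_labels_iff del: mf.simps)
  qed
qed

end

section \<open>Coefficients of low degree\<close>

text \<open>In the triple coefficient \<open>t $ k $ j $ i\<close> the indices belong to Z^k, Y^j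
  and X^i in this order.\<close>

lemma mult_quadratic:
  fixes s t :: "'k::field T"
  assumes "s $ 0 $ 0 $ 0 = 0" "t $ 0 $ 0 $ 0 = 0"
  shows "(s * t) $ 0 $ 0 $ 2 = s $ 0 $ 0 $ 1 * t $ 0 $ 0 $ 1"
    "(s * t) $ 0 $ 1 $ 1 = s $ 0 $ 0 $ 1 * t $ 0 $ 1 $ 0 + s $ 0 $ 1 $ 0 * t $ 0 $ 0 $ 1"
    "(s * t) $ 1 $ 0 $ 1 = s $ 0 $ 0 $ 1 * t $ 1 $ 0 $ 0 + s $ 1 $ 0 $ 0 * t $ 0 $ 0 $ 1"
    "(s * t) $ 0 $ 2 $ 0 = s $ 0 $ 1 $ 0 * t $ 0 $ 1 $ 0"
    "(s * t) $ 1 $ 1 $ 0 = s $ 0 $ 1 $ 0 * t $ 1 $ 0 $ 0 + s $ 1 $ 0 $ 0 * t $ 0 $ 1 $ 0"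
    "(s * t) $ 2 $ 0 $ 0 = s $ 1 $ 0 $ 0 * t $ 1 $ 0 $ 0"
  using assms by (simp_all add: fps_mult_nth numeral_2_eq_2 algebra_simps)

text \<open>The square of the maximal ideal.\<close>

definition max2 :: "'k::field T \<Rightarrow> bool" where
  "max2 t \<longleftrightarrow> t $ 0 $ 0 $ 0 = 0 \<and> t $ 0 $ 0 $ 1 = 0 \<and> t $ 0 $ 1 $ 0 = 0 \<and> t $ 1 $ 0 $ 0 = 0"

lemma mult_cubic:
  assumes "s $ 0 $ 0 $ 0 = 0" "max2 t"
  shows "(s * t) $ 0 $ 0 $ 3 = s $ 0 $ 0 $ 1 * t $ 0 $ 0 $ 2"
    "(s * t) $ 0 $ 1 $ 2 = s $ 0 $ 0 $ 1 * t $ 0 $ 1 $ 1 + s $ 0 $ 1 $ 0 * t $ 0 $ 0 $ 2"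
    "(s * t) $ 0 $ 2 $ 1 = s $ 0 $ 0 $ 1 * t $ 0 $ 2 $ 0 + s $ 0 $ 1 $ 0 * t $ 0 $ 1 $ 1"
    "(s * t) $ 0 $ 3 $ 0 = s $ 0 $ 1 $ 0 * t $ 0 $ 2 $ 0"
    "(s * t) $ 1 $ 2 $ 0 = s $ 1 $ 0 $ 0 * t $ 0 $ 2 $ 0 + s $ 0 $ 1 $ 0 * t $ 1 $ 1 $ 0"
  using assms by (simp_all add: max2_def fps_mult_nth numeral_2_eq_2 numeral_3_eq_3 algebra_simps)

lemma max2_mult: "s $ 0 $ 0 $ 0 = 0 \<Longrightarrow> t $ 0 $ 0 $ 0 = 0 \<Longrightarrow> max2 (s * t)"
  by (simp add: max2_def fps_mult_nth_1)

lemma max2_add: "max2 s \<Longrightarrow> max2 t \<Longrightarrow> max2 (s + t)" and max2_diff: "max2 s \<Longrightarrow> max2 t \<Longrightarrow> max2 (s - t)"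
  by (simp_all add: max2_def)

context
  fixes a b :: "'k::field"
begin

lemma unit_f_nth:
  "(e * f\<^sub>E a b) $ 0 $ 0 $ 2 = 0" "(e * f\<^sub>E a b) $ 0 $ 1 $ 1 = 0" "(e * f\<^sub>E a b) $ 1 $ 0 $ 1 = 0"
  "(e * f\<^sub>E a b) $ 0 $ 2 $ 0 = 0" "(e * f\<^sub>E a b) $ 1 $ 1 $ 0 = 0" "(e * f\<^sub>E a b) $ 2 $ 0 $ 0 = 0"
  "(e * f\<^sub>E a b) $ 0 $ 0 $ 3 = - (e $ 0 $ 0 $ 0)" "(e * f\<^sub>E a b) $ 0 $ 1 $ 2 = 0" "(e * f\<^sub>E a b) $ 0 $ 2 $ 1 = 0"
  "(e * f\<^sub>E a b) $ 0 $ 3 $ 0 = 0" "(e * f\<^sub>E a b) $ 1 $ 2 $ 0 = e $ 0 $ 0 $ 0"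
proof -
  define \<theta> where "\<theta> = \<Y>\<^sup>2 - cst b * \<Z>\<^sup>2 - cst a * \<X> * \<Z>"
  have \<theta>: "\<theta> $ 0 = fps_X\<^sup>2" "\<theta> $ Suc 0 = - (fps_const (fps_const a) * fps_const fps_X)"
    by (simp_all add: \<theta>_def fps_power_zeroth \<Y>_def \<Z>_def \<X>_def cst_def power2_eq_square mult.assoc flip: fps_const_mult)
  have ef: "e * f\<^sub>E a b = \<Z> * (e * \<theta>) - \<X> ^ 3 * e" unfolding f_eq \<theta>_def by (simp add: algebra_simps)
  have X3: "(\<X> ^ 3 * e) $ k $ j $ i = (if i < 3 then 0 else e $ k $ j $ (i - 3))" for k j i
    by (simp add: \<X>_def fps_const_power fps_X_power_mult_nth)
  have nth: "(e * f\<^sub>E a b) $ 0 $ j $ i = - (if i < 3 then 0 else e $ 0 $ j $ (i - 3))"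
    "(e * f\<^sub>E a b) $ Suc k $ j $ i = (e * \<theta>) $ k $ j $ i - (if i < 3 then 0 else e $ Suc k $ j $ (i - 3))" for k j i
    unfolding ef fps_sub_nth X3 by (simp_all add: \<Z>_def)
  show "(e * f\<^sub>E a b) $ 0 $ 0 $ 2 = 0" "(e * f\<^sub>E a b) $ 0 $ 1 $ 1 = 0" "(e * f\<^sub>E a b) $ 0 $ 2 $ 0 = 0"
    "(e * f\<^sub>E a b) $ 0 $ 0 $ 3 = - (e $ 0 $ 0 $ 0)" "(e * f\<^sub>E a b) $ 0 $ 1 $ 2 = 0" "(e * f\<^sub>E a b) $ 0 $ 2 $ 1 = 0"
    "(e * f\<^sub>E a b) $ 0 $ 3 $ 0 = 0" by (simp_all only: nth(1)) simp_all
  show "(e * f\<^sub>E a b) $ 1 $ 0 $ 1 = 0" "(e * f\<^sub>E a b) $ 1 $ 1 $ 0 = 0" "(e * f\<^sub>E a b) $ 1 $ 2 $ 0 = e $ 0 $ 0 $ 0"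
    by (simp_all only: nth(2) One_nat_def) (simp_all add: \<theta> fps_mult_nth numeral_2_eq_2 fps_X_power_nth)
  show "(e * f\<^sub>E a b) $ 2 $ 0 $ 0 = 0"
    by (simp only: nth(2) numeral_2_eq_2) (simp add: \<theta> fps_mult_nth_1 fps_power_zeroth)
qed

end

context
  fixes a b :: "'k::field"
  assumes smooth: "weierstrass a b l m 1 = 0 \<Longrightarrow> 2 * m \<noteq> 0 \<or> 3 * l\<^sup>2 + a \<noteq> 0"
begin

text \<open>If \<open>u\<close> had no linear part, the product \<open>w * u\<close> would have
  order at least four and the cubic form of f would be a linear form times a quadratic one.
  Comparing five of its coefficients rules this out, so \<open>u\<close> and \<open>v\<close> have
  independent linear parts.\<close>

lemma row_type':
  assumes c: "x $ 0 $ 0 $ 0 = 0" "u $ 0 $ 0 $ 0 = 0" "v $ 0 $ 0 $ 0 = 0" and w: "max2 w" and x: "max2 x"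
    and det: "x * v - w * u = e * f\<^sub>E a b" "e * s = 1" and vX: "v $ 0 $ 0 $ 1 \<noteq> 0" and uX: "u $ 0 $ 0 $ 1 = 0"
  shows "\<exists>i. row_label a b i \<and> meq 2 (mk2 x w u v) (snd (mf a b i))"
proof -
  have e0: "e $ 0 $ 0 $ 0 \<noteq> 0"
  proof
    assume "e $ 0 $ 0 $ 0 = 0"
    then have "(e * s) $ 0 $ 0 $ 0 = 0" by simp
    then show False unfolding det(2) by simp
  qed
  have "\<not> (u $ 0 $ 1 $ 0 = 0 \<and> u $ 1 $ 0 $ 0 = 0)"
  proof
    assume "u $ 0 $ 1 $ 0 = 0 \<and> u $ 1 $ 0 $ 0 = 0"
    then have u: "max2 u" using c uX by (simp add: max2_def)
    have wc: "w $ 0 $ 0 $ 0 = 0" "w $ 0 $ 0 $ 1 = 0" "w $ 0 $ 1 $ 0 = 0" "w $ 1 $ 0 $ 0 = 0" using w by (simp_all add: max2_def)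
    have eq: "v * x = e * f\<^sub>E a b + w * u" using det(1) by (simp add: algebra_simps)
    have "(v * x) $ 0 $ 0 $ 3 = (e * f\<^sub>E a b + w * u) $ 0 $ 0 $ 3" "(v * x) $ 0 $ 1 $ 2 = (e * f\<^sub>E a b + w * u) $ 0 $ 1 $ 2"
      "(v * x) $ 0 $ 2 $ 1 = (e * f\<^sub>E a b + w * u) $ 0 $ 2 $ 1" "(v * x) $ 0 $ 3 $ 0 = (e * f\<^sub>E a b + w * u) $ 0 $ 3 $ 0"
      "(v * x) $ 1 $ 2 $ 0 = (e * f\<^sub>E a b + w * u) $ 1 $ 2 $ 0" by (simp_all only: eq)
    then have "v $ 0 $ 0 $ 1 * x $ 0 $ 0 $ 2 = - (e $ 0 $ 0 $ 0)"
      "v $ 0 $ 0 $ 1 * x $ 0 $ 1 $ 1 + v $ 0 $ 1 $ 0 * x $ 0 $ 0 $ 2 = 0"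
      "v $ 0 $ 0 $ 1 * x $ 0 $ 2 $ 0 + v $ 0 $ 1 $ 0 * x $ 0 $ 1 $ 1 = 0"
      "v $ 0 $ 1 $ 0 * x $ 0 $ 2 $ 0 = 0"
      "v $ 1 $ 0 $ 0 * x $ 0 $ 2 $ 0 + v $ 0 $ 1 $ 0 * x $ 1 $ 1 $ 0 = e $ 0 $ 0 $ 0"
      by (simp_all only: fps_add_nth unit_f_nth mult_cubic[OF c(3) x] mult_cubic[OF wc(1) u] wc mult_zero_left add_0_right add_0_left)
    then show False using vX e0 by (cases "v $ 0 $ 1 $ 0 = 0") auto
  qed
  then have "u $ 0 $ 0 $ 1 * v $ 0 $ 1 $ 0 - u $ 0 $ 1 $ 0 * v $ 0 $ 0 $ 1 \<noteq> 0 \<or>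
    u $ 0 $ 0 $ 1 * v $ 1 $ 0 $ 0 - u $ 1 $ 0 $ 0 * v $ 0 $ 0 $ 1 \<noteq> 0" using vX uX by auto
  from row_type[OF smooth c(2,3) det this] show ?thesis by simp
qed

text \<open>The labels for which a column, instead of a row, consists of independent linear
  forms.\<close>

definition col_label :: "'k mf_label \<Rightarrow> bool" where
  "col_label i \<longleftrightarrow> i \<in> mf_labels a b \<and> (i = MF2 \<or> (\<exists>l m. i = MF1 l m))"

lemma row_label_transpose:
  assumes "row_label a b i"
  shows "\<exists>j. col_label j \<and> meq 2 (transpose_mat (snd (mf a b i))) (snd (mf a b j))"
proof -
  have "i = MF4 \<or> (\<exists>l m. i = MF3 l m)" using assms by (simp add: row_label_def[OF smooth])
  then show ?thesis
  proof (elim disjE exE)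
    assume i: "i = MF4"
    have "transpose_mat (snd (mf a b MF4)) = mk2 (- \<Z>) (\<X>\<^sup>2) \<X> (cst b * \<Z>\<^sup>2 - \<Y>\<^sup>2 + cst a * \<X> * \<Z>)"
      by (simp add: mk2_transpose)
    moreover have "meq 2 (mk2 (- \<Z>) (\<X>\<^sup>2) \<X> (cst b * \<Z>\<^sup>2 - \<Y>\<^sup>2 + cst a * \<X> * \<Z>)) (snd (mf a b MF2))"
      \<comment> \<open>The rows are exchanged, and then - aZ times the first column is added to the
        second.\<close>
      by (rule meq2I[of 0 0 1 1 "-1" 1 1 "- cst a * \<Z>" 0 1]) (simp_all add: mk2_mult algebra_simps power2_eq_square)
    ultimately show ?thesis using i by (intro exI[of _ MF2]) (simp add: col_label_def mf_labels_iff del: mf.simps)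
  next
    fix l m assume i: "i = MF3 l m"
    have w: "weierstrass a b l m 1 = 0" using assms by (simp add: i row_label_def[OF smooth] mf_labels_iff)
    have "transpose_mat (snd (mf a b (MF3 l m))) = mk2 (\<X> - cst l * \<Z>) (- (\<Z> * (\<Y> - cst m * \<Z>))) (- \<Y> - cst m * \<Z>) (- P\<^sub>E a l)"
      by (simp add: mk2_transpose)
    moreover have "meq 2 (mk2 (\<X> - cst l * \<Z>) (- (\<Z> * (\<Y> - cst m * \<Z>))) (- \<Y> - cst m * \<Z>) (- P\<^sub>E a l)) (snd (mf a b (MF1 l (- m))))"
    proof -
      have 1: "- \<Y> - cst m * \<Z> = cst (- m) * \<Z> - \<Y>" by (simp add: cst.hom_uminus)
      have 2: "- (\<Z> * (\<Y> - cst m * \<Z>)) = - (\<Z> * (\<Y> + cst (- m) * \<Z>))" by (simp add: cst.hom_uminus)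
      show ?thesis unfolding 1 2 mf.simps snd_conv
        using meq2_neg_col[of "\<X> - cst l * \<Z>" "- (\<Z> * (\<Y> + cst (- m) * \<Z>))" "cst (- m) * \<Z> - \<Y>" "- P\<^sub>E a l"]
        by (simp only: minus_minus)
    qed
    ultimately show ?thesis using i w
      by (intro exI[of _ "MF1 l (- m)"]) (simp add: col_label_def mf_labels_iff weierstrass_minus[OF smooth] del: mf.simps)
  qed
qed

text \<open>The X-coefficient of \<open>v\<close> serves as a pivot to clear the X-coefficients of
  \<open>u\<close> and \<open>w\<close>. As f starts in degree three, the quadratic coefficients of
  the determinant vanish; they show that \<open>x\<close> has no linear part and that the linear
  parts of \<open>w\<close> and \<open>u\<close> have product zero. So one of them vanishes, giving
  the row type or, after transposition, the column type.\<close>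

lemma classify2_aux:
  assumes c: "x $ 0 $ 0 $ 0 = 0" "w $ 0 $ 0 $ 0 = 0" "u $ 0 $ 0 $ 0 = 0" "v $ 0 $ 0 $ 0 = 0"
    and det: "x * v - w * u = e * f\<^sub>E a b" "e * s = 1" and vX: "v $ 0 $ 0 $ 1 \<noteq> 0"
  shows "\<exists>i. (row_label a b i \<or> col_label i) \<and> meq 2 (mk2 x w u v) (snd (mf a b i))"
proof -
  define p q where "p = cst (- (w $ 0 $ 0 $ 1) / v $ 0 $ 0 $ 1)" and "q = cst (- (u $ 0 $ 0 $ 1) / v $ 0 $ 0 $ 1)"
  define w' u' x' where "w' = w + p * v" and "u' = u + v * q" and "x' = x + p * u + w' * q"
  have m1: "meq 2 (mk2 x w u v) (mk2 x' w' u' v)"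
    using meq_trans[OF meq2_add_row[of x w u v p] meq2_add_col[of "x + p * u" "w + p * v" u v q]] by (simp add: x'_def w'_def u'_def)
  have det': "x' * v - w' * u' = e * f\<^sub>E a b" unfolding det(1)[symmetric] by (simp add: x'_def w'_def u'_def algebra_simps)
  have c': "x' $ 0 $ 0 $ 0 = 0" "w' $ 0 $ 0 $ 0 = 0" "u' $ 0 $ 0 $ 0 = 0"
    using c by (simp_all add: x'_def w'_def u'_def)
  have X: "w' $ 0 $ 0 $ 1 = 0" "u' $ 0 $ 0 $ 1 = 0"
    using vX c by (simp_all add: w'_def u'_def p_def q_def fps_mult_nth_1)
  have co: "(x' * v - w' * u') $ k $ j $ i = (e * f\<^sub>E a b) $ k $ j $ i" for k j i by (simp only: det')
  note q = mult_quadratic[OF c'(1) c(4)] mult_quadratic[OF c'(2,3)] unit_f_nth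
  have "x' $ 0 $ 0 $ 1 * v $ 0 $ 0 $ 1 = 0" using co[of 0 0 2] by (simp only: fps_sub_nth q X mult_zero_left diff_zero)
  then have xX: "x' $ 0 $ 0 $ 1 = 0" using vX by simp
  have "x' $ 0 $ 1 $ 0 * v $ 0 $ 0 $ 1 = 0" using co[of 0 1 1]
    by (simp only: fps_sub_nth q X xX mult_zero_left mult_zero_right diff_zero add_0_left add_0_right)
  then have xY: "x' $ 0 $ 1 $ 0 = 0" using vX by simp
  have "x' $ 1 $ 0 $ 0 * v $ 0 $ 0 $ 1 = 0" using co[of 1 0 1]
    by (simp only: fps_sub_nth q X xX mult_zero_left mult_zero_right diff_zero add_0_left add_0_right)
  then have xZ: "x' $ 1 $ 0 $ 0 = 0" using vX by simp
  have mx: "max2 x'" using c' xX xY xZ by (simp add: max2_def)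
  have YY: "w' $ 0 $ 1 $ 0 * u' $ 0 $ 1 $ 0 = 0" using co[of 0 2 0]
    by (simp only: fps_sub_nth q X xX xY mult_zero_left mult_zero_right diff_zero add_0_left add_0_right diff_0 neg_equal_0_iff_equal)
  have ZZ: "w' $ 1 $ 0 $ 0 * u' $ 1 $ 0 $ 0 = 0" using co[of 2 0 0]
    by (simp only: fps_sub_nth q X xX xZ mult_zero_left mult_zero_right diff_zero add_0_left add_0_right diff_0 neg_equal_0_iff_equal)
  have YZ: "w' $ 0 $ 1 $ 0 * u' $ 1 $ 0 $ 0 + w' $ 1 $ 0 $ 0 * u' $ 0 $ 1 $ 0 = 0" using co[of 1 1 0]
    by (simp only: fps_sub_nth q X xX xY xZ mult_zero_left mult_zero_right diff_zero add_0_left add_0_right diff_0 neg_equal_0_iff_equal)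
  \<comment> \<open>Two linear forms in Y and Z have product zero, so one of them is zero.\<close>
  have "max2 w' \<or> max2 u'" using YY ZZ YZ c' X unfolding max2_def by auto
  then show ?thesis
  proof
    assume "max2 w'"
    from row_type'[OF c'(1,3) c(4) this mx det' det(2) vX X(2)] meq_trans[OF m1] show ?thesis by blast
  next
    assume u': "max2 u'"
    have "x' * v - u' * w' = e * f\<^sub>E a b" using det' by (simp add: mult.commute)
    from row_type'[OF c'(1,2) c(4) u' mx this det(2) vX X(1)]
    obtain i where i: "row_label a b i" "meq 2 (mk2 x' u' w' v) (snd (mf a b i))" by blast
    obtain j where j: "col_label j" "meq 2 (transpose_mat (snd (mf a b i))) (snd (mf a b j))"
      using row_label_transpose[OF i(1)] by blast
    have "meq 2 (mk2 x' w' u' v) (transpose_mat (snd (mf a b i)))"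
      using meq_transpose[OF i(2)] by (simp only: mk2_transpose)
    from meq_trans[OF m1 meq_trans[OF this j(2)]] show ?thesis using j(1) by blast
  qed
qed

text \<open>The monomial X^3 occurs in f, so some entry has a nonzero X-coefficient. Exchanging rows
  and columns moves it to the lower right corner.\<close>

lemma classify2:
  assumes c: "x $ 0 $ 0 $ 0 = 0" "w $ 0 $ 0 $ 0 = 0" "u $ 0 $ 0 $ 0 = 0" "v $ 0 $ 0 $ 0 = 0"
    and det: "x * v - w * u = e * f\<^sub>E a b" "e * s = 1"
  shows "\<exists>i. (row_label a b i \<or> col_label i) \<and> meq 2 (mk2 x w u v) (snd (mf a b i))"
proof -
  have e0: "e $ 0 $ 0 $ 0 \<noteq> 0"
  proof
    assume "e $ 0 $ 0 $ 0 = 0"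
    then have "(e * s) $ 0 $ 0 $ 0 = 0" by simp
    then show False unfolding det(2) by simp
  qed
  have me: "(- e) * (- s) = 1" using det(2) by simp
  consider "v $ 0 $ 0 $ 1 \<noteq> 0" | "u $ 0 $ 0 $ 1 \<noteq> 0" | "w $ 0 $ 0 $ 1 \<noteq> 0" | "x $ 0 $ 0 $ 1 \<noteq> 0" |
    "x $ 0 $ 0 $ 1 = 0" "w $ 0 $ 0 $ 1 = 0" "u $ 0 $ 0 $ 1 = 0" "v $ 0 $ 0 $ 1 = 0" by blast
  then show ?thesis
  proof cases
    case 1 then show ?thesis using classify2_aux[OF c det] by blast
  next
    case 2
    have d: "w * u - x * v = (- e) * f\<^sub>E a b" using det(1) by (simp add: algebra_simps)
    show ?thesis using classify2_aux[OF c(2,1,4,3) d me 2] meq_trans[OF meq2_swap_cols] by blast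
  next
    case 3
    have d: "u * w - v * x = (- e) * f\<^sub>E a b" using det(1) by (simp add: algebra_simps)
    show ?thesis using classify2_aux[OF c(3,4,1,2) d me 3] meq_trans[OF meq2_swap_rows] by blast
  next
    case 4
    have d: "v * x - u * w = e * f\<^sub>E a b" using det(1) by (simp add: algebra_simps)
    show ?thesis using classify2_aux[OF c(4,3,2,1) d det(2) 4] meq_trans[OF meq_trans[OF meq2_swap_rows meq2_swap_cols]] by blast
  next
    case 5
    have "(s * t) $ 0 $ 0 $ 3 = 0" if "s $ 0 $ 0 $ 0 = 0" "s $ 0 $ 0 $ 1 = 0" "t $ 0 $ 0 $ 0 = 0" "t $ 0 $ 0 $ 1 = 0" for s t :: "'k T"
      using that by (simp add: fps_mult_nth numeral_3_eq_3)
    then have "(x * v - w * u) $ 0 $ 0 $ 3 = 0" using 5 c by simp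
    then show ?thesis using e0 unfolding det(1) unit_f_nth by simp
  qed
qed

end

section \<open>Presentations with three generators\<close>

lemma meq3I:
  assumes "det (mk3 u1 u2 u3 u4 u5 u6 u7 u8 u9) * s = 1" "det (mk3 v1 v2 v3 v4 v5 v6 v7 v8 v9) * t = (1 :: 'r::comm_ring_1)"
    "A \<in> carrier_mat 3 3" "B = mk3 u1 u2 u3 u4 u5 u6 u7 u8 u9 * A * mk3 v1 v2 v3 v4 v5 v6 v7 v8 v9"
  shows "meq 3 A B"
  by (rule meqI[OF assms(3) inv_mat_det inv_mat_det assms(4)]) (use assms in auto)

lemma mk3_eta:
  "A \<in> carrier_mat 3 3 \<Longrightarrow> \<exists>a b c d e f g h i. A = mk3 a b c d e f g h i"
  by (intro exI) (rule eq_mk3I; (rule refl | assumption))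

lemma meq3_rows: "meq 3 (mk3 a b c d e f g h i) (mk3 d e f g h i a b (c :: 'r::comm_ring_1))"
  by (rule meq3I[of 0 1 0 0 0 1 1 0 0 1 1 0 0 0 1 0 0 0 1 1]) (simp_all add: mk3_mult det_mk3)

lemma meq3_cols: "meq 3 (mk3 a b c d e f g h i) (mk3 b c a e f d h i (g :: 'r::comm_ring_1))"
  by (rule meq3I[of 1 0 0 0 1 0 0 0 1 1 0 0 1 1 0 0 0 1 0 1]) (simp_all add: mk3_mult det_mk3)

lemma meq3_pivot:
  assumes "i * s = (1 :: 'r::comm_ring_1)"
  shows "meq 3 (mk3 a b c d e f g h i) (mk3 (a - c * s * g) (b - c * s * h) 0 (d - f * s * g) (e - f * s * h) 0 0 0 1)"
proof (rule meq3I[of 1 0 "- c * s" 0 1 "- f * s" 0 0 s i 1 0 0 0 1 0 "- s * g" "- s * h" 1 1])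
  show "det (mk3 1 0 (- c * s) 0 1 (- f * s) 0 0 s) * i = 1" using assms by (simp add: det_mk3 mult.commute)
  have 1: "c - c * s * i = 0" "f - f * s * i = 0" "s * i = 1" "s * g - s * i * (s * g) = 0" "s * h - s * i * (s * h) = 0"
    using assms by (simp_all add: mult.assoc mult.commute[of s i])
  have 2: "c + - c * s * i = 0" "f + - f * s * i = 0" using 1 by simp_all
  show "mk3 (a - c * s * g) (b - c * s * h) 0 (d - f * s * g) (e - f * s * h) 0 0 0 1 =
    mk3 1 0 (- c * s) 0 1 (- f * s) 0 0 s * mk3 a b c d e f g h i * mk3 1 0 0 0 1 0 (- s * g) (- s * h) 1"
  proof (rule sym, rule eq_mk3I)
  qed (use 1 2 in \<open>simp_all add: mk3_mult algebra_simps\<close>)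
qed (simp_all add: det_mk3)

lemma meq2_pivot:
  assumes "d * s = (1 :: 'r::comm_ring_1)"
  shows "meq 2 (mk2 a b c d) (mk2 (a - b * s * c) 0 0 1)"
proof (rule meq2I[of 1 s "- b * s" 0 d 1 1 0 "- s * c" 1])
  have 1: "b + - b * s * d = 0" "s * d = 1" using assms by (simp_all add: mult.assoc mult.commute[of s d])
  have 2: "s * c + s * d * (- s * c) = 0" using 1 by simp
  show "mk2 (a - b * s * c) 0 0 1 = mk2 1 (- b * s) 0 s * mk2 a b c d * mk2 1 0 (- s * c) 1"
  proof (rule sym, rule eq_mk2I)
  qed (use 1 2 in \<open>simp_all add: mk2_mult algebra_simps\<close>)
qed (use assms in \<open>simp_all add: mult.commute\<close>)

section \<open>Column lattices of matrices of size at most three\<close>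

lemma submod_lat: "submod (lat A)" for A :: "'r::comm_ring_1 mat"
  unfolding submod_def
proof (intro conjI ballI allI)
  show "0 \<in> lat A" by (auto simp: lat_def intro!: exI[of _ "\<lambda>_. 0"])
next
  fix v w assume "v \<in> lat A" "w \<in> lat A"
  then obtain p q where "\<forall>i<dim_row A. v i = (\<Sum>j<dim_col A. A $$ (i, j) * p j)" "\<forall>i<dim_row A. w i = (\<Sum>j<dim_col A. A $$ (i, j) * q j)"
    unfolding lat_def by blast
  then show "v + w \<in> lat A" unfolding lat_def by (auto simp: distrib_left sum.distrib intro!: exI[of _ "\<lambda>j. p j + q j"])
next
  fix v t assume "v \<in> lat A"
  then obtain p where "\<forall>i<dim_row A. v i = (\<Sum>j<dim_col A. A $$ (i, j) * p j)" unfolding lat_def by blast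
  then show "t \<star> v \<in> lat A" unfolding lat_def
    by (auto simp: scal_apply sum_distrib_left mult.left_commute intro!: exI[of _ "\<lambda>j. t * p j"])
qed

lemma lat_mk2: "w \<in> lat (mk2 a b c d) \<longleftrightarrow> (\<exists>p q. w 0 = a * p + b * q \<and> w 1 = c * p + d * q)"
proof
  assume "w \<in> lat (mk2 a b c d)"
  then obtain u where "\<forall>i<2. w i = (\<Sum>j<2. mk2 a b c d $$ (i, j) * u j)" by (auto simp: lat_def)
  then show "\<exists>p q. w 0 = a * p + b * q \<and> w 1 = c * p + d * q"
    by (intro exI[of _ "u 0"] exI[of _ "u 1"]) (simp add: less_2_iff numeral_2_eq_2[symmetric] lessThan_atLeast0 sum_2)
next
  assume "\<exists>p q. w 0 = a * p + b * q \<and> w 1 = c * p + d * q"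
  then obtain p q where "w 0 = a * p + b * q" "w 1 = c * p + d * q" by blast
  then show "w \<in> lat (mk2 a b c d)" unfolding lat_def
    by (auto simp: less_2_iff lessThan_atLeast0 sum_2 intro!: exI[of _ "\<lambda>i. if i = 0 then p else q"])
qed

lemma lat_mk3: "w \<in> lat (mk3 a b c d e f g h i) \<longleftrightarrow>
   (\<exists>p q r. w 0 = a * p + b * q + c * r \<and> w 1 = d * p + e * q + f * r \<and> w 2 = g * p + h * q + i * r)"
proof
  assume "w \<in> lat (mk3 a b c d e f g h i)"
  then obtain u where "\<forall>k<3. w k = (\<Sum>j<3. mk3 a b c d e f g h i $$ (k, j) * u j)" by (auto simp: lat_def)
  then show "\<exists>p q r. w 0 = a * p + b * q + c * r \<and> w 1 = d * p + e * q + f * r \<and> w 2 = g * p + h * q + i * r"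
    by (intro exI[of _ "u 0"] exI[of _ "u 1"] exI[of _ "u 2"]) (simp add: less_3_iff lessThan_atLeast0 sum_3)
next
  assume "\<exists>p q r. w 0 = a * p + b * q + c * r \<and> w 1 = d * p + e * q + f * r \<and> w 2 = g * p + h * q + i * r"
  then obtain p q r where "w 0 = a * p + b * q + c * r" "w 1 = d * p + e * q + f * r" "w 2 = g * p + h * q + i * r" by blast
  then show "w \<in> lat (mk3 a b c d e f g h i)" unfolding lat_def
    by (auto simp: less_3_iff lessThan_atLeast0 sum_3 intro!: exI[of _ "\<lambda>i. if i = 0 then p else if i = 1 then q else r"])
qed

lemma lat_mk1: "w \<in> lat (mat_of_rows_list (Suc 0) [[a]]) \<longleftrightarrow> a dvd w 0"
proof
  assume "a dvd w 0"
  then obtain k where "w 0 = a * k" by (rule dvdE)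
  then show "w \<in> lat (mat_of_rows_list (Suc 0) [[a]])" by (auto simp: lat_def intro!: exI[of _ "\<lambda>_. k"])
qed (auto simp: lat_def)

text \<open>An equality of sets, not just an isomorphism: the unit entry leaves the last coordinate
  unconstrained, as are all coordinates beyond the rows of the smaller matrix.\<close>

lemma lat_split3: "lat (mk3 a b 0 c d 0 0 0 1) = lat (mk2 a b c (d :: 'r::comm_ring_1))"
  by (auto simp: lat_mk3 lat_mk2)

lemma lat_split2: "lat (mk2 a 0 0 1) = lat (mat_of_rows_list 1 [[a :: 'r::comm_ring_1]])"
  by (auto simp: lat_mk2 lat_mk1 dvd_def)

lemma mf_dim: "snd (mf a b i) \<in> carrier_mat (mf_size i) (mf_size i)"
  by (cases i) auto

context
  fixes a b :: "'k::field"
  assumes smooth: "weierstrass a b l m 1 = 0 \<Longrightarrow> 2 * m \<noteq> 0 \<or> 3 * l\<^sup>2 + a \<noteq> 0"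
begin

text \<open>The sums X k + Z l determine the pairs (k1, l1) and (k2, l2) up to multiples of (Z, -
  X). Such multiples are removed by subtracting multiples of the last row.\<close>

lemma MF5_last:
  assumes s: "V * s = 1" and B: "\<X> * k1 + \<Z> * l1 = \<Z> * (\<Y> + cst m * \<Z>)" and D: "\<X> * k2 + \<Z> * l2 = P\<^sub>E a l"
  shows "meq 3 (mk3 (\<X> - cst l * \<Z>) k1 l1 (cst m * \<Z> - \<Y>) k2 l2 0 (\<Z> * V) (- (\<X> * V))) (snd (mf a b (MF5 l m)))"
proof -
  have koszul: "\<exists>k. p = \<Z> * k \<and> q = - (\<X> * k)" if "\<X> * p + \<Z> * q = 0" for p q :: "'k T"
  proof -
    have "\<X> * p = \<Z> * (- q)" using that by (simp add: eq_neg_iff_add_eq_0)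
    then have "\<Z> dvd \<X> * p" by (metis dvd_triv_left)
    then have "\<Z> dvd p" by (rule XYZ.zx)
    then obtain k where k: "p = \<Z> * k" by (rule dvdE)
    then have "\<Z> * (\<X> * k + q) = 0" using that by (simp add: algebra_simps)
    then have "\<X> * k + q = 0" using XYZ.z0 mult_eq_0_iff by blast
    then show ?thesis using k by (metis minus_unique)
  qed
  have "\<X> * k1 + \<Z> * (l1 - (\<Y> + cst m * \<Z>)) = 0" using B by (simp add: algebra_simps)
  then obtain c1 where c1: "k1 = \<Z> * c1" "l1 - (\<Y> + cst m * \<Z>) = - (\<X> * c1)" using koszul by blast
  have "\<X> * (k2 + \<X> + cst l * \<Z>) + \<Z> * (l2 + (cst a + cst l ^ 2) * \<Z>) = 0"
    using D by (simp add: P\<^sub>E_def algebra_simps power2_eq_square)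
  then obtain c2 where c2: "k2 + \<X> + cst l * \<Z> = \<Z> * c2" "l2 + (cst a + cst l ^ 2) * \<Z> = - (\<X> * c2)" using koszul by blast
  have kl: "k1 = \<Z> * c1" "l1 = \<Y> + cst m * \<Z> - \<X> * c1" "k2 = \<Z> * c2 - \<X> - cst l * \<Z>"
    "l2 = - (\<X> * c2) - (cst a + cst l ^ 2) * \<Z>"
  proof -
    show "k1 = \<Z> * c1" by (rule c1)
    show "l1 = \<Y> + cst m * \<Z> - \<X> * c1" using diff_eq_eq[THEN iffD1, OF c1(2)] by simp
    show "k2 = \<Z> * c2 - \<X> - cst l * \<Z>" using c2(1) by (simp add: algebra_simps)
    show "l2 = - (\<X> * c2) - (cst a + cst l ^ 2) * \<Z>" by (rule eq_diff_eq[THEN iffD2, OF c2(2)])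
  qed
  show ?thesis
  proof (rule meq3I[of 1 0 "- (c1 * s)" 0 1 "- (c2 * s)" 0 0 "- s" "- V" 1 0 0 0 "- 1" 0 0 0 "- 1" 1])
    show "det (mk3 1 0 (- (c1 * s)) 0 1 (- (c2 * s)) 0 0 (- s)) * - V = 1" using s by (simp add: det_mk3 mult.commute)
    show "snd (mf a b (MF5 l m)) = mk3 1 0 (- (c1 * s)) 0 1 (- (c2 * s)) 0 0 (- s) *
      mk3 (\<X> - cst l * \<Z>) k1 l1 (cst m * \<Z> - \<Y>) k2 l2 0 (\<Z> * V) (- (\<X> * V)) * mk3 1 0 0 0 (- 1) 0 0 0 (- 1)"
      unfolding mk3_mult mf.simps snd_conv
      by (rule sym, rule eq_mk3I) (simp_all add: kl s algebra_simps)
  qed (simp_all add: det_mk3)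
qed

text \<open>The second column contributes only terms of order two, so all linear parts in a row are
  multiples of one linear form.\<close>

lemma linear_parts:
  assumes "p1 $ 0 $ 0 $ 0 = 0" "p2 $ 0 $ 0 $ 0 = 0" "max2 q1" "max2 q2"
    and \<rho>_def: "\<rho> = u * p1 + u' * p2"
  shows "(\<rho> * v + (u * q1 + u' * q2) * v') $ 0 $ 0 $ 1 = \<rho> $ 0 $ 0 $ 1 * v $ 0 $ 0 $ 0"
    "(\<rho> * v + (u * q1 + u' * q2) * v') $ 0 $ 1 $ 0 = \<rho> $ 0 $ 1 $ 0 * v $ 0 $ 0 $ 0"
    "(\<rho> * v + (u * q1 + u' * q2) * v') $ 1 $ 0 $ 0 = \<rho> $ 1 $ 0 $ 0 * v $ 0 $ 0 $ 0"
  using assms(1-4) by (simp_all add: \<rho>_def max2_def fps_mult_nth_1)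

text \<open>Contracting the last two columns with (X, Z), which annihilates (Z, - X), gives a matrix
  of size two with the same determinant up to sign. Its second column lies both in (X, Z) and in the
  square of the maximal ideal, which leaves only \<open>MF1\<close>. The equivalence to
  \<open>MF1\<close> is then lifted back to size three.\<close>

lemma classify3_final:
  assumes c: "p1 $ 0 $ 0 $ 0 = 0" "p2 $ 0 $ 0 $ 0 = 0" "q1 $ 0 $ 0 $ 0 = 0" "q2 $ 0 $ 0 $ 0 = 0" "t1 $ 0 $ 0 $ 0 = 0" "t2 $ 0 $ 0 $ 0 = 0"
    and det: "det (mk3 p1 q1 t1 p2 q2 t2 0 \<Z> (- \<X>)) = e * f\<^sub>E a b" "e * s = 1"
  shows "\<exists>l m. weierstrass a b l m 1 = 0 \<and> meq 3 (mk3 p1 q1 t1 p2 q2 t2 0 \<Z> (- \<X>)) (snd (mf a b (MF5 l m)))"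
proof -
  define c1 c2 where "c1 = \<X> * q1 + \<Z> * t1" and "c2 = \<X> * q2 + \<Z> * t2"
  have mc: "max2 c1" "max2 c2" unfolding c1_def c2_def by (intro max2_add max2_mult; simp add: c)+
  then have c0: "c1 $ 0 $ 0 $ 0 = 0" "c2 $ 0 $ 0 $ 0 = 0" by (simp_all add: max2_def)
  have "p1 * c2 - c1 * p2 = (- e) * f\<^sub>E a b" using det(1) by (simp add: det_mk3 c1_def c2_def algebra_simps)
  moreover have "(- e) * (- s) = 1" using det(2) by simp
  ultimately obtain i where i: "row_label a b i \<or> col_label a b i" "meq 2 (mk2 p1 c1 p2 c2) (snd (mf a b i))"
    using classify2[OF smooth c(1) c0(1) c(2) c0(2)] by blast
  obtain U V where UV: "inv_mat 2 U" "inv_mat 2 V" "snd (mf a b i) = U * mk2 p1 c1 p2 c2 * V" using i(2) by (auto simp: meq_def)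
  define u1 u2 u3 u4 where "u1 = U $$ (0, 0)" and "u2 = U $$ (0, Suc 0)" and "u3 = U $$ (Suc 0, 0)" and "u4 = U $$ (Suc 0, Suc 0)"
  define v1 v2 v3 v4 where "v1 = V $$ (0, 0)" and "v2 = V $$ (0, Suc 0)" and "v3 = V $$ (Suc 0, 0)" and "v4 = V $$ (Suc 0, Suc 0)"
  have U: "U = mk2 u1 u2 u3 u4" by (rule eq_mk2I) (use UV(1) in \<open>simp_all add: u1_def u2_def u3_def u4_def inv_mat_def\<close>)
  have V: "V = mk2 v1 v2 v3 v4" by (rule eq_mk2I) (use UV(2) in \<open>simp_all add: v1_def v2_def v3_def v4_def inv_mat_def\<close>)
  define \<rho>1 \<rho>2 where "\<rho>1 = u1 * p1 + u2 * p2" and "\<rho>2 = u3 * p1 + u4 * p2"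
  define A B C D where "A = \<rho>1 * v1 + (u1 * c1 + u2 * c2) * v3" and "B = \<rho>1 * v2 + (u1 * c1 + u2 * c2) * v4"
    and "C = \<rho>2 * v1 + (u3 * c1 + u4 * c2) * v3" and "D = \<rho>2 * v2 + (u3 * c1 + u4 * c2) * v4"
  have snd: "snd (mf a b i) = mk2 A B C D" unfolding UV(3) U V mk2_mult A_def B_def C_def D_def \<rho>1_def \<rho>2_def ..
  note AB = linear_parts[OF c(1,2) mc \<rho>1_def]
  have A: "A $ 0 $ 0 $ 1 = \<rho>1 $ 0 $ 0 $ 1 * v1 $ 0 $ 0 $ 0" "A $ 0 $ 1 $ 0 = \<rho>1 $ 0 $ 1 $ 0 * v1 $ 0 $ 0 $ 0" "A $ 1 $ 0 $ 0 = \<rho>1 $ 1 $ 0 $ 0 * v1 $ 0 $ 0 $ 0"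
    unfolding A_def by (rule AB)+
  have Bl: "B $ 0 $ 0 $ 1 = \<rho>1 $ 0 $ 0 $ 1 * v2 $ 0 $ 0 $ 0" "B $ 0 $ 1 $ 0 = \<rho>1 $ 0 $ 1 $ 0 * v2 $ 0 $ 0 $ 0" "B $ 1 $ 0 $ 0 = \<rho>1 $ 1 $ 0 $ 0 * v2 $ 0 $ 0 $ 0"
    unfolding B_def by (rule AB)+
  have Rc: "res_Y c1 = 0" "res_Y c2 = 0" by (simp_all add: c1_def c2_def res_Y.hom_add res_Y.hom_mult)
  have R: "res_Y A = res_Y \<rho>1 * res_Y v1" "res_Y B = res_Y \<rho>1 * res_Y v2" "res_Y C = res_Y \<rho>2 * res_Y v1" "res_Y D = res_Y \<rho>2 * res_Y v2"
    by (simp_all add: A_def B_def C_def D_def res_Y.hom_add res_Y.hom_mult Rc)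
  have c0_res: "t $ 0 $ 0 $ 0 = res_Y t $ 0" for t :: "'k T" by (simp add: res_Y_def)
  have ind: "A $ 0 $ 0 $ 1 * B $ 0 $ 1 $ 0 = A $ 0 $ 1 $ 0 * B $ 0 $ 0 $ 1" "A $ 0 $ 0 $ 1 * B $ 1 $ 0 $ 0 = A $ 1 $ 0 $ 0 * B $ 0 $ 0 $ 1"
    unfolding A Bl by (simp_all add: ac_simps)
  have mk2_eq: "A = a' \<and> B = b' \<and> C = c' \<and> D = d'" if "snd (mf a b i) = mk2 a' b' c' d'" for a' b' c' d'
    using that unfolding snd by (metis mk2_index)
  \<comment> \<open>\<open>MF3\<close> and \<open>MF4\<close> have independent linear forms in their
    first row, against \<open>ind\<close>. For \<open>MF2\<close> the entry with Y^2 forces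
    \<open>v1\<close> into (X, Z), and then the entry X could have no linear part.\<close>
  have "\<exists>l m. i = MF1 l m"
  proof -
    have "i \<noteq> MF4"
    proof
      assume "i = MF4"
      then have "A = - \<Z>" "B = \<X>" using mk2_eq by auto
      then show False using ind(2) by (simp add: \<Z>_def)
    qed
    moreover have "i \<noteq> MF3 l m" for l m
    proof
      assume "i = MF3 l m"
      then have "A = \<X> - cst l * \<Z>" "B = - \<Y> - cst m * \<Z>" using mk2_eq by auto
      then show False using ind(1) by (simp add: \<Z>_def)
    qed
    moreover have "i \<noteq> MF2"
    proof
      assume "i = MF2"
      then have AB': "A = \<X>" "B = cst b * \<Z>\<^sup>2 - \<Y>\<^sup>2" using mk2_eq by auto
      have "res_Y B \<noteq> 0" unfolding AB' by (simp add: res_Y.hom_minus res_Y.hom_mult res_Y.hom_power)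
      moreover have "res_Y A = 0" unfolding AB' by simp
      ultimately have "res_Y v1 = 0" using R(1,2) by auto
      then have "v1 $ 0 $ 0 $ 0 = 0" by (simp add: c0_res)
      then show False using A(1) unfolding AB' by simp
    qed
    ultimately show ?thesis by (cases i) (use i(1) in \<open>auto simp: row_label_def[OF smooth] col_label_def[OF smooth] mf_labels_iff\<close>)
  qed
  then obtain l m where lm: "i = MF1 l m" by blast
  then have w: "weierstrass a b l m 1 = 0"
    using i(1) by (auto simp: row_label_def[OF smooth] col_label_def[OF smooth] mf_labels_iff)
  have ABCD: "A = \<X> - cst l * \<Z>" "B = \<Z> * (\<Y> + cst m * \<Z>)" "C = cst m * \<Z> - \<Y>" "D = P\<^sub>E a l" using mk2_eq lm by auto
  have "res_Y C \<noteq> 0" unfolding ABCD by (simp add: res_Y.hom_minus res_Y.hom_mult)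
  moreover have "res_Y D = 0" unfolding ABCD by (simp add: P\<^sub>E_def res_Y.hom_minus res_Y.hom_mult res_Y.hom_power res_Y.hom_uminus)
  \<comment> \<open>The entry \<open>C\<close> is nonzero modulo (X, Z) while \<open>D\<close> is
    zero, so \<open>v2\<close> lies in (X, Z). Writing it as X x1 + Z z1 makes the column operation
    liftable to three columns.\<close>
  ultimately have rv2: "res_Y v2 = 0" using R(3,4) by auto
  then obtain x1 z1 where v2: "v2 = \<X> * x1 + \<Z> * z1" using res_Y_0D by blast
  obtain dv where dv: "(v1 * v4 - v2 * v3) * dv = 1" using inv_mat_det_unit[OF UV(2)] by (auto simp: V det_mk2)
  obtain du where du: "(u1 * u4 - u2 * u3) * du = 1" using inv_mat_det_unit[OF UV(1)] by (auto simp: U det_mk2)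
  have "v4 $ 0 $ 0 $ 0 \<noteq> 0"
  proof
    assume "v4 $ 0 $ 0 $ 0 = 0"
    then have "((v1 * v4 - v2 * v3) * dv) $ 0 $ 0 $ 0 = 0" using rv2 by (simp add: c0_res[of v2])
    then show False unfolding dv by simp
  qed
  then obtain s4 where s4: "v4 * s4 = 1" using T_unit by blast
  define k1 k2 l1 l2 where "k1 = u1 * (p1 * x1 + q1 * v4) + u2 * (p2 * x1 + q2 * v4)"
    and "k2 = u3 * (p1 * x1 + q1 * v4) + u4 * (p2 * x1 + q2 * v4)"
    and "l1 = u1 * (p1 * z1 + t1 * v4) + u2 * (p2 * z1 + t2 * v4)"
    and "l2 = u3 * (p1 * z1 + t1 * v4) + u4 * (p2 * z1 + t2 * v4)"
  have kB: "\<X> * k1 + \<Z> * l1 = \<Z> * (\<Y> + cst m * \<Z>)" unfolding ABCD(2)[symmetric]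
    by (simp add: B_def k1_def l1_def \<rho>1_def c1_def c2_def v2 algebra_simps)
  have kD: "\<X> * k2 + \<Z> * l2 = P\<^sub>E a l" unfolding ABCD(4)[symmetric]
    by (simp add: D_def k2_def l2_def \<rho>2_def c1_def c2_def v2 algebra_simps)
  have "meq 3 (mk3 p1 q1 t1 p2 q2 t2 0 \<Z> (- \<X>)) (mk3 A k1 l1 C k2 l2 0 (\<Z> * v4) (- (\<X> * v4)))"
  proof (rule meq3I[of u1 u2 0 u3 u4 0 0 0 1 du v1 x1 z1 "v3 * \<X>" v4 0 "v3 * \<Z>" 0 v4 "s4 * dv"])
    show "det (mk3 u1 u2 0 u3 u4 0 0 0 1) * du = 1" using du by (simp add: det_mk3 mult.commute)
    \<comment> \<open>The lifted column operation has determinant \<open>v4\<close> times that of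
      \<open>V\<close>, and \<open>v4\<close> is a unit because \<open>v2\<close> is not.\<close>
    have "det (mk3 v1 x1 z1 (v3 * \<X>) v4 0 (v3 * \<Z>) 0 v4) * (s4 * dv) = (v4 * s4) * ((v1 * v4 - v2 * v3) * dv)"
      by (simp add: det_mk3 v2 algebra_simps)
    then show "det (mk3 v1 x1 z1 (v3 * \<X>) v4 0 (v3 * \<Z>) 0 v4) * (s4 * dv) = 1" by (simp only: s4 dv mult_1)
    show "mk3 A k1 l1 C k2 l2 0 (\<Z> * v4) (- (\<X> * v4)) = mk3 u1 u2 0 u3 u4 0 0 0 1 * mk3 p1 q1 t1 p2 q2 t2 0 \<Z> (- \<X>) *
      mk3 v1 x1 z1 (v3 * \<X>) v4 0 (v3 * \<Z>) 0 v4"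
      unfolding mk3_mult
      by (rule sym, rule eq_mk3I) (simp_all add: A_def C_def k1_def k2_def l1_def l2_def \<rho>1_def \<rho>2_def c1_def c2_def algebra_simps)
  qed simp
  from meq_trans[OF this, unfolded ABCD(1,3), OF MF5_last[OF s4 kB kD]] show ?thesis using w by blast
qed

text \<open>The last row is X g + Z h, and its annihilator contains the cross product of g and h.
  With a unit first entry, the cross product extends to an invertible column operation that turns
  the last row into (0, Z, - X).\<close>

lemma classify3_minor:
  assumes c: "a1 $ 0 $ 0 $ 0 = 0" "a2 $ 0 $ 0 $ 0 = 0" "a3 $ 0 $ 0 $ 0 = 0" "b1 $ 0 $ 0 $ 0 = 0" "b2 $ 0 $ 0 $ 0 = 0" "b3 $ 0 $ 0 $ 0 = 0"
    and r: "r1 = \<X> * g1 + \<Z> * h1" "r2 = \<X> * g2 + \<Z> * h2" "r3 = \<X> * g3 + \<Z> * h3"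
    and n: "(g2 * h3 - g3 * h2) $ 0 $ 0 $ 0 \<noteq> 0"
    and det: "det (mk3 a1 a2 a3 b1 b2 b3 r1 r2 r3) = e * f\<^sub>E a b" "e * s = 1"
  shows "\<exists>l m. weierstrass a b l m 1 = 0 \<and> meq 3 (mk3 a1 a2 a3 b1 b2 b3 r1 r2 r3) (snd (mf a b (MF5 l m)))"
proof -
  define n1 where "n1 = g2 * h3 - g3 * h2"
  define n2 n3 where "n2 = g3 * h1 - g1 * h3" and "n3 = g1 * h2 - g2 * h1"
  obtain d where d: "n1 * d = 1" using T_unit n unfolding n1_def by blast
  define p1 q1 t1 p2 q2 t2 where "p1 = a1 * n1 + a2 * n2 + a3 * n3" and "q1 = a2 * (- g3 * d) + a3 * (g2 * d)" and "t1 = a2 * (- h3 * d) + a3 * (h2 * d)"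
    and "p2 = b1 * n1 + b2 * n2 + b3 * n3" and "q2 = b2 * (- g3 * d) + b3 * (g2 * d)" and "t2 = b2 * (- h3 * d) + b3 * (h2 * d)"
  have detV: "det (mk3 n1 0 0 n2 (- g3 * d) (- h3 * d) n3 (g2 * d) (h2 * d)) = 1"
  proof -
    have "det (mk3 n1 0 0 n2 (- g3 * d) (- h3 * d) n3 (g2 * d) (h2 * d)) = (n1 * d) * (n1 * d)"
      by (simp add: det_mk3 n1_def algebra_simps)
    then show ?thesis by (simp add: d)
  qed
  have m: "meq 3 (mk3 a1 a2 a3 b1 b2 b3 r1 r2 r3) (mk3 p1 q1 t1 p2 q2 t2 0 \<Z> (- \<X>))"
  proof (rule meq3I[of 1 0 0 0 1 0 0 0 1 1 n1 0 0 n2 "- g3 * d" "- h3 * d" n3 "g2 * d" "h2 * d" 1])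
    have 1: "r1 * n1 + r2 * n2 + r3 * n3 = 0" by (simp add: r n1_def n2_def n3_def algebra_simps)
    have "r2 * (- g3 * d) + r3 * (g2 * d) = \<Z> * (n1 * d)" by (simp add: r n1_def algebra_simps)
    then have 2: "r2 * (- g3 * d) + r3 * (g2 * d) = \<Z>" by (simp only: d mult_1_right)
    have "r2 * (- h3 * d) + r3 * (h2 * d) = - \<X> * (n1 * d)" by (simp add: r n1_def algebra_simps)
    then have 3: "r2 * (- h3 * d) + r3 * (h2 * d) = - \<X>" by (simp only: d mult_1_right)
    have I: "mk3 1 0 0 0 1 0 0 0 1 * mk3 a1 a2 a3 b1 b2 b3 r1 r2 r3 = mk3 a1 a2 a3 b1 b2 b3 r1 r2 r3" by (simp add: mk3_mult)
    show "mk3 p1 q1 t1 p2 q2 t2 0 \<Z> (- \<X>) = mk3 1 0 0 0 1 0 0 0 1 * mk3 a1 a2 a3 b1 b2 b3 r1 r2 r3 *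
      mk3 n1 0 0 n2 (- g3 * d) (- h3 * d) n3 (g2 * d) (h2 * d)"
      unfolding I unfolding mk3_mult 1 mult_zero_right add_0_left 2 3 p1_def p2_def q1_def q2_def t1_def t2_def ..
  qed (simp_all only: detV mult_1_right, simp_all add: det_mk3)
  obtain e' s' where e': "e' * s' = 1" "det (mk3 p1 q1 t1 p2 q2 t2 0 \<Z> (- \<X>)) = e' * (e * f\<^sub>E a b)"
    using meq_det[OF m] det(1) by metis
  have "\<exists>l m. weierstrass a b l m 1 = 0 \<and> meq 3 (mk3 p1 q1 t1 p2 q2 t2 0 \<Z> (- \<X>)) (snd (mf a b (MF5 l m)))"
    by (rule classify3_final[of _ _ _ _ _ _ "e' * e" "s' * s"])
      (use c e'(2) unit_mult[OF e'(1) det(2)] in \<open>simp_all add: p1_def p2_def q1_def q2_def t1_def t2_def mult.assoc\<close>)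
  then show ?thesis using meq_trans[OF m] by blast
qed

text \<open>Some minor of the pair g, h is a unit. Otherwise the constant vectors G and H would be
  proportional; since the Y^2-parts of the cofactors pair to zero with G (no X Y^2 in f) and to a
  nonzero value with H (Y^2 Z in f), G would vanish. But the monomial X^3 needs a nonzero G.\<close>

lemma classify3_row:
  assumes c: "a1 $ 0 $ 0 $ 0 = 0" "a2 $ 0 $ 0 $ 0 = 0" "a3 $ 0 $ 0 $ 0 = 0" "b1 $ 0 $ 0 $ 0 = 0" "b2 $ 0 $ 0 $ 0 = 0" "b3 $ 0 $ 0 $ 0 = 0"
    and r: "r1 = \<X> * g1 + \<Z> * h1" "r2 = \<X> * g2 + \<Z> * h2" "r3 = \<X> * g3 + \<Z> * h3"
    and det: "det (mk3 a1 a2 a3 b1 b2 b3 r1 r2 r3) = e * f\<^sub>E a b" "e * s = 1"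
  shows "\<exists>l m. weierstrass a b l m 1 = 0 \<and> meq 3 (mk3 a1 a2 a3 b1 b2 b3 r1 r2 r3) (snd (mf a b (MF5 l m)))"
proof -
  define C1 C2 C3 where "C1 = a2 * b3 - a3 * b2" and "C2 = a3 * b1 - a1 * b3" and "C3 = a1 * b2 - a2 * b1"
  have mC: "max2 C1" "max2 C2" "max2 C3" unfolding C1_def C2_def C3_def by (intro max2_diff max2_mult c)+
  have eq: "r1 * C1 + r2 * C2 + r3 * C3 = e * f\<^sub>E a b" using det(1) by (simp add: det_mk3 C1_def C2_def C3_def algebra_simps)
  have e0: "e $ 0 $ 0 $ 0 \<noteq> 0"
  proof
    assume "e $ 0 $ 0 $ 0 = 0"
    then have "(e * s) $ 0 $ 0 $ 0 = 0" by simp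
    then show False unfolding det(2) by simp
  qed
  have r0: "r1 $ 0 $ 0 $ 0 = 0" "r2 $ 0 $ 0 $ 0 = 0" "r3 $ 0 $ 0 $ 0 = 0" by (simp_all add: r)
  have rl: "r1 $ 0 $ 0 $ 1 = g1 $ 0 $ 0 $ 0" "r2 $ 0 $ 0 $ 1 = g2 $ 0 $ 0 $ 0" "r3 $ 0 $ 0 $ 1 = g3 $ 0 $ 0 $ 0"
    "r1 $ 0 $ 1 $ 0 = 0" "r2 $ 0 $ 1 $ 0 = 0" "r3 $ 0 $ 1 $ 0 = 0"
    "r1 $ 1 $ 0 $ 0 = h1 $ 0 $ 0 $ 0" "r2 $ 1 $ 0 $ 0 = h2 $ 0 $ 0 $ 0" "r3 $ 1 $ 0 $ 0 = h3 $ 0 $ 0 $ 0"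
    by (simp_all add: r \<Z>_def fps_mult_nth_1)
  have co: "(r1 * C1 + r2 * C2 + r3 * C3) $ k $ j $ i = (e * f\<^sub>E a b) $ k $ j $ i" for k j i by (simp only: eq)
  note mq = mult_cubic[OF r0(1) mC(1)] mult_cubic[OF r0(2) mC(2)] mult_cubic[OF r0(3) mC(3)] unit_f_nth rl
  define G1 G2 G3 H1 H2 H3 where "G1 = g1 $ 0 $ 0 $ 0" and "G2 = g2 $ 0 $ 0 $ 0" and "G3 = g3 $ 0 $ 0 $ 0"
    and "H1 = h1 $ 0 $ 0 $ 0" and "H2 = h2 $ 0 $ 0 $ 0" and "H3 = h3 $ 0 $ 0 $ 0"
  note GH = G1_def[symmetric] G2_def[symmetric] G3_def[symmetric] H1_def[symmetric] H2_def[symmetric] H3_def[symmetric]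
  have XXX: "G1 * C1 $ 0 $ 0 $ 2 + G2 * C2 $ 0 $ 0 $ 2 + G3 * C3 $ 0 $ 0 $ 2 = - (e $ 0 $ 0 $ 0)"
    using co[of 0 0 3] by (simp only: fps_add_nth mq GH)
  have XYY: "G1 * C1 $ 0 $ 2 $ 0 + G2 * C2 $ 0 $ 2 $ 0 + G3 * C3 $ 0 $ 2 $ 0 = 0"
    using co[of 0 2 1] by (simp only: fps_add_nth mq GH mult_zero_left add_0_right)
  have YYZ: "H1 * C1 $ 0 $ 2 $ 0 + H2 * C2 $ 0 $ 2 $ 0 + H3 * C3 $ 0 $ 2 $ 0 = e $ 0 $ 0 $ 0"
    using co[of 1 2 0] by (simp only: fps_add_nth mq GH mult_zero_left add_0_right)
  have "G2 * H3 - G3 * H2 \<noteq> 0 \<or> G3 * H1 - G1 * H3 \<noteq> 0 \<or> G1 * H2 - G2 * H1 \<noteq> 0"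
  proof (rule ccontr)
    assume "\<not> ?thesis"
    then have m: "G2 * H3 = G3 * H2" "G3 * H1 = G1 * H3" "G1 * H2 = G2 * H1" by auto
    have *: "g * (H1 * x + H2 * y + H3 * z) = h * (G1 * x + G2 * y + G3 * z)"
      if "g * H1 = h * G1" "g * H2 = h * G2" "g * H3 = h * G3" for g h x y z
    proof -
      have "g * (H1 * x + H2 * y + H3 * z) = (g * H1) * x + (g * H2) * y + (g * H3) * z" by (simp add: algebra_simps)
      then show ?thesis unfolding that by (simp add: algebra_simps)
    qed
    have "G1 * e $ 0 $ 0 $ 0 = 0" "G2 * e $ 0 $ 0 $ 0 = 0" "G3 * e $ 0 $ 0 $ 0 = 0"
      unfolding YYZ[symmetric]
      by (subst *[of _ H1] *[of _ H2] *[of _ H3]; (simp only: XYY mult_zero_right)?; (simp add: m mult.commute)?)+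
    then have "G1 = 0" "G2 = 0" "G3 = 0" using e0 by auto
    then show False using XXX e0 by simp
  qed
  then consider "(g2 * h3 - g3 * h2) $ 0 $ 0 $ 0 \<noteq> 0" | "(g3 * h1 - g1 * h3) $ 0 $ 0 $ 0 \<noteq> 0" | "(g1 * h2 - g2 * h1) $ 0 $ 0 $ 0 \<noteq> 0"
    unfolding G1_def G2_def G3_def H1_def H2_def H3_def by auto
  then show ?thesis
  proof cases
    case 1 then show ?thesis by (rule classify3_minor[OF c r _ det])
  next
    case 2
    have d: "det (mk3 a2 a3 a1 b2 b3 b1 r2 r3 r1) = e * f\<^sub>E a b" using det(1) by (simp add: det_mk3 algebra_simps)
    from classify3_minor[OF c(2,3,1,5,6,4) r(2,3,1) 2 d det(2)] show ?thesis using meq_trans[OF meq3_cols] by blast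
  next
    case 3
    have d: "det (mk3 a3 a1 a2 b3 b1 b2 r3 r1 r2) = e * f\<^sub>E a b" using det(1) by (simp add: det_mk3 algebra_simps)
    from classify3_minor[OF c(3,1,2,6,4,5) r(3,1,2) 3 d det(2)] show ?thesis
      using meq_trans[OF meq_trans[OF meq3_cols meq3_cols]] by blast
  qed
qed

text \<open>A combination of the rows with a unit coefficient at the third replaces the third row
  and lies in (X, Z).\<close>

lemma classify3_unit_row:
  assumes c: "a1 $ 0 $ 0 $ 0 = 0" "a2 $ 0 $ 0 $ 0 = 0" "a3 $ 0 $ 0 $ 0 = 0" "b1 $ 0 $ 0 $ 0 = 0" "b2 $ 0 $ 0 $ 0 = 0" "b3 $ 0 $ 0 $ 0 = 0"
    and y: "y2 $ 0 $ 0 $ 0 \<noteq> 0"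
    and r: "res_Y (a1 * y0 + b1 * y1 + c1 * y2) = 0" "res_Y (a2 * y0 + b2 * y1 + c2 * y2) = 0" "res_Y (a3 * y0 + b3 * y1 + c3 * y2) = 0"
    and det: "det (mk3 a1 a2 a3 b1 b2 b3 c1 c2 c3) = e * f\<^sub>E a b" "e * s = 1"
  shows "\<exists>l m. weierstrass a b l m 1 = 0 \<and> meq 3 (mk3 a1 a2 a3 b1 b2 b3 c1 c2 c3) (snd (mf a b (MF5 l m)))"
proof -
  obtain t where t: "y2 * t = 1" using T_unit y by blast
  define r1 r2 r3 where "r1 = a1 * y0 + b1 * y1 + c1 * y2" and "r2 = a2 * y0 + b2 * y1 + c2 * y2" and "r3 = a3 * y0 + b3 * y1 + c3 * y2"
  obtain g1 h1 g2 h2 g3 h3 where gh: "r1 = \<X> * g1 + \<Z> * h1" "r2 = \<X> * g2 + \<Z> * h2" "r3 = \<X> * g3 + \<Z> * h3"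
    using res_Y_0D r unfolding r1_def r2_def r3_def by metis
  have m: "meq 3 (mk3 a1 a2 a3 b1 b2 b3 c1 c2 c3) (mk3 a1 a2 a3 b1 b2 b3 r1 r2 r3)"
    by (rule meq3I[of 1 0 0 0 1 0 y0 y1 y2 t 1 0 0 0 1 0 0 0 1 1])
      (simp_all add: mk3_mult det_mk3 t r1_def r2_def r3_def mult.commute[of y0] mult.commute[of y1] mult.commute[of _ y2])
  have "det (mk3 a1 a2 a3 b1 b2 b3 r1 r2 r3) = y2 * det (mk3 a1 a2 a3 b1 b2 b3 c1 c2 c3)"
    by (simp add: det_mk3 r1_def r2_def r3_def algebra_simps)
  then have d: "det (mk3 a1 a2 a3 b1 b2 b3 r1 r2 r3) = (y2 * e) * f\<^sub>E a b" unfolding det(1) by (simp add: mult.assoc)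
  from classify3_row[OF c gh d unit_mult[OF t det(2)]] show ?thesis using meq_trans[OF m] by blast
qed

text \<open>Modulo (X, Z) the determinant vanishes, so the rows are dependent over K[[Y]]. Dividing
  the relation by the common power of Y makes one coefficient a unit, which is brought to the third
  row by a cyclic shift.\<close>

lemma classify3_max:
  assumes c: "a1 $ 0 $ 0 $ 0 = 0" "a2 $ 0 $ 0 $ 0 = 0" "a3 $ 0 $ 0 $ 0 = 0" "b1 $ 0 $ 0 $ 0 = 0" "b2 $ 0 $ 0 $ 0 = 0" "b3 $ 0 $ 0 $ 0 = 0"
      "c1 $ 0 $ 0 $ 0 = 0" "c2 $ 0 $ 0 $ 0 = 0" "c3 $ 0 $ 0 $ 0 = 0"
    and det: "det (mk3 a1 a2 a3 b1 b2 b3 c1 c2 c3) = e * f\<^sub>E a b" "e * s = 1"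
  shows "\<exists>l m. weierstrass a b l m 1 = 0 \<and> meq 3 (mk3 a1 a2 a3 b1 b2 b3 c1 c2 c3) (snd (mf a b (MF5 l m)))"
proof -
  \<comment> \<open>The matrix is transposed so that a kernel vector is a relation between the
    rows.\<close>
  define M where "M = mk3 (res_Y a1) (res_Y b1) (res_Y c1) (res_Y a2) (res_Y b2) (res_Y c2) (res_Y a3) (res_Y b3) (res_Y c3)"
  have M: "M \<in> carrier_mat 3 3" by (simp add: M_def)
  have "det M = res_Y (det (mk3 a1 a2 a3 b1 b2 b3 c1 c2 c3))"
    by (simp add: M_def det_mk3 res_Y.hom_add res_Y.hom_minus res_Y.hom_mult algebra_simps)
  also have "\<dots> = 0" unfolding det by (simp add: res_Y.hom_mult)
  finally obtain v where v: "v \<in> carrier_vec 3" "v \<noteq> 0\<^sub>v 3" "M *\<^sub>v v = 0\<^sub>v 3"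
    using det_0_iff_vec_prod_zero[OF M] by blast
  have "\<exists>i\<in>{..<3}. vec_index v i \<noteq> 0"
  proof (rule ccontr)
    assume "\<not> ?thesis"
    then have "v = 0\<^sub>v 3" using v(1) by (intro eq_vecI) auto
    then show False using v(2) by simp
  qed
  from common_order[OF this] obtain n w where w: "\<And>i. i < 3 \<Longrightarrow> vec_index v i = fps_X ^ n * w i" "\<exists>i\<in>{..<3}. w i $ 0 \<noteq> 0" by auto
  have z: "M $$ (j, 0) * w 0 + M $$ (j, Suc 0) * w 1 + M $$ (j, 2) * w 2 = 0" if j: "j < 3" for j
  proof -
    have "0 = vec_index (M *\<^sub>v v) j" using v(3) j by simp
    also have "\<dots> = M $$ (j, 0) * vec_index v 0 + M $$ (j, Suc 0) * vec_index v (Suc 0) + M $$ (j, 2) * vec_index v 2"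
      using M v(1) j by (simp add: scalar_prod_def sum_3)
    also have "\<dots> = fps_X ^ n * (M $$ (j, 0) * w 0 + M $$ (j, Suc 0) * w 1 + M $$ (j, 2) * w 2)"
      using w(1)[of 0] w(1)[of 1] w(1)[of 2] by (simp add: algebra_simps)
    finally show ?thesis by simp
  qed
  define y0 y1 y2 where "y0 = emb_Y (w 0)" and "y1 = emb_Y (w 1)" and "y2 = emb_Y (w 2)"
  have c0: "emb_Y p $ 0 $ 0 $ 0 = p $ 0" for p :: "'k fps" by (simp add: emb_Y_def)
  have R: "res_Y (a1 * y0 + b1 * y1 + c1 * y2) = 0" "res_Y (a2 * y0 + b2 * y1 + c2 * y2) = 0" "res_Y (a3 * y0 + b3 * y1 + c3 * y2) = 0"
    using z[of 0] z[of 1] z[of 2] by (simp_all add: M_def y0_def y1_def y2_def res_Y.hom_add res_Y.hom_mult)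
  consider "y2 $ 0 $ 0 $ 0 \<noteq> 0" | "y0 $ 0 $ 0 $ 0 \<noteq> 0" | "y1 $ 0 $ 0 $ 0 \<noteq> 0"
    using w(2) by (auto simp: less_3_iff y0_def y1_def y2_def c0)
  then show ?thesis
  proof cases
    case 1 then show ?thesis by (rule classify3_unit_row[OF c(1-6) _ R det])
  next
    case 2
    have R': "res_Y (b1 * y1 + c1 * y2 + a1 * y0) = 0" "res_Y (b2 * y1 + c2 * y2 + a2 * y0) = 0" "res_Y (b3 * y1 + c3 * y2 + a3 * y0) = 0"
      using R by (simp_all add: algebra_simps)
    have d: "det (mk3 b1 b2 b3 c1 c2 c3 a1 a2 a3) = e * f\<^sub>E a b" using det(1) by (simp add: det_mk3 algebra_simps)
    from classify3_unit_row[OF c(4-9) 2 R' d det(2)] show ?thesis using meq_trans[OF meq3_rows] by blast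
  next
    case 3
    have R': "res_Y (c1 * y2 + a1 * y0 + b1 * y1) = 0" "res_Y (c2 * y2 + a2 * y0 + b2 * y1) = 0" "res_Y (c3 * y2 + a3 * y0 + b3 * y1) = 0"
      using R by (simp_all add: algebra_simps)
    have d: "det (mk3 c1 c2 c3 a1 a2 a3 b1 b2 b3) = e * f\<^sub>E a b" using det(1) by (simp add: det_mk3 algebra_simps)
    from classify3_unit_row[OF c(7-9,1-3) 3 R' d det(2)] show ?thesis using meq_trans[OF meq_trans[OF meq3_rows meq3_rows]] by blast
  qed
qed

definition good :: "'k T mat \<Rightarrow> bool" where
  "good A \<longleftrightarrow> (\<exists>i\<in>mf_labels a b. liso (lat (snd (mf a b i))) (lat A))"

lemma good_meq: "meq n A B \<Longrightarrow> good B \<Longrightarrow> good A"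
  unfolding good_def using liso_trans[OF _ liso_meq[OF meq_sym] submod_lat] by blast

lemma good_label: "i \<in> mf_labels a b \<Longrightarrow> meq n A (snd (mf a b i)) \<Longrightarrow> good A"
  unfolding good_def using liso_meq[OF meq_sym] by blast

text \<open>A unit entry splits off and leaves a single generator with relation a unit times f, the
  case \<open>MF6\<close>.\<close>

lemma good2_unit:
  assumes v: "v $ 0 $ 0 $ 0 \<noteq> 0" and det: "x * v - w * u = e * f\<^sub>E a b" "e * s = 1"
  shows "good (mk2 x w u v)"
proof -
  obtain t where t: "v * t = 1" using T_unit v by blast
  have m: "meq 2 (mk2 x w u v) (mk2 (x - w * t * u) 0 0 1)" by (rule meq2_pivot[OF t])
  have "v * (x - w * t * u) = e * f\<^sub>E a b"
  proof -
    have "v * (x - w * t * u) = x * v - w * u * (v * t)" by (simp add: algebra_simps)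
    then show ?thesis by (simp add: t det)
  qed
  then have g: "x - w * t * u = (t * e) * f\<^sub>E a b" using unit_cancel[OF t, of "x - w * t * u"] by (simp add: mult.assoc)
  have te: "(t * e) * (v * s) = 1" using unit_mult[OF _ det(2), of t v] t by (simp add: mult.commute)
  have "(t * e) * f\<^sub>E a b dvd y \<longleftrightarrow> f\<^sub>E a b dvd y" for y
  proof
    assume "f\<^sub>E a b dvd y"
    then obtain k where "y = f\<^sub>E a b * k" by (rule dvdE)
    then have "y = (t * e) * f\<^sub>E a b * ((v * s) * k)" using te by (metis mult.commute mult.left_commute mult_1_right)
    then show "(t * e) * f\<^sub>E a b dvd y" by (metis dvd_triv_left)
  qed (rule dvd_mult_right)
  then have "lat (mk2 ((t * e) * f\<^sub>E a b) 0 0 1) = lat (snd (mf a b MF6))"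
    by (simp add: lat_split2 lat_mk1 set_eq_iff)
  then have "good (mk2 (x - w * t * u) 0 0 1)" unfolding good_def g
    using liso_meq[OF meq_refl[OF mf_dim[of a b MF6]]] by (intro bexI[of _ MF6]) (auto simp: mf_labels_iff)
  then show ?thesis using good_meq[OF m] by blast
qed

lemma good2:
  assumes det: "x * v - w * u = e * f\<^sub>E a b" "e * s = 1"
  shows "good (mk2 x w u v)"
proof -
  have me: "(- e) * (- s) = 1" using det(2) by simp
  consider "v $ 0 $ 0 $ 0 \<noteq> 0" | "u $ 0 $ 0 $ 0 \<noteq> 0" | "w $ 0 $ 0 $ 0 \<noteq> 0" | "x $ 0 $ 0 $ 0 \<noteq> 0" |
    "x $ 0 $ 0 $ 0 = 0" "w $ 0 $ 0 $ 0 = 0" "u $ 0 $ 0 $ 0 = 0" "v $ 0 $ 0 $ 0 = 0" by blast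
  then show ?thesis
  proof cases
    case 1 then show ?thesis using good2_unit[OF _ det] by blast
  next
    case 2
    have d: "w * u - x * v = (- e) * f\<^sub>E a b" using det(1) by (simp add: algebra_simps)
    show ?thesis using good2_unit[OF 2 d me] good_meq[OF meq2_swap_cols] by blast
  next
    case 3
    have d: "u * w - v * x = (- e) * f\<^sub>E a b" using det(1) by (simp add: algebra_simps)
    show ?thesis using good2_unit[OF 3 d me] good_meq[OF meq2_swap_rows] by blast
  next
    case 4
    have d: "v * x - u * w = e * f\<^sub>E a b" using det(1) by (simp add: algebra_simps)
    show ?thesis using good2_unit[OF 4 d det(2)] good_meq[OF meq_trans[OF meq2_swap_rows meq2_swap_cols]] by blast
  next
    case 5
    from classify2[OF smooth 5 det] obtain i where "row_label a b i \<or> col_label a b i" "meq 2 (mk2 x w u v) (snd (mf a b i))" by blast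
    then show ?thesis using good_label by (auto simp: row_label_def[OF smooth] col_label_def[OF smooth])
  qed
qed

lemma good3_unit:
  assumes "i $ 0 $ 0 $ 0 \<noteq> 0" and det: "det (mk3 a' b' c d e f g h i) = \<epsilon> * f\<^sub>E a b" "\<epsilon> * s = 1"
  shows "good (mk3 a' b' c d e f g h i)"
proof -
  obtain t where t: "i * t = 1" using T_unit assms(1) by blast
  note m = meq3_pivot[OF t, of a' b' c d e f g h]
  obtain e' s' where e': "e' * s' = 1" "det (mk3 (a' - c * t * g) (b' - c * t * h) 0 (d - f * t * g) (e - f * t * h) 0 0 0 1) = e' * (\<epsilon> * f\<^sub>E a b)"
    using meq_det[OF m] unfolding det(1) by blast
  then have "(a' - c * t * g) * (e - f * t * h) - (b' - c * t * h) * (d - f * t * g) = (e' * \<epsilon>) * f\<^sub>E a b"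
    by (simp add: det_mk3 mult.assoc mult.commute[of "d - f * (t * g)"])
  from good2[OF this unit_mult[OF e'(1) det(2)]]
  have "good (mk3 (a' - c * t * g) (b' - c * t * h) 0 (d - f * t * g) (e - f * t * h) 0 0 0 1)"
    unfolding good_def lat_split3 .
  then show ?thesis using good_meq[OF m] by blast
qed

text \<open>Cyclic shifts of rows and columns preserve the determinant and bring a unit from any of
  the nine positions to the lower right corner.\<close>

lemma good3:
  assumes A: "A \<in> carrier_mat 3 3" and det: "det A = \<epsilon> * f\<^sub>E a b" "\<epsilon> * s = 1"
  shows "good A"
proof -
  obtain a1 a2 a3 b1 b2 b3 c1 c2 c3 where A: "A = mk3 a1 a2 a3 b1 b2 b3 c1 c2 c3" using mk3_eta[OF A] by blast
  note dA = det(1)[unfolded A]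
  have d: "det (mk3 a2 a3 a1 b2 b3 b1 c2 c3 c1) = \<epsilon> * f\<^sub>E a b" "det (mk3 a3 a1 a2 b3 b1 b2 c3 c1 c2) = \<epsilon> * f\<^sub>E a b"
    "det (mk3 b1 b2 b3 c1 c2 c3 a1 a2 a3) = \<epsilon> * f\<^sub>E a b" "det (mk3 c1 c2 c3 a1 a2 a3 b1 b2 b3) = \<epsilon> * f\<^sub>E a b"
    "det (mk3 b2 b3 b1 c2 c3 c1 a2 a3 a1) = \<epsilon> * f\<^sub>E a b" "det (mk3 b3 b1 b2 c3 c1 c2 a3 a1 a2) = \<epsilon> * f\<^sub>E a b"
    "det (mk3 c2 c3 c1 a2 a3 a1 b2 b3 b1) = \<epsilon> * f\<^sub>E a b" "det (mk3 c3 c1 c2 a3 a1 a2 b3 b1 b2) = \<epsilon> * f\<^sub>E a b"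
    using dA by (simp_all add: det_mk3 algebra_simps)
  note R = meq3_rows and C = meq3_cols
  note R2 = meq_trans[OF R R] and C2 = meq_trans[OF C C]
  note gm = good_meq and gu = good3_unit[OF _ _ det(2)]
  consider "c3 $ 0 $ 0 $ 0 \<noteq> 0" | "c1 $ 0 $ 0 $ 0 \<noteq> 0" | "c2 $ 0 $ 0 $ 0 \<noteq> 0"
    | "a3 $ 0 $ 0 $ 0 \<noteq> 0" | "a1 $ 0 $ 0 $ 0 \<noteq> 0" | "a2 $ 0 $ 0 $ 0 \<noteq> 0"
    | "b3 $ 0 $ 0 $ 0 \<noteq> 0" | "b1 $ 0 $ 0 $ 0 \<noteq> 0" | "b2 $ 0 $ 0 $ 0 \<noteq> 0"
    | "a1 $ 0 $ 0 $ 0 = 0" "a2 $ 0 $ 0 $ 0 = 0" "a3 $ 0 $ 0 $ 0 = 0" "b1 $ 0 $ 0 $ 0 = 0" "b2 $ 0 $ 0 $ 0 = 0" "b3 $ 0 $ 0 $ 0 = 0"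
      "c1 $ 0 $ 0 $ 0 = 0" "c2 $ 0 $ 0 $ 0 = 0" "c3 $ 0 $ 0 $ 0 = 0" by blast
  then have "good (mk3 a1 a2 a3 b1 b2 b3 c1 c2 c3)"
  proof cases
    case 1 show ?thesis by (rule gu[OF 1 dA])
  next
    case 2 show ?thesis by (rule gm[OF C gu[OF 2 d(1)]])
  next
    case 3 show ?thesis by (rule gm[OF C2 gu[OF 3 d(2)]])
  next
    case 4 show ?thesis by (rule gm[OF R gu[OF 4 d(3)]])
  next
    case 5 show ?thesis by (rule gm[OF meq_trans[OF R C] gu[OF 5 d(5)]])
  next
    case 6 show ?thesis by (rule gm[OF meq_trans[OF R C2] gu[OF 6 d(6)]])
  next
    case 7 show ?thesis by (rule gm[OF R2 gu[OF 7 d(4)]])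
  next
    case 8 show ?thesis by (rule gm[OF meq_trans[OF R2 C] gu[OF 8 d(7)]])
  next
    case 9 show ?thesis by (rule gm[OF meq_trans[OF R2 C2] gu[OF 9 d(8)]])
  next
    case 10
    from classify3_max[OF 10 dA det(2)] show ?thesis
      using good_label mf_labels_iff(3) by blast
  qed
  then show ?thesis unfolding A .
qed

end

section \<open>Non-isomorphic factorisations\<close>

lemma linear_fn_diff: "linear_fn \<theta> \<Longrightarrow> \<theta> (v - w) = \<theta> v - \<theta> w"
proof -
  assume \<theta>: "linear_fn \<theta>"
  have "\<theta> (v - w + w) = \<theta> (v - w) + \<theta> w" using \<theta> unfolding linear_fn_def by blast
  then show "\<theta> (v - w) = \<theta> v - \<theta> w" by (simp add: eq_diff_eq)
qed

lemma linear_fn_sum: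
  assumes "linear_fn \<theta>"
  shows "\<theta> (\<Sum>k<(n::nat). t k \<star> x k) = (\<Sum>k<n. t k \<star> \<theta> (x k))"
proof (induction n)
  case 0
  have "\<theta> (0 \<star> 0) = 0 \<star> \<theta> 0" using assms unfolding linear_fn_def by blast
  then show ?case by (simp only: scal_simps lessThan_0 sum.empty)
next
  case (Suc n)
  have "\<theta> ((\<Sum>k<n. t k \<star> x k) + t n \<star> x n) = \<theta> (\<Sum>k<n. t k \<star> x k) + t n \<star> \<theta> (x n)"
    using assms unfolding linear_fn_def by simp
  then show ?case by (simp only: Suc sum.lessThan_Suc)
qed

abbreviation unit_fn :: "nat \<Rightarrow> nat \<Rightarrow> 'r::comm_ring_1" where
  "unit_fn k \<equiv> (\<lambda>i. if i = k then 1 else 0)"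

lemma sum_unit_fn: "i < n \<Longrightarrow> (\<Sum>k<n. v k \<star> unit_fn k) i = v i"
  by (simp add: sum_fun_apply scal_apply if_distrib cong: if_cong)

lemma lat_const:
  fixes B :: "'k::field T mat"
  assumes "v \<in> lat B" "\<And>i j. i < n \<Longrightarrow> j < n \<Longrightarrow> B $$ (i, j) $ 0 $ 0 $ 0 = 0" "B \<in> carrier_mat n n" "i < n"
  shows "v i $ 0 $ 0 $ 0 = 0"
proof -
  obtain u where "v i = (\<Sum>j<n. B $$ (i, j) * u j)" using assms(1,3,4) by (auto simp: lat_def)
  then show ?thesis using assms by (simp add: fps_sum_nth)
qed

text \<open>Both presentations are minimal, so an isomorphism induces an invertible constant matrix
  \<open>C\<close> on generators modulo the maximal ideal. Each column of \<open>A\<close> is sent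
  into the image of \<open>B\<close>; comparing linear terms there involves only constant terms of
  the two multipliers, \<open>C\<close> and \<open>D\<close>.\<close>

lemma liso_linear_part:
  fixes A B :: "'k::field T mat"
  assumes iso: "liso (lat A) (lat B)" and A: "A \<in> carrier_mat n n" and B: "B \<in> carrier_mat n' n'"
    and A0: "\<And>i j. i < n \<Longrightarrow> j < n \<Longrightarrow> A $$ (i, j) $ 0 $ 0 $ 0 = 0"
    and B0: "\<And>i j. i < n' \<Longrightarrow> j < n' \<Longrightarrow> B $$ (i, j) $ 0 $ 0 $ 0 = 0"
  obtains C D :: "nat \<Rightarrow> nat \<Rightarrow> 'k" where "n' = n"
    "\<And>x. (\<And>i. i < n \<Longrightarrow> (\<Sum>k<n. C i k * x k) = 0) \<Longrightarrow> (\<forall>k<n. x k = 0)"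
    "\<And>i j. i < n \<Longrightarrow> j < n \<Longrightarrow> (\<Sum>k<n. C i k * A $$ (k, j) $ 0 $ 0 $ 1) = (\<Sum>k<n. B $$ (i, k) $ 0 $ 0 $ 1 * D k j)"
    "\<And>i j. i < n \<Longrightarrow> j < n \<Longrightarrow> (\<Sum>k<n. C i k * A $$ (k, j) $ 0 $ 1 $ 0) = (\<Sum>k<n. B $$ (i, k) $ 0 $ 1 $ 0 * D k j)"
    "\<And>i j. i < n \<Longrightarrow> j < n \<Longrightarrow> (\<Sum>k<n. C i k * A $$ (k, j) $ 1 $ 0 $ 0) = (\<Sum>k<n. B $$ (i, k) $ 1 $ 0 $ 0 * D k j)"
proof -
  obtain \<theta> where \<theta>: "linear_fn \<theta>" "\<And>v. v \<in> lat A \<longleftrightarrow> \<theta> v \<in> lat B" "\<And>w. \<exists>v. w - \<theta> v \<in> lat B" using iso by (auto simp: liso_def)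
  note sB = submod_lat[of B]
  have expand: "\<theta> v - (\<Sum>k<n. v k \<star> \<theta> (unit_fn k)) \<in> lat B" for v
  proof -
    have "v - (\<Sum>k<n. v k \<star> unit_fn k) \<in> lat A"
      unfolding lat_def using A by (auto simp: sum_unit_fn intro!: exI[of _ "\<lambda>_. 0"])
    then show ?thesis unfolding \<theta>(2) linear_fn_diff[OF \<theta>(1)] linear_fn_sum[OF \<theta>(1)] .
  qed
  define C where "C i k = \<theta> (unit_fn k) i $ 0 $ 0 $ 0" for i k
  have c\<theta>: "\<theta> v i $ 0 $ 0 $ 0 = (\<Sum>k<n. C i k * v k $ 0 $ 0 $ 0)" if "i < n'" for v i
  proof -
    have "(\<theta> v - (\<Sum>k<n. v k \<star> \<theta> (unit_fn k))) i $ 0 $ 0 $ 0 = 0" by (rule lat_const[OF expand B0 B that])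
    then have "\<theta> v i $ 0 $ 0 $ 0 = (\<Sum>k<n. v k $ 0 $ 0 $ 0 * C i k)" by (simp add: sum_fun_apply scal_apply fps_sum_nth C_def)
    also have "\<dots> = (\<Sum>k<n. C i k * v k $ 0 $ 0 $ 0)" by (intro sum.cong refl mult.commute)
    finally show ?thesis .
  qed
  \<comment> \<open>Approximate preimages of the unit vectors; their constant terms give the inverse
    of \<open>C\<close>.\<close>
  obtain \<nu> where \<nu>: "\<And>l. unit_fn l - \<theta> (\<nu> l) \<in> lat B" using choice[of "\<lambda>l v. unit_fn l - \<theta> v \<in> lat B"] \<theta>(3) by blast
  define C' where "C' k l = \<nu> l k $ 0 $ 0 $ 0" for k l
  have CC': "(\<Sum>k<n. C i k * C' k l) = (if i = l then 1 else 0)" if "i < n'" for i l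
    using lat_const[OF \<nu>[of l] B0 B that] c\<theta>[OF that, of "\<nu> l"] by (simp add: C'_def split: if_splits)
  have C'C: "(\<Sum>l<n'. C' i l * C l k) = (if i = k then 1 else 0)" if "i < n" for i k
  proof -
    define w where "w = (\<Sum>l<n'. \<theta> (unit_fn k) l \<star> \<nu> l)"
    have "\<theta> (unit_fn k) - (\<Sum>l<n'. \<theta> (unit_fn k) l \<star> unit_fn l) \<in> lat B"
      unfolding lat_def using B by (auto simp: sum_unit_fn intro!: exI[of _ "\<lambda>_. 0"])
    moreover have "(\<Sum>l<n'. \<theta> (unit_fn k) l \<star> unit_fn l) - \<theta> w \<in> lat B"
      unfolding w_def linear_fn_sum[OF \<theta>(1)] by (intro submod_cong_sum[OF sB] submod_cong_scal[OF sB] \<nu>)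
    ultimately have "unit_fn k - w \<in> lat A"
      unfolding \<theta>(2) linear_fn_diff[OF \<theta>(1)] by (rule submod_cong_trans[OF sB])
    from lat_const[OF this A0 A that] show ?thesis
      by (simp add: w_def sum_fun_apply scal_apply fps_sum_nth C_def C'_def mult.commute split: if_splits)
  qed
  have inj: "\<forall>k<n. x k = 0" if x: "\<And>i. i < n' \<Longrightarrow> (\<Sum>k<n. C i k * x k) = 0" for x
  proof (intro allI impI)
    fix i assume i: "i < n"
    have "x i = (\<Sum>k<n. (\<Sum>l<n'. C' i l * C l k) * x k)" using i by (simp add: C'C if_distrib if_distribR cong: if_cong)
    also have "\<dots> = (\<Sum>l<n'. C' i l * (\<Sum>k<n. C l k * x k))"
      unfolding sum_distrib_left sum_distrib_right by (subst sum.swap) (simp only: ac_simps)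
    also have "\<dots> = 0" using x by simp
    finally show "x i = 0" .
  qed
  have "n \<le> n'"
  proof (rule ccontr)
    assume "\<not> n \<le> n'"
    then obtain c where c: "\<exists>k\<in>{..<n}. c k \<noteq> 0" "\<forall>j<n'. (\<Sum>k\<in>{..<n}. c k * C j k) = 0"
      using linear_dependence[of "{..<n}" n' "\<lambda>k j. C j k"] by auto
    then show False using inj[of c] by (auto simp: mult.commute)
  qed
  moreover have "n' \<le> n"
  proof (rule ccontr)
    assume "\<not> n' \<le> n"
    then obtain c where c: "\<exists>k\<in>{..<n'}. c k \<noteq> 0" "\<forall>j<n. (\<Sum>k\<in>{..<n'}. c k * C' j k) = 0"
      using linear_dependence[of "{..<n'}" n "\<lambda>k j. C' j k"] by auto
    have "c i = 0" if i: "i < n'" for i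
    proof -
      have "c i = (\<Sum>l<n'. (\<Sum>k<n. C i k * C' k l) * c l)" using i by (simp add: CC' if_distrib if_distribR cong: if_cong)
      also have "\<dots> = (\<Sum>k<n. C i k * (\<Sum>l<n'. c l * C' k l))"
        unfolding sum_distrib_left sum_distrib_right by (subst sum.swap) (simp only: ac_simps)
      also have "\<dots> = 0" using c(2) by simp
      finally show ?thesis .
    qed
    then show False using c(1) by auto
  qed
  ultimately have n: "n' = n" by simp
  have ex: "\<exists>W. \<forall>i<n. (\<Sum>k<n. \<theta> (unit_fn k) i * A $$ (k, j)) = (\<Sum>l<n. B $$ (i, l) * W l)" if j: "j < n" for j
  proof -
    have "(\<lambda>k. A $$ (k, j)) \<in> lat A" unfolding lat_def using A j
      by (auto simp: if_distrib cong: if_cong intro!: exI[of _ "unit_fn j"])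
    then have "\<theta> (\<lambda>k. A $$ (k, j)) \<in> lat B" unfolding \<theta>(2) .
    then have "(\<Sum>k<n. A $$ (k, j) \<star> \<theta> (unit_fn k)) \<in> lat B" using submod_cong[OF sB expand[of "\<lambda>k. A $$ (k, j)"]] by blast
    then obtain W where "\<And>i. i < n \<Longrightarrow> (\<Sum>k<n. A $$ (k, j) * \<theta> (unit_fn k) i) = (\<Sum>l<n. B $$ (i, l) * W l)"
      using B unfolding lat_def n by (auto simp: sum_fun_apply scal_apply)
    moreover have "(\<Sum>k<n. \<theta> (unit_fn k) i * A $$ (k, j)) = (\<Sum>k<n. A $$ (k, j) * \<theta> (unit_fn k) i)" for i
      by (intro sum.cong refl mult.commute)
    ultimately show ?thesis by (intro exI[of _ W]) simp
  qed
  define W where "W j = (SOME W. \<forall>i<n. (\<Sum>k<n. \<theta> (unit_fn k) i * A $$ (k, j)) = (\<Sum>l<n. B $$ (i, l) * W l))" for j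
  have W: "(\<Sum>k<n. \<theta> (unit_fn k) i * A $$ (k, j)) = (\<Sum>l<n. B $$ (i, l) * W j l)" if "i < n" "j < n" for i j
    using someI_ex[OF ex[OF that(2)], folded W_def] that(1) by blast
  define D where "D l j = W j l $ 0 $ 0 $ 0" for l j
  have W': "(\<Sum>k<n. \<theta> (unit_fn k) i * A $$ (k, j)) $ p $ q $ r = (\<Sum>l<n. B $$ (i, l) * W j l) $ p $ q $ r"
    if "i < n" "j < n" for i j p q r by (simp only: W[OF that])
  show thesis
  proof (rule that[OF n, of C D])
    show "(\<And>i. i < n \<Longrightarrow> (\<Sum>k<n. C i k * x k) = 0) \<Longrightarrow> (\<forall>k<n. x k = 0)" for x using inj n by blast
  qed (use W'[where p=0 and q=0 and r=1] W'[where p=0 and q=1 and r=0] W'[where p=1 and q=0 and r=0] A0 B0 n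
      in \<open>simp_all add: fps_sum_nth fps_mult_nth_1 C_def D_def\<close>)
qed

lemma mf_const:
  assumes "i < mf_size k" "j < mf_size k"
  shows "snd (mf a b k) $$ (i, j) $ 0 $ 0 $ 0 = 0"
  using assms by (cases k) (auto simp: less_2_iff less_3_iff P\<^sub>E_def \<Z>_def \<Y>_def \<X>_def f_eq fps_power_zeroth)

lemma inj2:
  fixes C :: "nat \<Rightarrow> nat \<Rightarrow> 'k::field"
  assumes "\<And>x :: nat \<Rightarrow> 'k. (\<And>i. i < 2 \<Longrightarrow> (\<Sum>k<2. C i k * x k) = 0) \<Longrightarrow> (\<forall>k<2. x k = 0)"
  shows "C 0 0 * C 1 1 \<noteq> C 0 1 * C 1 0"
proof
  assume d: "C 0 0 * C 1 1 = C 0 1 * C 1 0"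
  note s = less_2_iff lessThan_atLeast0 sum_2
  have K: "y = 0 \<and> z = 0" if "C 0 0 * y + C 0 1 * z = 0" "C 1 0 * y + C 1 1 * z = 0" for y z
  proof -
    have "\<forall>k<2. (if k = (0::nat) then y else z) = 0"
      by (rule assms) (use that in \<open>auto simp: s split: if_splits\<close>)
    then show ?thesis by (auto simp: s)
  qed
  have 1: "C 1 1 = 0 \<and> - C 1 0 = 0" by (rule K) (use d in \<open>simp_all add: mult.commute\<close>)
  have 2: "C 0 1 = 0 \<and> - C 0 0 = 0" by (rule K) (use 1 in \<open>simp_all add: mult.commute\<close>)
  show False using K[of 1 1] 1 2 by simp
qed

text \<open>The size is the number of generators. In size two the linear entries fill one column
  (\<open>MF1\<close>, \<open>MF2\<close>) or one row (\<open>MF3\<close>, \<open>MF4\<close>) and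
  their vanishing locus is a point of E; both are invariants of the equations for \<open>C\<close>
  and \<open>D\<close>. In size three the parameters of \<open>MF5\<close> are read off from the
  Z-coefficients.\<close>

lemma liso_labels_eq:
  fixes i j :: "'k::field mf_label"
  assumes iso: "liso (lat (snd (mf a b i))) (lat (snd (mf a b j)))"
  shows "i = j"
proof -
  obtain C D where CD: "mf_size j = mf_size i"
    "\<And>x. (\<And>r. r < mf_size i \<Longrightarrow> (\<Sum>k<mf_size i. C r k * x k) = 0) \<Longrightarrow> (\<forall>k<mf_size i. x k = 0)"
    "\<And>r s. r < mf_size i \<Longrightarrow> s < mf_size i \<Longrightarrow> (\<Sum>k<mf_size i. C r k * snd (mf a b i) $$ (k, s) $ 0 $ 0 $ 1) = (\<Sum>k<mf_size i. snd (mf a b j) $$ (r, k) $ 0 $ 0 $ 1 * D k s)"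
    "\<And>r s. r < mf_size i \<Longrightarrow> s < mf_size i \<Longrightarrow> (\<Sum>k<mf_size i. C r k * snd (mf a b i) $$ (k, s) $ 0 $ 1 $ 0) = (\<Sum>k<mf_size i. snd (mf a b j) $$ (r, k) $ 0 $ 1 $ 0 * D k s)"
    "\<And>r s. r < mf_size i \<Longrightarrow> s < mf_size i \<Longrightarrow> (\<Sum>k<mf_size i. C r k * snd (mf a b i) $$ (k, s) $ 1 $ 0 $ 0) = (\<Sum>k<mf_size i. snd (mf a b j) $$ (r, k) $ 1 $ 0 $ 0 * D k s)"
    using liso_linear_part[OF iso mf_dim mf_dim mf_const mf_const] by blast
  consider "mf_size i = 1" | "mf_size i = 2" | "mf_size i = 3" by (cases i) auto
  then show ?thesis
  proof cases
    case 1
    then show ?thesis using CD(1) by (cases i; cases j) auto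
  next
    case 2
    note CD' = CD(3-5)[unfolded 2 lessThan_atLeast0 sum_2]
    have z: "0 < (2::nat)" "Suc 0 < 2" by simp_all
    have d: "C 0 0 * C 1 1 \<noteq> C 0 1 * C 1 0" using inj2[of C] CD(2)[unfolded 2] by blast
    note n = power2_eq_square \<Z>_def \<Y>_def \<X>_def cst_def fps_mult_nth_1 P\<^sub>E_def
    note eqs = CD'(1)[OF z(1,1)] CD'(1)[OF z(1,2)] CD'(1)[OF z(2,1)] CD'(1)[OF z(2,2)]
      CD'(2)[OF z(1,1)] CD'(2)[OF z(1,2)] CD'(2)[OF z(2,1)] CD'(2)[OF z(2,2)]
      CD'(3)[OF z(1,1)] CD'(3)[OF z(1,2)] CD'(3)[OF z(2,1)] CD'(3)[OF z(2,2)]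
    show ?thesis
    proof (cases i)
      case (MF1 l m)
      then show ?thesis using 2 CD(1) d eqs by (cases j) (simp_all add: n)
    next
      case MF2
      then show ?thesis using 2 CD(1) d eqs by (cases j) (simp_all add: n)
    next
      case (MF3 l m)
      then show ?thesis using 2 CD(1) d eqs by (cases j) (simp_all add: n)
    next
      case MF4
      then show ?thesis using 2 CD(1) d eqs by (cases j) (simp_all add: n)
    qed (use 2 in simp_all)
  next
    case 3
    then obtain l m l' m' where ij: "i = MF5 l m" "j = MF5 l' m'" using CD(1) by (cases i; cases j) auto
    note CD' = CD(3-5)[unfolded 3 lessThan_atLeast0 sum_3, unfolded ij]
    note n = power2_eq_square \<Z>_def \<Y>_def \<X>_def cst_def fps_mult_nth_1
    have X: "C 0 0 = D 0 0" "C 0 1 = D 0 1" "C 0 2 = - D 0 2" "C 2 0 = - D 2 0" "C 2 1 = - D 2 1"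
      using CD'(1)[of 0 0] CD'(1)[of 0 1] CD'(1)[of 0 2] CD'(1)[of 2 0] CD'(1)[of 2 1] by (auto simp: n minus_equation_iff[of "C 0 2"])
    have Y: "C 0 0 = D 2 2" "D 0 1 = 0" "C 1 0 = D 0 2" "C 2 0 = 0" "C 2 1 = 0"
      using CD'(2)[of 0 2] CD'(2)[of 1 1] CD'(2)[of 1 2] CD'(2)[of 2 0] CD'(2)[of 2 2] by (auto simp: n)
    have Z: "C 0 2 = 0" "l * C 0 0 = l' * D 0 0" "m * C 0 0 = m' * D 2 2"
      using CD'(3)[of 0 1] CD'(3)[of 0 0] CD'(3)[of 0 2] X Y by (auto simp: n)
    \<comment> \<open>The equations force the rest of column 0 of \<open>C\<close> to vanish, so its
      top entry is nonzero by injectivity and can be cancelled.\<close>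
    have "C 0 0 \<noteq> 0"
    proof
      assume "C 0 0 = 0"
      then show False using CD(2)[of "\<lambda>k. if k = 0 then 1 else 0"] X Y Z(1)
        by (auto simp: 3 less_3_iff lessThan_atLeast0 sum_3)
    qed
    then show ?thesis using Z X Y ij by simp
  qed
qed

section \<open>The factorisations of the Weierstrass cubic\<close>

lemma weierstrass_poly_eq:
  "weierstrass_poly a b = [: [:[:0, 0, 0, -1:]:], [:0, 0, 1:], [:[:0, - a:]:], [:[:- b:]:] :]"
  by (simp add: weierstrass_poly_def weierstrass_def power2_eq_square power3_eq_cube one_pCons)

text \<open>At a point of the curve with last coordinate 1 the Z-derivative is a combination of the
  other two, so smoothness is carried by the derivatives in X and Y.\<close>

lemma smooth_weierstrass:
  fixes a b :: "'k::alg_closed_field"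
  assumes "smooth_plane_curve (weierstrass_poly a b)" and w: "weierstrass a b l m 1 = 0"
  shows "2 * m \<noteq> 0 \<or> 3 * l\<^sup>2 + a \<noteq> 0"
proof (rule ccontr)
  assume "\<not> ?thesis"
  then have m: "2 * m = 0" and l: "3 * l\<^sup>2 + a = 0" by auto
  let ?F = "weierstrass_poly a b"
  have F: "eval3 ?F l m 1 = weierstrass a b l m 1"
    by (simp add: weierstrass_poly_eq eval3_def weierstrass_def power2_eq_square power3_eq_cube algebra_simps)
  have Fx: "eval3 (map_poly (map_poly pderiv) ?F) l m 1 = - (3 * l\<^sup>2 + a)"
    by (simp add: weierstrass_poly_eq eval3_def map_poly_pCons pderiv_pCons power2_eq_square algebra_simps)
  have Fy: "eval3 (map_poly pderiv ?F) l m 1 = 2 * m"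
    by (simp add: weierstrass_poly_eq eval3_def map_poly_pCons pderiv_pCons power2_eq_square algebra_simps)
  have Fz: "eval3 (pderiv ?F) l m 1 = m\<^sup>2 - 2 * (a * l) - 3 * b"
    by (simp add: weierstrass_poly_eq eval3_def pderiv_pCons power2_eq_square algebra_simps)
  text \<open>Euler's relation for the cubic form.\<close>
  have "m\<^sup>2 - 2 * (a * l) - 3 * b = 3 * weierstrass a b l m 1 + l * (3 * l\<^sup>2 + a) - m * (2 * m)"
    by (simp add: weierstrass_def power2_eq_square power3_eq_cube algebra_simps)
  then have "m\<^sup>2 - 2 * (a * l) - 3 * b = 0" by (simp only: w l m mult_zero_right add_0_right diff_0_right)
  then show False using assms(1)[unfolded smooth_plane_curve_def, rule_format, of l m 1]
    unfolding F Fx Fy Fz using w l m by simp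
qed

lemma cst_weierstrass: "cst b = cst m ^ 2 - cst l ^ 3 - cst a * cst l" if "weierstrass a b l m 1 = 0"
proof -
  have "cst (weierstrass a b l m 1) = 0" using that by (simp add: cst.hom_zero)
  then have "cst m ^ 2 - cst l ^ 3 - cst a * cst l - cst b = 0"
    by (simp add: weierstrass_def cst.hom_minus cst.hom_mult cst.hom_power)
  then show ?thesis by (simp add: algebra_simps)
qed

lemma smult_one_mk: "t \<cdot>\<^sub>m 1\<^sub>m 2 = mk2 t 0 0 (t :: 'r::comm_ring_1)" "t \<cdot>\<^sub>m 1\<^sub>m 3 = mk3 t 0 0 0 t 0 0 0 t"
  "t \<cdot>\<^sub>m 1\<^sub>m (Suc 0) = mat_of_rows_list (Suc 0) [[t]]"
proof -
  show "t \<cdot>\<^sub>m 1\<^sub>m 2 = mk2 t 0 0 t" by (rule eq_mk2I) simp_all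
  show "t \<cdot>\<^sub>m 1\<^sub>m 3 = mk3 t 0 0 0 t 0 0 0 t" by (rule eq_mk3I) simp_all
  show "t \<cdot>\<^sub>m 1\<^sub>m (Suc 0) = mat_of_rows_list (Suc 0) [[t]]" by (rule eq_matI) auto
qed

lemma mf_factorisation:
  assumes "i \<in> mf_labels a b"
  shows "matrix_factorisation (f\<^sub>E a b) (mf_size i) (mf a b i)"
proof -
  note n = f\<^sub>E_def weierstrass_def P\<^sub>E_def power2_eq_square power3_eq_cube
  show ?thesis
  proof (cases i)
    case (MF1 l m)
    then have w: "weierstrass a b l m 1 = 0" using assms by (auto simp: mf_labels_def)
    show ?thesis unfolding MF1 mf.simps mf_size.simps matrix_factorisation_def prod.case mk2_mult smult_one_mk
      by (simp add: n cst_weierstrass[OF w] algebra_simps)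
  next
    case MF2
    then show ?thesis unfolding MF2 mf.simps mf_size.simps matrix_factorisation_def prod.case mk2_mult smult_one_mk
      by (simp add: n algebra_simps)
  next
    case (MF3 l m)
    then have w: "weierstrass a b l m 1 = 0" using assms by (auto simp: mf_labels_def)
    show ?thesis unfolding MF3 mf.simps mf_size.simps matrix_factorisation_def prod.case mk2_mult smult_one_mk
      by (simp add: n cst_weierstrass[OF w] algebra_simps)
  next
    case MF4
    then show ?thesis unfolding MF4 mf.simps mf_size.simps matrix_factorisation_def prod.case mk2_mult smult_one_mk
      by (simp add: n algebra_simps)
  next
    case (MF5 l m)
    then have w: "weierstrass a b l m 1 = 0" using assms by (auto simp: mf_labels_def)
    show ?thesis unfolding MF5 mf.simps mf_size.simps matrix_factorisation_def prod.case mk3_mult smult_one_mk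
      by (simp add: n cst_weierstrass[OF w] algebra_simps)
  next
    case MF6
    then show ?thesis using mk1_mult[of 1 "f\<^sub>E a b"] mk1_mult[of "f\<^sub>E a b" 1]
      by (simp add: matrix_factorisation_def smult_one_mk)
  qed
qed

text \<open>At Z = 0 a multiple of f is divisible by X^3, whereas this entry has a term 1, X^2 or
  Y^2.\<close>

lemma mf_pivot: "\<not> f\<^sub>E a b dvd fst (mf a b i) $$ (0, 0)"
proof
  assume "f\<^sub>E a b dvd fst (mf a b i) $$ (0, 0)"
  then obtain k where k: "fst (mf a b i) $$ (0, 0) = f\<^sub>E a b * k" by (rule dvdE)
  have c: "fst (mf a b i) $$ (0, 0) $ 0 $ s $ r = (f\<^sub>E a b * k) $ 0 $ s $ r" for s r unfolding k ..
  have f: "(f\<^sub>E a b * k) $ 0 $ s $ r = - (if r < 3 then 0 else k $ 0 $ s $ (r - 3))" for s r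
    by (simp add: f_nth0 fps_const_power fps_X_power_mult_nth)
  show False using c[of 0 0] c[of 0 2] c[of 2 0] unfolding f
    by (cases i) (auto simp: P\<^sub>E_def \<Z>_def \<Y>_def \<X>_def cst_def power2_eq_square fps_X_mult_nth)
qed

text \<open>The first matrix has rank one modulo f, which is what makes the cokernel of the second
  one a module of rank one.\<close>

lemma mf_minor:
  assumes i: "i \<in> mf_labels a b" and rs: "r < mf_size i" "s < mf_size i"
  shows "f\<^sub>E a b dvd fst (mf a b i) $$ (0, 0) * fst (mf a b i) $$ (r, s) - fst (mf a b i) $$ (r, 0) * fst (mf a b i) $$ (0, s)"
    (is "_ dvd ?m r s")
proof (cases "r = 0 \<or> s = 0")
  case True
  then show ?thesis by (auto simp: mult.commute)
next
  case False
  note n = f\<^sub>E_def weierstrass_def P\<^sub>E_def power2_eq_square power3_eq_cube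
  show ?thesis
  proof (cases i)
    case (MF1 l m)
    then have w: "weierstrass a b l m 1 = 0" using i by (auto simp: mf_labels_def)
    have "?m 1 1 = f\<^sub>E a b * 1" by (simp add: MF1 n cst_weierstrass[OF w] algebra_simps)
    then show ?thesis using False rs MF1 by (auto simp: less_2_iff)
  next
    case MF2
    have "?m 1 1 = f\<^sub>E a b * - 1" by (simp add: MF2 n algebra_simps)
    then show ?thesis using False rs MF2 by (auto simp: less_2_iff)
  next
    case (MF3 l m)
    then have w: "weierstrass a b l m 1 = 0" using i by (auto simp: mf_labels_def)
    have "?m 1 1 = f\<^sub>E a b * - 1" by (simp add: MF3 n cst_weierstrass[OF w] algebra_simps)
    then show ?thesis using False rs MF3 by (auto simp: less_2_iff)
  next
    case MF4
    have "?m 1 1 = f\<^sub>E a b * 1" by (simp add: MF4 n algebra_simps)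
    then show ?thesis using False rs MF4 by (auto simp: less_2_iff)
  next
    case (MF5 l m)
    then have w: "weierstrass a b l m 1 = 0" using i by (auto simp: mf_labels_def)
    have "?m 1 1 = f\<^sub>E a b * - \<X>" "?m 2 1 = f\<^sub>E a b * - \<Z>" "?m 1 2 = f\<^sub>E a b * - ((cst a + cst l ^ 2) * \<Z>)"
      "?m 2 2 = f\<^sub>E a b * (\<X> + cst l * \<Z>)"
      by (simp_all add: MF5 n cst_weierstrass[OF w] algebra_simps)
    then have d: "f\<^sub>E a b dvd ?m 1 1" "f\<^sub>E a b dvd ?m 2 1" "f\<^sub>E a b dvd ?m 1 2" "f\<^sub>E a b dvd ?m 2 2"
      by (metis dvd_triv_left)+
    consider "r = 1 \<and> s = 1" | "r = 2 \<and> s = 1" | "r = 1 \<and> s = 2" | "r = 2 \<and> s = 2"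
      using rs False by (auto simp: MF5 less_3_iff)
    then show ?thesis by cases (use d in simp_all)
  next
    case MF6
    then show ?thesis using False rs by auto
  qed
qed

text \<open>All rows of the first matrix are proportional to its first row modulo the prime f. Hence
  the membership test of \<open>lat_iff\<close> reduces to one linear form, and the cokernel embeds
  into S.\<close>

lemma lat_functional:
  assumes i: "i \<in> mf_labels a b"
  obtains c where "\<And>v. v \<in> lat (snd (mf a b i)) \<longleftrightarrow> f\<^sub>E a b dvd (\<Sum>j<mf_size i. c j * v j)"
proof -
  define \<alpha> n where "\<alpha> = fst (mf a b i)" and "n = mf_size i"
  have F: "\<alpha> \<in> carrier_mat n n" "snd (mf a b i) \<in> carrier_mat n n" "\<alpha> * snd (mf a b i) = f\<^sub>E a b \<cdot>\<^sub>m 1\<^sub>m n" "snd (mf a b i) * \<alpha> = f\<^sub>E a b \<cdot>\<^sub>m 1\<^sub>m n"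
    using mf_factorisation[OF i] by (auto simp: matrix_factorisation_def \<alpha>_def n_def split: prod.splits)
  have n: "0 < n" by (cases i) (simp_all add: n_def)
  have "f\<^sub>E a b dvd (\<Sum>j<n. \<alpha> $$ (r, j) * v j)" if 0: "f\<^sub>E a b dvd (\<Sum>j<n. \<alpha> $$ (0, j) * v j)" and r: "r < n" for r v
  proof -
    have "\<alpha> $$ (0, 0) * (\<Sum>j<n. \<alpha> $$ (r, j) * v j) =
      \<alpha> $$ (r, 0) * (\<Sum>j<n. \<alpha> $$ (0, j) * v j) + (\<Sum>j<n. (\<alpha> $$ (0, 0) * \<alpha> $$ (r, j) - \<alpha> $$ (r, 0) * \<alpha> $$ (0, j)) * v j)"
      by (simp add: sum_distrib_left algebra_simps flip: sum.distrib)
    also have "f\<^sub>E a b dvd \<dots>"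
      using mf_minor[OF i] r by (intro dvd_add dvd_mult[OF 0] dvd_sum dvd_mult2) (auto simp: \<alpha>_def n_def)
    finally show ?thesis using f_prime mf_pivot unfolding \<alpha>_def by blast
  qed
  then have "v \<in> lat (snd (mf a b i)) \<longleftrightarrow> f\<^sub>E a b dvd (\<Sum>j<n. \<alpha> $$ (0, j) * v j)" for v
    unfolding lat_iff[OF F] using n by blast
  then show thesis using that[of "\<lambda>j. \<alpha> $$ (0, j)"] unfolding n_def by blast
qed

lemma mf_iso_liso:
  assumes ij: "i \<in> mf_labels a b" "j \<in> mf_labels a b" and iso: "mf_iso (mf a b i) (mf a b j)"
  shows "liso (lat (snd (mf a b i))) (lat (snd (mf a b j)))"
proof -
  have d: "dim_row (fst (mf a b k)) = mf_size k" for k by (cases k) auto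
  define n where "n = mf_size i"
  have n: "mf_size j = n" using iso unfolding n_def d[symmetric] by (auto simp: mf_iso_def split: prod.splits)
  obtain U V where UV: "U \<in> carrier_mat n n" "V \<in> carrier_mat n n" "invertible_mat U" "invertible_mat V"
    "U * snd (mf a b i) = snd (mf a b j) * V"
    using iso d[of i] by (auto simp: mf_iso_def n_def split: prod.splits)
  have inv: "inv_mat n W" if W: "W \<in> carrier_mat n n" "invertible_mat W" for W :: "'a T mat"
  proof -
    obtain W' where W': "W * W' = 1\<^sub>m n" "W' * W = 1\<^sub>m (dim_row W')" using W by (auto simp: invertible_mat_def inverts_mat_def)
    have "dim_col W' = n" using arg_cong[OF W'(1), of dim_col] by simp
    moreover have "dim_row W' = n" using arg_cong[OF W'(2), of dim_col] W by simp
    ultimately have "W' \<in> carrier_mat n n" by auto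
    then show ?thesis using W W' by (auto simp: inv_mat_def)
  qed
  obtain V' where V': "V' \<in> carrier_mat n n" "V * V' = 1\<^sub>m n" "V' * V = 1\<^sub>m n" using inv[OF UV(2,4)] by (auto simp: inv_mat_def)
  have c: "snd (mf a b i) \<in> carrier_mat n n" "snd (mf a b j) \<in> carrier_mat n n" using mf_dim n unfolding n_def by metis+
  have "U * snd (mf a b i) * V' = snd (mf a b j) * (V * V')" unfolding UV(5) using c UV V' by (simp add: assoc_mult_mat[of _ n n _ n])
  then have "snd (mf a b j) = U * snd (mf a b i) * V'" using c V' by simp
  moreover have "inv_mat n V'" using V' UV(2) by (auto simp: inv_mat_def)
  ultimately have "meq n (snd (mf a b i)) (snd (mf a b j))" using c inv[OF UV(1,3)] unfolding meq_def by blast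
  then show ?thesis by (rule liso_meq)
qed

section \<open>The hypersurface ring\<close>

text \<open>The coset of \<open>t\<close> modulo f, in a form where equality is divisibility of the
  difference.\<close>

definition residue_class :: "'k::field \<Rightarrow> 'k \<Rightarrow> 'k T \<Rightarrow> 'k T set" ("\<kappa>") where
  "\<kappa> a b t = {s. f\<^sub>E a b dvd s - t}"

lemma residue_class_eq_iff: "\<kappa> a b s = \<kappa> a b t \<longleftrightarrow> f\<^sub>E a b dvd s - t"
proof
  assume "\<kappa> a b s = \<kappa> a b t"
  moreover have "s \<in> \<kappa> a b s" by (simp add: residue_class_def)
  ultimately show "f\<^sub>E a b dvd s - t" by (simp add: residue_class_def)
next
  assume st: "f\<^sub>E a b dvd s - t"
  have "f\<^sub>E a b dvd u - s \<longleftrightarrow> f\<^sub>E a b dvd u - t" for u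
    using dvd_add_left_iff[OF st, of "u - s"] by simp
  then show "\<kappa> a b s = \<kappa> a b t" by (simp add: residue_class_def)
qed

lemma PIdl_f: "PIdl\<^bsub>class_ring\<^esub> (f\<^sub>E a b) = {s. f\<^sub>E a b dvd s}"
  by (auto simp: cgenideal_def dvd_def mult.commute)

lemma rcoset_f: "(+>\<^bsub>class_ring\<^esub>) (PIdl\<^bsub>class_ring\<^esub> (f\<^sub>E a b)) = \<kappa> a b"
proof
  show "PIdl\<^bsub>class_ring\<^esub> (f\<^sub>E a b) +>\<^bsub>class_ring\<^esub> t = \<kappa> a b t" for t
  proof (intro Set.set_eqI iffI)
    fix s assume "s \<in> \<kappa> a b t"
    then have "f\<^sub>E a b dvd s - t" "s = s - t + t" by (simp_all add: residue_class_def)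
    then show "s \<in> PIdl\<^bsub>class_ring\<^esub> (f\<^sub>E a b) +>\<^bsub>class_ring\<^esub> t" unfolding PIdl_f a_r_coset_def' by auto
  qed (auto simp: PIdl_f a_r_coset_def' residue_class_def)
qed

lemma PIdl_ideal: "ideal (PIdl\<^bsub>class_ring\<^esub> (f\<^sub>E a b)) class_ring"
  by (rule cring.cgenideal_ideal[OF class_cring.is_cring]) simp

lemma S_cring: "cring (S\<^sub>E a b)"
  unfolding S\<^sub>E_def by (rule ideal.quotient_is_cring[OF PIdl_ideal class_cring.is_cring])

lemma S_hom: "ring_hom_ring class_ring (S\<^sub>E a b) (\<kappa> a b)"
  using ideal.rcos_ring_hom_ring[OF PIdl_ideal] unfolding rcoset_f S\<^sub>E_def .

lemma S_simps [simp]: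
  "\<kappa> a b s \<oplus>\<^bsub>S\<^sub>E a b\<^esub> \<kappa> a b t = \<kappa> a b (s + t)" "\<kappa> a b s \<otimes>\<^bsub>S\<^sub>E a b\<^esub> \<kappa> a b t = \<kappa> a b (s * t)"
  "\<one>\<^bsub>S\<^sub>E a b\<^esub> = \<kappa> a b 1" "\<zero>\<^bsub>S\<^sub>E a b\<^esub> = \<kappa> a b 0" "\<kappa> a b t \<in> carrier (S\<^sub>E a b)"
proof -
  interpret ring_hom_ring class_ring "S\<^sub>E a b" "\<kappa> a b" by (rule S_hom)
  show "\<kappa> a b s \<oplus>\<^bsub>S\<^sub>E a b\<^esub> \<kappa> a b t = \<kappa> a b (s + t)" using hom_add[of s t] by simp
  show "\<kappa> a b s \<otimes>\<^bsub>S\<^sub>E a b\<^esub> \<kappa> a b t = \<kappa> a b (s * t)" using hom_mult[of s t] by simp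
  show "\<one>\<^bsub>S\<^sub>E a b\<^esub> = \<kappa> a b 1" using hom_one by simp
  show "\<zero>\<^bsub>S\<^sub>E a b\<^esub> = \<kappa> a b 0" using hom_zero by simp
  show "\<kappa> a b t \<in> carrier (S\<^sub>E a b)" using hom_closed[of t] by simp
qed

lemma S_carrier: "carrier (S\<^sub>E a b) = range (\<kappa> a b)"
  unfolding S\<^sub>E_def FactRing_def A_RCOSETS_def' rcoset_f[symmetric] by auto

lemma S_carrierE: "x \<in> carrier (S\<^sub>E a b) \<Longrightarrow> (\<And>t. x = \<kappa> a b t \<Longrightarrow> P) \<Longrightarrow> P"
  unfolding S_carrier by blast

lemma S_minus [simp]: "\<ominus>\<^bsub>S\<^sub>E a b\<^esub> \<kappa> a b t = \<kappa> a b (- t)"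
proof -
  interpret cring "S\<^sub>E a b" by (rule S_cring)
  show ?thesis by (rule minus_equality) simp_all
qed

lemma S_domain: "domain (S\<^sub>E a b)"
proof (rule domain.intro[OF S_cring], unfold_locales)
  have "\<not> f\<^sub>E a b dvd 1"
  proof
    assume "f\<^sub>E a b dvd 1"
    then obtain k where "1 = f\<^sub>E a b * k" by (rule dvdE)
    then have "(1 :: 'a T) $ 0 $ 0 $ 0 = (f\<^sub>E a b * k) $ 0 $ 0 $ 0" by simp
    then show False by simp
  qed
  then show "\<one>\<^bsub>S\<^sub>E a b\<^esub> \<noteq> \<zero>\<^bsub>S\<^sub>E a b\<^esub>" by (simp add: residue_class_eq_iff)
next
  fix x y assume xy: "x \<otimes>\<^bsub>S\<^sub>E a b\<^esub> y = \<zero>\<^bsub>S\<^sub>E a b\<^esub>" "x \<in> carrier (S\<^sub>E a b)" "y \<in> carrier (S\<^sub>E a b)"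
  then obtain s t where "x = \<kappa> a b s" "y = \<kappa> a b t" by (auto elim!: S_carrierE)
  then show "x = \<zero>\<^bsub>S\<^sub>E a b\<^esub> \<or> y = \<zero>\<^bsub>S\<^sub>E a b\<^esub>" using xy(1) f_prime[of a b s t] by (simp add: residue_class_eq_iff)
qed

interpretation S: domain "S\<^sub>E a b" for a b :: "'k::field"
  by (rule S_domain)

section \<open>The maximal ideal, the primes and the dimension of the hypersurface ring\<close>

definition max_S :: "'k::field \<Rightarrow> 'k \<Rightarrow> 'k T set set" where
  "max_S a b = \<kappa> a b ` {t. t $ 0 $ 0 $ 0 = 0}"

lemma residue_class_image_iff:
  assumes P: "tprime P" "f\<^sub>E a b \<in> P" shows "\<kappa> a b t \<in> \<kappa> a b ` P \<longleftrightarrow> t \<in> P"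
proof
  assume "\<kappa> a b t \<in> \<kappa> a b ` P"
  then obtain s where s: "s \<in> P" "f\<^sub>E a b dvd t - s" by (auto simp: residue_class_eq_iff)
  then obtain k where "t - s = f\<^sub>E a b * k" by (auto elim: dvdE)
  then have "t = s + k * f\<^sub>E a b" by (simp add: algebra_simps)
  then show "t \<in> P" using s(1) P by (simp add: tprime_def)
qed simp

lemma prime_image:
  assumes P: "tprime P" "f\<^sub>E a b \<in> P" shows "primeideal (\<kappa> a b ` P) (S\<^sub>E a b)"
proof (rule primeidealI)
  note iff = residue_class_image_iff[OF P]
  note D = P(1)[unfolded tprime_def]
  show "cring (S\<^sub>E a b)" by (rule S_cring)
  show "ideal (\<kappa> a b ` P) (S\<^sub>E a b)"
  proof (rule idealI)
    show "ring (S\<^sub>E a b)" by (rule S.ring_axioms)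
    show "subgroup (\<kappa> a b ` P) (add_monoid (S\<^sub>E a b))"
    proof (rule group.subgroupI[OF S.add.is_group])
      show "\<kappa> a b ` P \<noteq> {}" using D by auto
      show "inv\<^bsub>add_monoid (S\<^sub>E a b)\<^esub> x \<in> \<kappa> a b ` P" if x: "x \<in> \<kappa> a b ` P" for x
      proof -
        obtain t where t: "x = \<kappa> a b t" "t \<in> P" using x by auto
        then have "(- 1) * t \<in> P" using D by blast
        moreover have "inv\<^bsub>add_monoid (S\<^sub>E a b)\<^esub> x = \<kappa> a b ((- 1) * t)" unfolding a_inv_def[symmetric] t(1) by simp
        ultimately show ?thesis by (simp only: iff)
      qed
      show "x \<otimes>\<^bsub>add_monoid (S\<^sub>E a b)\<^esub> y \<in> \<kappa> a b ` P" if "x \<in> \<kappa> a b ` P" "y \<in> \<kappa> a b ` P" for x y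
        using that D by (auto simp: iff)
    qed auto
    show "x \<otimes>\<^bsub>S\<^sub>E a b\<^esub> y \<in> \<kappa> a b ` P" "y \<otimes>\<^bsub>S\<^sub>E a b\<^esub> x \<in> \<kappa> a b ` P" if "y \<in> \<kappa> a b ` P" "x \<in> carrier (S\<^sub>E a b)" for x y
      using that D by (auto simp: iff mult.commute elim!: S_carrierE)
  qed
  have "\<kappa> a b 1 \<notin> \<kappa> a b ` P" using D by (simp only: iff simp_thms)
  then show "carrier (S\<^sub>E a b) \<noteq> \<kappa> a b ` P" using S_simps(5) by blast
  show "x \<in> \<kappa> a b ` P \<or> y \<in> \<kappa> a b ` P"
    if "x \<in> carrier (S\<^sub>E a b)" "y \<in> carrier (S\<^sub>E a b)" "x \<otimes>\<^bsub>S\<^sub>E a b\<^esub> y \<in> \<kappa> a b ` P" for x y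
  proof -
    obtain s t where "x = \<kappa> a b s" "y = \<kappa> a b t" using \<open>x \<in> carrier (S\<^sub>E a b)\<close> \<open>y \<in> carrier (S\<^sub>E a b)\<close> by (metis S_carrierE)
    then show ?thesis using that(3) D by (simp add: iff del: image_iff)
  qed
qed

lemma prime_preimage:
  assumes "primeideal P (S\<^sub>E a b)" shows "tprime {t. \<kappa> a b t \<in> P}" "f\<^sub>E a b \<in> {t. \<kappa> a b t \<in> P}"
proof -
  interpret primeideal P "S\<^sub>E a b" by fact
  have 0: "\<kappa> a b 0 \<in> P" using additive_subgroup.zero_closed[OF additive_subgroup_axioms] by simp
  have "\<kappa> a b (f\<^sub>E a b) = \<kappa> a b 0" by (simp add: residue_class_eq_iff)
  then show "f\<^sub>E a b \<in> {t. \<kappa> a b t \<in> P}" using 0 by simp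
  show "tprime {t. \<kappa> a b t \<in> P}" unfolding tprime_def
  proof (intro conjI ballI allI impI)
    show "0 \<in> {t. \<kappa> a b t \<in> P}" using 0 by simp
    show "s + t \<in> {t. \<kappa> a b t \<in> P}" if "s \<in> {t. \<kappa> a b t \<in> P}" "t \<in> {t. \<kappa> a b t \<in> P}" for s t
      using a_closed[of "\<kappa> a b s" "\<kappa> a b t"] that by simp
    show "r * s \<in> {t. \<kappa> a b t \<in> P}" if "s \<in> {t. \<kappa> a b t \<in> P}" for r s
      using I_l_closed[of "\<kappa> a b s" "\<kappa> a b r"] that by simp
    show "1 \<notin> {t. \<kappa> a b t \<in> P}" using one_imp_carrier I_notcarr by auto
    show "s \<in> {t. \<kappa> a b t \<in> P} \<or> t \<in> {t. \<kappa> a b t \<in> P}" if "s * t \<in> {t. \<kappa> a b t \<in> P}" for s t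
      using I_prime[of "\<kappa> a b s" "\<kappa> a b t"] that by simp
  qed
qed

lemma tprime_max: "tprime {t :: 'k::field T. t $ 0 $ 0 $ 0 = 0}"
  by (auto simp: tprime_def)

lemma tprime_res_Y: "tprime {t :: 'k::field T. res_Y t = 0}"
  by (auto simp: tprime_def res_Y.hom_add res_Y.hom_mult)

lemma tprime_f: "tprime {t. f\<^sub>E a b dvd t}"
  using f_prime S.one_not_zero[of a b] by (auto simp: tprime_def residue_class_eq_iff)

lemma max_S_ideal: "ideal (max_S a b) (S\<^sub>E a b)"
  using prime_image[OF tprime_max, of a b] unfolding max_S_def primeideal_def by simp

lemma max_S_iff: "\<kappa> a b t \<in> max_S a b \<longleftrightarrow> t $ 0 $ 0 $ 0 = 0"
  using residue_class_image_iff[OF tprime_max, of a b t] by (simp add: max_S_def)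

lemma ideal_le_max_S:
  assumes "ideal J (S\<^sub>E a b)" shows "J \<subseteq> max_S a b \<or> J = carrier (S\<^sub>E a b)"
proof (rule disjCI)
  interpret ideal J "S\<^sub>E a b" by fact
  assume "J \<noteq> carrier (S\<^sub>E a b)"
  show "J \<subseteq> max_S a b"
  proof (rule subsetI, rule ccontr)
    fix x assume x: "x \<in> J" "x \<notin> max_S a b"
    then obtain t where t: "x = \<kappa> a b t" using a_subset by (auto elim!: S_carrierE)
    then have "t $ 0 $ 0 $ 0 \<noteq> 0" using x max_S_iff by auto
    then obtain s where "t * s = 1" using T_unit by blast
    then have "\<one>\<^bsub>S\<^sub>E a b\<^esub> \<in> J" using I_r_closed[OF x(1), of "\<kappa> a b s"] by (simp add: t)
    then show False using one_imp_carrier \<open>J \<noteq> carrier (S\<^sub>E a b)\<close> by blast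
  qed
qed

lemma maximalideals_S: "{I. maximalideal I (S\<^sub>E a b)} = {max_S a b}"
proof -
  have ne: "carrier (S\<^sub>E a b) \<noteq> max_S a b"
  proof
    assume "carrier (S\<^sub>E a b) = max_S a b"
    then have "\<kappa> a b 1 \<in> max_S a b" using S_simps(5) by metis
    then show False by (simp add: max_S_iff)
  qed
  have "maximalideal (max_S a b) (S\<^sub>E a b)"
      proof (rule maximalidealI[OF max_S_ideal ne])
    fix J assume "ideal J (S\<^sub>E a b)" "max_S a b \<subseteq> J"
    then show "J = max_S a b \<or> J = carrier (S\<^sub>E a b)" using ideal_le_max_S[of J a b] by (metis subset_antisym)
  qed
  moreover have "I = max_S a b" if "maximalideal I (S\<^sub>E a b)" for I
  proof -
    interpret maximalideal I "S\<^sub>E a b" by fact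
    have "I \<subseteq> max_S a b" using ideal_le_max_S[OF ideal_axioms] I_notcarr by metis
    moreover have "max_S a b \<subseteq> carrier (S\<^sub>E a b)" by (auto simp: max_S_def)
    ultimately show ?thesis using I_maximal[OF max_S_ideal] ne by metis
  qed
  ultimately show ?thesis by blast
qed

text \<open>The chain 0, (X, Z), maximal ideal attains the value two; the upper bound pulls a chain
  of primes back to T.\<close>

lemma krull_dim_S: "krull_dim (S\<^sub>E a b) = 2"
proof (rule antisym)
  show "krull_dim (S\<^sub>E a b) \<le> 2" unfolding krull_dim_def
  proof (rule Sup_least, clarify)
    fix n P assume P: "\<forall>i\<le>n. primeideal (P i) (S\<^sub>E a b)" "\<forall>i<n. P i \<subset> P (Suc i)"
    show "enat n \<le> 2"
    proof (rule ccontr)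
      assume "\<not> enat n \<le> 2"
      then have n: "3 \<le> n" by (simp add: numeral_eq_enat)
      define Q where "Q i = {t. \<kappa> a b t \<in> P i}" for i
      show False
      proof (rule no_prime_chain[of Q a b])
        show "tprime (Q i)" "f\<^sub>E a b \<in> Q i" if "i \<le> 3" for i
          unfolding Q_def using prime_preimage[of "P i" a b] P(1) that n by auto
        show "Q i \<subset> Q (Suc i)" if "i < 3" for i
        proof -
          have s: "P i \<subset> P (Suc i)" using P(2) that n by auto
          then obtain x where x: "x \<in> P (Suc i)" "x \<notin> P i" by blast
          have "primeideal (P (Suc i)) (S\<^sub>E a b)" using P(1) that n by auto
          then have "x \<in> carrier (S\<^sub>E a b)" using x(1) additive_subgroup.a_subset[OF ideal.axioms(1)[OF primeideal.axioms(1)]] by blast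
          then obtain t where "x = \<kappa> a b t" by (auto elim!: S_carrierE)
          then show ?thesis using s x by (auto simp: Q_def)
        qed
      qed
    qed
  qed
  define P where "P i = \<kappa> a b ` (if i = 0 then {t. f\<^sub>E a b dvd t} else if i = 1 then {t. res_Y t = 0} else {t. t $ 0 $ 0 $ 0 = 0})" for i :: nat
  have "primeideal (P i) (S\<^sub>E a b)" for i
    unfolding P_def by (auto intro!: prime_image tprime_f tprime_res_Y tprime_max)
  moreover have "P i \<subset> P (Suc i)" if i: "i < 2" for i
  proof -
    have "P 0 \<subseteq> P 1" unfolding P_def by (auto elim!: dvdE simp: res_Y.hom_mult)
    moreover have "\<kappa> a b \<X> \<in> P 1" by (simp add: P_def)
    moreover have "\<kappa> a b \<X> \<notin> P 0"
    proof -
      have "\<not> f\<^sub>E a b dvd \<X>"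
      proof
        assume "f\<^sub>E a b dvd \<X>"
        then obtain k where "\<X> = f\<^sub>E a b * k" by (rule dvdE)
        then have "\<X> $ 0 $ 0 $ 1 = (f\<^sub>E a b * k) $ 0 $ 0 $ 1" by simp
        then show False by (simp add: \<X>_def fps_X_power_mult_nth)
      qed
      then show ?thesis using residue_class_image_iff[OF tprime_f, of a b a b \<X>] by (simp add: P_def)
    qed
    moreover have "P 1 \<subseteq> P 2" unfolding P_def by (auto simp: res_Y_def fps_eq_iff)
    moreover have "\<kappa> a b \<Y> \<in> P 2" by (simp add: P_def)
    moreover have "\<kappa> a b \<Y> \<notin> P 1" using residue_class_image_iff[OF tprime_res_Y, of a b \<Y>] by (simp add: P_def)
    moreover have "i = 0 \<or> i = 1" using i by auto
    ultimately show ?thesis by (auto simp: numeral_2_eq_2)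
  qed
  ultimately have "enat 2 \<in> {enat n | n. \<exists>P. (\<forall>i\<le>n. primeideal (P i) (S\<^sub>E a b)) \<and> (\<forall>i<n. P i \<subset> P (Suc i))}" by blast
  then show "2 \<le> krull_dim (S\<^sub>E a b)" unfolding krull_dim_def by (simp add: Sup_upper numeral_eq_enat)
qed

lemma max_S_list:
  "set xs \<subseteq> max_S a b \<Longrightarrow> \<exists>ts. xs = map (\<kappa> a b) ts \<and> (\<forall>t\<in>set ts. t $ 0 $ 0 $ 0 = 0)"
proof (induction xs)
  case (Cons x xs)
  then obtain ts t where "xs = map (\<kappa> a b) ts \<and> (\<forall>t\<in>set ts. t $ 0 $ 0 $ 0 = 0)" "x = \<kappa> a b t" "t $ 0 $ 0 $ 0 = 0"
    by (auto simp: max_S_def)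
  then show ?case by (intro exI[of _ "t # ts"]) auto
qed simp

section \<open>Presented modules\<close>

text \<open>\<open>G\<close> presents \<open>M\<close> as the quotient of the free module on the first \<open>N\<close> unit vectors by \<open>L\<close>;
  the coordinates from \<open>N\<close> on are ignored.\<close>

lemma ex_other: "A \<noteq> {z} \<Longrightarrow> z \<in> A \<Longrightarrow> \<exists>x\<in>A. x \<noteq> z"
  by blast

locale presented = Module.module "S\<^sub>E a b" M for a b :: "'k::field" and M :: "('k T set, 'm) module" +
  fixes G :: "(nat \<Rightarrow> 'k T) \<Rightarrow> 'm" and L :: "(nat \<Rightarrow> 'k T) set" and N :: nat
  assumes carrier_eq: "carrier M = range G"
    and G_add: "G (v + w) = G v \<oplus>\<^bsub>M\<^esub> G w" and G_scal: "G (t \<star> v) = \<kappa> a b t \<odot>\<^bsub>M\<^esub> G v"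
    and L_iff: "v \<in> L \<longleftrightarrow> G v = \<zero>\<^bsub>M\<^esub>" and G_support: "(\<forall>i<N. v i = 0) \<Longrightarrow> G v = \<zero>\<^bsub>M\<^esub>"
begin

lemma G_closed [simp]: "G v \<in> carrier M"
  by (simp add: carrier_eq)

lemma G_0: "G 0 = \<zero>\<^bsub>M\<^esub>"
  by (rule G_support) simp

lemma G_minus: "G (- v) = \<ominus>\<^bsub>M\<^esub> G v"
  using G_add[of "- v" v] G_0 by (intro M.minus_equality[symmetric]) simp_all

lemma G_eq_iff: "G v = G w \<longleftrightarrow> v - w \<in> L"
proof -
  have "G (v - w) = G v \<oplus>\<^bsub>M\<^esub> (\<ominus>\<^bsub>M\<^esub> G w)" using G_add[of v "- w"] by (simp add: G_minus)
  then show ?thesis unfolding L_iff using M.r_neg[of "G w"] M.minus_equality[of "G v" "\<ominus>\<^bsub>M\<^esub> G w"] by auto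
qed

lemma submod_L: "submod L"
  unfolding submod_def L_iff Ball_def by (auto simp: G_0 G_add G_scal)

lemma f_L: "f\<^sub>E a b \<star> v \<in> L"
proof -
  have "\<kappa> a b (f\<^sub>E a b) = \<kappa> a b 0" by (simp add: residue_class_eq_iff)
  then have "G (f\<^sub>E a b \<star> v) = G (0 \<star> v)" by (simp only: G_scal)
  then show ?thesis by (simp only: L_iff scal_simps G_0)
qed

lemma support_L: "(\<forall>i<N. v i = 0) \<Longrightarrow> v \<in> L"
  by (simp add: L_iff G_support)

lemma submodule_image: "submod L' \<Longrightarrow> submodule (S\<^sub>E a b) (G ` L') M"
  by (rule submodule.intro[OF module_axioms])
    (auto simp: submodD G_0[symmetric] elim!: S_carrierE simp flip: G_add G_scal)

lemma finitely_generated: "finitely_generated (S\<^sub>E a b) M"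
  unfolding finitely_generated_def
proof (intro exI conjI)
  let ?A = "(\<lambda>k. G (unit_fn k)) ` {..<N}"
  show "finite ?A" "?A \<subseteq> carrier M" by auto
  then interpret K: submodule "S\<^sub>E a b" "span ?A" M by (intro span_is_submodule)
  have A: "?A \<subseteq> span ?A" by (rule in_own_span) auto
  have "G (\<Sum>k<n. v k \<star> unit_fn k) \<in> span ?A" if "n \<le> N" for n v using that
  proof (induction n)
    case 0
    then show ?case using K.zero_closed G_0 by (simp add: zero_fun_def)
  next
    case (Suc n)
    then have "G (unit_fn n) \<in> span ?A" using A by auto
    then have "\<kappa> a b (v n) \<odot>\<^bsub>M\<^esub> G (unit_fn n) \<in> span ?A" by (intro K.smult_closed) simp_all
    moreover have "G (\<Sum>k<n. v k \<star> unit_fn k) \<in> span ?A" using Suc by simp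
    ultimately show ?case unfolding sum.lessThan_Suc G_add G_scal by (rule K.m_closed[rotated])
  qed
  note span = this
  have eq: "G v = G (\<Sum>k<N. v k \<star> unit_fn k)" for v
    unfolding G_eq_iff by (rule support_L) (simp add: sum_unit_fn)
  have "G v \<in> span ?A" for v by (subst eq[of v]) (rule span[OF order_refl])
  then show "span ?A = carrier M" using K.subset carrier_eq by auto
qed

section \<open>Regular sequences and depth of a presented module\<close>

lemma submod_foldl_adjoin: "submod L' \<Longrightarrow> submod (foldl adjoin L' ts)"
  by (induction ts arbitrary: L') (auto intro: submod_adjoin)

lemma foldl_adjoin_mono: "submod L' \<Longrightarrow> v \<in> L' \<Longrightarrow> v \<in> foldl adjoin L' ts"
  by (induction ts arbitrary: L') (auto intro: submod_adjoin adjoinI)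

lemma foldl_adjoin_mult: "submod L' \<Longrightarrow> t \<in> set ts \<Longrightarrow> t \<star> v \<in> foldl adjoin L' ts"
  by (induction ts arbitrary: L') (auto intro: submod_adjoin foldl_adjoin_mono adjoinI)

text \<open>The submodule generated by the products with x1, ..., xn corresponds to adjoining these
  elements one after the other, which turns regular sequences on M into statements about
  lattices.\<close>

lemma list_smult_module_iff:
  "G v \<in> list_smult_module (S\<^sub>E a b) M (map (\<kappa> a b) ts) \<longleftrightarrow> v \<in> foldl adjoin L ts"
proof
  define X where "X = {x \<odot>\<^bsub>M\<^esub> v | x v. x \<in> set (map (\<kappa> a b) ts) \<and> v \<in> carrier M}"
  have lsm: "list_smult_module (S\<^sub>E a b) M (map (\<kappa> a b) ts) = span X" by (simp add: list_smult_module_def X_def)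
  have XC: "X \<subseteq> carrier M" by (auto simp: X_def)
  note sub = submod_foldl_adjoin[OF submod_L, of ts]
  {
    assume "G v \<in> list_smult_module (S\<^sub>E a b) M (map (\<kappa> a b) ts)"
    moreover have "X \<subseteq> G ` foldl adjoin L ts"
      using foldl_adjoin_mult[OF submod_L] by (auto simp: X_def carrier_eq simp flip: G_scal)
    then have "span X \<subseteq> G ` foldl adjoin L ts" by (rule span_is_subset[OF _ submodule_image[OF sub]])
    ultimately obtain w where "w \<in> foldl adjoin L ts" "G v = G w" unfolding lsm by auto
    then show "v \<in> foldl adjoin L ts" using submod_cong[OF sub, of v w] foldl_adjoin_mono[OF submod_L] by (simp add: G_eq_iff)
  next
    interpret K: submodule "S\<^sub>E a b" "span X" M by (rule span_is_submodule[OF XC])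
    have X: "X \<subseteq> span X" by (rule in_own_span[OF XC])
    have "G v \<in> span X" if "v \<in> foldl adjoin L' us" "\<And>v. v \<in> L' \<Longrightarrow> G v \<in> span X" "set us \<subseteq> set ts" for L' us v
      using that
    proof (induction us arbitrary: L')
      case (Cons u us)
      have "G w \<in> span X" if w: "w \<in> adjoin L' u" for w
      proof -
        obtain w' where w': "w - u \<star> w' \<in> L'" using w by (auto simp: adjoin_def)
        have "\<kappa> a b u \<odot>\<^bsub>M\<^esub> G w' \<in> X" unfolding X_def
          using Cons.prems(3) by (auto intro!: exI[of _ "\<kappa> a b u"] exI[of _ "G w'"])
        then have "G (w - u \<star> w') \<oplus>\<^bsub>M\<^esub> \<kappa> a b u \<odot>\<^bsub>M\<^esub> G w' \<in> span X" using Cons.prems(2)[OF w'] X by blast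
        then show ?thesis unfolding G_scal[symmetric] G_add[symmetric] by simp
      qed
      then show ?case using Cons by simp
    qed simp
    then show "v \<in> foldl adjoin L ts \<Longrightarrow> G v \<in> list_smult_module (S\<^sub>E a b) M (map (\<kappa> a b) ts)"
      unfolding lsm using L_iff K.zero_closed by (metis order_refl)
  }
qed

lemma regular_sequence_iff:
  "regular_sequence (S\<^sub>E a b) M (map (\<kappa> a b) ts) \<longleftrightarrow>
    (\<forall>i<length ts. \<forall>v. ts ! i \<star> v \<in> foldl adjoin L (take i ts) \<longrightarrow> v \<in> foldl adjoin L (take i ts)) \<and>
    (\<exists>v. v \<notin> foldl adjoin L ts)"
proof -
  have "list_smult_module (S\<^sub>E a b) M (map (\<kappa> a b) ts) \<subseteq> carrier M"
    unfolding list_smult_module_def by (rule span_is_subset2) auto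
  then have "list_smult_module (S\<^sub>E a b) M (map (\<kappa> a b) ts) \<noteq> carrier M \<longleftrightarrow> (\<exists>v. v \<notin> foldl adjoin L ts)"
    unfolding list_smult_module_iff[symmetric] carrier_eq by blast
  moreover have "(\<forall>v\<in>carrier M. P v) \<longleftrightarrow> (\<forall>v. P (G v))" for P by (auto simp: carrier_eq)
  ultimately show ?thesis
    unfolding regular_sequence_def
    by (auto simp: take_map list_smult_module_iff simp flip: G_scal cong: conj_cong)
qed

lemma mcmD:
  assumes "maximal_cohen_macaulay (S\<^sub>E a b) M"
  obtains x1 x2 where "x1 $ 0 $ 0 $ 0 = 0" "x2 $ 0 $ 0 $ 0 = 0" "\<And>v. x1 \<star> v \<in> L \<Longrightarrow> v \<in> L"
    "\<And>v. x2 \<star> v \<in> adjoin L x1 \<Longrightarrow> v \<in> adjoin L x1" "\<exists>v. v \<notin> L"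
proof -
  have "depth (S\<^sub>E a b) (max_S a b) M = 2"
    using assms maximalideals_S[of a b] by (auto simp: maximal_cohen_macaulay_def krull_dim_S)
  \<comment> \<open>A supremum that exceeds 1 is exceeded by some member, hence a regular sequence
    of length at least two exists.\<close>
  then have "\<not> depth (S\<^sub>E a b) (max_S a b) M \<le> 1" by (simp add: numeral_eq_enat one_enat_def)
  then obtain xs where xs: "set xs \<subseteq> max_S a b" "regular_sequence (S\<^sub>E a b) M xs" "\<not> enat (length xs) \<le> 1"
    unfolding depth_def Sup_le_iff by blast
  have "\<exists>ts. xs = map (\<kappa> a b) ts \<and> (\<forall>t\<in>set ts. t $ 0 $ 0 $ 0 = 0)" by (rule max_S_list[OF xs(1)])
  then obtain ts where ts: "xs = map (\<kappa> a b) ts" "\<forall>t\<in>set ts. t $ 0 $ 0 $ 0 = 0" by blast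
  note reg = xs(2)[unfolded ts(1) regular_sequence_iff]
  have "1 < length ts" using xs(3) ts(1) by (simp add: one_enat_def)
  then obtain x1 x2 us where us: "ts = x1 # x2 # us" by (cases ts; cases "tl ts") auto
  show thesis
  proof (rule that[of x1 x2])
    show "x1 $ 0 $ 0 $ 0 = 0" "x2 $ 0 $ 0 $ 0 = 0" using ts(2) us by auto
    show "v \<in> L" if "x1 \<star> v \<in> L" for v using conjunct1[OF reg, rule_format, of 0 v] that us by simp
    show "v \<in> adjoin L x1" if "x2 \<star> v \<in> adjoin L x1" for v using conjunct1[OF reg, rule_format, of 1 v] that us by simp
    show "\<exists>v. v \<notin> L" using conjunct2[OF reg] foldl_adjoin_mono[OF submod_L] by blast
  qed
qed

lemma mcmI:
  assumes Z: "\<And>v. \<Z> \<star> v \<in> L \<Longrightarrow> v \<in> L" and Y: "\<And>v. \<Y> \<star> v \<in> adjoin L \<Z> \<Longrightarrow> v \<in> adjoin L \<Z>"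
    and YL: "\<And>v. \<Y> \<star> v \<in> L \<Longrightarrow> v \<in> L" and v0: "v0 \<notin> adjoin (adjoin L \<Z>) \<Y>"
  shows "maximal_cohen_macaulay (S\<^sub>E a b) M"
proof -
  have "depth (S\<^sub>E a b) (max_S a b) M = 2"
  proof (rule antisym)
    show "depth (S\<^sub>E a b) (max_S a b) M \<le> 2" unfolding depth_def
    proof (rule Sup_least, clarify)
      fix xs assume xs: "set xs \<subseteq> max_S a b" "regular_sequence (S\<^sub>E a b) M xs"
      show "enat (length xs) \<le> 2"
      proof (rule ccontr)
        assume "\<not> enat (length xs) \<le> 2"
        then have "2 < length xs" by (simp add: numeral_eq_enat)
        moreover have "\<exists>ts. xs = map (\<kappa> a b) ts \<and> (\<forall>t\<in>set ts. t $ 0 $ 0 $ 0 = 0)" by (rule max_S_list[OF xs(1)])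
        ultimately obtain ts where ts: "xs = map (\<kappa> a b) ts" "\<forall>t\<in>set ts. t $ 0 $ 0 $ 0 = 0" "2 < length ts" by auto
        then obtain x1 x2 x3 us where us: "ts = x1 # x2 # x3 # us" by (cases ts; cases "tl ts"; cases "tl (tl ts)") auto
        note reg = conjunct1[OF xs(2)[unfolded ts(1) regular_sequence_iff], rule_format]
        show False
          by (rule regular_length_le_2[OF submod_L f_L Z YL Y v0, of x1 x2 x3])
            (use ts(2) us reg[of 0] reg[of 1] reg[of 2] in \<open>auto simp: numeral_2_eq_2\<close>)
      qed
    qed
    have "set (map (\<kappa> a b) [\<Z>, \<Y>]) \<subseteq> max_S a b" by (simp add: max_S_iff)
    moreover have "regular_sequence (S\<^sub>E a b) M (map (\<kappa> a b) [\<Z>, \<Y>])"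
      unfolding regular_sequence_iff using Z Y v0 by (auto simp: less_Suc_eq)
    ultimately have "enat (length (map (\<kappa> a b) [\<Z>, \<Y>])) \<le> depth (S\<^sub>E a b) (max_S a b) M"
      unfolding depth_def by (intro Sup_upper) blast
    then show "2 \<le> depth (S\<^sub>E a b) (max_S a b) M" by (simp add: numeral_eq_enat numeral_2_eq_2)
  qed
  then show ?thesis unfolding maximal_cohen_macaulay_def maximalideals_S krull_dim_S
    using module_axioms finitely_generated by simp
qed

text \<open>Nonzero elements of two direct summands are proportional, so a common multiple lies in
  the intersection and is zero; torsion-freeness then makes one of them zero.\<close>

lemma indecomposable:
  assumes ne: "\<exists>v. v \<notin> L" and tf: "\<And>s v. \<not> f\<^sub>E a b dvd s \<Longrightarrow> s \<star> v \<in> L \<Longrightarrow> v \<in> L"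
    and rank: "\<And>v w. \<exists>s t. \<not> (f\<^sub>E a b dvd s \<and> f\<^sub>E a b dvd t) \<and> s \<star> v - t \<star> w \<in> L"
  shows "indecomposable (S\<^sub>E a b) M"
  unfolding indecomposable_def
proof (intro conjI allI impI)
  show "Module.module (S\<^sub>E a b) M" by (rule module_axioms)
  obtain v where "v \<notin> L" using ne by (rule exE)
  then have "G v \<noteq> \<zero>\<^bsub>M\<^esub>" unfolding L_iff .
  then show "carrier M \<noteq> {\<zero>\<^bsub>M\<^esub>}" using G_closed[of v] by (metis singletonD)
  fix N1 N2
  assume A: "submodule (S\<^sub>E a b) N1 M \<and> submodule (S\<^sub>E a b) N2 M \<and> N1 \<inter> N2 = {\<zero>\<^bsub>M\<^esub>} \<and> N1 <+>\<^bsub>M\<^esub> N2 = carrier M"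
  show "N1 = {\<zero>\<^bsub>M\<^esub>} \<or> N2 = {\<zero>\<^bsub>M\<^esub>}"
  proof (rule ccontr)
    interpret N1: submodule "S\<^sub>E a b" N1 M using A by simp
    interpret N2: submodule "S\<^sub>E a b" N2 M using A by simp
    assume "\<not> ?thesis"
    then have ne: "N1 \<noteq> {\<zero>\<^bsub>M\<^esub>}" "N2 \<noteq> {\<zero>\<^bsub>M\<^esub>}" by simp_all
    obtain x where x: "x \<in> N1" "x \<noteq> \<zero>\<^bsub>M\<^esub>" using ex_other[OF ne(1) N1.zero_closed] by (rule bexE)
    obtain y where y: "y \<in> N2" "y \<noteq> \<zero>\<^bsub>M\<^esub>" using ex_other[OF ne(2) N2.zero_closed] by (rule bexE)
    note xy = x y
    have "x \<in> range G" "y \<in> range G" using xy(1,3) N1.subset N2.subset unfolding carrier_eq by (simp_all only: subsetD)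
    then obtain v w where vw: "x = G v" "y = G w" by (elim rangeE)
    obtain s t where st: "\<not> (f\<^sub>E a b dvd s \<and> f\<^sub>E a b dvd t)" "s \<star> v - t \<star> w \<in> L" using rank by blast
    have eq: "\<kappa> a b s \<odot>\<^bsub>M\<^esub> x = \<kappa> a b t \<odot>\<^bsub>M\<^esub> y" using st(2) unfolding vw G_eq_iff[symmetric] G_scal .
    have "\<kappa> a b s \<odot>\<^bsub>M\<^esub> x \<in> N1" "\<kappa> a b t \<odot>\<^bsub>M\<^esub> y \<in> N2" using xy by auto
    then have "\<kappa> a b s \<odot>\<^bsub>M\<^esub> x \<in> N1 \<inter> N2" using eq by simp
    then have "\<kappa> a b s \<odot>\<^bsub>M\<^esub> x = \<zero>\<^bsub>M\<^esub>" using A by simp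
    then have "\<kappa> a b s \<odot>\<^bsub>M\<^esub> x = \<zero>\<^bsub>M\<^esub>" "\<kappa> a b t \<odot>\<^bsub>M\<^esub> y = \<zero>\<^bsub>M\<^esub>" using eq by simp_all
    then have "s \<star> v \<in> L" "t \<star> w \<in> L" by (simp_all add: L_iff G_scal vw)
    then have "v \<in> L \<or> w \<in> L" using tf[of s v] tf[of t w] st(1) by metis
    then show False using xy vw by (simp add: L_iff)
  qed
qed

end

text \<open>All module axioms hold for vectors and descend along the surjection \<open>G\<close>, so
  only compatibility of \<open>G\<close> with the operations has to be checked.\<close>

lemma presentedI:
  fixes M :: "('k::field T set, 'm) module"
  assumes "carrier M = range G" "\<zero>\<^bsub>M\<^esub> = G 0" "\<And>v w. G (v + w) = G v \<oplus>\<^bsub>M\<^esub> G w"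
    and "\<And>t v. G (t \<star> v) = \<kappa> a b t \<odot>\<^bsub>M\<^esub> G v" "\<And>v. v \<in> L \<longleftrightarrow> G v = G 0" "\<And>v. (\<forall>i<N. v i = 0) \<Longrightarrow> G v = G 0"
  shows "presented a b M G L N"
proof (intro presented.intro presented_axioms.intro)
  note plus = assms(3)[symmetric] and scal = assms(4)[symmetric]
  have ag: "abelian_group M"
  proof (rule abelian_groupI, unfold assms(1,2))
    show "x \<oplus>\<^bsub>M\<^esub> y \<in> range G" if "x \<in> range G" "y \<in> range G" for x y using that by (elim rangeE) (simp add: plus)
    show "G 0 \<in> range G" by simp
    show "x \<oplus>\<^bsub>M\<^esub> y \<oplus>\<^bsub>M\<^esub> z = x \<oplus>\<^bsub>M\<^esub> (y \<oplus>\<^bsub>M\<^esub> z)" if "x \<in> range G" "y \<in> range G" "z \<in> range G" for x y z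
      using that by (elim rangeE) (simp add: plus add.assoc)
    show "x \<oplus>\<^bsub>M\<^esub> y = y \<oplus>\<^bsub>M\<^esub> x" if "x \<in> range G" "y \<in> range G" for x y
      using that by (elim rangeE) (simp add: plus add.commute)
    show "G 0 \<oplus>\<^bsub>M\<^esub> x = x" if "x \<in> range G" for x using that by (elim rangeE) (simp only: plus add_0_left)
    show "\<exists>y\<in>range G. y \<oplus>\<^bsub>M\<^esub> x = G 0" if x: "x \<in> range G" for x
    proof -
      obtain v where v: "x = G v" using x by blast
      have "G (- v) \<oplus>\<^bsub>M\<^esub> x = G 0" unfolding v plus by simp
      then show ?thesis by (intro bexI[of _ "G (- v)"] rangeI)
    qed
  qed
  show "Module.module (S\<^sub>E a b) M"
  proof (rule moduleI[OF S_cring ag], unfold assms(1))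
    show "r \<odot>\<^bsub>M\<^esub> x \<in> range G" if "r \<in> carrier (S\<^sub>E a b)" "x \<in> range G" for r x
      using that by (elim S_carrierE rangeE) (simp add: scal)
    show "(r \<oplus>\<^bsub>S\<^sub>E a b\<^esub> s) \<odot>\<^bsub>M\<^esub> x = r \<odot>\<^bsub>M\<^esub> x \<oplus>\<^bsub>M\<^esub> s \<odot>\<^bsub>M\<^esub> x"
      if "r \<in> carrier (S\<^sub>E a b)" "s \<in> carrier (S\<^sub>E a b)" "x \<in> range G" for r s x
      using that by (elim S_carrierE rangeE) (simp only: S_simps scal plus scal_simps)
    show "r \<odot>\<^bsub>M\<^esub> (x \<oplus>\<^bsub>M\<^esub> y) = r \<odot>\<^bsub>M\<^esub> x \<oplus>\<^bsub>M\<^esub> r \<odot>\<^bsub>M\<^esub> y"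
      if "r \<in> carrier (S\<^sub>E a b)" "x \<in> range G" "y \<in> range G" for r x y
      using that by (elim S_carrierE rangeE) (simp only: S_simps scal plus scal_simps)
    show "(r \<otimes>\<^bsub>S\<^sub>E a b\<^esub> s) \<odot>\<^bsub>M\<^esub> x = r \<odot>\<^bsub>M\<^esub> (s \<odot>\<^bsub>M\<^esub> x)"
      if "r \<in> carrier (S\<^sub>E a b)" "s \<in> carrier (S\<^sub>E a b)" "x \<in> range G" for r s x
      using that by (elim S_carrierE rangeE) (simp only: S_simps scal scal_simps)
    show "\<one>\<^bsub>S\<^sub>E a b\<^esub> \<odot>\<^bsub>M\<^esub> x = x" if "x \<in> range G" for x
      using that by (elim rangeE) (simp only: S_simps scal scal_simps)
  qed
  show "carrier M = range G" by (rule assms)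
  show "G (v + w) = G v \<oplus>\<^bsub>M\<^esub> G w" for v w by (rule assms)
  show "G (t \<star> v) = \<kappa> a b t \<odot>\<^bsub>M\<^esub> G v" for t v by (rule assms)
  show "v \<in> L \<longleftrightarrow> G v = \<zero>\<^bsub>M\<^esub>" for v unfolding assms(2) by (rule assms)
  show "(\<forall>i<N. v i = 0) \<Longrightarrow> G v = \<zero>\<^bsub>M\<^esub>" for v unfolding assms(2) by (rule assms)
qed

lemma ex_presented:
  fixes M :: "('k::field T set, 'm) module"
  assumes "Module.module (S\<^sub>E a b) M" "finitely_generated (S\<^sub>E a b) M"
  obtains G L N where "presented a b M G L N"
proof -
  interpret Module.module "S\<^sub>E a b" M by fact
  obtain A where A: "finite A" "A \<subseteq> carrier M" "span A = carrier M" using assms(2) by (auto simp: finitely_generated_def)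
  define N where "N = card A"
  obtain g where g: "bij_betw g {..<N} A" using ex_bij_betw_nat_finite[OF A(1)] by (auto simp: N_def lessThan_atLeast0)
  then have gA: "g ` {..<N} = A" "inj_on g {..<N}" by (auto simp: bij_betw_def)
  then have gC [simp]: "k < N \<Longrightarrow> g k \<in> carrier M" for k using A(2) by auto
  define G where "G v = (\<Oplus>\<^bsub>M\<^esub>k\<in>{..<N}. \<kappa> a b (v k) \<odot>\<^bsub>M\<^esub> g k)" for v
  have "carrier M \<subseteq> range G"
  proof
    fix x assume "x \<in> carrier M"
    then obtain c where c: "c \<in> A \<rightarrow> carrier (S\<^sub>E a b)" "lincomb c A = x" using finite_in_span[OF A(1,2)] A(3) by auto
    have "\<forall>k. \<exists>t. k < N \<longrightarrow> c (g k) = \<kappa> a b t" using c(1) gA(1) S_carrier[of a b] by blast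
    from choice[OF this] obtain v where v: "\<And>k. k < N \<Longrightarrow> c (g k) = \<kappa> a b (v k)" by blast
    have "x = (\<Oplus>\<^bsub>M\<^esub>y\<in>g ` {..<N}. c y \<odot>\<^bsub>M\<^esub> y)" using c(2) by (simp add: lincomb_def gA)
    also have "\<dots> = (\<Oplus>\<^bsub>M\<^esub>k\<in>{..<N}. c (g k) \<odot>\<^bsub>M\<^esub> g k)"
      by (rule M.finsum_reindex) (use c(1) gA in \<open>auto simp: Pi_iff\<close>)
    also have "\<dots> = G v" unfolding G_def by (rule M.finsum_cong') (auto simp: v)
    finally show "x \<in> range G" by simp
  qed
  then have car: "carrier M = range G" by (auto simp: G_def intro!: M.finsum_closed)
  have sup: "G v = \<zero>\<^bsub>M\<^esub>" if "\<forall>i<N. v i = 0" for v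
    unfolding G_def by (rule M.add.finprod_one_eqI) (use that in \<open>simp add: smult_l_null[simplified]\<close>)
  have "presented a b M G {v. G v = \<zero>\<^bsub>M\<^esub>} N"
  proof (intro presented.intro presented_axioms.intro)
    show "G (v + w) = G v \<oplus>\<^bsub>M\<^esub> G w" for v w
    proof -
      have "G (v + w) = (\<Oplus>\<^bsub>M\<^esub>k\<in>{..<N}. \<kappa> a b (v k) \<odot>\<^bsub>M\<^esub> g k \<oplus>\<^bsub>M\<^esub> \<kappa> a b (w k) \<odot>\<^bsub>M\<^esub> g k)"
        unfolding G_def by (rule M.finsum_cong') (auto simp: smult_l_distr simp flip: S_simps(1))
      also have "\<dots> = G v \<oplus>\<^bsub>M\<^esub> G w" unfolding G_def by (rule M.finsum_addf) auto
      finally show ?thesis .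
    qed
    show "G (t \<star> v) = \<kappa> a b t \<odot>\<^bsub>M\<^esub> G v" for t v
      unfolding G_def by (subst finsum_smult_ldistr) (auto intro!: M.finsum_cong' simp: scal_apply smult_assoc1 simp flip: S_simps(2))
    show "Module.module (S\<^sub>E a b) M" by (rule assms)
    show "carrier M = range G" by (rule car)
    show "v \<in> {v. G v = \<zero>\<^bsub>M\<^esub>} \<longleftrightarrow> G v = \<zero>\<^bsub>M\<^esub>" for v by simp
    show "(\<forall>i<N. v i = 0) \<Longrightarrow> G v = \<zero>\<^bsub>M\<^esub>" for v by (rule sup)
  qed
  then show thesis by (rule that)
qed

section \<open>Isomorphic modules\<close>

lemma module_iso_iff:
  "module_iso R M N \<longleftrightarrow> Module.module R M \<and> Module.module R N \<and> (\<exists>h. bij_betw h (carrier M) (carrier N) \<and>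
    (\<forall>x\<in>carrier M. \<forall>y\<in>carrier M. h (x \<oplus>\<^bsub>M\<^esub> y) = h x \<oplus>\<^bsub>N\<^esub> h y) \<and>
    (\<forall>r\<in>carrier R. \<forall>x\<in>carrier M. h (r \<odot>\<^bsub>M\<^esub> x) = r \<odot>\<^bsub>N\<^esub> h x))"
proof -
  have 1: "h \<in> LinearCombinations.module_hom R M N \<longleftrightarrow> h \<in> carrier M \<rightarrow> carrier N \<and>
    (\<forall>x\<in>carrier M. \<forall>y\<in>carrier M. h (x \<oplus>\<^bsub>M\<^esub> y) = h x \<oplus>\<^bsub>N\<^esub> h y) \<and>
    (\<forall>r\<in>carrier R. \<forall>x\<in>carrier M. h (r \<odot>\<^bsub>M\<^esub> x) = r \<odot>\<^bsub>N\<^esub> h x)" for h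
    unfolding LinearCombinations.module_hom_def by auto
  have 2: "bij_betw h (carrier M) (carrier N) \<Longrightarrow> h \<in> carrier M \<rightarrow> carrier N" for h
    by (auto simp: bij_betw_def)
  show ?thesis unfolding module_iso_def mod_hom_def mod_hom_axioms_def 1 using 2 by (intro iffI; elim exE conjE; intro exI conjI; assumption?) auto
qed

lemma module_isoI:
  assumes "Module.module R M" "Module.module R N" "bij_betw h (carrier M) (carrier N)"
    and "\<And>x y. x \<in> carrier M \<Longrightarrow> y \<in> carrier M \<Longrightarrow> h (x \<oplus>\<^bsub>M\<^esub> y) = h x \<oplus>\<^bsub>N\<^esub> h y"
    and "\<And>r x. r \<in> carrier R \<Longrightarrow> x \<in> carrier M \<Longrightarrow> h (r \<odot>\<^bsub>M\<^esub> x) = r \<odot>\<^bsub>N\<^esub> h x"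
  shows "module_iso R M N"
  unfolding module_iso_iff using assms by (intro conjI exI[of _ h]) simp_all

lemma module_iso_sym:
  assumes "module_iso R M N" shows "module_iso R N M"
proof -
  obtain h where h: "Module.module R M" "Module.module R N" "bij_betw h (carrier M) (carrier N)"
    "\<And>x y. x \<in> carrier M \<Longrightarrow> y \<in> carrier M \<Longrightarrow> h (x \<oplus>\<^bsub>M\<^esub> y) = h x \<oplus>\<^bsub>N\<^esub> h y"
    "\<And>r x. r \<in> carrier R \<Longrightarrow> x \<in> carrier M \<Longrightarrow> h (r \<odot>\<^bsub>M\<^esub> x) = r \<odot>\<^bsub>N\<^esub> h x" using assms unfolding module_iso_iff by blast
  interpret M: Module.module R M by fact
  interpret N: Module.module R N by fact
  define k where "k = inv_into (carrier M) h"
  have k: "bij_betw k (carrier N) (carrier M)" unfolding k_def by (rule bij_betw_inv_into[OF h(3)])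
  have kC: "y \<in> carrier N \<Longrightarrow> k y \<in> carrier M" for y using k by (auto simp: bij_betw_def)
  have hk: "y \<in> carrier N \<Longrightarrow> h (k y) = y" for y unfolding k_def by (rule bij_betw_inv_into_right[OF h(3)])
  have kh: "x \<in> carrier M \<Longrightarrow> k (h x) = x" for x unfolding k_def by (rule bij_betw_inv_into_left[OF h(3)])
  show "module_iso R N M"
  proof (rule module_isoI[OF h(2,1) k])
    fix x y assume xy: "x \<in> carrier N" "y \<in> carrier N"
    then have "h (k x \<oplus>\<^bsub>M\<^esub> k y) = x \<oplus>\<^bsub>N\<^esub> y" by (simp add: h(4) kC hk)
    then show "k (x \<oplus>\<^bsub>N\<^esub> y) = k x \<oplus>\<^bsub>M\<^esub> k y" using kh[of "k x \<oplus>\<^bsub>M\<^esub> k y"] kC xy by simp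
  next
    fix r x assume rx: "r \<in> carrier R" "x \<in> carrier N"
    then have "h (r \<odot>\<^bsub>M\<^esub> k x) = r \<odot>\<^bsub>N\<^esub> x" by (simp add: h(5) kC hk)
    then show "k (r \<odot>\<^bsub>N\<^esub> x) = r \<odot>\<^bsub>M\<^esub> k x" using kh[of "r \<odot>\<^bsub>M\<^esub> k x"] kC rx by simp
  qed
qed

lemma module_iso_trans:
  assumes "module_iso R M N" "module_iso R N P" shows "module_iso R M P"
proof -
  obtain h where h: "Module.module R M" "Module.module R N" "bij_betw h (carrier M) (carrier N)"
    "\<And>x y. x \<in> carrier M \<Longrightarrow> y \<in> carrier M \<Longrightarrow> h (x \<oplus>\<^bsub>M\<^esub> y) = h x \<oplus>\<^bsub>N\<^esub> h y"
    "\<And>r x. r \<in> carrier R \<Longrightarrow> x \<in> carrier M \<Longrightarrow> h (r \<odot>\<^bsub>M\<^esub> x) = r \<odot>\<^bsub>N\<^esub> h x" using assms(1) unfolding module_iso_iff by blast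
  obtain k where k: "Module.module R N" "Module.module R P" "bij_betw k (carrier N) (carrier P)"
    "\<And>x y. x \<in> carrier N \<Longrightarrow> y \<in> carrier N \<Longrightarrow> k (x \<oplus>\<^bsub>N\<^esub> y) = k x \<oplus>\<^bsub>P\<^esub> k y"
    "\<And>r x. r \<in> carrier R \<Longrightarrow> x \<in> carrier N \<Longrightarrow> k (r \<odot>\<^bsub>N\<^esub> x) = r \<odot>\<^bsub>P\<^esub> k x" using assms(2) unfolding module_iso_iff by blast
  have hC: "x \<in> carrier M \<Longrightarrow> h x \<in> carrier N" for x using h(3) by (auto simp: bij_betw_def)
  show ?thesis by (rule module_isoI[OF h(1) k(2) bij_betw_trans[OF h(3) k(3)]]) (auto simp: h(4,5) k(4,5) hC)
qed

text \<open>A map of lattices descends to the quotients. Conversely, an isomorphism is lifted to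
  vectors by choosing representatives for the images of the generators and extending
  linearly.\<close>

lemma module_iso_iff_liso:
  assumes "presented a b M1 G1 L1 N1" "presented a b M2 G2 L2 N2"
  shows "module_iso (S\<^sub>E a b) M1 M2 \<longleftrightarrow> liso L1 L2"
proof
  interpret p1: presented a b M1 G1 L1 N1 by fact
  interpret p2: presented a b M2 G2 L2 N2 by fact
  {
    assume "liso L1 L2"
    then obtain \<theta> where \<theta>: "linear_fn \<theta>" "\<And>v. v \<in> L1 \<longleftrightarrow> \<theta> v \<in> L2" "\<And>w. \<exists>v. w - \<theta> v \<in> L2" by (auto simp: liso_def)
    define h where "h x = G2 (\<theta> (SOME v. G1 v = x))" for x
    have iff: "G2 (\<theta> v) = G2 (\<theta> w) \<longleftrightarrow> G1 v = G1 w" for v w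
      unfolding p1.G_eq_iff p2.G_eq_iff \<theta>(2) linear_fn_diff[OF \<theta>(1)] ..
    have h: "h (G1 v) = G2 (\<theta> v)" for v unfolding h_def iff by (rule someI[of "\<lambda>w. G1 w = G1 v" v]) (rule refl)
    have lin: "\<theta> (v + w) = \<theta> v + \<theta> w" "\<theta> (t \<star> v) = t \<star> \<theta> v" for v w t using \<theta>(1) by (auto simp: linear_fn_def)
    show "module_iso (S\<^sub>E a b) M1 M2"
    proof (rule module_isoI[OF p1.module_axioms p2.module_axioms])
      have "\<exists>v. G2 w = G2 (\<theta> v)" for w using \<theta>(3)[of w] by (simp add: p2.G_eq_iff)
      then show "bij_betw h (carrier M1) (carrier M2)"
        by (auto simp: bij_betw_def inj_on_def p1.carrier_eq p2.carrier_eq h iff image_iff)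
      show "h (x \<oplus>\<^bsub>M1\<^esub> y) = h x \<oplus>\<^bsub>M2\<^esub> h y" if "x \<in> carrier M1" "y \<in> carrier M1" for x y
        using that unfolding p1.carrier_eq by (elim rangeE) (simp only: p1.G_add[symmetric] p2.G_add[symmetric] h lin)
      show "h (r \<odot>\<^bsub>M1\<^esub> x) = r \<odot>\<^bsub>M2\<^esub> h x" if "r \<in> carrier (S\<^sub>E a b)" "x \<in> carrier M1" for r x
        using that unfolding p1.carrier_eq by (elim rangeE S_carrierE) (simp only: p1.G_scal[symmetric] p2.G_scal[symmetric] h lin)
    qed
  next
    assume "module_iso (S\<^sub>E a b) M1 M2"
    then obtain h where h: "bij_betw h (carrier M1) (carrier M2)"
      "\<And>x y. x \<in> carrier M1 \<Longrightarrow> y \<in> carrier M1 \<Longrightarrow> h (x \<oplus>\<^bsub>M1\<^esub> y) = h x \<oplus>\<^bsub>M2\<^esub> h y"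
      "\<And>r x. r \<in> carrier (S\<^sub>E a b) \<Longrightarrow> x \<in> carrier M1 \<Longrightarrow> h (r \<odot>\<^bsub>M1\<^esub> x) = r \<odot>\<^bsub>M2\<^esub> h x" unfolding module_iso_iff by blast
    have hC: "h (G1 v) \<in> carrier M2" for v using h(1) by (auto simp: bij_betw_def)
    define e where "e k = (SOME w. G2 w = h (G1 (unit_fn k)))" for k
    have e: "G2 (e k) = h (G1 (unit_fn k))" for k
    proof -
      have "\<exists>w. G2 w = h (G1 (unit_fn k))" using hC[of "unit_fn k"] unfolding p2.carrier_eq by (metis rangeE)
      then show ?thesis unfolding e_def by (rule someI_ex)
    qed
    define \<theta> where "\<theta> v = (\<Sum>k<N1. v k \<star> e k)" for v
    have h0: "h \<zero>\<^bsub>M1\<^esub> = \<zero>\<^bsub>M2\<^esub>"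
    proof -
      have "h (G1 (0 \<star> 0)) = G2 (0 \<star> e 0)" unfolding p1.G_scal using h(3)[of "\<kappa> a b 0" "G1 0"] hC[of 0] p2.smult_l_null p2.G_0
        by (simp add: scal_simps)
      then show ?thesis by (simp add: scal_simps p1.G_0 p2.G_0)
    qed
    have part: "G2 (\<Sum>k<n. v k \<star> e k) = h (G1 (\<Sum>k<n. v k \<star> unit_fn k))" for n v
    proof (induction n)
      case (Suc n)
      then show ?case unfolding sum.lessThan_Suc p1.G_add p2.G_add p1.G_scal p2.G_scal by (simp add: h e)
    qed (use h0 p1.G_0 p2.G_0 in \<open>simp add: zero_fun_def\<close>)
    have "G1 v = G1 (\<Sum>k<N1. v k \<star> unit_fn k)" for v
      unfolding p1.G_eq_iff by (rule p1.support_L) (simp add: sum_unit_fn)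
    then have G2: "G2 (\<theta> v) = h (G1 v)" for v unfolding \<theta>_def part by metis
    show "liso L1 L2" unfolding liso_def
    proof (intro exI[of _ \<theta>] conjI allI)
      show "linear_fn \<theta>" unfolding linear_fn_def \<theta>_def
        by (auto simp: fun_eq_iff sum_fun_apply scal_apply algebra_simps sum.distrib sum_distrib_left)
      show "v \<in> L1 \<longleftrightarrow> \<theta> v \<in> L2" for v
      proof -
        have "h (G1 v) = h (G1 0) \<longleftrightarrow> G1 v = G1 0" using h(1) by (auto simp: bij_betw_def inj_on_def)
        then show ?thesis by (simp add: p1.L_iff p2.L_iff G2 p1.G_0 h0)
      qed
      show "\<exists>v. w - \<theta> v \<in> L2" for w
      proof -
        have "G2 w \<in> h ` carrier M1" using h(1) by (simp add: bij_betw_def)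
        then show ?thesis by (auto simp: p1.carrier_eq p2.G_eq_iff[symmetric] G2)
      qed
    qed
  }
qed

section \<open>Cokernels\<close>

text \<open>The class of a function \<open>v\<close> collects the vectors of length \<open>n\<close>
  that agree with it modulo the image. Scalars may be cosets because f maps every vector into the
  image.\<close>

lemma cokernel_presented:
  fixes \<alpha> \<beta> :: "'k::field T mat"
  assumes mf: "matrix_factorisation (f\<^sub>E a b) n (\<alpha>, \<beta>)"
  shows "presented a b (cokernel \<beta>) (\<lambda>v. {u \<in> carrier_vec n. (\<lambda>i. vec_index u i) - v \<in> lat \<beta>}) (lat \<beta>) n" (is "presented a b _ ?G _ _")
proof -
  have car: "\<alpha> \<in> carrier_mat n n" "\<beta> \<in> carrier_mat n n" "\<alpha> * \<beta> = f\<^sub>E a b \<cdot>\<^sub>m 1\<^sub>m n" "\<beta> * \<alpha> = f\<^sub>E a b \<cdot>\<^sub>m 1\<^sub>m n"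
    using mf by (auto simp: matrix_factorisation_def)
  note sub = submod_lat[of \<beta>]
  define V where "V = module_vec TYPE('k T) n"
  define K where "K = (\<lambda>v. \<beta> *\<^sub>v v) ` carrier_vec n"
  have dim: "dim_row \<beta> = n" "dim_col \<beta> = n" using car by auto
  have K: "u \<in> K \<longleftrightarrow> u \<in> carrier_vec n \<and> (\<lambda>i. vec_index u i) \<in> lat \<beta>" for u
  proof -
    have "u \<in> carrier_vec n \<Longrightarrow> vec n (\<lambda>i. vec_index u i) = u" by (intro eq_vecI) auto
    moreover have "x \<in> carrier_vec n \<Longrightarrow> \<beta> *\<^sub>v x \<in> carrier_vec n" for x using car(2) by simp
    ultimately show ?thesis unfolding K_def lat_iff_vec[OF car(2)] by auto
  qed
  have G0: "?G 0 = K" by (auto simp: K)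
  have zero: "(\<forall>i<n. v i = 0) \<Longrightarrow> v \<in> lat \<beta>" for v
    unfolding lat_def using dim by (auto intro!: exI[of _ "\<lambda>_. 0"])
  have ext: "v \<in> lat \<beta> \<longleftrightarrow> w \<in> lat \<beta>" if "\<And>i. i < n \<Longrightarrow> v i = w i" for v w
    using that by (auto simp: lat_def dim)
  have vecI: "vec n v \<in> ?G v" for v by (auto intro: zero)
  have cong: "?G v = ?G w \<longleftrightarrow> v - w \<in> lat \<beta>" for v w
  proof
    assume "?G v = ?G w"
    then have "vec n v \<in> ?G w" using vecI[of v] by simp
    then have "(\<lambda>i. vec_index (vec n v) i) - w \<in> lat \<beta>" by simp
    then show "v - w \<in> lat \<beta>" by (subst ext[of _ "(\<lambda>i. vec_index (vec n v) i) - w"]) simp_all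
  next
    assume "v - w \<in> lat \<beta>"
    then have "u - v \<in> lat \<beta> \<longleftrightarrow> u - w \<in> lat \<beta>" for u
      using submod_cong[OF sub, of "u - w" "u - v"] by simp
    then show "?G v = ?G w" by simp
  qed
  have rcos: "K +>\<^bsub>V\<^esub> u = ?G (\<lambda>i. vec_index u i)" if u: "u \<in> carrier_vec n" for u
  proof (intro Set.set_eqI iffI)
    fix x assume "x \<in> K +>\<^bsub>V\<^esub> u"
    then obtain h where h: "h \<in> K" "x = h + u" by (auto simp: a_r_coset_def' V_def module_vec_simps)
    moreover have "(\<lambda>i. vec_index x i) - (\<lambda>i. vec_index u i) \<in> lat \<beta> \<longleftrightarrow> (\<lambda>i. vec_index h i) \<in> lat \<beta>"
      by (rule ext) (use h u in \<open>auto simp: K\<close>)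
    ultimately show "x \<in> ?G (\<lambda>i. vec_index u i)" using u by (auto simp: K)
  next
    fix x assume x: "x \<in> ?G (\<lambda>i. vec_index u i)"
    have "(\<lambda>i. vec_index (x - u) i) \<in> lat \<beta> \<longleftrightarrow> (\<lambda>i. vec_index x i) - (\<lambda>i. vec_index u i) \<in> lat \<beta>"
      by (rule ext) (use x u in auto)
    then have "x - u \<in> K" using x u by (simp add: K)
    moreover have "x = x - u + u" using x u by (intro eq_vecI) auto
    ultimately show "x \<in> K +>\<^bsub>V\<^esub> u" by (auto simp: a_r_coset_def' V_def module_vec_simps)
  qed
  have vecG: "?G v = ?G (\<lambda>i. vec_index (vec n v) i)" for v
    unfolding cong by (rule zero) simp
  show ?thesis
  proof (rule presentedI)
    have "carrier (cokernel \<beta>) = {K +>\<^bsub>V\<^esub> u | u. u \<in> carrier_vec n}"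
      by (auto simp: cokernel_def Let_def K_def V_def dim A_RCOSETS_def' a_r_coset_def' module_vec_simps)
    also have "\<dots> = range ?G"
    proof (intro Set.set_eqI iffI)
      fix x assume "x \<in> range ?G"
      then obtain v where "x = ?G v" by blast
      then have "x = K +>\<^bsub>V\<^esub> vec n v" using vecG[of v] rcos[of "vec n v"] by simp
      then show "x \<in> {K +>\<^bsub>V\<^esub> u | u. u \<in> carrier_vec n}" by auto
    qed (use rcos in auto)
    finally show "carrier (cokernel \<beta>) = range ?G" .
    show "\<zero>\<^bsub>cokernel \<beta>\<^esub> = ?G 0" unfolding G0 by (simp add: cokernel_def Let_def K_def dim)
    show "?G (v + w) = ?G v \<oplus>\<^bsub>cokernel \<beta>\<^esub> ?G w" for v w
    proof -
      have "?G v \<oplus>\<^bsub>cokernel \<beta>\<^esub> ?G w = (\<Union>x\<in>?G v. \<Union>y\<in>?G w. {x + y})"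
        by (simp add: cokernel_def Let_def set_add_def' module_vec_simps dim)
      also have "\<dots> = ?G (v + w)"
      proof (intro Set.set_eqI iffI)
        fix u assume "u \<in> (\<Union>x\<in>?G v. \<Union>y\<in>?G w. {x + y})"
        then obtain x y where xy: "x \<in> ?G v" "y \<in> ?G w" "u = x + y" by blast
        have "(\<lambda>i. vec_index u i) - (v + w) \<in> lat \<beta> \<longleftrightarrow> ((\<lambda>i. vec_index x i) - v) + ((\<lambda>i. vec_index y i) - w) \<in> lat \<beta>"
          by (rule ext) (use xy in auto)
        then show "u \<in> ?G (v + w)" using xy submod_add[OF sub] by auto
      next
        fix u assume u: "u \<in> ?G (v + w)"
        have "(\<lambda>i. vec_index (u - vec n v) i) - w \<in> lat \<beta> \<longleftrightarrow> (\<lambda>i. vec_index u i) - (v + w) \<in> lat \<beta>"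
          by (rule ext) (use u in auto)
        then have "u - vec n v \<in> ?G w" using u by auto
        moreover have "u = vec n v + (u - vec n v)" using u by (intro eq_vecI) auto
        ultimately show "u \<in> (\<Union>x\<in>?G v. \<Union>y\<in>?G w. {x + y})" using vecI[of v] by blast
      qed
      finally show ?thesis ..
    qed
    show "?G (t \<star> v) = \<kappa> a b t \<odot>\<^bsub>cokernel \<beta>\<^esub> ?G v" for t v
    proof -
      \<comment> \<open>Two representatives of the scalar differ by a multiple of f, whose effect
        lies in the image; so all members of the union defining the scalar product coincide.\<close>
      have eq: "K +>\<^bsub>V\<^esub> s \<cdot>\<^sub>v u = ?G (t \<star> v)" if s: "s \<in> \<kappa> a b t" and u: "u \<in> ?G v" for s u
      proof -
        obtain k where k: "s - t = f\<^sub>E a b * k" using s by (auto simp: residue_class_def elim: dvdE)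
        have "f\<^sub>E a b \<star> k \<star> v + s \<star> ((\<lambda>i. vec_index u i) - v) \<in> lat \<beta>"
          using u by (intro submod_add[OF sub] submod_scal[OF sub] f_lat[OF car]) simp
        moreover have "(\<lambda>i. vec_index (s \<cdot>\<^sub>v u) i) - t \<star> v \<in> lat \<beta> \<longleftrightarrow>
          f\<^sub>E a b \<star> k \<star> v + s \<star> ((\<lambda>i. vec_index u i) - v) \<in> lat \<beta>"
        proof (rule ext)
          fix i assume i: "i < n"
          have "f\<^sub>E a b * (k * v i) = (s - t) * v i" by (simp add: k mult.assoc)
          moreover have "vec_index (s \<cdot>\<^sub>v u) i = s * vec_index u i" using u i by auto
          ultimately show "((\<lambda>i. vec_index (s \<cdot>\<^sub>v u) i) - t \<star> v) i = (f\<^sub>E a b \<star> k \<star> v + s \<star> ((\<lambda>i. vec_index u i) - v)) i"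
            by (simp add: scal_apply algebra_simps del: index_smult_vec)
        qed
        ultimately have "?G (\<lambda>i. vec_index (s \<cdot>\<^sub>v u) i) = ?G (t \<star> v)" unfolding cong by simp
        then show ?thesis using rcos[of "s \<cdot>\<^sub>v u"] u by simp
      qed
      have "\<kappa> a b t \<odot>\<^bsub>cokernel \<beta>\<^esub> ?G v = (\<Union>s\<in>\<kappa> a b t. \<Union>u\<in>?G v. K +>\<^bsub>V\<^esub> s \<cdot>\<^sub>v u)"
        by (simp add: cokernel_def Let_def K_def V_def dim module_vec_simps)
      also have "\<dots> = (\<Union>s\<in>\<kappa> a b t. \<Union>u\<in>?G v. ?G (t \<star> v))" using eq by (intro SUP_cong refl)
      also have "\<dots> = ?G (t \<star> v)"
      proof -
        have "t \<in> \<kappa> a b t" by (simp add: residue_class_def)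
        then show ?thesis using vecI[of v] by blast
      qed
      finally show ?thesis ..
    qed
    show "v \<in> lat \<beta> \<longleftrightarrow> ?G v = ?G 0" for v unfolding cong by simp
    show "(\<forall>i<n. v i = 0) \<Longrightarrow> ?G v = ?G 0" for v
      unfolding cong by (rule zero) simp
  qed
qed

section \<open>The field of fractions\<close>

definition frac_S :: "'k::field \<Rightarrow> 'k \<Rightarrow> 'k T \<Rightarrow> 'k T \<Rightarrow> ('k T set \<times> 'k T set) set" where
  "frac_S a b s t = fraction (S\<^sub>E a b) (\<kappa> a b s) (\<kappa> a b t)"

lemma residue_class_0_iff: "\<kappa> a b t = \<kappa> a b 0 \<longleftrightarrow> f\<^sub>E a b dvd t"
  by (simp add: residue_class_eq_iff)

lemma f_dvd_mult_iff: "f\<^sub>E a b dvd s * t \<longleftrightarrow> f\<^sub>E a b dvd s \<or> f\<^sub>E a b dvd t"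
  using f_prime by auto

lemma f_not_dvd_1: "\<not> f\<^sub>E a b dvd 1"
  using S.one_not_zero[of a b] by (simp add: residue_class_0_iff)

lemma mem_frac_S_iff:
  assumes "\<not> f\<^sub>E a b dvd t"
  shows "(\<kappa> a b u, \<kappa> a b w) \<in> frac_S a b s t \<longleftrightarrow> \<not> f\<^sub>E a b dvd w \<and> f\<^sub>E a b dvd s * w - u * t"
  using assms by (simp add: frac_S_def fraction_def frac_rel_def residue_class_0_iff residue_class_eq_iff)

lemma mem_frac_SE:
  assumes "p \<in> frac_S a b s t" "\<not> f\<^sub>E a b dvd t"
  obtains u w where "p = (\<kappa> a b u, \<kappa> a b w)" "\<not> f\<^sub>E a b dvd w" "f\<^sub>E a b dvd s * w - u * t"
proof -
  have "fst p \<in> carrier (S\<^sub>E a b)" "snd p \<in> carrier (S\<^sub>E a b)"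
    using assms(1) by (auto simp: frac_S_def fraction_def frac_rel_def)
  then obtain u w where "p = (\<kappa> a b u, \<kappa> a b w)" by (metis S_carrierE prod.collapse)
  then show thesis using that mem_frac_S_iff[OF assms(2)] assms(1) by blast
qed

lemma frac_S_eq_iff:
  assumes t: "\<not> f\<^sub>E a b dvd t" "\<not> f\<^sub>E a b dvd t'"
  shows "frac_S a b s t = frac_S a b s' t' \<longleftrightarrow> f\<^sub>E a b dvd s * t' - s' * t"
proof
  assume eq: "frac_S a b s t = frac_S a b s' t'"
  have "(\<kappa> a b s', \<kappa> a b t') \<in> frac_S a b s t" unfolding eq using t by (simp add: mem_frac_S_iff)
  then show "f\<^sub>E a b dvd s * t' - s' * t" using t by (simp add: mem_frac_S_iff)
next
  assume d: "f\<^sub>E a b dvd s * t' - s' * t"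
  have "f\<^sub>E a b dvd s * w - u * t \<longleftrightarrow> f\<^sub>E a b dvd s' * w - u * t'" for u w
  proof -
    have "f\<^sub>E a b dvd t' * (s * w - u * t) \<longleftrightarrow> f\<^sub>E a b dvd (s * t' - s' * t) * w + t * (s' * w - u * t')"
      by (simp add: algebra_simps)
    also have "\<dots> \<longleftrightarrow> f\<^sub>E a b dvd t * (s' * w - u * t')" by (rule dvd_add_right_iff[OF dvd_mult2[OF d]])
    finally show ?thesis using t by (simp add: f_dvd_mult_iff)
  qed
  then have "(\<kappa> a b u, \<kappa> a b w) \<in> frac_S a b s t \<longleftrightarrow> (\<kappa> a b u, \<kappa> a b w) \<in> frac_S a b s' t'" for u w
    using t by (simp add: mem_frac_S_iff)
  then have "p \<in> frac_S a b s t \<longleftrightarrow> p \<in> frac_S a b s' t'" for p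
    using mem_frac_SE[OF _ t(1), of p] mem_frac_SE[OF _ t(2), of p] by metis
  then show "frac_S a b s t = frac_S a b s' t'" by (rule Set.set_eqI)
qed

abbreviation Q_E :: "'k::field \<Rightarrow> 'k \<Rightarrow> ('k T set \<times> 'k T set) set ring" where
  "Q_E a b \<equiv> fraction_field (S\<^sub>E a b)"

lemma Q_carrier: "carrier (Q_E a b) = {frac_S a b s t | s t. \<not> f\<^sub>E a b dvd t}"
proof -
  have "carrier (Q_E a b) = {fraction (S\<^sub>E a b) x y | x y. x \<in> carrier (S\<^sub>E a b) \<and> y \<in> carrier (S\<^sub>E a b) \<and> y \<noteq> \<zero>\<^bsub>S\<^sub>E a b\<^esub>}"
    by (auto simp: fraction_field_def quotient_def fraction_def)
  also have "\<dots> = {frac_S a b s t | s t. \<not> f\<^sub>E a b dvd t}"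
    unfolding S_carrier frac_S_def S_simps residue_class_0_iff[symmetric] by (intro Collect_cong iffI; elim exE conjE rangeE; blast)
  finally show ?thesis .
qed

lemma Q_carrierE: "x \<in> carrier (Q_E a b) \<Longrightarrow> (\<And>s t. x = frac_S a b s t \<Longrightarrow> \<not> f\<^sub>E a b dvd t \<Longrightarrow> P) \<Longrightarrow> P"
  unfolding Q_carrier by blast

lemma frac_S_carrier: "\<not> f\<^sub>E a b dvd t \<Longrightarrow> frac_S a b s t \<in> carrier (Q_E a b)"
  unfolding Q_carrier by blast

text \<open>Operations written as a union over all representatives take a definite value once every
  representative yields the same one.\<close>

lemma UN_const: "A \<noteq> {} \<Longrightarrow> (\<And>x. x \<in> A \<Longrightarrow> g x = c) \<Longrightarrow> (\<Union>x\<in>A. g x) = c"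
  by auto

lemma frac_S_ne: "\<not> f\<^sub>E a b dvd t \<Longrightarrow> frac_S a b s t \<noteq> {}"
  using mem_frac_S_iff[of a b t s t s] by auto

lemma Q_mult:
  assumes t: "\<not> f\<^sub>E a b dvd t" "\<not> f\<^sub>E a b dvd t'"
  shows "frac_S a b s t \<otimes>\<^bsub>Q_E a b\<^esub> frac_S a b s' t' = frac_S a b (s * s') (t * t')"
  unfolding fraction_field_def monoid.simps
proof (rule UN_const[OF frac_S_ne[OF t(1)]], erule mem_frac_SE[OF _ t(1)], simp only: prod.case,
    rule UN_const[OF frac_S_ne[OF t(2)]], erule mem_frac_SE[OF _ t(2)], simp only: prod.case)
  fix u w u' w' assume w: "\<not> f\<^sub>E a b dvd w" "\<not> f\<^sub>E a b dvd w'"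
    and d: "f\<^sub>E a b dvd s * w - u * t" "f\<^sub>E a b dvd s' * w' - u' * t'"
  have "f\<^sub>E a b dvd (s * w - u * t) * (s' * w') + (u * t) * (s' * w' - u' * t')" using d by simp
  also have "(s * w - u * t) * (s' * w') + (u * t) * (s' * w' - u' * t') = (s * s') * (w * w') - (u * u') * (t * t')"
    by (simp add: algebra_simps)
  finally have "frac_S a b (s * s') (t * t') = frac_S a b (u * u') (w * w')"
    using t w by (simp add: frac_S_eq_iff f_dvd_mult_iff)
  then show "fraction (S\<^sub>E a b) (\<kappa> a b u \<otimes>\<^bsub>S\<^sub>E a b\<^esub> \<kappa> a b u') (\<kappa> a b w \<otimes>\<^bsub>S\<^sub>E a b\<^esub> \<kappa> a b w') = frac_S a b (s * s') (t * t')"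
    by (simp add: frac_S_def)
qed

lemma Q_add:
  assumes t: "\<not> f\<^sub>E a b dvd t" "\<not> f\<^sub>E a b dvd t'"
  shows "frac_S a b s t \<oplus>\<^bsub>Q_E a b\<^esub> frac_S a b s' t' = frac_S a b (s * t' + s' * t) (t * t')"
  unfolding fraction_field_def ring.simps
proof (rule UN_const[OF frac_S_ne[OF t(1)]], erule mem_frac_SE[OF _ t(1)], simp only: prod.case,
    rule UN_const[OF frac_S_ne[OF t(2)]], erule mem_frac_SE[OF _ t(2)], simp only: prod.case)
  fix u w u' w' assume w: "\<not> f\<^sub>E a b dvd w" "\<not> f\<^sub>E a b dvd w'"
    and d: "f\<^sub>E a b dvd s * w - u * t" "f\<^sub>E a b dvd s' * w' - u' * t'"
  have "f\<^sub>E a b dvd (s * w - u * t) * (t' * w') + (s' * w' - u' * t') * (t * w)" using d by simp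
  also have "(s * w - u * t) * (t' * w') + (s' * w' - u' * t') * (t * w) = (s * t' + s' * t) * (w * w') - (u * w' + u' * w) * (t * t')"
    by (simp add: algebra_simps)
  finally have "frac_S a b (s * t' + s' * t) (t * t') = frac_S a b (u * w' + u' * w) (w * w')"
    using t w by (simp add: frac_S_eq_iff f_dvd_mult_iff)
  then show "fraction (S\<^sub>E a b) (\<kappa> a b u \<otimes>\<^bsub>S\<^sub>E a b\<^esub> \<kappa> a b w' \<oplus>\<^bsub>S\<^sub>E a b\<^esub> \<kappa> a b u' \<otimes>\<^bsub>S\<^sub>E a b\<^esub> \<kappa> a b w)
    (\<kappa> a b w \<otimes>\<^bsub>S\<^sub>E a b\<^esub> \<kappa> a b w') = frac_S a b (s * t' + s' * t) (t * t')"
    by (simp add: frac_S_def)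
qed

lemma Q_one: "\<one>\<^bsub>Q_E a b\<^esub> = frac_S a b 1 1" and Q_zero: "\<zero>\<^bsub>Q_E a b\<^esub> = frac_S a b 0 1"
  by (simp_all add: fraction_field_def frac_S_def)

lemmas Q_simps = Q_mult Q_add Q_one Q_zero f_dvd_mult_iff f_not_dvd_1 frac_S_carrier frac_S_eq_iff

lemma frac_S_eqI: "\<not> f\<^sub>E a b dvd t \<Longrightarrow> \<not> f\<^sub>E a b dvd t' \<Longrightarrow> s * t' = s' * t \<Longrightarrow> frac_S a b s t = frac_S a b s' t'"
  by (simp add: frac_S_eq_iff)

lemma Q_field: "field (Q_E a b)"
proof -
  have "cring (Q_E a b)"
  proof (rule cringI)
    show "abelian_group (Q_E a b)"
    proof (rule abelian_groupI)
      fix x assume "x \<in> carrier (Q_E a b)"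
      then show "\<exists>y\<in>carrier (Q_E a b). y \<oplus>\<^bsub>Q_E a b\<^esub> x = \<zero>\<^bsub>Q_E a b\<^esub>"
      proof (rule Q_carrierE)
        fix s t assume x: "x = frac_S a b s t" "\<not> f\<^sub>E a b dvd t"
        then show ?thesis by (intro bexI[of _ "frac_S a b (- s) t"]) (simp_all add: Q_simps)
      qed
    qed (auto elim!: Q_carrierE simp: Q_simps algebra_simps)
    show "comm_monoid (Q_E a b)"
      by (rule comm_monoidI) (auto elim!: Q_carrierE simp: Q_simps algebra_simps)
    show "(x \<oplus>\<^bsub>Q_E a b\<^esub> y) \<otimes>\<^bsub>Q_E a b\<^esub> z = x \<otimes>\<^bsub>Q_E a b\<^esub> z \<oplus>\<^bsub>Q_E a b\<^esub> y \<otimes>\<^bsub>Q_E a b\<^esub> z"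
      if "x \<in> carrier (Q_E a b)" "y \<in> carrier (Q_E a b)" "z \<in> carrier (Q_E a b)" for x y z
      using that by (elim Q_carrierE)
        (simp add: Q_mult Q_add f_dvd_mult_iff, rule frac_S_eqI, simp_all add: f_dvd_mult_iff algebra_simps)
  qed
  then show ?thesis
  proof (rule cring.cring_fieldI2)
    show "\<zero>\<^bsub>Q_E a b\<^esub> \<noteq> \<one>\<^bsub>Q_E a b\<^esub>" by (simp add: Q_simps)
    fix x assume "x \<in> carrier (Q_E a b)" "x \<noteq> \<zero>\<^bsub>Q_E a b\<^esub>"
    then show "\<exists>y\<in>carrier (Q_E a b). x \<otimes>\<^bsub>Q_E a b\<^esub> y = \<one>\<^bsub>Q_E a b\<^esub>"
    proof (elim Q_carrierE)
      fix s t assume x: "x = frac_S a b s t" "\<not> f\<^sub>E a b dvd t" "x \<noteq> \<zero>\<^bsub>Q_E a b\<^esub>"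
      then have "\<not> f\<^sub>E a b dvd s" by (simp add: Q_simps)
      then show ?thesis using x by (intro bexI[of _ "frac_S a b t s"]) (simp_all add: Q_simps mult.commute)
    qed
  qed
qed

interpretation Q: field "Q_E a b" for a b :: "'k::field"
  by (rule Q_field)

section \<open>Base change to the field of fractions\<close>

context presented
begin

definition "keys_V = carrier M \<times> carrier (Q_E a b)"

abbreviation "FG \<equiv> free_Abelian_group keys_V"

definition "rels = tensor_relations (S\<^sub>E a b) (Q_E a b) (\<lambda>r. fraction (S\<^sub>E a b) r \<one>\<^bsub>S\<^sub>E a b\<^esub>) M"

definition "RN = generate FG rels"

definition "V = base_change (S\<^sub>E a b) (Q_E a b) (\<lambda>r. fraction (S\<^sub>E a b) r \<one>\<^bsub>S\<^sub>E a b\<^esub>) M"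

definition act where "act q = frag_extend (\<lambda>(x, p). frag_of (x, q \<otimes>\<^bsub>Q_E a b\<^esub> p))"

lemma keys_V_iff [simp]: "(x, q) \<in> keys_V \<longleftrightarrow> x \<in> carrier M \<and> q \<in> carrier (Q_E a b)"
  by (simp add: keys_V_def)

lemma V_eq: "V = \<lparr>carrier = rcosets\<^bsub>FG\<^esub> RN, monoid.mult = undefined, monoid.one = undefined, ring.zero = RN,
    ring.add = set_mult FG, smult = (\<lambda>q C. \<Union>c\<in>C. RN #>\<^bsub>FG\<^esub> act q c)\<rparr>"
  unfolding V_def base_change_def Let_def RN_def rels_def act_def keys_V_def ..

lemma rels_eq: "rels =
  {frag_of (G (v + w), q) - frag_of (G v, q) - frag_of (G w, q) | v w q. q \<in> carrier (Q_E a b)} \<union>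
  {frag_of (G v, p \<oplus>\<^bsub>Q_E a b\<^esub> q) - frag_of (G v, p) - frag_of (G v, q) | v p q. p \<in> carrier (Q_E a b) \<and> q \<in> carrier (Q_E a b)} \<union>
  {frag_of (G (s \<star> v), q) - frag_of (G v, frac_S a b s 1 \<otimes>\<^bsub>Q_E a b\<^esub> q) | s v q. q \<in> carrier (Q_E a b)}"
proof -
  have 1: "{frag_of (x \<oplus>\<^bsub>M\<^esub> y, q) - frag_of (x, q) - frag_of (y, q) | x y q. x \<in> carrier M \<and> y \<in> carrier M \<and> q \<in> carrier (Q_E a b)} =
    {frag_of (G (v + w), q) - frag_of (G v, q) - frag_of (G w, q) | v w q. q \<in> carrier (Q_E a b)}"
    unfolding G_add carrier_eq by blast
  have 2: "{frag_of (x, p \<oplus>\<^bsub>Q_E a b\<^esub> q) - frag_of (x, p) - frag_of (x, q) | x p q. x \<in> carrier M \<and> p \<in> carrier (Q_E a b) \<and> q \<in> carrier (Q_E a b)} =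
    {frag_of (G v, p \<oplus>\<^bsub>Q_E a b\<^esub> q) - frag_of (G v, p) - frag_of (G v, q) | v p q. p \<in> carrier (Q_E a b) \<and> q \<in> carrier (Q_E a b)}"
    unfolding carrier_eq by blast
  have 3: "{frag_of (r \<odot>\<^bsub>M\<^esub> x, q) - frag_of (x, fraction (S\<^sub>E a b) r \<one>\<^bsub>S\<^sub>E a b\<^esub> \<otimes>\<^bsub>Q_E a b\<^esub> q) | r x q.
      r \<in> carrier (S\<^sub>E a b) \<and> x \<in> carrier M \<and> q \<in> carrier (Q_E a b)} =
    {frag_of (G (s \<star> v), q) - frag_of (G v, frac_S a b s 1 \<otimes>\<^bsub>Q_E a b\<^esub> q) | s v q. q \<in> carrier (Q_E a b)}"
    unfolding G_scal S_simps(3) frac_S_def carrier_eq S_carrier by blast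
  show ?thesis unfolding rels_def tensor_relations_def 1 2 3 ..
qed

lemma relsE:
  assumes "r \<in> rels"
  obtains v w q where "q \<in> carrier (Q_E a b)" "r = frag_of (G (v + w), q) - frag_of (G v, q) - frag_of (G w, q)"
  | v p q where "p \<in> carrier (Q_E a b)" "q \<in> carrier (Q_E a b)" "r = frag_of (G v, p \<oplus>\<^bsub>Q_E a b\<^esub> q) - frag_of (G v, p) - frag_of (G v, q)"
  | s v q where "q \<in> carrier (Q_E a b)" "r = frag_of (G (s \<star> v), q) - frag_of (G v, frac_S a b s 1 \<otimes>\<^bsub>Q_E a b\<^esub> q)"
  using assms unfolding rels_eq by blast

lemma frac_1_carrier [simp]: "frac_S a b s 1 \<in> carrier (Q_E a b)"
  by (simp add: frac_S_carrier f_not_dvd_1)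

lemma keys_diff_le: "Poly_Mapping.keys c \<subseteq> A \<Longrightarrow> Poly_Mapping.keys d \<subseteq> A \<Longrightarrow> Poly_Mapping.keys (c - d) \<subseteq> A"
  using keys_diff[of c d] by blast

lemma rels_subset: "rels \<subseteq> carrier FG"
proof
  fix r assume "r \<in> rels"
  then show "r \<in> carrier FG"
    by (rule relsE) (simp_all add: keys_diff_le)
qed

lemma RN_subgroup: "subgroup RN FG"
  unfolding RN_def by (rule group.generate_is_subgroup[OF group_free_Abelian_group rels_subset])

lemma RN_keys: "c \<in> RN \<Longrightarrow> Poly_Mapping.keys c \<subseteq> keys_V"
  using subsetD[OF subgroup.subset[OF RN_subgroup], of c] by simp

lemma RN_0: "0 \<in> RN"
  using subgroup.one_closed[OF RN_subgroup] by simp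

lemma RN_add: "c \<in> RN \<Longrightarrow> d \<in> RN \<Longrightarrow> c + d \<in> RN"
  using subgroup.m_closed[OF RN_subgroup] by simp

lemma RN_minus: "c \<in> RN \<Longrightarrow> - c \<in> RN"
  using subgroup.m_inv_closed[OF RN_subgroup, of c] RN_keys[of c] by simp

lemma RN_diff: "c \<in> RN \<Longrightarrow> d \<in> RN \<Longrightarrow> c - d \<in> RN"
  using RN_add[OF _ RN_minus, of c d] by simp

lemma RN_rels: "r \<in> rels \<Longrightarrow> r \<in> RN"
  unfolding RN_def by (rule generate.incl)

lemma RN_induct [consumes 1]:
  assumes "c \<in> RN" "P 0" "\<And>r. r \<in> rels \<Longrightarrow> P r" "\<And>c d. c \<in> RN \<Longrightarrow> d \<in> RN \<Longrightarrow> P c \<Longrightarrow> P d \<Longrightarrow> P (c - d)"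
  shows "P c"
proof -
  have minus: "P (- d)" if "d \<in> RN" "P d" for d using assms(4)[OF RN_0 that(1) assms(2) that(2)] by simp
  show ?thesis using assms(1) unfolding RN_def
  proof (induction rule: generate.induct)
    case one
    then show ?case using assms(2) by simp
  next
    case (incl h)
    then show ?case by (rule assms(3))
  next
    case (inv h)
    then have "inv\<^bsub>FG\<^esub> h = - h" using RN_keys[OF RN_rels] by simp
    then show ?case using minus[OF RN_rels[OF inv] assms(3)[OF inv]] by simp
  next
    case (eng c d)
    then have cd: "c \<in> RN" "d \<in> RN" by (simp_all add: RN_def)
    have "P (c - - d)" by (rule assms(4)[OF cd(1) RN_minus[OF cd(2)] eng(3) minus[OF cd(2) eng(4)]])
    then show ?case by simp
  qed
qed

lemma act_simps: "act q 0 = 0" "act q (c + d) = act q c + act q d" "act q (c - d) = act q c - act q d"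
  "act q (frag_of (x, p)) = frag_of (x, q \<otimes>\<^bsub>Q_E a b\<^esub> p)"
  by (simp_all add: act_def frag_extend_add frag_extend_diff)

lemma act_keys:
  assumes "q \<in> carrier (Q_E a b)" "Poly_Mapping.keys c \<subseteq> keys_V" shows "Poly_Mapping.keys (act q c) \<subseteq> keys_V"
  using assms(2) by (induction c rule: free_Abelian_group_induct[consumes 1]) (auto simp: act_simps assms(1) keys_diff_le keys_V_def)

lemma act_RN:
  assumes q: "q \<in> carrier (Q_E a b)" and c: "c \<in> RN" shows "act q c \<in> RN"
  using c
proof (induction rule: RN_induct)
  case 1
  then show ?case by (simp add: act_simps RN_0)
next
  case (2 r)
  then show ?case
  proof (cases rule: relsE)
    case (1 v w p)
    have "act q r = frag_of (G (v + w), q \<otimes>\<^bsub>Q_E a b\<^esub> p) - frag_of (G v, q \<otimes>\<^bsub>Q_E a b\<^esub> p) - frag_of (G w, q \<otimes>\<^bsub>Q_E a b\<^esub> p)"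
      by (simp add: 1 act_simps)
    moreover have "\<dots> \<in> rels" unfolding rels_eq using q 1 by blast
    ultimately show ?thesis by (simp add: RN_rels)
  next
    case (2 v p p')
    have "act q r = frag_of (G v, q \<otimes>\<^bsub>Q_E a b\<^esub> p \<oplus>\<^bsub>Q_E a b\<^esub> q \<otimes>\<^bsub>Q_E a b\<^esub> p') - frag_of (G v, q \<otimes>\<^bsub>Q_E a b\<^esub> p) - frag_of (G v, q \<otimes>\<^bsub>Q_E a b\<^esub> p')"
      using q 2 by (simp add: act_simps Q.r_distr)
    moreover have "\<dots> \<in> rels" unfolding rels_eq using q 2 by blast
    ultimately show ?thesis by (simp add: RN_rels)
  next
    case (3 s v p)
    have "act q r = frag_of (G (s \<star> v), q \<otimes>\<^bsub>Q_E a b\<^esub> p) - frag_of (G v, frac_S a b s 1 \<otimes>\<^bsub>Q_E a b\<^esub> (q \<otimes>\<^bsub>Q_E a b\<^esub> p))"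
      using q 3 by (simp add: act_simps Q.m_lcomm)
    moreover have "\<dots> \<in> rels" unfolding rels_eq using q 3 by blast
    ultimately show ?thesis by (simp add: RN_rels)
  qed
next
  case (3 c d)
  then show ?case by (simp add: act_simps RN_diff)
qed

definition cl where "cl c = {u. u - c \<in> RN}"

lemma cl_self: "c \<in> cl c"
  by (simp add: cl_def RN_0)

lemma cl_eq_iff: "cl c = cl d \<longleftrightarrow> c - d \<in> RN"
proof
  assume "cl c = cl d"
  then show "c - d \<in> RN" using cl_self[of c] by (simp add: cl_def)
next
  assume cd: "c - d \<in> RN"
  have "u - c \<in> RN \<longleftrightarrow> u - d \<in> RN" for u
    using RN_add[OF _ cd, of "u - c"] RN_diff[OF _ cd, of "u - d"] by auto
  then show "cl c = cl d" by (simp add: cl_def)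
qed

lemma rcoset_eq: "RN #>\<^bsub>FG\<^esub> c = cl c"
proof (intro Set.set_eqI iffI)
  fix u assume "u \<in> cl c"
  then have "u - c \<in> RN" "u = u - c + c" by (simp_all add: cl_def)
  then show "u \<in> RN #>\<^bsub>FG\<^esub> c" unfolding r_coset_def by (auto intro!: bexI[of _ "u - c"])
qed (auto simp: r_coset_def cl_def)

lemma V_carrier: "carrier V = cl ` {c. Poly_Mapping.keys c \<subseteq> keys_V}"
  by (auto simp: V_eq RCOSETS_def rcoset_eq)

lemma V_zero: "\<zero>\<^bsub>V\<^esub> = cl 0"
  by (simp add: V_eq cl_def)

lemma V_add: "cl c \<oplus>\<^bsub>V\<^esub> cl d = cl (c + d)"
proof -
  have "cl c \<oplus>\<^bsub>V\<^esub> cl d = (\<Union>h\<in>cl c. \<Union>k\<in>cl d. {h + k})" by (simp add: V_eq set_mult_def)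
  also have "\<dots> = cl (c + d)"
  proof (intro Set.set_eqI iffI)
    fix u assume "u \<in> (\<Union>h\<in>cl c. \<Union>k\<in>cl d. {h + k})"
    then obtain h k where hk: "h - c \<in> RN" "k - d \<in> RN" "u = h + k" by (auto simp: cl_def)
    have "(h - c) + (k - d) \<in> RN" by (rule RN_add[OF hk(1,2)])
    then show "u \<in> cl (c + d)" by (simp add: cl_def hk(3) algebra_simps)
  next
    fix u assume "u \<in> cl (c + d)"
    then have "u - c \<in> cl d" by (simp add: cl_def algebra_simps)
    moreover have "u = c + (u - c)" by simp
    ultimately show "u \<in> (\<Union>h\<in>cl c. \<Union>k\<in>cl d. {h + k})" using cl_self[of c] by blast
  qed
  finally show ?thesis .
qed

lemma V_smult: "q \<in> carrier (Q_E a b) \<Longrightarrow> q \<odot>\<^bsub>V\<^esub> cl c = cl (act q c)"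
proof -
  assume q: "q \<in> carrier (Q_E a b)"
  have "q \<odot>\<^bsub>V\<^esub> cl c = (\<Union>u\<in>cl c. cl (act q u))"
    by (simp add: V_eq rcoset_eq)
  also have "\<dots> = cl (act q c)"
  proof (rule UN_const)
    show "cl c \<noteq> {}" using cl_self by blast
    show "cl (act q u) = cl (act q c)" if u: "u \<in> cl c" for u
    proof -
      have "u - c \<in> RN" using u by (simp add: cl_def)
      then show ?thesis unfolding cl_eq_iff act_simps(3)[symmetric] by (rule act_RN[OF q])
    qed
  qed
  finally show ?thesis .
qed

lemma keys_add_le: "Poly_Mapping.keys c \<subseteq> A \<Longrightarrow> Poly_Mapping.keys d \<subseteq> A \<Longrightarrow> Poly_Mapping.keys (c + d) \<subseteq> A"
  using keys_add[of c d] by blast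

lemma V_vectorspace: "vectorspace (Q_E a b) V"
proof (rule vectorspace.intro)
  show "field (Q_E a b)" by (rule Q_field)
  have ag: "abelian_group V"
  proof (rule abelian_groupI)
    fix x assume "x \<in> carrier V"
    then obtain c where c: "x = cl c" "Poly_Mapping.keys c \<subseteq> keys_V" by (auto simp: V_carrier)
    then show "\<exists>y\<in>carrier V. y \<oplus>\<^bsub>V\<^esub> x = \<zero>\<^bsub>V\<^esub>"
      by (intro bexI[of _ "cl (- c)"]) (auto simp: V_add V_zero V_carrier)
  qed (auto simp: V_carrier V_zero V_add keys_add_le Groups.add_ac)
  show "Module.module (Q_E a b) V"
  proof (rule moduleI[OF Q.is_cring ag])
    show "q \<odot>\<^bsub>V\<^esub> x \<in> carrier V" if "q \<in> carrier (Q_E a b)" "x \<in> carrier V" for q x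
      using that act_keys[of q] by (auto simp: V_carrier V_smult)
    show "(p \<oplus>\<^bsub>Q_E a b\<^esub> q) \<odot>\<^bsub>V\<^esub> x = p \<odot>\<^bsub>V\<^esub> x \<oplus>\<^bsub>V\<^esub> q \<odot>\<^bsub>V\<^esub> x"
      if pq: "p \<in> carrier (Q_E a b)" "q \<in> carrier (Q_E a b)" and x: "x \<in> carrier V" for p q x
    proof -
      obtain c where c: "x = cl c" "Poly_Mapping.keys c \<subseteq> keys_V" using x by (auto simp: V_carrier)
      \<comment> \<open>Additivity in the scalar holds only modulo the relations; associativity and
        the unit law hold already for formal combinations.\<close>
      have "act (p \<oplus>\<^bsub>Q_E a b\<^esub> q) c - (act p c + act q c) \<in> RN" using c(2)
      proof (induction c rule: free_Abelian_group_induct[consumes 1])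
        case 1
        then show ?case by (simp add: act_simps RN_0)
      next
        case (2 c d)
        from RN_diff[OF 2(3,4)] show ?case by (simp add: act_simps algebra_simps)
      next
        case (3 k)
        then obtain v r where k: "k = (G v, r)" "r \<in> carrier (Q_E a b)" by (cases k) (auto simp: carrier_eq)
        have "act (p \<oplus>\<^bsub>Q_E a b\<^esub> q) (frag_of k) - (act p (frag_of k) + act q (frag_of k)) =
          frag_of (G v, p \<otimes>\<^bsub>Q_E a b\<^esub> r \<oplus>\<^bsub>Q_E a b\<^esub> q \<otimes>\<^bsub>Q_E a b\<^esub> r) - frag_of (G v, p \<otimes>\<^bsub>Q_E a b\<^esub> r) - frag_of (G v, q \<otimes>\<^bsub>Q_E a b\<^esub> r)"
          using pq k by (simp add: act_simps Q.l_distr)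
        moreover have "\<dots> \<in> rels" unfolding rels_eq using pq k by blast
        ultimately show ?case by (simp add: RN_rels)
      qed
      then show ?thesis using pq by (simp add: c V_smult V_add cl_eq_iff)
    qed
    show "q \<odot>\<^bsub>V\<^esub> (x \<oplus>\<^bsub>V\<^esub> y) = q \<odot>\<^bsub>V\<^esub> x \<oplus>\<^bsub>V\<^esub> q \<odot>\<^bsub>V\<^esub> y"
      if "q \<in> carrier (Q_E a b)" "x \<in> carrier V" "y \<in> carrier V" for q x y
      using that by (auto simp: V_carrier V_smult V_add act_simps)
    show "(p \<otimes>\<^bsub>Q_E a b\<^esub> q) \<odot>\<^bsub>V\<^esub> x = p \<odot>\<^bsub>V\<^esub> (q \<odot>\<^bsub>V\<^esub> x)"
      if pq: "p \<in> carrier (Q_E a b)" "q \<in> carrier (Q_E a b)" and x: "x \<in> carrier V" for p q x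
    proof -
      obtain c where c: "x = cl c" "Poly_Mapping.keys c \<subseteq> keys_V" using x by (auto simp: V_carrier)
      have "act (p \<otimes>\<^bsub>Q_E a b\<^esub> q) c = act p (act q c)" using c(2)
        by (induction c rule: free_Abelian_group_induct[consumes 1]) (auto simp: act_simps Q.m_assoc pq)
      then show ?thesis using pq by (simp add: c V_smult)
    qed
    show "\<one>\<^bsub>Q_E a b\<^esub> \<odot>\<^bsub>V\<^esub> x = x" if x: "x \<in> carrier V" for x
    proof -
      obtain c where c: "x = cl c" "Poly_Mapping.keys c \<subseteq> keys_V" using x by (auto simp: V_carrier)
      have "act \<one>\<^bsub>Q_E a b\<^esub> c = c" using c(2)
        by (induction c rule: free_Abelian_group_induct[consumes 1]) (auto simp: act_simps)
      then show ?thesis by (simp add: c V_smult)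
    qed
  qed
qed

end

section \<open>Modules of rank one\<close>

lemma Q_minus: "\<not> f\<^sub>E a b dvd t \<Longrightarrow> \<ominus>\<^bsub>Q_E a b\<^esub> frac_S a b s t = frac_S a b (- s) t"
  by (rule Q.minus_equality) (simp_all add: Q_simps)

context presented
begin

lemma has_rank_iff: "has_rank (S\<^sub>E a b) M n \<longleftrightarrow> vectorspace.fin_dim (Q_E a b) V \<and> vectorspace.dim (Q_E a b) V = n"
  by (simp only: has_rank_def Let_def V_def)

lemma RN_add_left:
  "q \<in> carrier (Q_E a b) \<Longrightarrow> frag_of (G (v + w), q) - frag_of (G v, q) - frag_of (G w, q) \<in> RN"
  by (rule RN_rels) (auto simp: rels_eq)

lemma RN_add_right:
  "p \<in> carrier (Q_E a b) \<Longrightarrow> q \<in> carrier (Q_E a b) \<Longrightarrow>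
    frag_of (G v, p \<oplus>\<^bsub>Q_E a b\<^esub> q) - frag_of (G v, p) - frag_of (G v, q) \<in> RN"
  by (rule RN_rels) (auto simp: rels_eq)

lemma RN_scal:
  "q \<in> carrier (Q_E a b) \<Longrightarrow> frag_of (G (s \<star> v), q) - frag_of (G v, frac_S a b s 1 \<otimes>\<^bsub>Q_E a b\<^esub> q) \<in> RN"
  by (rule RN_rels) (auto simp: rels_eq)

text \<open>The form \<open>\<psi>\<close> embeds M into S and extends to a map of the tensor
  product into the field of fractions. It shows that v0 tensor 1 is nonzero, and this element spans
  because \<open>\<psi> v0\<close> times \<open>v\<close> equals \<open>\<psi> v\<close> times
  \<open>v0\<close> in M.\<close>

lemma has_rank_1I:
  assumes \<psi>: "\<And>v w. \<psi> (v + w) = \<psi> v + \<psi> w" "\<And>t v. \<psi> (t \<star> v) = t * \<psi> v"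
    and L: "\<And>v. v \<in> L \<longleftrightarrow> f\<^sub>E a b dvd \<psi> v" and v0: "v0 \<notin> L"
  shows "has_rank (S\<^sub>E a b) M 1"
proof -
  interpret V: vectorspace "Q_E a b" V by (rule V_vectorspace)
  have \<psi>_diff: "\<psi> (v - w) = \<psi> v - \<psi> w" for v w using \<psi>(1)[of "v - w" w] by (simp add: eq_diff_eq)
  define \<rho> where "\<rho> x = frac_S a b (\<psi> (SOME v. G v = x)) 1" for x
  have \<rho>: "\<rho> (G v) = frac_S a b (\<psi> v) 1" for v
  proof -
    have "G (SOME w. G w = G v) = G v" by (rule someI[of "\<lambda>w. G w = G v" v]) (rule refl)
    then show ?thesis unfolding \<rho>_def G_eq_iff L \<psi>_diff by (simp add: frac_S_eq_iff f_not_dvd_1)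
  qed
  have img: "(\<lambda>(x, q). \<rho> x \<otimes>\<^bsub>Q_E a b\<^esub> q) ` keys_V \<subseteq> carrier (add_monoid (Q_E a b))"
    by (auto simp: keys_V_def carrier_eq \<rho>)
  obtain h where h: "h \<in> hom FG (add_monoid (Q_E a b))" "\<And>k. k \<in> keys_V \<Longrightarrow> h (frag_of k) = (case k of (x, q) \<Rightarrow> \<rho> x \<otimes>\<^bsub>Q_E a b\<^esub> q)"
    by (rule comm_group.free_Abelian_group_universal[OF Q.a_comm_group img], rule that)
  have hC: "h c \<in> carrier (Q_E a b)" if "Poly_Mapping.keys c \<subseteq> keys_V" for c using hom_in_carrier[OF h(1), of c] that by simp
  have h_add: "h (c + d) = h c \<oplus>\<^bsub>Q_E a b\<^esub> h d" if "Poly_Mapping.keys c \<subseteq> keys_V" "Poly_Mapping.keys d \<subseteq> keys_V" for c d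
    using hom_mult[OF h(1), of c d] that by simp
  have h_diff: "h (c - d) = h c \<oplus>\<^bsub>Q_E a b\<^esub> (\<ominus>\<^bsub>Q_E a b\<^esub> h d)" if cd: "Poly_Mapping.keys c \<subseteq> keys_V" "Poly_Mapping.keys d \<subseteq> keys_V" for c d
  proof -
    have k: "Poly_Mapping.keys (c - d) \<subseteq> keys_V" by (rule keys_diff_le[OF cd])
    have "h c = h (c - d) \<oplus>\<^bsub>Q_E a b\<^esub> h d" using h_add[OF k cd(2)] by simp
    then show ?thesis using hC[OF k] hC[OF cd(2)] by (simp add: Q.a_assoc Q.r_neg)
  qed
  have kfrag: "Poly_Mapping.keys (frag_of (G v, q)) \<subseteq> keys_V" if "q \<in> carrier (Q_E a b)" for v q using that by simp
  have hf: "h (frag_of (G v, q)) = frac_S a b (\<psi> v) 1 \<otimes>\<^bsub>Q_E a b\<^esub> q" if "q \<in> carrier (Q_E a b)" for v q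
    using h(2)[of "(G v, q)"] that by (simp add: \<rho>)
  have h_RN: "h c = \<zero>\<^bsub>Q_E a b\<^esub>" if "c \<in> RN" for c using that
  proof (induction rule: RN_induct)
    case 1
    have "h 0 = h 0 \<oplus>\<^bsub>Q_E a b\<^esub> (\<ominus>\<^bsub>Q_E a b\<^esub> h 0)" using h_diff[of 0 0] by simp
    then show ?case using hC[of 0] by (simp only: keys_zero empty_subsetI simp_thms Q.r_neg)
  next
    case (2 r)
    then show ?case
    proof (cases rule: relsE)
      case (1 v w q)
      obtain s t where q: "q = frac_S a b s t" "\<not> f\<^sub>E a b dvd t" using 1(1) by (rule Q_carrierE)
      show ?thesis unfolding 1(2)
        by (simp add: h_diff keys_diff_le kfrag hf 1(1), simp add: q Q_minus Q_simps \<psi> algebra_simps)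
    next
      case (2 v p q)
      obtain s t where q: "q = frac_S a b s t" "\<not> f\<^sub>E a b dvd t" using 2(2) by (rule Q_carrierE)
      obtain s' t' where p: "p = frac_S a b s' t'" "\<not> f\<^sub>E a b dvd t'" using 2(1) by (rule Q_carrierE)
      show ?thesis unfolding 2(3)
        by (simp add: h_diff keys_diff_le kfrag hf 2(1,2), simp add: p q Q_minus Q_simps \<psi> algebra_simps)
    next
      case (3 s v q)
      obtain s' t where q: "q = frac_S a b s' t" "\<not> f\<^sub>E a b dvd t" using 3(1) by (rule Q_carrierE)
      show ?thesis unfolding 3(2)
        by (simp add: h_diff keys_diff_le kfrag hf 3(1), simp add: q Q_minus Q_simps \<psi> algebra_simps)
    qed
  next
    case (3 c d)
    then show ?case by (simp add: h_diff RN_keys)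
  qed
  define e where "e = cl (frag_of (G v0, \<one>\<^bsub>Q_E a b\<^esub>))"
  have eC: "e \<in> carrier V" unfolding e_def V_carrier by (intro imageI) simp
  have e_ne: "e \<noteq> \<zero>\<^bsub>V\<^esub>"
  proof
    assume "e = \<zero>\<^bsub>V\<^esub>"
    then have "frag_of (G v0, \<one>\<^bsub>Q_E a b\<^esub>) \<in> RN" by (simp add: e_def V_zero cl_eq_iff)
    from h_RN[OF this] have "frac_S a b (\<psi> v0) 1 = frac_S a b 0 1" by (simp add: hf Q_zero)
    then show False using v0 by (simp add: frac_S_eq_iff f_not_dvd_1 L)
  qed
  have span: "\<exists>q\<in>carrier (Q_E a b). c - frag_of (G v0, q) \<in> RN" if "Poly_Mapping.keys c \<subseteq> keys_V" for c
    using that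
  proof (induction c rule: free_Abelian_group_induct[consumes 1])
    case 1
    have "frag_of (G v0, \<zero>\<^bsub>Q_E a b\<^esub>) - frag_of (G v0, \<zero>\<^bsub>Q_E a b\<^esub>) - frag_of (G v0, \<zero>\<^bsub>Q_E a b\<^esub>) \<in> RN"
      using RN_add_right[of "\<zero>\<^bsub>Q_E a b\<^esub>" "\<zero>\<^bsub>Q_E a b\<^esub>" v0] by simp
    then show ?case by (intro bexI[of _ "\<zero>\<^bsub>Q_E a b\<^esub>"]) simp_all
  next
    case (2 c d)
    then obtain p q where pq: "p \<in> carrier (Q_E a b)" "q \<in> carrier (Q_E a b)" "c - frag_of (G v0, p) \<in> RN" "d - frag_of (G v0, q) \<in> RN" by blast
    define r where "r = p \<oplus>\<^bsub>Q_E a b\<^esub> (\<ominus>\<^bsub>Q_E a b\<^esub> q)"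
    have r: "r \<in> carrier (Q_E a b)" "r \<oplus>\<^bsub>Q_E a b\<^esub> q = p" using pq by (simp_all add: r_def Q.a_assoc Q.l_neg)
    have "frag_of (G v0, p) - frag_of (G v0, r) - frag_of (G v0, q) \<in> RN" using RN_add_right[OF r(1) pq(2), of v0] by (simp add: r(2))
    from RN_add[OF RN_diff[OF pq(3,4)] this] have "c - d - frag_of (G v0, r) \<in> RN" by (simp add: algebra_simps)
    then show ?case using r(1) by blast
  next
    case (3 k)
    then obtain v q where k: "k = (G v, q)" "q \<in> carrier (Q_E a b)" by (cases k) (auto simp: carrier_eq)
    define s t where "s = \<psi> v0" and "t = \<psi> v"
    have s: "\<not> f\<^sub>E a b dvd s" using v0 by (simp add: L s_def)
    have "s \<star> v - t \<star> v0 \<in> L" by (simp add: L \<psi>_diff \<psi> s_def t_def mult.commute)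
    then have eq: "G (s \<star> v) = G (t \<star> v0)" by (simp add: G_eq_iff)
    obtain x y where q: "q = frac_S a b x y" "\<not> f\<^sub>E a b dvd y" using k(2) by (rule Q_carrierE)
    \<comment> \<open>The scalar is divided by \<open>s\<close>, so that moving \<open>s\<close>
      across the tensor sign replaces \<open>v\<close> by a multiple of \<open>v0\<close>.\<close>
    define q' where "q' = frac_S a b x (s * y)"
    have q': "q' \<in> carrier (Q_E a b)" "frac_S a b s 1 \<otimes>\<^bsub>Q_E a b\<^esub> q' = q" using q s by (simp_all add: q'_def Q_simps algebra_simps)
    have 1: "frag_of (G (s \<star> v), q') - frag_of (G v, q) \<in> RN" using RN_scal[OF q'(1), of s v] by (simp only: q'(2))
    have 2: "frag_of (G (t \<star> v0), q') - frag_of (G v0, frac_S a b t 1 \<otimes>\<^bsub>Q_E a b\<^esub> q') \<in> RN" by (rule RN_scal[OF q'(1)])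
    have "frag_of k - frag_of (G v0, frac_S a b t 1 \<otimes>\<^bsub>Q_E a b\<^esub> q') \<in> RN" using RN_diff[OF 2 1] by (simp add: eq k)
    then show ?case by (rule bexI) (use q'(1) in simp)
  qed
  have gen: "V.span {e} = carrier V"
  proof
    show "V.span {e} \<subseteq> carrier V" using eC by (intro V.span_is_subset2) simp
    interpret K: submodule "Q_E a b" "V.span {e}" V by (rule V.span_is_submodule) (use eC in simp)
    have eK: "e \<in> V.span {e}" using V.in_own_span[of "{e}"] eC by simp
    show "carrier V \<subseteq> V.span {e}"
    proof
      fix x assume "x \<in> carrier V"
      then obtain c where c: "x = cl c" "Poly_Mapping.keys c \<subseteq> keys_V" by (auto simp: V_carrier)
      obtain q where q: "q \<in> carrier (Q_E a b)" "c - frag_of (G v0, q) \<in> RN" using span[OF c(2)] by blast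
      have "x = q \<odot>\<^bsub>V\<^esub> e" using q by (simp add: c(1) e_def V_smult act_simps cl_eq_iff)
      then show "x \<in> V.span {e}" using K.smult_closed[OF q(1) eK] by simp
    qed
  qed
  have "V.fin_dim" unfolding V.fin_dim_def using gen eC by (intro exI[of _ "{e}"]) simp
  moreover have "V.dim = 1" by (rule V.dim1I[OF gen e_ne eC])
  ultimately show ?thesis unfolding has_rank_iff by blast
qed

text \<open>\<open>ev d c v\<close>: all denominators in the formal combination \<open>c\<close> divide \<open>d\<close>, and clearing them
  turns \<open>c\<close> into the element \<open>G v\<close> of \<open>M\<close>.\<close>

inductive ev :: "'k T \<Rightarrow> ('m \<times> ('k T set \<times> 'k T set) set \<Rightarrow>\<^sub>0 int) \<Rightarrow> (nat \<Rightarrow> 'k T) \<Rightarrow> bool" for d where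
  ev_0: "ev d 0 0"
| ev_1: "ev d (frag_of (G v, frac_S a b s d)) (s \<star> v)"
| ev_diff: "ev d c v \<Longrightarrow> ev d c' v' \<Longrightarrow> ev d (c - c') (v - v')"

lemma ev_mult:
  assumes d: "\<not> f\<^sub>E a b dvd d" "\<not> f\<^sub>E a b dvd e" and ev: "ev d c v" shows "ev (e * d) c (e \<star> v)"
  using ev
proof (induction rule: ev.induct)
  case ev_0
  show ?case using ev.ev_0[of "e * d"] by (simp only: scal_simps)
next
  case (ev_1 v s)
  have "frac_S a b s d = frac_S a b (e * s) (e * d)" using d by (simp add: Q_simps algebra_simps)
  then show ?case using ev.ev_1[of "e * d" v "e * s"] by (simp add: scal_simps)
next
  case (ev_diff c v c' v')
  show ?case using ev.ev_diff[OF ev_diff.IH] by (simp only: scal_simps)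
qed

text \<open>Each defining relation of the tensor product becomes a true equation in M after clearing
  denominators; for a difference of relations the product of the two denominators is used.\<close>

lemma RN_ev: "c \<in> RN \<Longrightarrow> \<exists>d v. \<not> f\<^sub>E a b dvd d \<and> v \<in> L \<and> ev d c v"
proof (induction rule: RN_induct)
  case 1
  show ?case using f_not_dvd_1 ev_0[of 1] submod_0[OF submod_L] by blast
next
  case (2 r)
  then show ?case
  proof (cases rule: relsE)
    case (1 v w q)
    obtain s t where q: "q = frac_S a b s t" "\<not> f\<^sub>E a b dvd t" using 1(1) by (rule Q_carrierE)
    have "ev t r (s \<star> (v + w) - s \<star> v - s \<star> w)" unfolding 1(2) q by (intro ev_diff ev_1)
    moreover have "s \<star> (v + w) - s \<star> v - s \<star> w \<in> L" using submod_0[OF submod_L] by (simp add: scal_simps)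
    ultimately show ?thesis using q(2) by blast
  next
    case (2 v p q)
    obtain s t where p: "p = frac_S a b s t" "\<not> f\<^sub>E a b dvd t" using 2(1) by (rule Q_carrierE)
    obtain s' t' where q: "q = frac_S a b s' t'" "\<not> f\<^sub>E a b dvd t'" using 2(2) by (rule Q_carrierE)
    have c: "p = frac_S a b (s * t') (t * t')" "q = frac_S a b (s' * t) (t * t')"
      "p \<oplus>\<^bsub>Q_E a b\<^esub> q = frac_S a b (s * t' + s' * t) (t * t')"
      using p q by (simp_all add: Q_simps algebra_simps)
    have "ev (t * t') r ((s * t' + s' * t) \<star> v - (s * t') \<star> v - (s' * t) \<star> v)" unfolding 2(3) c(3) by (subst c(1), subst c(2)) (intro ev_diff ev_1)
    moreover have "(s * t' + s' * t) \<star> v - (s * t') \<star> v - (s' * t) \<star> v \<in> L" using submod_0[OF submod_L] by (simp add: scal_simps)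
    ultimately show ?thesis using p(2) q(2) f_dvd_mult_iff by blast
  next
    case (3 s v q)
    obtain s' t where q: "q = frac_S a b s' t" "\<not> f\<^sub>E a b dvd t" using 3(1) by (rule Q_carrierE)
    have c: "frac_S a b s 1 \<otimes>\<^bsub>Q_E a b\<^esub> q = frac_S a b (s * s') t" using q by (simp add: Q_simps)
    have "ev t r (s' \<star> s \<star> v - (s * s') \<star> v)" unfolding 3(2) c unfolding q by (intro ev_diff ev_1)
    moreover have "s' \<star> s \<star> v - (s * s') \<star> v \<in> L" using submod_0[OF submod_L] by (simp add: scal_simps mult.commute)
    ultimately show ?thesis using q(2) by blast
  qed
next
  case (3 c c')
  then obtain d v d' v' where d: "\<not> f\<^sub>E a b dvd d" "v \<in> L" "ev d c v" "\<not> f\<^sub>E a b dvd d'" "v' \<in> L" "ev d' c' v'" by blast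
  have "ev (d * d') (c - c') (d' \<star> v - d \<star> v')"
    using ev_diff[OF ev_mult[OF d(1,4,3)] ev_mult[OF d(4,1,6), unfolded mult.commute[of d d']]] by (simp add: mult.commute)
  moreover have "d' \<star> v - d \<star> v' \<in> L" using d by (intro submod_diff[OF submod_L] submod_scal[OF submod_L])
  ultimately show ?case using d f_dvd_mult_iff by blast
qed

text \<open>The kernel of the map from M to its base change is torsion. Since \<open>ev\<close> is
  only a relation, its value is shown to be unique: with a fixed denominator \<open>d\<close> it is
  given by a homomorphism from a free abelian group to M.\<close>

lemma RN_frag_of:
  assumes "frag_of (G z, frac_S a b 1 1) \<in> RN" shows "\<exists>d. \<not> f\<^sub>E a b dvd d \<and> d \<star> z \<in> L"
proof -
  obtain d v where d: "\<not> f\<^sub>E a b dvd d" "v \<in> L" "ev d (frag_of (G z, frac_S a b 1 1)) v" using RN_ev[OF assms] by blast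
  define K where "K = carrier M \<times> range (\<lambda>s. frac_S a b s d)"
  \<comment> \<open>A chosen numerator over the denominator \<open>d\<close>; it is unique modulo f
    because f is prime and does not divide \<open>d\<close>.\<close>
  define \<sigma> where "\<sigma> q = (SOME s. frac_S a b s d = q)" for q
  have \<sigma>: "\<kappa> a b (\<sigma> (frac_S a b s d)) = \<kappa> a b s" for s
  proof -
    have "frac_S a b (\<sigma> (frac_S a b s d)) d = frac_S a b s d"
      unfolding \<sigma>_def by (rule someI[of "\<lambda>r. frac_S a b r d = frac_S a b s d" s]) (rule refl)
    then have "f\<^sub>E a b dvd (\<sigma> (frac_S a b s d) - s) * d" using d(1) by (simp add: frac_S_eq_iff algebra_simps)
    then show ?thesis using d(1) by (simp add: f_dvd_mult_iff residue_class_eq_iff)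
  qed
  have img: "(\<lambda>(x, q). \<kappa> a b (\<sigma> q) \<odot>\<^bsub>M\<^esub> x) ` K \<subseteq> carrier (add_monoid M)" by (auto simp: K_def)
  obtain h where h: "h \<in> hom (free_Abelian_group K) (add_monoid M)" "\<And>k. k \<in> K \<Longrightarrow> h (frag_of k) = (case k of (x, q) \<Rightarrow> \<kappa> a b (\<sigma> q) \<odot>\<^bsub>M\<^esub> x)"
    by (rule comm_group.free_Abelian_group_universal[OF M.a_comm_group img], rule that)
  have hC: "h c \<in> carrier M" if "Poly_Mapping.keys c \<subseteq> K" for c using hom_in_carrier[OF h(1), of c] that by simp
  have h_add: "h (c + c') = h c \<oplus>\<^bsub>M\<^esub> h c'" if "Poly_Mapping.keys c \<subseteq> K" "Poly_Mapping.keys c' \<subseteq> K" for c c'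
    using hom_mult[OF h(1), of c c'] that by simp
  have h_diff: "h (c - c') = h c \<oplus>\<^bsub>M\<^esub> (\<ominus>\<^bsub>M\<^esub> h c')" if cd: "Poly_Mapping.keys c \<subseteq> K" "Poly_Mapping.keys c' \<subseteq> K" for c c'
  proof -
    have k: "Poly_Mapping.keys (c - c') \<subseteq> K" by (rule keys_diff_le[OF cd])
    have "h c = h (c - c') \<oplus>\<^bsub>M\<^esub> h c'" using h_add[OF k cd(2)] by simp
    then show ?thesis using hC[OF k] hC[OF cd(2)] by (simp add: M.a_assoc M.r_neg)
  qed
  have hf: "h (frag_of (G v, frac_S a b s d)) = G (s \<star> v)" for v s
    using h(2)[of "(G v, frac_S a b s d)"] by (simp add: K_def \<sigma> G_scal)
  have "Poly_Mapping.keys c \<subseteq> K \<and> h c = G v" if "ev d c v" for c v using that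
  proof (induction rule: ev.induct)
    case ev_0
    have "h 0 = h 0 \<oplus>\<^bsub>M\<^esub> (\<ominus>\<^bsub>M\<^esub> h 0)" using h_diff[of 0 0] by simp
    then show ?case using hC[of 0] by (simp only: keys_zero empty_subsetI simp_thms M.r_neg G_0)
  next
    case (ev_1 v s)
    then show ?case by (simp add: hf) (simp add: K_def)
  next
    case (ev_diff c v c' v')
    have "G (v - v') = G v \<oplus>\<^bsub>M\<^esub> (\<ominus>\<^bsub>M\<^esub> G v')" using G_add[of v "- v'"] by (simp only: G_minus add_uminus_conv_diff)
    then show ?case using ev_diff.IH by (simp only: h_diff keys_diff_le simp_thms)
  qed
  from this[OF d(3)] have "h (frag_of (G z, frac_S a b 1 1)) = G v" by blast
  moreover have "frac_S a b 1 1 = frac_S a b d d" using d(1) by (simp add: Q_simps)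
  ultimately have "G (d \<star> z) = G v" by (simp add: hf)
  then have "d \<star> z \<in> L" using d(2) by (simp add: L_iff)
  then show ?thesis using d(1) by blast
qed

text \<open>In a space of dimension one the images of \<open>v\<close> and \<open>w\<close> are
  proportional. Clearing denominators gives an element that vanishes after base change, hence a
  torsion element, and a further factor removes it.\<close>

lemma has_rank_1D:
  assumes "has_rank (S\<^sub>E a b) M 1"
  shows "\<exists>s t. \<not> (f\<^sub>E a b dvd s \<and> f\<^sub>E a b dvd t) \<and> s \<star> v - t \<star> w \<in> L"
proof -
  interpret V: vectorspace "Q_E a b" V by (rule V_vectorspace)
  have "V.fin_dim" "V.dim = 1" using assms by (simp_all add: has_rank_iff)
  then obtain B where B: "finite B" "V.basis B" using V.finite_basis_exists by blast
  then have "card B = 1" using V.dim_basis \<open>V.dim = 1\<close> by simp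
  then obtain e where "B = {e}" by (auto simp: card_1_singleton_iff)
  then have e: "e \<in> carrier V" "V.span {e} = carrier V" using B(2) by (auto simp: V.basis_def)
  have mult: "\<exists>q\<in>carrier (Q_E a b). x = q \<odot>\<^bsub>V\<^esub> e" if x: "x \<in> carrier V" for x
  proof -
    obtain g where "g \<in> {e} \<rightarrow> carrier (Q_E a b)" "V.lincomb g {e} = x" using V.finite_in_span[of "{e}" x] e x by auto
    then show ?thesis using e(1) by (intro bexI[of _ "g e"]) (auto simp: V.lincomb_def)
  qed
  define E where "E v = frag_of (G v, \<one>\<^bsub>Q_E a b\<^esub>)" for v
  have EC: "cl (E v) \<in> carrier V" for v unfolding V_carrier by (intro imageI) (simp add: E_def)
  obtain p where p: "p \<in> carrier (Q_E a b)" "cl (E v) = p \<odot>\<^bsub>V\<^esub> e" using mult[OF EC] by blast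
  obtain q where q: "q \<in> carrier (Q_E a b)" "cl (E w) = q \<odot>\<^bsub>V\<^esub> e" using mult[OF EC] by blast
  obtain p1 p2 where pp: "p = frac_S a b p1 p2" "\<not> f\<^sub>E a b dvd p2" using p(1) by (rule Q_carrierE)
  obtain q1 q2 where qq: "q = frac_S a b q1 q2" "\<not> f\<^sub>E a b dvd q2" using q(1) by (rule Q_carrierE)
  show ?thesis
  proof (cases "f\<^sub>E a b dvd p1")
    \<comment> \<open>The image of \<open>v\<close> is zero, so \<open>v\<close> itself is torsion
      and \<open>w\<close> receives the factor zero.\<close>
    case True
    then have "p = \<zero>\<^bsub>Q_E a b\<^esub>" using pp by (simp add: Q_simps)
    then have "cl (E v) = cl 0" using p(2) V.smult_l_null[OF e(1)] by (simp add: V_zero)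
    then have "frag_of (G v, frac_S a b 1 1) \<in> RN" by (simp add: cl_eq_iff E_def Q_one)
    then obtain d where "\<not> f\<^sub>E a b dvd d" "d \<star> v \<in> L" using RN_frag_of by blast
    then show ?thesis by (intro exI[of _ d] exI[of _ 0]) (simp add: scal_simps)
  next
    case False
    define r where "r = frac_S a b (p2 * q2) 1"
    have r: "r \<in> carrier (Q_E a b)" by (simp add: r_def)
    \<comment> \<open>The coefficients \<open>p\<close> and \<open>q\<close> of the two images are
      exchanged crosswise and multiplied by both denominators.\<close>
    define s t where "s = q1 * p2" and "t = p1 * q2"
    have rq: "r \<otimes>\<^bsub>Q_E a b\<^esub> q = frac_S a b s 1" "r \<otimes>\<^bsub>Q_E a b\<^esub> p = frac_S a b t 1"
      using pp qq by (simp_all add: r_def s_def t_def Q_simps algebra_simps)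
    have "frac_S a b s 1 \<odot>\<^bsub>V\<^esub> cl (E v) = frac_S a b t 1 \<odot>\<^bsub>V\<^esub> cl (E w)"
    proof -
      have "frac_S a b s 1 \<odot>\<^bsub>V\<^esub> cl (E v) = (frac_S a b s 1 \<otimes>\<^bsub>Q_E a b\<^esub> p) \<odot>\<^bsub>V\<^esub> e" using p e by (simp add: V.smult_assoc1)
      also have "frac_S a b s 1 \<otimes>\<^bsub>Q_E a b\<^esub> p = frac_S a b t 1 \<otimes>\<^bsub>Q_E a b\<^esub> q"
        unfolding rq[symmetric] using r p(1) q(1) by (simp add: Q.m_ac)
      also have "\<dots> \<odot>\<^bsub>V\<^esub> e = frac_S a b t 1 \<odot>\<^bsub>V\<^esub> cl (E w)" using q e by (simp add: V.smult_assoc1)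
      finally show ?thesis .
    qed
    then have A: "frag_of (G v, frac_S a b s 1) - frag_of (G w, frac_S a b t 1) \<in> RN"
      by (simp add: V_smult E_def act_simps cl_eq_iff)
    have B1: "E (s \<star> v) - frag_of (G v, frac_S a b s 1) \<in> RN" using RN_scal[of "\<one>\<^bsub>Q_E a b\<^esub>" s v] by (simp add: E_def)
    have B2: "E (t \<star> w) - frag_of (G w, frac_S a b t 1) \<in> RN" using RN_scal[of "\<one>\<^bsub>Q_E a b\<^esub>" t w] by (simp add: E_def)
    define z where "z = s \<star> v - t \<star> w"
    have C: "E (s \<star> v) - E z - E (t \<star> w) \<in> RN" using RN_add_left[of "\<one>\<^bsub>Q_E a b\<^esub>" z "t \<star> w"] by (simp add: E_def z_def)
    from RN_diff[OF RN_diff[OF RN_add[OF A B1] B2] C] have "E z \<in> RN" by (simp add: algebra_simps)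
    then obtain d where d: "\<not> f\<^sub>E a b dvd d" "d \<star> z \<in> L" using RN_frag_of by (auto simp: E_def Q_one)
    have "\<not> f\<^sub>E a b dvd d * t" using d(1) False qq(2) by (simp add: t_def f_dvd_mult_iff)
    moreover have "(d * s) \<star> v - (d * t) \<star> w \<in> L" using d(2) by (simp add: z_def scal_simps)
    ultimately show ?thesis by blast
  qed
qed

end

section \<open>The classification\<close>

context
  fixes a b :: "'k::alg_closed_field" and i
  assumes i: "i \<in> mf_labels a b"
begin

lemma mf_fact:
  "fst (mf a b i) \<in> carrier_mat (mf_size i) (mf_size i)" "snd (mf a b i) \<in> carrier_mat (mf_size i) (mf_size i)"
  "fst (mf a b i) * snd (mf a b i) = f\<^sub>E a b \<cdot>\<^sub>m 1\<^sub>m (mf_size i)" "snd (mf a b i) * fst (mf a b i) = f\<^sub>E a b \<cdot>\<^sub>m 1\<^sub>m (mf_size i)"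
  using mf_factorisation[OF i] by (auto simp: matrix_factorisation_def split: prod.splits)

lemma mf_presented: "\<exists>G. presented a b (cokernel (snd (mf a b i))) G (lat (snd (mf a b i))) (mf_size i)"
  using cokernel_presented[of a b "mf_size i" "fst (mf a b i)" "snd (mf a b i)"] mf_factorisation[OF i] by auto

lemma mf_module:
  "maximal_cohen_macaulay (S\<^sub>E a b) (cokernel (snd (mf a b i)))"
  "indecomposable (S\<^sub>E a b) (cokernel (snd (mf a b i)))"
  "has_rank (S\<^sub>E a b) (cokernel (snd (mf a b i))) 1"
proof -
  obtain G where "presented a b (cokernel (snd (mf a b i))) G (lat (snd (mf a b i))) (mf_size i)" using mf_presented by blast
  then interpret presented a b "cokernel (snd (mf a b i))" G "lat (snd (mf a b i))" "mf_size i" .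
  have n: "0 < mf_size i" by (cases i) auto
  have v0: "(\<lambda>_. 1) \<notin> adjoin (adjoin (lat (snd (mf a b i))) \<Z>) \<Y>" by (rule lat_proper[OF mf_fact n mf_const])
  note tf = lat_torsion_free[OF mf_fact]
  show "maximal_cohen_macaulay (S\<^sub>E a b) (cokernel (snd (mf a b i)))"
    using tf[OF Z_not_f_dvd[OF mf_fact]] lat_Y_regular[OF mf_fact] tf[OF Y_not_f_dvd[OF mf_fact]] v0 by (rule mcmI)
  have ne: "(\<lambda>_. 1) \<notin> lat (snd (mf a b i))" using v0 adjoinI(1)[OF submod_L] adjoinI(1)[OF submod_adjoin[OF submod_L]] by blast
  obtain c where c: "\<And>v. v \<in> lat (snd (mf a b i)) \<longleftrightarrow> f\<^sub>E a b dvd (\<Sum>j<mf_size i. c j * v j)" using lat_functional[OF i] by blast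
  define \<psi> where "\<psi> v = (\<Sum>j<mf_size i. c j * v j)" for v
  have \<psi>: "\<psi> (v + w) = \<psi> v + \<psi> w" "\<psi> (t \<star> v) = t * \<psi> v" for v w t
    by (simp_all add: \<psi>_def scal_apply distrib_left sum.distrib sum_distrib_left mult.left_commute)
  note L = c[folded \<psi>_def]
  show rank: "has_rank (S\<^sub>E a b) (cokernel (snd (mf a b i))) 1" by (rule has_rank_1I[OF \<psi> L ne])
  show "indecomposable (S\<^sub>E a b) (cokernel (snd (mf a b i)))"
  proof (rule indecomposable)
    show "\<exists>v. v \<notin> lat (snd (mf a b i))" using ne by blast
    show "\<not> f\<^sub>E a b dvd s \<Longrightarrow> s \<star> v \<in> lat (snd (mf a b i)) \<Longrightarrow> v \<in> lat (snd (mf a b i))" for s v by (rule tf)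
    show "\<exists>s t. \<not> (f\<^sub>E a b dvd s \<and> f\<^sub>E a b dvd t) \<and> s \<star> v - t \<star> w \<in> lat (snd (mf a b i))" for v w
      by (rule has_rank_1D[OF rank])
  qed
qed

end

lemma mf_label_inj:
  fixes a b :: "'k::alg_closed_field"
  assumes "i \<in> mf_labels a b" "j \<in> mf_labels a b"
    and "module_iso (S\<^sub>E a b) (cokernel (snd (mf a b i))) (cokernel (snd (mf a b j)))"
  shows "i = j"
proof -
  obtain G G' where "presented a b (cokernel (snd (mf a b i))) G (lat (snd (mf a b i))) (mf_size i)"
    "presented a b (cokernel (snd (mf a b j))) G' (lat (snd (mf a b j))) (mf_size j)"
    using mf_presented assms(1,2) by blast
  then show ?thesis using module_iso_iff_liso assms(3) liso_labels_eq by blast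
qed

lemma mcm_rank_1_classification:
  fixes a b :: "'k::alg_closed_field" and M :: "('k T set, 'm) module"
  assumes smooth: "smooth_plane_curve (weierstrass_poly a b)"
    and M: "maximal_cohen_macaulay (S\<^sub>E a b) M" "has_rank (S\<^sub>E a b) M 1"
  shows "\<exists>i\<in>mf_labels a b. module_iso (S\<^sub>E a b) M (cokernel (snd (mf a b i)))"
proof -
  obtain G L N where p: "presented a b M G L N"
    using ex_presented[of a b M] M(1) by (auto simp: maximal_cohen_macaulay_def)
  interpret presented a b M G L N by (rule p)
  obtain x1 x2 where x: "x1 $ 0 $ 0 $ 0 = 0" "x2 $ 0 $ 0 $ 0 = 0" "\<And>v. x1 \<star> v \<in> L \<Longrightarrow> v \<in> L"
    "\<And>v. x2 \<star> v \<in> adjoin L x1 \<Longrightarrow> v \<in> adjoin L x1" "\<exists>v. v \<notin> L" by (rule mcmD[OF M(1)], rule that)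
  interpret rank1_lattice a b L N x1 x2
  proof unfold_locales
    show "submod L" by (rule submod_L)
    show "(\<forall>i<N. v i = 0) \<Longrightarrow> v \<in> L" for v by (rule support_L)
    show "f\<^sub>E a b \<star> v \<in> L" for v by (rule f_L)
    show "x1 $ 0 $ 0 $ 0 = 0" "x2 $ 0 $ 0 $ 0 = 0" "\<exists>v. v \<notin> L" by (fact x)+
    show "x1 \<star> v \<in> L \<Longrightarrow> v \<in> L" for v by (rule x)
    show "x2 \<star> v \<in> adjoin L x1 \<Longrightarrow> v \<in> adjoin L x1" for v by (rule x)
    show "\<exists>s t. \<not> (f\<^sub>E a b dvd s \<and> f\<^sub>E a b dvd t) \<and> s \<star> v - t \<star> w \<in> L" for v w by (rule has_rank_1D[OF M(2)])
  qed
  obtain \<Phi> where \<Phi>: "\<Phi> \<in> carrier_mat 3 3" "det \<Phi> = (- 1) * f\<^sub>E a b" "liso (lat \<Phi>) L" using presentation by auto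
  note sm = smooth_weierstrass[OF smooth]
  have "good a b \<Phi>" by (rule good3[OF sm \<Phi>(1,2), of "- 1"]) simp_all
  then obtain i where i: "i \<in> mf_labels a b" "liso (lat (snd (mf a b i))) (lat \<Phi>)" by (auto simp: good_def[OF sm])
  obtain G' where G': "presented a b (cokernel (snd (mf a b i))) G' (lat (snd (mf a b i))) (mf_size i)" using mf_presented[OF i(1)] by blast
  have "module_iso (S\<^sub>E a b) (cokernel (snd (mf a b i))) M"
    using module_iso_iff_liso[OF G' p] liso_trans[OF i(2) \<Phi>(3) submod_L] by blast
  then show ?thesis using i(1) module_iso_sym by blast
qed

theorem theorem2p11:
  fixes a b :: "'k :: alg_closed_field"
  assumes "smooth_plane_curve (weierstrass_poly a b)"
  shows
    "(\<forall>i \<in> mf_labels a b. matrix_factorisation (f\<^sub>E a b) (mf_size i) (mf a b i)) \<and>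
     (\<forall>i \<in> mf_labels a b. \<forall>j \<in> mf_labels a b. i \<noteq> j \<longrightarrow> \<not> mf_iso (mf a b i) (mf a b j)) \<and>
     (\<forall>i \<in> mf_labels a b.
        maximal_cohen_macaulay (S\<^sub>E a b) (cokernel (snd (mf a b i))) \<and>
        indecomposable (S\<^sub>E a b) (cokernel (snd (mf a b i))) \<and>
        has_rank (S\<^sub>E a b) (cokernel (snd (mf a b i))) 1) \<and>
     (\<forall>M :: ('k T set, 'm) module.
        maximal_cohen_macaulay (S\<^sub>E a b) M \<and> indecomposable (S\<^sub>E a b) M \<and> has_rank (S\<^sub>E a b) M 1 \<longrightarrow>
        (\<exists>!i. i \<in> mf_labels a b \<and> module_iso (S\<^sub>E a b) M (cokernel (snd (mf a b i)))))"
proof (intro conjI ballI allI impI)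
  fix M :: "('k T set, 'm) module"
  assume "maximal_cohen_macaulay (S\<^sub>E a b) M \<and> indecomposable (S\<^sub>E a b) M \<and> has_rank (S\<^sub>E a b) M 1"
  then obtain i where i: "i \<in> mf_labels a b" "module_iso (S\<^sub>E a b) M (cokernel (snd (mf a b i)))"
    using mcm_rank_1_classification[OF assms] by blast
  show "\<exists>!i. i \<in> mf_labels a b \<and> module_iso (S\<^sub>E a b) M (cokernel (snd (mf a b i)))"
  proof (rule ex1I)
    show "i \<in> mf_labels a b \<and> module_iso (S\<^sub>E a b) M (cokernel (snd (mf a b i)))" by (rule conjI[OF i])
    fix j assume "j \<in> mf_labels a b \<and> module_iso (S\<^sub>E a b) M (cokernel (snd (mf a b j)))"
    \<comment> \<open>Two labels isomorphic to the same module have isomorphic cokernels, and the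
      linear parts distinguish these.\<close>
    then have "j \<in> mf_labels a b" "module_iso (S\<^sub>E a b) (cokernel (snd (mf a b j))) (cokernel (snd (mf a b i)))"
      using module_iso_trans[OF module_iso_sym i(2), of "cokernel (snd (mf a b j))"] by simp_all
    then show "j = i" by (rule mf_label_inj[OF _ i(1)])
  qed
next
  fix i j assume ij: "i \<in> mf_labels a b" "j \<in> mf_labels a b" "i \<noteq> j"
  show "\<not> mf_iso (mf a b i) (mf a b j)"
  proof
    assume "mf_iso (mf a b i) (mf a b j)"
    then have "i = j" by (rule liso_labels_eq[OF mf_iso_liso[OF ij(1,2)]])
    then show False using ij(3) by simp
  qed
next
  fix i assume i: "i \<in> mf_labels a b"
  show "matrix_factorisation (f\<^sub>E a b) (mf_size i) (mf a b i)" by (rule mf_factorisation[OF i])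
  show "maximal_cohen_macaulay (S\<^sub>E a b) (cokernel (snd (mf a b i)))" by (rule mf_module[OF i])
  show "indecomposable (S\<^sub>E a b) (cokernel (snd (mf a b i)))" by (rule mf_module[OF i])
  show "has_rank (S\<^sub>E a b) (cokernel (snd (mf a b i))) 1" by (rule mf_module[OF i])
qed

end
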